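(* Let $K$ be a simplicial complex on $[m]$ and let $(\underline X,\underline A)=\{(X_k,A_k)\}_{k=1}^m$ be such that each $(X_k,A_k)$ is a simplicial complex pair on $[n_k]$ densely split on $\mathcal T_k\subset\mathcal X_{n_k}$. Let $\underline{\mathcal S}=\mathcal S_1\times\cdots\times\mathcal S_m$, where $\mathcal S_k$ is the dense support index set of $(X_k,A_k)$ on $\mathcal T_k$. Then for any $\mathcal D$ with $\underline{\mathcal S}\subset\mathcal D\subset\mathcal X_m$ and any $\mathcal T\subset\underline{\mathcal T}=\mathcal T_1\times\cdots\times\mathcal T_m$, the total (co)homology group of the polyhedral join simplicial complex $\mathcal Z^*(K;\underline X,\underline A)$ on $\mathcal T$ satisfies $$H_*^{\mathcal T}(\mathcal Z^*(K;\underline X,\underline A))\cong H_*^{\mathcal D}(K)\,\widehat\otimes\,H_*^{\mathcal D;\mathcal T}(\underline X,\underline A),\qquad H^*_{\mathcal T}(\mathcal Z^*(K;\underline X,\underline A))\cong H^*_{\mathcal D}(K)\,\widehat\otimes\,H^*_{\mathcal D;\mathcal T}(\underline X,\underline A).$$ Precisely, for $(\tilde\sigma,\tilde\omega)\in\mathcal T$ with $\sigma_k=\tilde\sigma\cap[n_k]$, $\omega_k=\tilde\omega\cap[n_k]$, $$H_*^{\tilde\sigma,\tilde\omega}(\mathcal Z^*(K;\underline X,\underline A))\cong\bigoplus_{(\sigma,\omega)\in\mathcal D}H_*^{\sigma,\omega}(K)\otimes H_1^{\sigma_1,\omega_1}\otimes\cdots\otimes H_m^{\sigma_m,\omega_m},$$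 $$H^*_{\tilde\sigma,\tilde\omega}(\mathcal Z^*(K;\underline X,\underline A))\cong\bigoplus_{(\sigma,\omega)\in\mathcal D}H^*_{\sigma,\omega}(K)\otimes H^1_{\sigma_1,\omega_1}\otimes\cdots\otimes H^m_{\sigma_m,\omega_m},$$ where, according as $k\in\sigma$, $k\in\omega$, or $k\notin\sigma\cup\omega$, $H_k^{\sigma_k,\omega_k}$ is $\operatorname{coker}\theta_{\sigma_k,\omega_k}$, $\ker\theta_{\sigma_k,\omega_k}$, $\operatorname{coim}\theta_{\sigma_k,\omega_k}$, and $H^k_{\sigma_k,\omega_k}$ is $\ker\theta^\circ_{\sigma_k,\omega_k}$, $\operatorname{coker}\theta^\circ_{\sigma_k,\omega_k}$, $\operatorname{im}\theta^\circ_{\sigma_k,\omega_k}$. If all $\theta_{\sigma_k,\omega_k}$ are epimorphisms, then one may take $\mathcal D=\mathcal R_m$.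
   Context: **Simplicial complexes.** $[m]=\{1,\dots,m\}$. A simplicial complex $K$ on $[m]$ is a set of subsets of $[m]$ closed under taking subsets; $\{i\}\in K$ is not required; the void complex $\{\,\}$ and $\{\emptyset\}$ are allowed. $[n]=[n_1]\sqcup\cdots\sqcup[n_m]$ (disjoint union). $X*Y=\{\sigma\sqcup\tau:\sigma\in X,\tau\in Y\}$, with $\{\,\}*Z=\{\,\}$. For pairs $A_k\subset X_k$ of simplicial complexes on $[n_k]$, $\mathcal Z^*(K;\underline X,\underline A)=\bigcup_{\tau\in K}Y_1*\cdots*Y_m$ with $Y_k=X_k$ if $k\in\tau$, $Y_k=A_k$ otherwise; it is a simplicial complex on $[n]$, void if $K=\{\,\}$. **Index sets.** $\mathcal X=\{\mathrm e,\mathrm n,\mathrm i\}$; $\mathcal X_m=\{(\sigma,\omega):\sigma,\omega\subset[m],\sigma\cap\omega=\emptyset\}$, identified with $\mathcal X^m$ by $s_k=\mathrm e$ if $k\in\sigma$, $s_k=\mathrm n$ if $k\in\omega$, $s_k=\mathrm i$ otherwise; $\mathcal R_m=\{(\emptyset,\omega):\omega\subset[m]\}$. $\underline{\mathcal T}=\mathcal T_1\times\cdots\times\mathcal T_m$ is identified with the set of $(\tilde\sigma,\tilde\omega)\in\mathcal X_n$ such that $(\tilde\sigma\cap[n_k],\tilde\omega\cap[n_k])\in\mathcal T_k$ for all $k$. **Total (co)homology.** $T_*^{\mathcal X}$ is free on $\mathrm e,\mathrm n,\mathrm i$ (degree $0$) and $\bar{\mathrm n}$ (degree $1$), $d\bar{\mathrm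 n}=\mathrm n$, with $\mathrm n,\bar{\mathrm n}$ both of index $\mathrm n$; $S_*^{\mathcal X}=\mathbb Z(\mathrm n,\mathrm i)$. For $K$ on $[m]$, $T_*^{\mathcal X_m}(K)=\sum_{\tau\in K}U_1\otimes\cdots\otimes U_m\subset(T_*^{\mathcal X})^{\otimes m}$, $U_k=T_*^{\mathcal X}$ if $k\in\tau$, $S_*^{\mathcal X}$ otherwise ($0$ for $K=\{\,\}$). Its homology is $\oplus_{(\sigma,\omega)\in\mathcal X_m}H_*^{\sigma,\omega}(K)$, the homology of the dual complex is $\oplus_{(\sigma,\omega)}H^*_{\sigma,\omega}(K)$. For $\mathcal D\subset\mathcal X_m$, $T_*^{\mathcal D}(K)$, $H_*^{\mathcal D}(K)$, $H^*_{\mathcal D}(K)$ are the sums of the local pieces with index in $\mathcal D$. Coefficients are $\mathbb Z$ or a field. **Densely split pairs.** A pair $A\subset X$ of simplicial complexes on $[l]$ is densely split on $\mathcal T\subset\mathcal X_l$ if for every $(\sigma,\omega)\in\mathcal T$ the homomorphism $\theta_{\sigma,\omega}\colon H_*^{\sigma,\omega}(A)\to H_*^{\sigma,\omega}(X)$ induced by inclusion has free kernel, cokernel and coimage ($\operatorname{coim}f=\mathrm{source}/\ker f$). $\theta^\circ_{\sigma,\omega}\colon H^*_{\sigma,\omega}(X)\to H^*_{\sigma,\omega}(A)$ is the cohomology homomorphism. $H_*^{\mathcal X;\mathcal T}(X,A)=\oplus_{s\in\mathcal X,(\sigma,\omega)\in\mathcal T}H_*^{s;\sigma,\omega}$ with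 $H_*^{\mathrm e;\sigma,\omega}=\operatorname{coker}\theta_{\sigma,\omega}$, $H_*^{\mathrm n;\sigma,\omega}=\ker\theta_{\sigma,\omega}$, $H_*^{\mathrm i;\sigma,\omega}=\operatorname{coim}\theta_{\sigma,\omega}$; dually $H^*_{\mathcal X;\mathcal T}(X,A)$ with $\ker\theta^\circ_{\sigma,\omega}$, $\operatorname{coker}\theta^\circ_{\sigma,\omega}$, $\operatorname{im}\theta^\circ_{\sigma,\omega}$ for $\mathrm e,\mathrm n,\mathrm i$. The dense support index set is $\{s\in\mathcal X: H_*^{s;\sigma,\omega}\neq0\text{ for some }(\sigma,\omega)\in\mathcal T\}$. For a sequence, $H_*^{\mathcal X_m;\underline{\mathcal T}}(\underline X,\underline A)=\otimes_kH_*^{\mathcal X;\mathcal T_k}(X_k,A_k)$, indexed by $\mathcal X_m\times\underline{\mathcal T}$ (cohomology similarly), and $H_*^{\mathcal D;\mathcal T}$, $H^*_{\mathcal D;\mathcal T}$ are the restrictions to $\mathcal D\times\mathcal T$. **Diagonal tensor product** (with respect to $\mathcal D$): for $A=\oplus_{s\in\mathcal D}A^s$ and $B=\oplus_{s\in\mathcal D,t\in\mathcal T}B^{s;t}$, $A\widehat\otimes B=\oplus_{s,t}A^s\otimes B^{s;t}$, which is viewed as indexed by $\mathcal T$. *)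

theory Defs
  imports
    "HOL-Algebra.Module"
    "HOL-Algebra.QuotRing"
    "HOL-Algebra.IntRing"
    "HOL-Library.FuncSet"
    "HOL-Library.Product_Lexorder"
begin

section \<open>Modules over a commutative ring\<close>

text \<open>
  The multiplicative fields of a module record carry no information and are left undefined.
\<close>

definition module_iso ::
    "('r, 'x) ring_scheme \<Rightarrow> ('r, 'a, 'y) module_scheme \<Rightarrow> ('r, 'b, 'z) module_scheme \<Rightarrow> bool"
  where "module_iso R M N \<longleftrightarrow>
    (\<exists>h. bij_betw h (carrier M) (carrier N)
       \<and> (\<forall>x\<in>carrier M. \<forall>y\<in>carrier M. h (x \<oplus>\<^bsub>M\<^esub> y) = h x \<oplus>\<^bsub>N\<^esub> h y)
       \<and> (\<forall>a\<in>carrier R. \<forall>x\<in>carrier M. h (a \<odot>\<^bsub>M\<^esub> x) = a \<odot>\<^bsub>N\<^esub> h x))"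

definition free_mod :: "('r, 'x) ring_scheme \<Rightarrow> 's set \<Rightarrow> ('r, 's \<Rightarrow> 'r) module"
  where "free_mod R S =
    \<lparr> carrier = {f. (\<forall>x\<in>S. f x \<in> carrier R) \<and> (\<forall>x. x \<notin> S \<longrightarrow> f x = \<zero>\<^bsub>R\<^esub>)
                  \<and> finite {x. f x \<noteq> \<zero>\<^bsub>R\<^esub>}},
      monoid.mult = undefined, one = undefined,
      zero = (\<lambda>x. \<zero>\<^bsub>R\<^esub>),
      add = (\<lambda>f g x. f x \<oplus>\<^bsub>R\<^esub> g x),
      smult = (\<lambda>a f x. a \<otimes>\<^bsub>R\<^esub> f x) \<rparr>"

definition free_gen :: "('r, 'x) ring_scheme \<Rightarrow> 's \<Rightarrow> 's \<Rightarrow> 'r"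
  where "free_gen R x = (\<lambda>y. if y = x then \<one>\<^bsub>R\<^esub> else \<zero>\<^bsub>R\<^esub>)"

text \<open>A basis of \<open>M\<close> can be taken as the index set \<open>S\<close>, so its type is no restriction.\<close>

definition free_module :: "('r, 'x) ring_scheme \<Rightarrow> ('r, 'a, 'y) module_scheme \<Rightarrow> bool"
  where "free_module R M \<longleftrightarrow> (\<exists>S :: 'a set. module_iso R (free_mod R S) M)"

definition quot_mod :: "('r, 'a, 'y) module_scheme \<Rightarrow> 'a set \<Rightarrow> ('r, 'a set) module"
  where "quot_mod M N =
    \<lparr> carrier = a_rcosets\<^bsub>M\<^esub> N,
      monoid.mult = undefined, one = undefined,
      zero = N,
      add = (\<lambda>C D. C <+>\<^bsub>M\<^esub> D),
      smult = (\<lambda>a C. \<Union>x\<in>C. N +>\<^bsub>M\<^esub> (a \<odot>\<^bsub>M\<^esub> x)) \<rparr>"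

definition subquot_mod :: "('r, 'a, 'y) module_scheme \<Rightarrow> 'a set \<Rightarrow> 'a set \<Rightarrow> ('r, 'a set) module"
  where "subquot_mod M P Q = quot_mod (M\<lparr>carrier := P\<rparr>) Q"

text \<open>
  The kernel and the image of \<open>f : M \<rightarrow> N\<close> are taken modulo the zero submodule.  This is the kernel
  (image) up to the canonical isomorphism \<open>x \<mapsto> {x}\<close>, and it makes kernels, cokernels, images and
  coimages of homomorphisms between modules with the same element type have the same element type
  again, so that they can appear in one family.
\<close>

definition mod_ker ::
    "('r, 'a, 'y) module_scheme \<Rightarrow> ('r, 'b, 'z) module_scheme \<Rightarrow> ('a \<Rightarrow> 'b) \<Rightarrow> ('r, 'a set) module"
  where "mod_ker M N f = subquot_mod M (a_kernel M N f) {\<zero>\<^bsub>M\<^esub>}"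

definition mod_im ::
    "('r, 'a, 'y) module_scheme \<Rightarrow> ('r, 'b, 'z) module_scheme \<Rightarrow> ('a \<Rightarrow> 'b) \<Rightarrow> ('r, 'b set) module"
  where "mod_im M N f = subquot_mod N (f ` carrier M) {\<zero>\<^bsub>N\<^esub>}"

definition mod_coker ::
    "('r, 'a, 'y) module_scheme \<Rightarrow> ('r, 'b, 'z) module_scheme \<Rightarrow> ('a \<Rightarrow> 'b) \<Rightarrow> ('r, 'b set) module"
  where "mod_coker M N f = quot_mod N (f ` carrier M)"

definition mod_coim ::
    "('r, 'a, 'y) module_scheme \<Rightarrow> ('r, 'b, 'z) module_scheme \<Rightarrow> ('a \<Rightarrow> 'b) \<Rightarrow> ('r, 'a set) module"
  where "mod_coim M N f = quot_mod M (a_kernel M N f)"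

definition dual_mod ::
    "('r, 'x) ring_scheme \<Rightarrow> ('r, 'a, 'y) module_scheme \<Rightarrow> ('r, 'a \<Rightarrow> 'r) module"
  where "dual_mod R M =
    \<lparr> carrier = {f \<in> carrier M \<rightarrow>\<^sub>E carrier R.
                   (\<forall>x\<in>carrier M. \<forall>y\<in>carrier M. f (x \<oplus>\<^bsub>M\<^esub> y) = f x \<oplus>\<^bsub>R\<^esub> f y)
                 \<and> (\<forall>a\<in>carrier R. \<forall>x\<in>carrier M. f (a \<odot>\<^bsub>M\<^esub> x) = a \<otimes>\<^bsub>R\<^esub> f x)},
      monoid.mult = undefined, one = undefined,
      zero = (\<lambda>x\<in>carrier M. \<zero>\<^bsub>R\<^esub>),
      add = (\<lambda>f g. \<lambda>x\<in>carrier M. f x \<oplus>\<^bsub>R\<^esub> g x),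
      smult = (\<lambda>a f. \<lambda>x\<in>carrier M. a \<otimes>\<^bsub>R\<^esub> f x) \<rparr>"

definition dsum :: "'i set \<Rightarrow> ('i \<Rightarrow> ('r, 'a) module) \<Rightarrow> ('r, 'i \<Rightarrow> 'a) module"
  where "dsum I M =
    \<lparr> carrier = {f \<in> (\<Pi>\<^sub>E i\<in>I. carrier (M i)). finite {i\<in>I. f i \<noteq> \<zero>\<^bsub>M i\<^esub>}},
      monoid.mult = undefined, one = undefined,
      zero = (\<lambda>i\<in>I. \<zero>\<^bsub>M i\<^esub>),
      add = (\<lambda>f g. \<lambda>i\<in>I. f i \<oplus>\<^bsub>M i\<^esub> g i),
      smult = (\<lambda>a f. \<lambda>i\<in>I. a \<odot>\<^bsub>M i\<^esub> f i) \<rparr>"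

definition mod_span ::
    "('r, 'x) ring_scheme \<Rightarrow> ('r, 'a, 'y) module_scheme \<Rightarrow> 'a set \<Rightarrow> 'a set"
  where "mod_span R M G = \<Inter>{N. submodule N R M \<and> G \<subseteq> N}"

subsection \<open>Tensor products over \<open>R\<close>\<close>

text \<open>
  Tensor products are the free module on tuples modulo the multilinearity relations, once for two
  modules and once for a family with finite index set \<open>I\<close> (for empty \<open>I\<close> the result is free of rank
  one).
\<close>

definition tensor_rels ::
    "('r, 'x) ring_scheme \<Rightarrow> ('r, 'a) module \<Rightarrow> ('r, 'b) module \<Rightarrow> ('a \<times> 'b \<Rightarrow> 'r) set"
  where "tensor_rels R M N =
    (let F = free_mod R (carrier M \<times> carrier N); g = free_gen R in
      {g (x \<oplus>\<^bsub>M\<^esub> x', y) \<ominus>\<^bsub>F\<^esub> (g (x, y) \<oplus>\<^bsub>F\<^esub> g (x', y)) | x x' y.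
          x \<in> carrier M \<and> x' \<in> carrier M \<and> y \<in> carrier N}
    \<union> {g (x, y \<oplus>\<^bsub>N\<^esub> y') \<ominus>\<^bsub>F\<^esub> (g (x, y) \<oplus>\<^bsub>F\<^esub> g (x, y')) | x y y'.
          x \<in> carrier M \<and> y \<in> carrier N \<and> y' \<in> carrier N}
    \<union> {g (a \<odot>\<^bsub>M\<^esub> x, y) \<ominus>\<^bsub>F\<^esub> a \<odot>\<^bsub>F\<^esub> g (x, y) | a x y.
          a \<in> carrier R \<and> x \<in> carrier M \<and> y \<in> carrier N}
    \<union> {g (x, a \<odot>\<^bsub>N\<^esub> y) \<ominus>\<^bsub>F\<^esub> a \<odot>\<^bsub>F\<^esub> g (x, y) | a x y.
          a \<in> carrier R \<and> x \<in> carrier M \<and> y \<in> carrier N})"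

definition tensor ::
    "('r, 'x) ring_scheme \<Rightarrow> ('r, 'a) module \<Rightarrow> ('r, 'b) module \<Rightarrow> ('r, ('a \<times> 'b \<Rightarrow> 'r) set) module"
  where "tensor R M N =
    (let F = free_mod R (carrier M \<times> carrier N) in
      quot_mod F (mod_span R F (tensor_rels R M N)))"

definition tensor_fam_rels ::
    "('r, 'x) ring_scheme \<Rightarrow> 'i set \<Rightarrow> ('i \<Rightarrow> ('r, 'a) module) \<Rightarrow> (('i \<Rightarrow> 'a) \<Rightarrow> 'r) set"
  where "tensor_fam_rels R I M =
    (let F = free_mod R (\<Pi>\<^sub>E i\<in>I. carrier (M i)); g = free_gen R in
      {g (x(i := y \<oplus>\<^bsub>M i\<^esub> y')) \<ominus>\<^bsub>F\<^esub> (g (x(i := y)) \<oplus>\<^bsub>F\<^esub> g (x(i := y'))) | x i y y'.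
          x \<in> (\<Pi>\<^sub>E i\<in>I. carrier (M i)) \<and> i \<in> I \<and> y \<in> carrier (M i) \<and> y' \<in> carrier (M i)}
    \<union> {g (x(i := a \<odot>\<^bsub>M i\<^esub> y)) \<ominus>\<^bsub>F\<^esub> a \<odot>\<^bsub>F\<^esub> g (x(i := y)) | x i a y.
          x \<in> (\<Pi>\<^sub>E i\<in>I. carrier (M i)) \<and> i \<in> I \<and> a \<in> carrier R \<and> y \<in> carrier (M i)})"

definition tensor_fam ::
    "('r, 'x) ring_scheme \<Rightarrow> 'i set \<Rightarrow> ('i \<Rightarrow> ('r, 'a) module) \<Rightarrow> ('r, (('i \<Rightarrow> 'a) \<Rightarrow> 'r) set) module"
  where "tensor_fam R I M =
    (let F = free_mod R (\<Pi>\<^sub>E i\<in>I. carrier (M i)) in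
      quot_mod F (mod_span R F (tensor_fam_rels R I M)))"

subsection \<open>Graded modules\<close>

type_synonym ('r, 'a) gmodule = "nat \<Rightarrow> ('r, 'a) module"

definition gmodule_iso ::
    "('r, 'x) ring_scheme \<Rightarrow> ('r, 'a) gmodule \<Rightarrow> ('r, 'b) gmodule \<Rightarrow> bool"
  where "gmodule_iso R A B \<longleftrightarrow> (\<forall>q. module_iso R (A q) (B q))"

definition gdsum :: "'i set \<Rightarrow> ('i \<Rightarrow> ('r, 'a) gmodule) \<Rightarrow> ('r, 'i \<Rightarrow> 'a) gmodule"
  where "gdsum I A q = dsum I (\<lambda>i. A i q)"

definition gtensor ::
    "('r, 'x) ring_scheme \<Rightarrow> ('r, 'a) gmodule \<Rightarrow> ('r, 'b) gmodule
      \<Rightarrow> ('r, nat \<times> nat \<Rightarrow> ('a \<times> 'b \<Rightarrow> 'r) set) gmodule"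
  where "gtensor R A B q = dsum {(i, j). i + j = q} (\<lambda>(i, j). tensor R (A i) (B j))"

definition gtensor_fam ::
    "('r, 'x) ring_scheme \<Rightarrow> 'i set \<Rightarrow> ('i \<Rightarrow> ('r, 'a) gmodule)
      \<Rightarrow> ('r, ('i \<Rightarrow> nat) \<Rightarrow> (('i \<Rightarrow> 'a) \<Rightarrow> 'r) set) gmodule"
  where "gtensor_fam R I A q =
    dsum {d \<in> I \<rightarrow>\<^sub>E UNIV. (\<Sum>i\<in>I. d i) = q} (\<lambda>d. tensor_fam R I (\<lambda>i. A i (d i)))"

text \<open>
  \<open>diag_tensor R D A B\<close> is the diagonal tensor product of the \<open>D\<close>-indexed module \<open>A\<close> with the
  module \<open>B\<close> indexed by pairs \<open>(s, t)\<close>; it is a family indexed by \<open>t\<close>.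
\<close>

definition diag_tensor ::
    "('r, 'x) ring_scheme \<Rightarrow> 's set \<Rightarrow> ('s \<Rightarrow> ('r, 'a) gmodule) \<Rightarrow> ('s \<Rightarrow> 't \<Rightarrow> ('r, 'b) gmodule)
      \<Rightarrow> 't \<Rightarrow> ('r, 's \<Rightarrow> nat \<times> nat \<Rightarrow> ('a \<times> 'b \<Rightarrow> 'r) set) gmodule"
  where "diag_tensor R D A B t = gdsum D (\<lambda>s. gtensor R (A s) (B s t))"

section \<open>Simplicial complexes and polyhedral joins\<close>

definition simplicial_complex :: "'v set \<Rightarrow> 'v set set \<Rightarrow> bool"
  where "simplicial_complex V K \<longleftrightarrow> K \<subseteq> Pow V \<and> (\<forall>\<tau>\<in>K. \<forall>\<rho>. \<rho> \<subseteq> \<tau> \<longrightarrow> \<rho> \<in> K)"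

text \<open>
  The disjoint union of the \<open>[n\<^sub>k]\<close> is \<open>Sigma {1..m} (\<lambda>k. {1..n k})\<close>, with \<open>(k, j)\<close> the vertex \<open>j\<close> of
  \<open>[n\<^sub>k]\<close>, ordered lexicographically.  An \<open>m\<close>-fold join is void as soon as one factor is.
\<close>

definition vertices :: "nat \<Rightarrow> (nat \<Rightarrow> nat) \<Rightarrow> (nat \<times> nat) set"
  where "vertices m n = Sigma {1..m} (\<lambda>k. {1..n k})"

definition joins :: "'k set \<Rightarrow> ('k \<Rightarrow> 'v set set) \<Rightarrow> ('k \<times> 'v) set set"
  where "joins I Y = {Sigma I \<sigma> | \<sigma>. \<forall>k\<in>I. \<sigma> k \<in> Y k}"

definition polyhedral_join ::
    "nat \<Rightarrow> nat set set \<Rightarrow> (nat \<Rightarrow> 'v set set) \<Rightarrow> (nat \<Rightarrow> 'v set set) \<Rightarrow> (nat \<times> 'v) set set"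
  where "polyhedral_join m K X A = (\<Union>\<tau>\<in>K. joins {1..m} (\<lambda>k. if k \<in> \<tau> then X k else A k))"

section \<open>Index sets\<close>

datatype xsym = Xe | Xn | Xi

type_synonym 'v xindex = "'v set \<times> 'v set"

definition xindices :: "'v set \<Rightarrow> 'v xindex set"
  where "xindices V = {(\<sigma>, \<omega>). \<sigma> \<subseteq> V \<and> \<omega> \<subseteq> V \<and> \<sigma> \<inter> \<omega> = {}}"

definition rindices :: "'v set \<Rightarrow> 'v xindex set"
  where "rindices V = {({}, \<omega>) | \<omega>. \<omega> \<subseteq> V}"

definition xsym_at :: "'v xindex \<Rightarrow> 'v \<Rightarrow> xsym"
  where "xsym_at s k = (if k \<in> fst s then Xe else if k \<in> snd s then Xn else Xi)"

definition xindex_part :: "'k \<Rightarrow> ('k \<times> 'v) xindex \<Rightarrow> 'v xindex"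
  where "xindex_part k t = (fst t `` {k}, snd t `` {k})"

definition xindex_prod ::
    "nat \<Rightarrow> (nat \<Rightarrow> nat) \<Rightarrow> (nat \<Rightarrow> nat xindex set) \<Rightarrow> (nat \<times> nat) xindex set"
  where "xindex_prod m n Ts =
    {t \<in> xindices (vertices m n). \<forall>k\<in>{1..m}. xindex_part k t \<in> Ts k}"

definition xsym_prod :: "nat \<Rightarrow> (nat \<Rightarrow> xsym set) \<Rightarrow> nat xindex set"
  where "xsym_prod m S = {s \<in> xindices {1..m}. \<forall>k\<in>{1..m}. xsym_at s k \<in> S k}"

section \<open>Total homology and cohomology of a simplicial complex\<close>

text \<open>
  \<open>Te, Tn, Ti, Tnbar\<close> are the generators of the complex \<open>T\<close> with \<open>d Tnbar = Tn\<close>.  The tensor power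
  of \<open>T\<close> over the vertex set \<open>V\<close> is the free module on the words \<open>w \<in> V \<rightarrow>\<^sub>E UNIV\<close> (the tensor
  products of generators, in the order of \<open>V\<close>), and the subcomplex of \<open>K\<close> is spanned by the words
  that lie in one of its summands: for some \<open>\<tau> \<in> K\<close> all letters outside \<open>\<tau>\<close> are \<open>Tn\<close> or \<open>Ti\<close>.
\<close>

datatype tgen = Te | Tn | Ti | Tnbar

fun tdeg :: "tgen \<Rightarrow> nat"
  where "tdeg Tnbar = 1" | "tdeg Te = 0" | "tdeg Tn = 0" | "tdeg Ti = 0"

definition twords :: "'v set \<Rightarrow> 'v set set \<Rightarrow> ('v \<Rightarrow> tgen) set"
  where "twords V K = {w \<in> V \<rightarrow>\<^sub>E UNIV. \<exists>\<tau>\<in>K. \<forall>v\<in>V. v \<notin> \<tau> \<longrightarrow> w v \<in> {Tn, Ti}}"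

definition word_index :: "'v set \<Rightarrow> ('v \<Rightarrow> tgen) \<Rightarrow> 'v xindex"
  where "word_index V w = ({v\<in>V. w v = Te}, {v\<in>V. w v \<in> {Tn, Tnbar}})"

definition word_deg :: "'v set \<Rightarrow> ('v \<Rightarrow> tgen) \<Rightarrow> nat"
  where "word_deg V w = (\<Sum>v\<in>V. tdeg (w v))"

definition tchain ::
    "('r, 'x) ring_scheme \<Rightarrow> 'v set \<Rightarrow> 'v set set \<Rightarrow> 'v xindex \<Rightarrow> ('r, ('v \<Rightarrow> tgen) \<Rightarrow> 'r) gmodule"
  where "tchain R V K s q =
    free_mod R {w \<in> twords V K. word_index V w = s \<and> word_deg V w = q}"

text \<open>
  The differential of the tensor power, with the Koszul sign: only letters \<open>Tnbar\<close> contribute.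
\<close>

definition word_boundary ::
    "('r, 'x) ring_scheme \<Rightarrow> 'v::linorder set \<Rightarrow> ('v \<Rightarrow> tgen) \<Rightarrow> ('v \<Rightarrow> tgen) \<Rightarrow> 'r"
  where "word_boundary R V w = (\<lambda>y. \<Oplus>\<^bsub>R\<^esub>v\<in>{v\<in>V. w v = Tnbar}.
    (\<ominus>\<^bsub>R\<^esub> \<one>\<^bsub>R\<^esub>) [^]\<^bsub>R\<^esub> (\<Sum>u\<in>{u\<in>V. u < v}. tdeg (w u)) \<otimes>\<^bsub>R\<^esub> free_gen R (w(v := Tn)) y)"

definition tboundary ::
    "('r, 'x) ring_scheme \<Rightarrow> 'v::linorder set \<Rightarrow> (('v \<Rightarrow> tgen) \<Rightarrow> 'r) \<Rightarrow> ('v \<Rightarrow> tgen) \<Rightarrow> 'r"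
  where "tboundary R V c = (\<lambda>y. \<Oplus>\<^bsub>R\<^esub>w\<in>V \<rightarrow>\<^sub>E UNIV. c w \<otimes>\<^bsub>R\<^esub> word_boundary R V w y)"

definition tcycles ::
    "('r, 'x) ring_scheme \<Rightarrow> 'v::linorder set \<Rightarrow> 'v set set \<Rightarrow> 'v xindex \<Rightarrow> nat
      \<Rightarrow> (('v \<Rightarrow> tgen) \<Rightarrow> 'r) set"
  where "tcycles R V K s q = {c \<in> carrier (tchain R V K s q). tboundary R V c = (\<lambda>w. \<zero>\<^bsub>R\<^esub>)}"

definition tboundaries ::
    "('r, 'x) ring_scheme \<Rightarrow> 'v::linorder set \<Rightarrow> 'v set set \<Rightarrow> 'v xindex \<Rightarrow> nat
      \<Rightarrow> (('v \<Rightarrow> tgen) \<Rightarrow> 'r) set"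
  where "tboundaries R V K s q = tboundary R V ` carrier (tchain R V K s (Suc q))"

definition thom ::
    "('r, 'x) ring_scheme \<Rightarrow> 'v::linorder set \<Rightarrow> 'v set set \<Rightarrow> 'v xindex
      \<Rightarrow> ('r, (('v \<Rightarrow> tgen) \<Rightarrow> 'r) set) gmodule"
  where "thom R V K s q =
    subquot_mod (tchain R V K s q) (tcycles R V K s q) (tboundaries R V K s q)"

definition tcochain ::
    "('r, 'x) ring_scheme \<Rightarrow> 'v set \<Rightarrow> 'v set set \<Rightarrow> 'v xindex
      \<Rightarrow> ('r, (('v \<Rightarrow> tgen) \<Rightarrow> 'r) \<Rightarrow> 'r) gmodule"
  where "tcochain R V K s q = dual_mod R (tchain R V K s q)"

definition tcoboundary ::
    "('r, 'x) ring_scheme \<Rightarrow> 'v::linorder set \<Rightarrow> 'v set set \<Rightarrow> 'v xindex \<Rightarrow> nat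
      \<Rightarrow> ((('v \<Rightarrow> tgen) \<Rightarrow> 'r) \<Rightarrow> 'r) \<Rightarrow> (('v \<Rightarrow> tgen) \<Rightarrow> 'r) \<Rightarrow> 'r"
  where "tcoboundary R V K s q f = (\<lambda>c\<in>carrier (tchain R V K s (Suc q)). f (tboundary R V c))"

definition tcocycles ::
    "('r, 'x) ring_scheme \<Rightarrow> 'v::linorder set \<Rightarrow> 'v set set \<Rightarrow> 'v xindex \<Rightarrow> nat
      \<Rightarrow> ((('v \<Rightarrow> tgen) \<Rightarrow> 'r) \<Rightarrow> 'r) set"
  where "tcocycles R V K s q =
    {f \<in> carrier (tcochain R V K s q). tcoboundary R V K s q f = \<zero>\<^bsub>tcochain R V K s (Suc q)\<^esub>}"

definition tcoboundaries ::
    "('r, 'x) ring_scheme \<Rightarrow> 'v::linorder set \<Rightarrow> 'v set set \<Rightarrow> 'v xindex \<Rightarrow> nat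
      \<Rightarrow> ((('v \<Rightarrow> tgen) \<Rightarrow> 'r) \<Rightarrow> 'r) set"
  where "tcoboundaries R V K s q =
    (case q of 0 \<Rightarrow> {\<zero>\<^bsub>tcochain R V K s 0\<^esub>}
     | Suc p \<Rightarrow> tcoboundary R V K s p ` carrier (tcochain R V K s p))"

definition tcoh ::
    "('r, 'x) ring_scheme \<Rightarrow> 'v::linorder set \<Rightarrow> 'v set set \<Rightarrow> 'v xindex
      \<Rightarrow> ('r, ((('v \<Rightarrow> tgen) \<Rightarrow> 'r) \<Rightarrow> 'r) set) gmodule"
  where "tcoh R V K s q =
    subquot_mod (tcochain R V K s q) (tcocycles R V K s q) (tcoboundaries R V K s q)"

section \<open>Pairs of simplicial complexes\<close>

text \<open>
  For \<open>A \<subseteq> X\<close> a chain of \<open>A\<close> is literally a chain of \<open>X\<close>, so \<open>theta\<close> sends the class of a cycle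
  \<open>z\<close> of \<open>A\<close> to the class of \<open>z\<close> in \<open>X\<close>, and \<open>theta_co\<close> restricts cocycles of \<open>X\<close> to chains of \<open>A\<close>.
\<close>

definition theta ::
    "('r, 'x) ring_scheme \<Rightarrow> 'v::linorder set \<Rightarrow> 'v set set \<Rightarrow> 'v xindex \<Rightarrow> nat
      \<Rightarrow> (('v \<Rightarrow> tgen) \<Rightarrow> 'r) set \<Rightarrow> (('v \<Rightarrow> tgen) \<Rightarrow> 'r) set"
  where "theta R V X s q C = (\<Union>z\<in>C. tboundaries R V X s q +>\<^bsub>tchain R V X s q\<^esub> z)"

definition theta_co ::
    "('r, 'x) ring_scheme \<Rightarrow> 'v::linorder set \<Rightarrow> 'v set set \<Rightarrow> 'v xindex \<Rightarrow> nat
      \<Rightarrow> ((('v \<Rightarrow> tgen) \<Rightarrow> 'r) \<Rightarrow> 'r) set \<Rightarrow> ((('v \<Rightarrow> tgen) \<Rightarrow> 'r) \<Rightarrow> 'r) set"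
  where "theta_co R V A s q C =
    (\<Union>f\<in>C. tcoboundaries R V A s q +>\<^bsub>tcochain R V A s q\<^esub> restrict f (carrier (tchain R V A s q)))"

definition theta_epi ::
    "('r, 'x) ring_scheme \<Rightarrow> 'v::linorder set \<Rightarrow> 'v set set \<Rightarrow> 'v set set \<Rightarrow> 'v xindex \<Rightarrow> bool"
  where "theta_epi R V X A s \<longleftrightarrow>
    (\<forall>q. theta R V X s q ` carrier (thom R V A s q) = carrier (thom R V X s q))"

definition coker_theta ::
    "('r, 'x) ring_scheme \<Rightarrow> 'v::linorder set \<Rightarrow> 'v set set \<Rightarrow> 'v set set \<Rightarrow> 'v xindex
      \<Rightarrow> ('r, (('v \<Rightarrow> tgen) \<Rightarrow> 'r) set set) gmodule"
  where "coker_theta R V X A s q = mod_coker (thom R V A s q) (thom R V X s q) (theta R V X s q)"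

definition ker_theta ::
    "('r, 'x) ring_scheme \<Rightarrow> 'v::linorder set \<Rightarrow> 'v set set \<Rightarrow> 'v set set \<Rightarrow> 'v xindex
      \<Rightarrow> ('r, (('v \<Rightarrow> tgen) \<Rightarrow> 'r) set set) gmodule"
  where "ker_theta R V X A s q = mod_ker (thom R V A s q) (thom R V X s q) (theta R V X s q)"

definition coim_theta ::
    "('r, 'x) ring_scheme \<Rightarrow> 'v::linorder set \<Rightarrow> 'v set set \<Rightarrow> 'v set set \<Rightarrow> 'v xindex
      \<Rightarrow> ('r, (('v \<Rightarrow> tgen) \<Rightarrow> 'r) set set) gmodule"
  where "coim_theta R V X A s q = mod_coim (thom R V A s q) (thom R V X s q) (theta R V X s q)"

definition ker_theta_co ::
    "('r, 'x) ring_scheme \<Rightarrow> 'v::linorder set \<Rightarrow> 'v set set \<Rightarrow> 'v set set \<Rightarrow> 'v xindex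
      \<Rightarrow> ('r, ((('v \<Rightarrow> tgen) \<Rightarrow> 'r) \<Rightarrow> 'r) set set) gmodule"
  where "ker_theta_co R V X A s q =
    mod_ker (tcoh R V X s q) (tcoh R V A s q) (theta_co R V A s q)"

definition coker_theta_co ::
    "('r, 'x) ring_scheme \<Rightarrow> 'v::linorder set \<Rightarrow> 'v set set \<Rightarrow> 'v set set \<Rightarrow> 'v xindex
      \<Rightarrow> ('r, ((('v \<Rightarrow> tgen) \<Rightarrow> 'r) \<Rightarrow> 'r) set set) gmodule"
  where "coker_theta_co R V X A s q =
    mod_coker (tcoh R V X s q) (tcoh R V A s q) (theta_co R V A s q)"

definition im_theta_co ::
    "('r, 'x) ring_scheme \<Rightarrow> 'v::linorder set \<Rightarrow> 'v set set \<Rightarrow> 'v set set \<Rightarrow> 'v xindex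
      \<Rightarrow> ('r, ((('v \<Rightarrow> tgen) \<Rightarrow> 'r) \<Rightarrow> 'r) set set) gmodule"
  where "im_theta_co R V X A s q =
    mod_im (tcoh R V X s q) (tcoh R V A s q) (theta_co R V A s q)"

text \<open>Freeness of a graded module is freeness in every degree.\<close>

definition densely_split ::
    "('r, 'x) ring_scheme \<Rightarrow> 'v::linorder set \<Rightarrow> 'v set set \<Rightarrow> 'v set set \<Rightarrow> 'v xindex set \<Rightarrow> bool"
  where "densely_split R V X A Ts \<longleftrightarrow>
    (\<forall>s\<in>Ts. \<forall>q. free_module R (ker_theta R V X A s q)
              \<and> free_module R (coker_theta R V X A s q)
              \<and> free_module R (coim_theta R V X A s q))"

fun pair_hom ::
    "('r, 'x) ring_scheme \<Rightarrow> 'v::linorder set \<Rightarrow> 'v set set \<Rightarrow> 'v set set \<Rightarrow> xsym \<Rightarrow> 'v xindex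
      \<Rightarrow> ('r, (('v \<Rightarrow> tgen) \<Rightarrow> 'r) set set) gmodule"
  where
    "pair_hom R V X A Xe t = coker_theta R V X A t"
  | "pair_hom R V X A Xn t = ker_theta R V X A t"
  | "pair_hom R V X A Xi t = coim_theta R V X A t"

fun pair_coh ::
    "('r, 'x) ring_scheme \<Rightarrow> 'v::linorder set \<Rightarrow> 'v set set \<Rightarrow> 'v set set \<Rightarrow> xsym \<Rightarrow> 'v xindex
      \<Rightarrow> ('r, ((('v \<Rightarrow> tgen) \<Rightarrow> 'r) \<Rightarrow> 'r) set set) gmodule"
  where
    "pair_coh R V X A Xe t = ker_theta_co R V X A t"
  | "pair_coh R V X A Xn t = coker_theta_co R V X A t"
  | "pair_coh R V X A Xi t = im_theta_co R V X A t"

definition dense_support ::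
    "('r, 'x) ring_scheme \<Rightarrow> 'v::linorder set \<Rightarrow> 'v set set \<Rightarrow> 'v set set \<Rightarrow> 'v xindex set
      \<Rightarrow> xsym set"
  where "dense_support R V X A Ts =
    {s. \<exists>t\<in>Ts. \<exists>q. carrier (pair_hom R V X A s t q) \<noteq> {\<zero>\<^bsub>pair_hom R V X A s t q\<^esub>}}"

text \<open>
  The local pieces of the (co)homology of a sequence of pairs \<open>(X k, A k)\<close> on \<open>[n\<^sub>k]\<close>.
\<close>

definition seq_hom ::
    "('r, 'x) ring_scheme \<Rightarrow> nat \<Rightarrow> (nat \<Rightarrow> nat) \<Rightarrow> (nat \<Rightarrow> nat set set) \<Rightarrow> (nat \<Rightarrow> nat set set)
      \<Rightarrow> nat xindex \<Rightarrow> (nat \<times> nat) xindex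
      \<Rightarrow> ('r, (nat \<Rightarrow> nat) \<Rightarrow> ((nat \<Rightarrow> ((nat \<Rightarrow> tgen) \<Rightarrow> 'r) set set) \<Rightarrow> 'r) set) gmodule"
  where "seq_hom R m n X A s t =
    gtensor_fam R {1..m}
      (\<lambda>k. pair_hom R {1..n k} (X k) (A k) (xsym_at s k) (xindex_part k t))"

definition seq_coh ::
    "('r, 'x) ring_scheme \<Rightarrow> nat \<Rightarrow> (nat \<Rightarrow> nat) \<Rightarrow> (nat \<Rightarrow> nat set set) \<Rightarrow> (nat \<Rightarrow> nat set set)
      \<Rightarrow> nat xindex \<Rightarrow> (nat \<times> nat) xindex
      \<Rightarrow> ('r, (nat \<Rightarrow> nat) \<Rightarrow> ((nat \<Rightarrow> (((nat \<Rightarrow> tgen) \<Rightarrow> 'r) \<Rightarrow> 'r) set set) \<Rightarrow> 'r) set) gmodule"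
  where "seq_coh R m n X A s t =
    gtensor_fam R {1..m}
      (\<lambda>k. pair_coh R {1..n k} (X k) (A k) (xsym_at s k) (xindex_part k t))"

end

theory Submission
  imports "HOL-Algebra.Ring_Divisibility" Defs
begin

text \<open>Cut a word on the vertices of the join \<open>Z\<close> into its parts on the sets \<open>[n\<^sub>k]\<close>.  It belongs to \<open>Z\<close> iff all parts
  are words of \<open>X k\<close> and the positions \<open>k\<close> whose part is not a word of \<open>A k\<close> form a face of \<open>K\<close>.  Hence the chain
  complex of \<open>Z\<close> at the index \<open>t\<close> is a \<^emph>\<open>tensor product over\<close> \<open>K\<close> (\<open>joins_roll\<close>): the span, in the tensor product
  of the complexes of the \<open>X k\<close>, of those words which leave the subcomplexes of the \<open>A k\<close> only along a face of \<open>K\<close>.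
  This construction makes sense for arbitrary based complexes with a chosen part of the basis; the complex of \<open>K\<close>
  itself is the instance whose factors have the letters of one kind as basis and \<open>Tn\<close>, \<open>Ti\<close> as the chosen part.

  A tensor product over \<open>K\<close> keeps its homology and cohomology when a factor is replaced by one that is homotopy
  equivalent to it as a pair (\<open>tensor_equiv\<close>).  Over a principal ideal domain, and \<open>R\<close> is one, a densely split pair
  has a minimal model.  A class of the cokernel of \<open>\<theta>\<close> is represented by a cycle of \<open>X\<close>, a class of the coimage by
  a cycle of \<open>A\<close>, and a class of the kernel by a cycle of \<open>A\<close> together with a chain of \<open>X\<close> that it bounds.  These
  representatives, labelled by the letters \<open>Te\<close>, by \<open>Ti\<close>, and by \<open>Tn\<close> and \<open>Tnbar\<close>, span a subcomplex; sections of
  the differentials and of the projections to the free modules give a deformation retraction of the pair onto it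
  that preserves the subcomplex of \<open>A\<close> (\<open>retraction_exists\<close>).

  After the replacement the basis consists of words of labels, a label being a class with a letter.  The differential
  changes letters and keeps classes.  So the complex is a direct sum of blocks, one for every choice \<open>\<beta>\<close> of a class
  of each pair, and the block of \<open>\<beta>\<close> is, up to signs and a shift by the total degree of the classes, the complex of
  \<open>K\<close> at the index in \<open>\<X>\<^sub>m\<close> formed by the kinds of the classes (\<open>blocks_split\<close>).  This yields both
  isomorphisms as sums over blocks (\<open>join_hom\<close>, \<open>join_coh\<close>).  Tensoring with a free module amounts to taking one copy
  for each basis element, so the sum over the blocks is the diagonal tensor product (\<open>tensor_blocks\<close>).

  In cohomology the blocks are the same, because the kernel, cokernel and image of \<open>\<theta>\<degree>\<close> are free on the same
  bases: a cocycle is evaluated on the representatives of the classes (\<open>coh_ker\<close>, \<open>coh_coker\<close>, \<open>coh_im\<close>).  The set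
  \<open>D\<close> only has to contain the indices of the blocks.  A kind that occurs in a block has a nonzero module, hence lies
  in the dense support, and the kind \<open>Xe\<close> does not occur when all \<open>\<theta>\<close> are onto (\<open>polyhedral_join_iso\<close>).\<close>

section \<open>Linear maps and submodules\<close>

definition lin ::
    "('r, 'x) ring_scheme \<Rightarrow> ('r, 'a, 'y) module_scheme \<Rightarrow> ('r, 'b, 'z) module_scheme \<Rightarrow> ('a \<Rightarrow> 'b) \<Rightarrow> bool"
  where "lin R M N f \<longleftrightarrow> f \<in> carrier M \<rightarrow> carrier N
    \<and> (\<forall>x\<in>carrier M. \<forall>y\<in>carrier M. f (x \<oplus>\<^bsub>M\<^esub> y) = f x \<oplus>\<^bsub>N\<^esub> f y)
    \<and> (\<forall>a\<in>carrier R. \<forall>x\<in>carrier M. f (a \<odot>\<^bsub>M\<^esub> x) = a \<odot>\<^bsub>N\<^esub> f x)"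

lemma linI:
  assumes "\<And>x. x \<in> carrier M \<Longrightarrow> f x \<in> carrier N"
    and "\<And>x y. x \<in> carrier M \<Longrightarrow> y \<in> carrier M \<Longrightarrow> f (x \<oplus>\<^bsub>M\<^esub> y) = f x \<oplus>\<^bsub>N\<^esub> f y"
    and "\<And>a x. a \<in> carrier R \<Longrightarrow> x \<in> carrier M \<Longrightarrow> f (a \<odot>\<^bsub>M\<^esub> x) = a \<odot>\<^bsub>N\<^esub> f x"
  shows "lin R M N f"
  using assms by (auto simp: lin_def)

lemma lin_closed: "lin R M N f \<Longrightarrow> x \<in> carrier M \<Longrightarrow> f x \<in> carrier N"
  by (auto simp: lin_def)

lemma lin_add: "lin R M N f \<Longrightarrow> x \<in> carrier M \<Longrightarrow> y \<in> carrier M \<Longrightarrow> f (x \<oplus>\<^bsub>M\<^esub> y) = f x \<oplus>\<^bsub>N\<^esub> f y"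
  by (auto simp: lin_def)

lemma lin_smult: "lin R M N f \<Longrightarrow> a \<in> carrier R \<Longrightarrow> x \<in> carrier M \<Longrightarrow> f (a \<odot>\<^bsub>M\<^esub> x) = a \<odot>\<^bsub>N\<^esub> f x"
  by (auto simp: lin_def)

lemma lin_comp: "lin R M N f \<Longrightarrow> lin R N P g \<Longrightarrow> lin R M P (\<lambda>x. g (f x))"
  by (auto simp: lin_def Pi_iff)

lemma lin_cong:
  assumes "lin R M N f" "module R M" "\<And>x. x \<in> carrier M \<Longrightarrow> g x = f x"
  shows "lin R M N g"
proof -
  interpret M: module R M by fact
  show ?thesis using assms(1,3) by (auto simp: lin_def Pi_iff)
qed

lemma lin_zero:
  assumes "lin R M N f" "module R M" "module R N"
  shows "f \<zero>\<^bsub>M\<^esub> = \<zero>\<^bsub>N\<^esub>"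
proof -
  interpret M: module R M by fact
  interpret N: module R N by fact
  have "f (\<zero>\<^bsub>R\<^esub> \<odot>\<^bsub>M\<^esub> \<zero>\<^bsub>M\<^esub>) = \<zero>\<^bsub>R\<^esub> \<odot>\<^bsub>N\<^esub> f \<zero>\<^bsub>M\<^esub>"
    by (rule lin_smult[OF assms(1)]) auto
  thus ?thesis using lin_closed[OF assms(1)] by simp
qed

lemma module_uminus:
  assumes "module R M" "x \<in> carrier M"
  shows "\<ominus>\<^bsub>M\<^esub> x = (\<ominus>\<^bsub>R\<^esub> \<one>\<^bsub>R\<^esub>) \<odot>\<^bsub>M\<^esub> x"
proof -
  interpret M: module R M by fact
  show ?thesis using assms(2) M.smult_l_minus[of "\<one>\<^bsub>R\<^esub>" x] by simp
qed

lemma lin_minus: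
  assumes "lin R M N f" "module R M" "module R N" "x \<in> carrier M" "y \<in> carrier M"
  shows "f (x \<ominus>\<^bsub>M\<^esub> y) = f x \<ominus>\<^bsub>N\<^esub> f y"
proof -
  interpret M: module R M by fact
  interpret N: module R N by fact
  have "f (\<ominus>\<^bsub>M\<^esub> y) = \<ominus>\<^bsub>N\<^esub> f y"
    using assms lin_closed[OF assms(1)] by (simp add: module_uminus lin_smult[OF assms(1)])
  thus ?thesis using assms lin_add[OF assms(1), of x "\<ominus>\<^bsub>M\<^esub> y"]
    by (simp add: a_minus_def)
qed

lemma module_minus_eq_zero:
  assumes "module R M" "x \<in> carrier M" "y \<in> carrier M"
  shows "x \<ominus>\<^bsub>M\<^esub> y = \<zero>\<^bsub>M\<^esub> \<longleftrightarrow> x = y"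
proof -
  interpret M: module R M by fact
  show ?thesis
  proof
    assume "x \<ominus>\<^bsub>M\<^esub> y = \<zero>\<^bsub>M\<^esub>"
    hence "x \<oplus>\<^bsub>M\<^esub> \<ominus>\<^bsub>M\<^esub> y \<oplus>\<^bsub>M\<^esub> y = y" using assms by (simp add: a_minus_def)
    thus "x = y" using assms by (simp add: M.a_assoc M.l_neg)
  qed (use assms in \<open>simp add: a_minus_def M.r_neg\<close>)
qed

lemma lin_uminus_eq:
  assumes "lin R M N f" "module R M" "module R N" "x \<in> carrier M" "y \<in> carrier M"
  shows "f x = f y \<longleftrightarrow> f (x \<ominus>\<^bsub>M\<^esub> y) = \<zero>\<^bsub>N\<^esub>"
proof -
  interpret M: module R M by fact
  interpret N: module R N by fact
  show ?thesis using assms lin_closed[OF assms(1)]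
    by (simp add: lin_minus[OF assms(1-3)] module_minus_eq_zero)
qed

lemma module_iso_lin: "module_iso R M N \<longleftrightarrow> (\<exists>h. lin R M N h \<and> bij_betw h (carrier M) (carrier N))"
  by (auto simp: module_iso_def lin_def bij_betw_def)

lemma module_iso_refl: "module_iso R M M"
  unfolding module_iso_def by (rule exI[of _ "\<lambda>x. x"]) (auto simp: bij_betw_def)

lemma lin_inv_into:
  assumes "module R M" "lin R M N h" "bij_betw h (carrier M) (carrier N)"
  shows "lin R N M (inv_into (carrier M) h)"
proof -
  interpret M: module R M by fact
  let ?g = "inv_into (carrier M) h"
  have g: "?g y \<in> carrier M" "h (?g y) = y" if "y \<in> carrier N" for y
    using assms(3) that by (auto simp: bij_betw_def inv_into_into f_inv_into_f)
  have gh: "?g (h x) = x" if "x \<in> carrier M" for x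
    using assms(3) that by (simp add: bij_betw_def)
  show ?thesis
  proof (rule linI)
    fix x y assume "x \<in> carrier N" "y \<in> carrier N"
    thus "?g (x \<oplus>\<^bsub>N\<^esub> y) = ?g x \<oplus>\<^bsub>M\<^esub> ?g y"
      using gh[of "?g x \<oplus>\<^bsub>M\<^esub> ?g y"] g lin_add[OF assms(2)] by simp
  next
    fix a x assume "a \<in> carrier R" "x \<in> carrier N"
    thus "?g (a \<odot>\<^bsub>N\<^esub> x) = a \<odot>\<^bsub>M\<^esub> ?g x"
      using gh[of "a \<odot>\<^bsub>M\<^esub> ?g x"] g lin_smult[OF assms(2)] by simp
  qed (rule g)
qed

lemma module_iso_sym: "module R M \<Longrightarrow> module_iso R M N \<Longrightarrow> module_iso R N M"
  unfolding module_iso_lin using lin_inv_into bij_betw_inv_into by blast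

lemma module_iso_trans: "module_iso R M N \<Longrightarrow> module_iso R N P \<Longrightarrow> module_iso R M P"
  unfolding module_iso_lin using lin_comp bij_betw_trans by (fastforce simp: o_def)

lemma module_image:
  assumes "module R M"
    and im: "p ` carrier M = carrier N"
    and add: "\<And>x y. x \<in> carrier M \<Longrightarrow> y \<in> carrier M \<Longrightarrow> p (x \<oplus>\<^bsub>M\<^esub> y) = p x \<oplus>\<^bsub>N\<^esub> p y"
    and sm: "\<And>a x. a \<in> carrier R \<Longrightarrow> x \<in> carrier M \<Longrightarrow> p (a \<odot>\<^bsub>M\<^esub> x) = a \<odot>\<^bsub>N\<^esub> p x"
    and zero: "p \<zero>\<^bsub>M\<^esub> = \<zero>\<^bsub>N\<^esub>"
  shows "module R N"
proof -
  interpret M: module R M by fact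
  have ex: "\<exists>x\<in>carrier M. y = p x" if "y \<in> carrier N" for y using im that by auto
  have cl: "p x \<in> carrier N" if "x \<in> carrier M" for x using im that by auto
  show ?thesis
  proof (rule moduleI)
    show "cring R" by (rule M.is_cring)
    show "abelian_group N"
    proof (rule abelian_groupI)
      fix x y assume "x \<in> carrier N" "y \<in> carrier N"
      then obtain x' y' where "x' \<in> carrier M" "x = p x'" "y' \<in> carrier M" "y = p y'"
        using ex by blast
      thus "x \<oplus>\<^bsub>N\<^esub> y \<in> carrier N" "x \<oplus>\<^bsub>N\<^esub> y = y \<oplus>\<^bsub>N\<^esub> x"
        using cl by (simp_all flip: add add: M.a_comm)
    next
      show "\<zero>\<^bsub>N\<^esub> \<in> carrier N" using cl[of "\<zero>\<^bsub>M\<^esub>"] zero by simp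
    next
      fix x y z assume "x \<in> carrier N" "y \<in> carrier N" "z \<in> carrier N"
      then obtain x' y' z' where "x' \<in> carrier M" "x = p x'" "y' \<in> carrier M" "y = p y'"
        "z' \<in> carrier M" "z = p z'"
        using ex by metis
      thus "x \<oplus>\<^bsub>N\<^esub> y \<oplus>\<^bsub>N\<^esub> z = x \<oplus>\<^bsub>N\<^esub> (y \<oplus>\<^bsub>N\<^esub> z)"
        by (simp flip: add add: M.a_assoc)
    next
      fix x assume "x \<in> carrier N"
      then obtain x' where x': "x' \<in> carrier M" "x = p x'" using ex by blast
      show "\<zero>\<^bsub>N\<^esub> \<oplus>\<^bsub>N\<^esub> x = x" using x' by (simp flip: add zero)
      show "\<exists>y\<in>carrier N. y \<oplus>\<^bsub>N\<^esub> x = \<zero>\<^bsub>N\<^esub>"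
        by (rule bexI[of _ "p (\<ominus>\<^bsub>M\<^esub> x')"]) (use x' cl in \<open>simp_all flip: add zero add: M.l_neg\<close>)
    qed
  next
    fix a b x assume h: "a \<in> carrier R" "b \<in> carrier R" "x \<in> carrier N"
    then obtain x' where x': "x' \<in> carrier M" "x = p x'" using ex by blast
    show "a \<odot>\<^bsub>N\<^esub> x \<in> carrier N" using h x' cl by (simp flip: sm)
    show "(a \<oplus>\<^bsub>R\<^esub> b) \<odot>\<^bsub>N\<^esub> x = a \<odot>\<^bsub>N\<^esub> x \<oplus>\<^bsub>N\<^esub> b \<odot>\<^bsub>N\<^esub> x"
      using h x' by (simp flip: sm add add: M.smult_l_distr)
    show "a \<otimes>\<^bsub>R\<^esub> b \<odot>\<^bsub>N\<^esub> x = a \<odot>\<^bsub>N\<^esub> (b \<odot>\<^bsub>N\<^esub> x)"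
      using h x' by (simp flip: sm add add: M.smult_assoc1)
  next
    fix a x y assume h: "a \<in> carrier R" "x \<in> carrier N" "y \<in> carrier N"
    then obtain x' y' where "x' \<in> carrier M" "x = p x'" "y' \<in> carrier M" "y = p y'"
      using ex by blast
    thus "a \<odot>\<^bsub>N\<^esub> (x \<oplus>\<^bsub>N\<^esub> y) = a \<odot>\<^bsub>N\<^esub> x \<oplus>\<^bsub>N\<^esub> a \<odot>\<^bsub>N\<^esub> y"
      using h by (simp flip: sm add add: M.smult_r_distr)
  next
    fix x assume "x \<in> carrier N"
    then obtain x' where "x' \<in> carrier M" "x = p x'" using ex by blast
    thus "\<one>\<^bsub>R\<^esub> \<odot>\<^bsub>N\<^esub> x = x" by (simp flip: sm)
  qed
qed

text \<open>Equivalent to \<open>submodule\<close> (\<open>subm_submodule\<close>), in a form that simplification transfers to restricted carriers.\<close>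

definition subm :: "('r, 'x) ring_scheme \<Rightarrow> ('r, 'a, 'y) module_scheme \<Rightarrow> 'a set \<Rightarrow> bool"
  where "subm R M P \<longleftrightarrow> P \<subseteq> carrier M \<and> \<zero>\<^bsub>M\<^esub> \<in> P \<and> (\<forall>x\<in>P. \<forall>y\<in>P. x \<oplus>\<^bsub>M\<^esub> y \<in> P)
    \<and> (\<forall>a\<in>carrier R. \<forall>x\<in>P. a \<odot>\<^bsub>M\<^esub> x \<in> P)"

lemma submI:
  assumes "P \<subseteq> carrier M" "\<zero>\<^bsub>M\<^esub> \<in> P" "\<And>x y. x \<in> P \<Longrightarrow> y \<in> P \<Longrightarrow> x \<oplus>\<^bsub>M\<^esub> y \<in> P"
    "\<And>a x. a \<in> carrier R \<Longrightarrow> x \<in> P \<Longrightarrow> a \<odot>\<^bsub>M\<^esub> x \<in> P"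
  shows "subm R M P"
  using assms by (auto simp: subm_def)

lemma subm_uminus: "module R M \<Longrightarrow> subm R M P \<Longrightarrow> x \<in> P \<Longrightarrow> \<ominus>\<^bsub>M\<^esub> x \<in> P"
proof -
  assume a: "module R M" "subm R M P" "x \<in> P"
  interpret module R M by fact
  show ?thesis using a by (auto simp: module_uminus subm_def)
qed

lemma subm_minus: "module R M \<Longrightarrow> subm R M P \<Longrightarrow> x \<in> P \<Longrightarrow> y \<in> P \<Longrightarrow> x \<ominus>\<^bsub>M\<^esub> y \<in> P"
  using subm_uminus[of R M P y] by (auto simp: subm_def a_minus_def)

lemma subm_submodule: "module R M \<Longrightarrow> subm R M P \<longleftrightarrow> submodule P R M"
proof
  assume a: "module R M" "subm R M P"
  interpret module R M by fact
  show "submodule P R M"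
    using a(2) subm_uminus[OF a] by (intro submoduleI) (auto simp: subm_def)
next
  assume a: "module R M" "submodule P R M"
  interpret module R M by fact
  show "subm R M P"
    using submoduleE[OF a(2)] a(2) subgroup.one_closed[of P "add_monoid M"]
    by (auto simp: subm_def submodule_def)
qed

lemma module_subm: "module R M \<Longrightarrow> subm R M P \<Longrightarrow> module R (M\<lparr>carrier := P\<rparr>)"
  using submodule.submodule_is_module subm_submodule by blast

lemma subm_minus_op:
  assumes "module R M" "subm R M P" "x \<in> P" "y \<in> P"
  shows "x \<ominus>\<^bsub>M\<lparr>carrier := P\<rparr>\<^esub> y = x \<ominus>\<^bsub>M\<^esub> y"
proof -
  interpret M: module R M by fact
  interpret P: module R "M\<lparr>carrier := P\<rparr>" by (rule module_subm) fact+
  have "\<ominus>\<^bsub>M\<lparr>carrier := P\<rparr>\<^esub> y = \<ominus>\<^bsub>M\<^esub> y"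
    using assms by (subst (1 2) module_uminus[where R = R])
      (auto simp: M.module_axioms P.module_axioms subm_def)
  thus ?thesis by (simp add: a_minus_def)
qed

lemma subm_carrier: "module R M \<Longrightarrow> subm R M (carrier M)"
proof -
  assume "module R M"
  then interpret module R M .
  show ?thesis by (auto simp: subm_def)
qed

lemma subm_restrict: "subm R M P \<Longrightarrow> subm R M Q \<Longrightarrow> P \<subseteq> Q \<Longrightarrow> subm R (M\<lparr>carrier := Q\<rparr>) P"
  by (auto simp: subm_def)

lemma subm_kernel:
  assumes "module R M" "module R N" "lin R M N f" "subm R N Q"
  shows "subm R M {x \<in> carrier M. f x \<in> Q}"
proof -
  interpret M: module R M by fact
  show ?thesis using assms lin_zero[OF assms(3,1,2)]
    by (intro submI) (auto simp: lin_add lin_smult subm_def)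
qed

lemma subm_zero: "module R N \<Longrightarrow> subm R N {\<zero>\<^bsub>N\<^esub>}"
proof -
  assume "module R N"
  then interpret module R N .
  show ?thesis by (auto simp: subm_def)
qed

lemma subm_image:
  assumes "module R M" "module R N" "lin R M N f" "subm R M P"
  shows "subm R N (f ` P)"
proof -
  have "f x \<oplus>\<^bsub>N\<^esub> f y \<in> f ` P" if "x \<in> P" "y \<in> P" for x y
    using assms(4) that lin_add[OF assms(3), of x y] by (auto simp: subm_def subset_iff intro!: image_eqI[of _ f "x \<oplus>\<^bsub>M\<^esub> y"])
  moreover have "a \<odot>\<^bsub>N\<^esub> f x \<in> f ` P" if "x \<in> P" "a \<in> carrier R" for x a
    using assms(4) that lin_smult[OF assms(3), of a x]
    by (auto simp: subm_def subset_iff intro!: image_eqI[of _ f "a \<odot>\<^bsub>M\<^esub> x"])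
  ultimately show ?thesis
    using assms lin_zero[OF assms(3,1,2)] lin_closed[OF assms(3)]
    by (intro submI) (auto simp: subm_def intro: rev_image_eqI)
qed

text \<open>\<open>p\<close> exhibits \<open>N\<close> as the quotient of \<open>M\<close> by \<open>Q\<close>.  Two modules presented by the same \<open>M\<close> and \<open>Q\<close> are isomorphic, so
  homology modules can be compared without ever looking at cosets.\<close>

definition presents ::
    "('r, 'x) ring_scheme \<Rightarrow> ('r, 'a, 'y) module_scheme \<Rightarrow> ('a \<Rightarrow> 'b) \<Rightarrow> ('r, 'b, 'z) module_scheme
      \<Rightarrow> 'a set \<Rightarrow> bool"
  where "presents R M p N Q \<longleftrightarrow> module R M \<and> module R N \<and> lin R M N p
    \<and> p ` carrier M = carrier N \<and> {x\<in>carrier M. p x = \<zero>\<^bsub>N\<^esub>} = Q"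

lemma presents_eq_iff:
  assumes "presents R M p N Q" "x \<in> carrier M" "y \<in> carrier M"
  shows "p x = p y \<longleftrightarrow> x \<ominus>\<^bsub>M\<^esub> y \<in> Q"
proof -
  interpret M: module R M using assms by (simp add: presents_def)
  show ?thesis
    using assms lin_uminus_eq[of R M N p x y] by (auto simp: presents_def)
qed

lemma presents_iso:
  assumes "presents R M p N Q" "presents R M p' N' Q"
  shows "module_iso R N N'"
proof -
  interpret M: module R M using assms by (simp add: presents_def)
  define h where "h y = p' (SOME x. x \<in> carrier M \<and> p x = y)" for y
  have im: "p ` carrier M = carrier N" "p' ` carrier M = carrier N'"
    using assms by (auto simp: presents_def)
  have l: "lin R M N p" "lin R M N' p'" using assms by (auto simp: presents_def)
  have h: "h (p x) = p' x" if "x \<in> carrier M" for x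
  proof -
    let ?x = "SOME x'. x' \<in> carrier M \<and> p x' = p x"
    have "?x \<in> carrier M \<and> p ?x = p x" by (rule someI[of _ x]) (use that in auto)
    thus ?thesis
      using presents_eq_iff[OF assms(1), of ?x x] presents_eq_iff[OF assms(2), of ?x x] that
      by (simp add: h_def)
  qed
  show ?thesis unfolding module_iso_lin
  proof (intro exI conjI)
    show "lin R N N' h"
      using h l im by (intro linI) (auto simp flip: im(1) lin_add[OF l(1)] lin_smult[OF l(1)]
          simp: lin_add[OF l(2)] lin_smult[OF l(2)])
    show "bij_betw h (carrier N) (carrier N')"
      unfolding bij_betw_def
    proof
      show "inj_on h (carrier N)"
        using h presents_eq_iff[OF assms(1)] presents_eq_iff[OF assms(2)]
        by (auto simp: inj_on_def simp flip: im(1))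
      show "h ` carrier N = carrier N'"
        using h im by (simp flip: im add: image_image)
    qed
  qed
qed

lemma presents_comp:
  assumes "presents R M p N Q" "presents R N p' N' Q'"
  shows "presents R M (\<lambda>x. p' (p x)) N' {x\<in>carrier M. p x \<in> Q'}"
proof -
  have "lin R M N p" "p ` carrier M = carrier N" using assms by (auto simp: presents_def)
  thus ?thesis using assms lin_comp[of R M N p N' p']
    by (auto simp: presents_def lin_closed simp flip: image_image)
qed

lemma presents_sub:
  assumes "presents R M p N Q" "subm R M P"
  shows "presents R (M\<lparr>carrier := P\<rparr>) p (N\<lparr>carrier := p ` P\<rparr>) (P \<inter> Q)"
proof -
  have l: "lin R M N p" and m: "module R M" "module R N" using assms by (auto simp: presents_def)
  have "subm R N (p ` P)" by (rule subm_image[OF m l assms(2)])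
  hence "module R (N\<lparr>carrier := p ` P\<rparr>)" by (rule module_subm[OF m(2)])
  moreover have "lin R (M\<lparr>carrier := P\<rparr>) (N\<lparr>carrier := p ` P\<rparr>) p"
    using assms(2) l by (intro linI) (auto simp: lin_add lin_smult subm_def subset_iff)
  ultimately show ?thesis using assms module_subm[OF m(1) assms(2)]
    by (auto simp: presents_def subm_def)
qed

lemma presents_bij:
  assumes "module R M" "module R N" "lin R M N h" "bij_betw h (carrier M) (carrier N)"
  shows "presents R M h N {\<zero>\<^bsub>M\<^esub>}"
proof -
  interpret M: module R M by fact
  have "{x\<in>carrier M. h x = \<zero>\<^bsub>N\<^esub>} = {\<zero>\<^bsub>M\<^esub>}"
  proof -
    have h0: "h \<zero>\<^bsub>M\<^esub> = \<zero>\<^bsub>N\<^esub>" by (rule lin_zero[OF assms(3,1,2)])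
    have "x = \<zero>\<^bsub>M\<^esub>" if "x \<in> carrier M" "h x = \<zero>\<^bsub>N\<^esub>" for x
      using inj_onD[of h "carrier M" x "\<zero>\<^bsub>M\<^esub>"] assms(4) that h0 by (simp add: bij_betw_def)
    thus ?thesis using h0 by blast
  qed
  thus ?thesis using assms by (auto simp: presents_def bij_betw_def)
qed

lemma presents_iso_right:
  assumes "presents R M p N Q" "module_iso R N N'" "module R N'"
  shows "\<exists>p'. presents R M p' N' Q"
proof -
  obtain h where h: "lin R N N' h" "bij_betw h (carrier N) (carrier N')"
    using assms(2) unfolding module_iso_lin by blast
  have m: "module R N" and Q: "{x\<in>carrier M. p x = \<zero>\<^bsub>N\<^esub>} = Q" using assms by (auto simp: presents_def)
  have "presents R M (\<lambda>x. h (p x)) N' Q"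
    using presents_comp[OF assms(1) presents_bij[OF m assms(3) h]] Q by simp
  thus ?thesis by blast
qed

section \<open>Quotients\<close>

lemma quot_mod_simps [simp]:
  "carrier (quot_mod M Q) = a_rcosets\<^bsub>M\<^esub> Q"
  "\<zero>\<^bsub>quot_mod M Q\<^esub> = Q"
  "C \<oplus>\<^bsub>quot_mod M Q\<^esub> D = C <+>\<^bsub>M\<^esub> D"
  "a \<odot>\<^bsub>quot_mod M Q\<^esub> C = (\<Union>x\<in>C. Q +>\<^bsub>M\<^esub> (a \<odot>\<^bsub>M\<^esub> x))"
  by (auto simp: quot_mod_def)

lemma presents_quot:
  assumes m: "module R M" and Q: "subm R M Q"
  shows "presents R M (\<lambda>x. Q +>\<^bsub>M\<^esub> x) (quot_mod M Q) Q"
proof -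
  interpret M: module R M by fact
  interpret Q: abelian_subgroup Q M
    using Q subm_submodule[OF m, of Q]
    by (intro abelian_subgroupI3 additive_subgroup.intro) (auto simp: submodule_def M.abelian_group_axioms)
  let ?p = "\<lambda>x. Q +>\<^bsub>M\<^esub> x"
  have im: "?p ` carrier M = carrier (quot_mod M Q)"
    by (auto simp: A_RCOSETS_def')
  have ind: "?p y = ?p x" if "x \<in> carrier M" "y \<in> ?p x" for x y
    using Q.a_repr_independence'[OF that(2,1)] by simp
  have ker: "?p x = Q \<longleftrightarrow> x \<in> Q" if "x \<in> carrier M" for x
    using Q.a_rcos_const[of x] Q.a_rcos_self[OF that] by auto
  have add: "?p (x \<oplus>\<^bsub>M\<^esub> y) = ?p x <+>\<^bsub>M\<^esub> ?p y" if "x \<in> carrier M" "y \<in> carrier M" for x y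
    using Q.a_rcos_sum[OF that] by simp
  have sm: "?p (a \<odot>\<^bsub>M\<^esub> x) = (\<Union>z\<in>?p x. ?p (a \<odot>\<^bsub>M\<^esub> z))"
    if a: "a \<in> carrier R" and x: "x \<in> carrier M" for a x
  proof -
    have "?p (a \<odot>\<^bsub>M\<^esub> z) = ?p (a \<odot>\<^bsub>M\<^esub> x)" if "z \<in> ?p x" for z
    proof -
      obtain q where q: "q \<in> Q" "z = q \<oplus>\<^bsub>M\<^esub> x" using \<open>z \<in> ?p x\<close> by (auto simp: a_r_coset_def')
      hence "a \<odot>\<^bsub>M\<^esub> z \<in> ?p (a \<odot>\<^bsub>M\<^esub> x)"
        using a x Q by (auto simp: a_r_coset_def' subm_def M.smult_r_distr subset_iff)
      thus ?thesis using ind a x by simp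
    qed
    thus ?thesis using Q.a_rcos_self[OF x] by blast
  qed
  have "module R (quot_mod M Q)"
    by (rule module_image[OF m im]) (use add sm ker in auto)
  moreover have "lin R M (quot_mod M Q) ?p"
    using im add sm by (intro linI) auto
  ultimately show ?thesis
    using m im ker Q by (auto simp: presents_def subm_def)
qed

lemma module_quot: "module R M \<Longrightarrow> subm R M Q \<Longrightarrow> module R (quot_mod M Q)"
  using presents_quot by (auto simp: presents_def)

lemma presents_subquot:
  assumes "module R M" "subm R M P" "subm R M Q" "Q \<subseteq> P"
  shows "presents R (M\<lparr>carrier := P\<rparr>) (\<lambda>x. Q +>\<^bsub>M\<^esub> x) (subquot_mod M P Q) Q"
  using presents_quot[OF module_subm[OF assms(1,2)] subm_restrict[OF assms(3,2,4)]]
  by (simp add: subquot_mod_def a_r_coset_def')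

lemma module_subquot:
  assumes "module R M" "subm R M P" "subm R M Q" "Q \<subseteq> P"
  shows "module R (subquot_mod M P Q)"
  using presents_subquot[OF assms] by (simp add: presents_def)

text \<open>The modules attached to a map \<open>th\<close> between subquotients are themselves subquotients of \<open>M\<close> or \<open>N\<close>.  This trades
  cosets of cosets for conditions on elements of \<open>P\<close> and \<open>P'\<close>.\<close>

lemma induced_map:
  assumes M: "module R M" "subm R M P" "subm R M Q" "Q \<subseteq> P"
    and N: "module R N" "subm R N P'" "subm R N Q'" "Q' \<subseteq> P'"
    and u: "lin R (M\<lparr>carrier := P\<rparr>) (N\<lparr>carrier := P'\<rparr>) u" "u ` Q \<subseteq> Q'"
    and th: "\<And>C. th C = (\<Union>z\<in>C. Q' +>\<^bsub>N\<^esub> u z)"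
  defines "HM \<equiv> subquot_mod M P Q" and "HN \<equiv> subquot_mod N P' Q'"
  shows "\<And>z. z \<in> P \<Longrightarrow> th (Q +>\<^bsub>M\<^esub> z) = Q' +>\<^bsub>N\<^esub> u z"
    and "\<exists>p. presents R (M\<lparr>carrier := {x\<in>P. u x \<in> Q'}\<rparr>) p (mod_ker HM HN th) Q"
    and "\<exists>p. presents R (N\<lparr>carrier := P'\<rparr>) p (mod_coker HM HN th) {y\<in>P'. \<exists>x\<in>P. y \<ominus>\<^bsub>N\<^esub> u x \<in> Q'}"
    and "\<exists>p. presents R (M\<lparr>carrier := P\<rparr>) p (mod_coim HM HN th) {x\<in>P. u x \<in> Q'}"
    and "\<exists>p. presents R (M\<lparr>carrier := P\<rparr>) p (mod_im HM HN th) {x\<in>P. u x \<in> Q'}"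
proof -
  let ?M = "M\<lparr>carrier := P\<rparr>" and ?N = "N\<lparr>carrier := P'\<rparr>"
  let ?p = "\<lambda>x. Q +>\<^bsub>M\<^esub> x" and ?q = "\<lambda>x. Q' +>\<^bsub>N\<^esub> x"
  have pM: "presents R ?M ?p HM Q" unfolding HM_def by (rule presents_subquot) fact+
  have pN: "presents R ?N ?q HN Q'" unfolding HN_def by (rule presents_subquot) fact+
  have mM: "module R ?M" "module R HM" and mN: "module R ?N" "module R HN"
    using pM pN by (auto simp: presents_def)
  interpret M': module R ?M by fact
  interpret N': module R ?N by fact
  interpret HM: module R HM by fact
  interpret HN: module R HN by fact
  have imM: "?p ` P = carrier HM" and imN: "?q ` P' = carrier HN"
    using pM pN by (auto simp: presents_def)
  have lM: "lin R ?M HM ?p" and lN: "lin R ?N HN ?q"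
    using pM pN by (auto simp: presents_def)
  have uP: "u x \<in> P'" if "x \<in> P" for x using u(1) that by (auto simp: lin_def)
  have zP: "?p z \<subseteq> P" if "z \<in> P" for z using that M(2,4) by (auto simp: a_r_coset_def' subm_def)
  have QQ: "u x = u y \<or> u x \<ominus>\<^bsub>N\<^esub> u y \<in> Q'" if "x \<in> P" "y \<in> P" "x \<ominus>\<^bsub>?M\<^esub> y \<in> Q" for x y
    using lin_minus[OF u(1) mM(1) mN(1), of x y] that u(2)
      subm_minus_op[OF N(1,2), of "u x" "u y"] uP by auto
  have congr: "?q (u x) = ?q (u y)" if "x \<in> P" "y \<in> P" "?p x = ?p y" for x y
    using that presents_eq_iff[OF pM, of x y] presents_eq_iff[OF pN, of "u x" "u y"]
      uP QQ[of x y] subm_minus_op[OF N(1,2), of "u x" "u y"] by auto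
  have self: "z \<in> ?p z" if "z \<in> P" for z
    using that M(3) M'.l_zero[of z] by (auto simp: a_r_coset_def' subm_def intro!: bexI[of _ "\<zero>\<^bsub>M\<^esub>"])
  show th': "th (?p z) = ?q (u z)" if z: "z \<in> P" for z
  proof -
    have "?q (u y) = ?q (u z)" if "y \<in> ?p z" for y
    proof (rule congr)
      show y: "y \<in> P" "z \<in> P" using zP z that by auto
      obtain q where q: "q \<in> Q" "y = q \<oplus>\<^bsub>M\<^esub> z" using \<open>y \<in> ?p z\<close> by (auto simp: a_r_coset_def')
      have "?p y = ?p q \<oplus>\<^bsub>HM\<^esub> ?p z" using q z M(4) lin_add[OF lM, of q z] by auto
      moreover have "?p q = \<zero>\<^bsub>HM\<^esub>" using pM q by (auto simp: presents_def)
      moreover have "?p z \<in> carrier HM" using imM z by auto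
      ultimately show "?p y = ?p z" by simp
    qed
    thus ?thesis unfolding th using self[OF z] by blast
  qed
  have l: "lin R HM HN th"
  proof (rule linI)
    fix x y assume "x \<in> carrier HM" "y \<in> carrier HM"
    then obtain a b where ab: "a \<in> P" "x = ?p a" "b \<in> P" "y = ?p b" by (auto simp flip: imM)
    have "x \<oplus>\<^bsub>HM\<^esub> y = ?p (a \<oplus>\<^bsub>M\<^esub> b)" using lin_add[OF lM, of a b] ab by simp
    thus "th (x \<oplus>\<^bsub>HM\<^esub> y) = th x \<oplus>\<^bsub>HN\<^esub> th y"
      using ab M(2) th' lin_add[OF u(1), of a b] lin_add[OF lN, of "u a" "u b"] uP
      by (auto simp: subm_def)
  next
    fix a x assume a: "a \<in> carrier R" "x \<in> carrier HM"
    then obtain b where b: "b \<in> P" "x = ?p b" by (auto simp flip: imM)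
    have "a \<odot>\<^bsub>HM\<^esub> x = ?p (a \<odot>\<^bsub>M\<^esub> b)" using lin_smult[OF lM, of a b] a b by simp
    thus "th (a \<odot>\<^bsub>HM\<^esub> x) = a \<odot>\<^bsub>HN\<^esub> th x"
      using a b M(2) th' lin_smult[OF u(1), of a b] lin_smult[OF lN, of a "u b"] uP
      by (auto simp: subm_def)
  qed (use th' uP in \<open>auto simp flip: imM imN\<close>)
  have kerth: "subm R HM (a_kernel HM HN th)"
    using subm_kernel[OF mM(2) mN(2) l subm_zero[OF mN(2)]] by (simp add: a_kernel_def')
  have q0: "?q x = \<zero>\<^bsub>HN\<^esub> \<longleftrightarrow> x \<in> Q'" if "x \<in> P'" for x
    using pN that by (auto simp: presents_def)
  have q0M: "?p x = \<zero>\<^bsub>HM\<^esub> \<longleftrightarrow> x \<in> Q" if "x \<in> P" for x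
    using pM that by (auto simp: presents_def)
  have ak: "?p x \<in> a_kernel HM HN th \<longleftrightarrow> u x \<in> Q'" if "x \<in> P" for x
    using that th' uP q0 imM by (auto simp: a_kernel_def')
  have imth: "th ` carrier HM = (\<lambda>x. ?q (u x)) ` P"
    using th' by (auto simp flip: imM)
  have sth: "subm R HN (th ` carrier HM)"
    by (rule subm_image[OF mM(2) mN(2) l subm_carrier]) fact
  show "\<exists>p. presents R ?M p (mod_coim HM HN th) {x\<in>P. u x \<in> Q'}"
    using presents_comp[OF pM presents_quot[OF mM(2) kerth]] ak
    by (auto simp: mod_coim_def cong: conj_cong)
  show "\<exists>p. presents R ?N p (mod_coker HM HN th) {y\<in>P'. \<exists>x\<in>P. y \<ominus>\<^bsub>N\<^esub> u x \<in> Q'}"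
  proof -
    have "?q y \<in> th ` carrier HM \<longleftrightarrow> (\<exists>x\<in>P. y \<ominus>\<^bsub>N\<^esub> u x \<in> Q')" if "y \<in> P'" for y
      using that presents_eq_iff[OF pN, of y "u _"] uP subm_minus_op[OF N(1,2), of y "u _"]
      by (auto simp: imth image_iff)
    thus ?thesis
      using presents_comp[OF pN presents_quot[OF mN(2) sth]]
      by (auto simp: mod_coker_def cong: conj_cong)
  qed
  show "\<exists>p. presents R (M\<lparr>carrier := {x\<in>P. u x \<in> Q'}\<rparr>) p (mod_ker HM HN th) Q"
  proof -
    let ?P = "{x\<in>P. u x \<in> Q'}"
    have sP: "subm R ?M ?P"
      using subm_kernel[OF mM(1) mN(1) u(1) subm_restrict[OF N(3,2,4)]] by simp
    have "presents R (?M\<lparr>carrier := ?P\<rparr>) ?p (HM\<lparr>carrier := ?p ` ?P\<rparr>) (?P \<inter> Q)"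
      by (rule presents_sub[OF pM sP])
    moreover have "?p ` ?P = a_kernel HM HN th"
    proof (intro equalityI subsetI)
      fix C assume C: "C \<in> a_kernel HM HN th"
      hence "C \<in> ?p ` P" using imM by (simp add: a_kernel_def')
      then obtain x where "x \<in> P" "C = ?p x" by blast
      thus "C \<in> ?p ` ?P" using ak C by auto
    qed (use ak in auto)
    moreover have "?P \<inter> Q = Q" using u(2) M(4) by auto
    ultimately have 1: "presents R (M\<lparr>carrier := ?P\<rparr>) ?p (HM\<lparr>carrier := a_kernel HM HN th\<rparr>) Q"
      by simp
    hence mk: "module R (HM\<lparr>carrier := a_kernel HM HN th\<rparr>)" by (simp add: presents_def)
    show ?thesis
      using presents_comp[OF 1 presents_quot[OF mk subm_zero[OF mk]]] 1
      by (auto simp: mod_ker_def subquot_mod_def presents_def)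
  qed
  show "\<exists>p. presents R ?M p (mod_im HM HN th) {x\<in>P. u x \<in> Q'}"
  proof -
    let ?I = "HN\<lparr>carrier := th ` carrier HM\<rparr>"
    have mI: "module R ?I" by (rule module_subm[OF mN(2) sth])
    have "lin R ?M ?I (\<lambda>x. th (?p x))"
      using lin_comp[OF lM l] imM by (auto simp: lin_def Pi_iff)
    hence 1: "presents R ?M (\<lambda>x. th (?p x)) ?I {x\<in>P. u x \<in> Q'}"
      using mM mI th' uP q0 by (auto simp: presents_def imth image_image cong: conj_cong image_cong)
    show ?thesis
      using presents_comp[OF 1 presents_quot[OF mI subm_zero[OF mI]]] 1
      by (auto simp: mod_im_def subquot_mod_def presents_def)
  qed
qed

section \<open>Free modules, direct sums and tensor products\<close>

lemma free_mod_simps [simp]: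
  "\<zero>\<^bsub>free_mod R S\<^esub> = (\<lambda>x. \<zero>\<^bsub>R\<^esub>)"
  "f \<oplus>\<^bsub>free_mod R S\<^esub> g = (\<lambda>x. f x \<oplus>\<^bsub>R\<^esub> g x)"
  "a \<odot>\<^bsub>free_mod R S\<^esub> f = (\<lambda>x. a \<otimes>\<^bsub>R\<^esub> f x)"
  by (auto simp: free_mod_def)

lemma dsum_simps [simp]:
  "\<zero>\<^bsub>dsum I M\<^esub> = (\<lambda>i\<in>I. \<zero>\<^bsub>M i\<^esub>)"
  "f \<oplus>\<^bsub>dsum I M\<^esub> g = (\<lambda>i\<in>I. f i \<oplus>\<^bsub>M i\<^esub> g i)"
  "a \<odot>\<^bsub>dsum I M\<^esub> f = (\<lambda>i\<in>I. a \<odot>\<^bsub>M i\<^esub> f i)"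
  by (auto simp: dsum_def)

lemma carrier_dsum: "finite I \<Longrightarrow> carrier (dsum I M) = (\<Pi>\<^sub>E i\<in>I. carrier (M i))"
  by (auto simp: dsum_def)

context cring
begin

abbreviation Fr :: "'s set \<Rightarrow> ('a, 's \<Rightarrow> 'a) module" where "Fr S \<equiv> free_mod R S"
abbreviation vec :: "'s set \<Rightarrow> ('s \<Rightarrow> 'a) set" where "vec S \<equiv> carrier (free_mod R S)"

lemma free_mod_carrier:
  "f \<in> vec S \<longleftrightarrow>
    (\<forall>x. f x \<in> carrier R) \<and> (\<forall>x. x \<notin> S \<longrightarrow> f x = \<zero>) \<and> finite {x. f x \<noteq> \<zero>}"
  by (auto simp: free_mod_def)

lemma free_mod_carrier_fin:
  "finite S \<Longrightarrow> f \<in> vec S \<longleftrightarrow> (\<forall>x. f x \<in> carrier R) \<and> (\<forall>x. x \<notin> S \<longrightarrow> f x = \<zero>)"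
  unfolding free_mod_carrier by (auto intro: finite_subset)

lemma finite_support_smult:
  "finite {x. f x \<noteq> \<zero>} \<Longrightarrow> a \<in> carrier R \<Longrightarrow> finite {x. a \<otimes> f x \<noteq> \<zero>}"
  by (rule finite_subset[of _ "{x. f x \<noteq> \<zero>}"]) auto

lemma module_free: "module R (Fr S)"
proof (rule moduleI)
  show "cring R" by (rule is_cring)
  have fin: "finite {x. f x \<oplus> g x \<noteq> \<zero>}" if "finite {x. f x \<noteq> \<zero>}" "finite {x. g x \<noteq> \<zero>}" for f g :: "'c \<Rightarrow> 'a"
    by (rule finite_subset[OF _ finite_UnI[OF that]]) auto
  show "abelian_group (Fr S)"
  proof (rule abelian_groupI)
    fix f assume f: "f \<in> vec S"
    hence "(\<lambda>x. \<ominus> f x) \<in> vec S"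
      by (auto simp: free_mod_carrier elim!: finite_subset[rotated])
    thus "\<exists>g\<in>vec S. g \<oplus>\<^bsub>Fr S\<^esub> f = \<zero>\<^bsub>Fr S\<^esub>"
      using f by (intro bexI[of _ "\<lambda>x. \<ominus> f x"]) (auto simp: free_mod_carrier l_neg)
  qed (auto simp: free_mod_carrier a_ac fin)
qed (auto simp: free_mod_carrier finite_support_smult l_distr r_distr m_assoc)

lemma free_gen_carrier: "s \<in> S \<Longrightarrow> free_gen R s \<in> vec S"
  by (auto simp: free_mod_carrier free_gen_def if_distrib cong: if_cong intro: finite_subset[of _ "{s}"])

lemma free_minus:
  assumes "f \<in> vec S" "g \<in> vec S"
  shows "f \<ominus>\<^bsub>Fr S\<^esub> g = (\<lambda>x. f x \<ominus> g x)"
  using assms module_uminus[OF module_free assms(2)]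
  by (auto simp: a_minus_def free_mod_carrier l_minus)

lemma free_span:
  assumes "subm R (Fr S) P" "\<And>s. s \<in> S \<Longrightarrow> free_gen R s \<in> P"
  shows "P = vec S"
proof -
  have "f \<in> P" if "finite T" "f \<in> vec S" "{x. f x \<noteq> \<zero>} \<subseteq> T" for T f
    using that
  proof (induction T arbitrary: f rule: finite_induct)
    case empty
    hence "f = \<zero>\<^bsub>Fr S\<^esub>" by auto
    thus ?case using assms(1) by (simp only: subm_def)
  next
    case (insert t T)
    show ?case
    proof (cases "t \<in> S")
      case False
      hence "f t = \<zero>" using insert.prems by (auto simp: free_mod_carrier)
      hence "{x. f x \<noteq> \<zero>} \<subseteq> T" using insert.prems by auto
      thus ?thesis using insert by blast
    next
      case True
      define g where "g = f(t := \<zero>)"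
      have "g \<in> P"
      proof (rule insert.IH)
        show "g \<in> vec S"
          using insert.prems(1) by (auto simp: g_def free_mod_carrier elim!: finite_subset[rotated])
        show "{x. g x \<noteq> \<zero>} \<subseteq> T" using insert.prems(2) by (auto simp: g_def)
      qed
      moreover have "f t \<odot>\<^bsub>Fr S\<^esub> free_gen R t \<in> P"
        using assms True insert.prems(1) unfolding subm_def by (simp only: free_mod_carrier)
      ultimately have "g \<oplus>\<^bsub>Fr S\<^esub> (f t \<odot>\<^bsub>Fr S\<^esub> free_gen R t) \<in> P"
        using assms(1) by (simp only: subm_def)
      moreover have "g \<oplus>\<^bsub>Fr S\<^esub> (f t \<odot>\<^bsub>Fr S\<^esub> free_gen R t) = f"
        using insert.prems(1) by (auto simp: g_def free_gen_def free_mod_carrier)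
      ultimately show ?thesis by simp
    qed
  qed
  thus ?thesis using assms(1) by (auto simp: subm_def free_mod_carrier)
qed

lemma lin_eq_on_gens:
  assumes "module R N" "lin R (Fr S) N f" "lin R (Fr S) N g"
    "\<And>s. s \<in> S \<Longrightarrow> f (free_gen R s) = g (free_gen R s)" "c \<in> vec S"
  shows "f c = g c"
proof -
  interpret F: module R "Fr S" by (rule module_free)
  have "subm R (Fr S) {c \<in> vec S. f c = g c}"
  proof (rule submI)
    show "\<zero>\<^bsub>Fr S\<^esub> \<in> {c \<in> vec S. f c = g c}"
      using F.M.zero_closed lin_zero[OF assms(2) module_free assms(1)] lin_zero[OF assms(3) module_free assms(1)] by simp
  next
    fix x y assume "x \<in> {c \<in> vec S. f c = g c}" "y \<in> {c \<in> vec S. f c = g c}"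
    thus "x \<oplus>\<^bsub>Fr S\<^esub> y \<in> {c \<in> vec S. f c = g c}"
      using F.M.add.m_closed[of x y] lin_add[OF assms(2)] lin_add[OF assms(3)] by (simp del: free_mod_simps)
  next
    fix a x assume "a \<in> carrier R" "x \<in> {c \<in> vec S. f c = g c}"
    thus "a \<odot>\<^bsub>Fr S\<^esub> x \<in> {c \<in> vec S. f c = g c}"
      using F.smult_closed[of a x] lin_smult[OF assms(2)] lin_smult[OF assms(3)] by (simp del: free_mod_simps)
  qed auto
  hence "{c \<in> vec S. f c = g c} = vec S"
    by (rule free_span) (simp add: assms(4) free_gen_carrier)
  thus ?thesis using assms(5) by blast
qed

text \<open>The linear map out of the free module with values \<open>\<phi>\<close> on the generators.  Summing over the support of \<open>c\<close> keeps the
  sum finite for an infinite set of generators, as needed for tensor products.\<close>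

definition free_ext :: "('a, 'n, 'z) module_scheme \<Rightarrow> ('s \<Rightarrow> 'n) \<Rightarrow> ('s \<Rightarrow> 'a) \<Rightarrow> 'n"
  where "free_ext N \<phi> c = finsum N (\<lambda>s. c s \<odot>\<^bsub>N\<^esub> \<phi> s) {s. c s \<noteq> \<zero>}"

lemma free_ext_eq:
  assumes "module R N" "\<phi> \<in> S \<rightarrow> carrier N" "c \<in> vec S" "finite T" "{s. c s \<noteq> \<zero>} \<subseteq> T" "T \<subseteq> S"
  shows "free_ext N \<phi> c = finsum N (\<lambda>s. c s \<odot>\<^bsub>N\<^esub> \<phi> s) T"
proof -
  interpret N: module R N by fact
  show ?thesis unfolding free_ext_def
    by (rule N.add.finprod_mono_neutral_cong_left) (use assms in \<open>auto simp: free_mod_carrier Pi_iff subset_iff\<close>)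
qed

lemma free_ext_lin:
  assumes "module R N" "\<phi> \<in> S \<rightarrow> carrier N"
  shows "lin R (Fr S) N (free_ext N \<phi>)"
proof (rule linI)
  interpret N: module R N by fact
  interpret F: module R "Fr S" by (rule module_free)
  fix c assume c: "c \<in> vec S"
  have cS: "{s. c s \<noteq> \<zero>} \<subseteq> S" "finite {s. c s \<noteq> \<zero>}" "\<And>s. c s \<in> carrier R"
    using c by (auto simp: free_mod_carrier)
  thus "free_ext N \<phi> c \<in> carrier N"
    unfolding free_ext_def using assms by (intro N.finsum_closed) (auto simp: Pi_iff)
  fix d assume d: "d \<in> vec S"
  have dS: "{s. d s \<noteq> \<zero>} \<subseteq> S" "finite {s. d s \<noteq> \<zero>}" "\<And>s. d s \<in> carrier R"
    using d by (auto simp: free_mod_carrier)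
  let ?T = "{s. c s \<noteq> \<zero>} \<union> {s. d s \<noteq> \<zero>}"
  have T: "finite ?T" "?T \<subseteq> S" using cS dS by auto
  have \<phi>: "\<phi> s \<in> carrier N" if "s \<in> ?T" for s using assms(2) T that by blast
  have cd: "c \<oplus>\<^bsub>Fr S\<^esub> d \<in> vec S" using c d F.M.add.m_closed by blast
  have "free_ext N \<phi> (c \<oplus>\<^bsub>Fr S\<^esub> d) = finsum N (\<lambda>s. (c s \<oplus> d s) \<odot>\<^bsub>N\<^esub> \<phi> s) ?T"
    by (subst free_ext_eq[OF assms cd T(1) _ T(2)]) auto
  also have "\<dots> = finsum N (\<lambda>s. c s \<odot>\<^bsub>N\<^esub> \<phi> s \<oplus>\<^bsub>N\<^esub> d s \<odot>\<^bsub>N\<^esub> \<phi> s) ?T"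
    by (rule N.finsum_cong') (use cS(3) dS(3) \<phi> in \<open>auto simp: N.smult_l_distr\<close>)
  also have "\<dots> = finsum N (\<lambda>s. c s \<odot>\<^bsub>N\<^esub> \<phi> s) ?T \<oplus>\<^bsub>N\<^esub> finsum N (\<lambda>s. d s \<odot>\<^bsub>N\<^esub> \<phi> s) ?T"
    by (rule N.finsum_addf) (use cS(3) dS(3) \<phi> in \<open>auto simp: Pi_iff\<close>)
  also have "\<dots> = free_ext N \<phi> c \<oplus>\<^bsub>N\<^esub> free_ext N \<phi> d"
    using free_ext_eq[OF assms c T(1) _ T(2)] free_ext_eq[OF assms d T(1) _ T(2)] by simp
  finally show "free_ext N \<phi> (c \<oplus>\<^bsub>Fr S\<^esub> d) = free_ext N \<phi> c \<oplus>\<^bsub>N\<^esub> free_ext N \<phi> d" .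
next
  interpret N: module R N by fact
  interpret F: module R "Fr S" by (rule module_free)
  fix a c assume a: "a \<in> carrier R" and c: "c \<in> vec S"
  have cS: "{s. c s \<noteq> \<zero>} \<subseteq> S" "finite {s. c s \<noteq> \<zero>}" "\<And>s. c s \<in> carrier R"
    using c by (auto simp: free_mod_carrier)
  have \<phi>: "\<phi> s \<in> carrier N" if "c s \<noteq> \<zero>" for s using assms(2) cS that by blast
  have ac: "a \<odot>\<^bsub>Fr S\<^esub> c \<in> vec S" using a c F.smult_closed by blast
  have "free_ext N \<phi> (a \<odot>\<^bsub>Fr S\<^esub> c) = finsum N (\<lambda>s. (a \<otimes> c s) \<odot>\<^bsub>N\<^esub> \<phi> s) {s. c s \<noteq> \<zero>}"
    by (subst free_ext_eq[OF assms ac cS(2) _ cS(1)]) (use a in auto)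
  also have "\<dots> = finsum N (\<lambda>s. a \<odot>\<^bsub>N\<^esub> (c s \<odot>\<^bsub>N\<^esub> \<phi> s)) {s. c s \<noteq> \<zero>}"
    by (rule N.finsum_cong') (use a cS(3) \<phi> in \<open>auto simp: N.smult_assoc1\<close>)
  also have "\<dots> = a \<odot>\<^bsub>N\<^esub> free_ext N \<phi> c"
    unfolding free_ext_def
    by (rule N.finsum_smult_ldistr[symmetric]) (use a cS \<phi> in \<open>auto simp: Pi_iff\<close>)
  finally show "free_ext N \<phi> (a \<odot>\<^bsub>Fr S\<^esub> c) = a \<odot>\<^bsub>N\<^esub> free_ext N \<phi> c" .
qed

lemma free_ext_gen:
  assumes "module R N" "\<phi> \<in> S \<rightarrow> carrier N" "s \<in> S"
  shows "free_ext N \<phi> (free_gen R s) = \<phi> s"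
proof -
  interpret N: module R N by fact
  have "free_ext N \<phi> (free_gen R s) = finsum N (\<lambda>t. free_gen R s t \<odot>\<^bsub>N\<^esub> \<phi> t) {s}"
    by (rule free_ext_eq[OF assms(1,2) free_gen_carrier[OF assms(3)]])
      (use assms(3) in \<open>auto simp: free_gen_def\<close>)
  also have "\<dots> = \<phi> s" using assms(2,3) by (simp add: free_gen_def Pi_iff)
  finally show ?thesis .
qed

subsection \<open>Finite direct sums\<close>

lemma module_dsum:
  assumes I: "finite I" and M: "\<And>i. i \<in> I \<Longrightarrow> module R (M i)"
  shows "module R (dsum I M)"
proof (rule moduleI)
  note ag = module.axioms(2)[OF M] and am = abelian_group.axioms(1)[OF module.axioms(2)[OF M]]
  show "cring R" by (rule is_cring)
  show "abelian_group (dsum I M)"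
  proof (rule abelian_groupI)
    fix f assume f: "f \<in> carrier (dsum I M)"
    hence "(\<lambda>i\<in>I. \<ominus>\<^bsub>M i\<^esub> f i) \<in> carrier (dsum I M)"
      by (auto simp: carrier_dsum I PiE_iff ag abelian_group.a_inv_closed)
    thus "\<exists>g\<in>carrier (dsum I M). g \<oplus>\<^bsub>dsum I M\<^esub> f = \<zero>\<^bsub>dsum I M\<^esub>"
      using f by (intro bexI[of _ "\<lambda>i\<in>I. \<ominus>\<^bsub>M i\<^esub> f i"])
        (auto simp: carrier_dsum I PiE_iff ag abelian_group.l_neg cong: restrict_cong)
  next
    fix f assume "f \<in> carrier (dsum I M)"
    thus "\<zero>\<^bsub>dsum I M\<^esub> \<oplus>\<^bsub>dsum I M\<^esub> f = f"
      by (auto simp: carrier_dsum I PiE_iff ag am abelian_monoid.l_zero extensional_def restrict_def)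
  next
    fix f g assume "f \<in> carrier (dsum I M)" "g \<in> carrier (dsum I M)"
    thus "f \<oplus>\<^bsub>dsum I M\<^esub> g = g \<oplus>\<^bsub>dsum I M\<^esub> f"
      by (auto simp: carrier_dsum I PiE_iff intro!: restrict_ext abelian_monoid.a_comm[OF am])
  qed (auto simp: carrier_dsum I PiE_iff ag am abelian_monoid.a_closed abelian_monoid.zero_closed
      abelian_monoid.a_assoc cong: restrict_cong)
qed (auto simp: carrier_dsum I PiE_iff module.smult_closed[OF M] module.smult_l_distr[OF M] module.smult_r_distr[OF M]
      module.smult_assoc1[OF M] module.smult_one[OF M] extensional_def restrict_def fun_eq_iff)

lemma dsum_cong:
  assumes I: "finite I" and M: "\<And>i. i \<in> I \<Longrightarrow> module_iso R (M i) (N i)"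
  shows "module_iso R (dsum I M) (dsum I N)"
proof -
  obtain h where h: "\<And>i. i \<in> I \<Longrightarrow> lin R (M i) (N i) (h i)" "\<And>i. i \<in> I \<Longrightarrow> bij_betw (h i) (carrier (M i)) (carrier (N i))"
    using M unfolding module_iso_lin by metis
  let ?h = "\<lambda>f. \<lambda>i\<in>I. h i (f i)"
  have "lin R (dsum I M) (dsum I N) ?h"
    by (rule linI) (auto simp: carrier_dsum I PiE_iff lin_closed[OF h(1)] lin_add[OF h(1)] lin_smult[OF h(1)]
        cong: restrict_cong)
  moreover have "bij_betw ?h (carrier (dsum I M)) (carrier (dsum I N))"
  proof (rule bij_betw_byWitness[where f' = "\<lambda>f. \<lambda>i\<in>I. inv_into (carrier (M i)) (h i) (f i)"])
    have k: "inv_into (carrier (M i)) (h i) y \<in> carrier (M i)" "h i (inv_into (carrier (M i)) (h i) y) = y"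
      if "i \<in> I" "y \<in> carrier (N i)" for i y
      using h(2)[OF that(1)] that(2) by (auto simp: bij_betw_def inv_into_into f_inv_into_f)
    have k2: "inv_into (carrier (M i)) (h i) (h i x) = x" if "i \<in> I" "x \<in> carrier (M i)" for i x
      using h(2)[OF that(1)] that(2) by (simp add: bij_betw_def)
    show "\<forall>f\<in>carrier (dsum I M). (\<lambda>i\<in>I. inv_into (carrier (M i)) (h i) (?h f i)) = f"
      by (auto simp: carrier_dsum I PiE_iff k2 extensional_def restrict_def fun_eq_iff)
    show "\<forall>f\<in>carrier (dsum I N). ?h (\<lambda>i\<in>I. inv_into (carrier (M i)) (h i) (f i)) = f"
      by (auto simp: carrier_dsum I PiE_iff k extensional_def restrict_def fun_eq_iff)
    show "?h ` carrier (dsum I M) \<subseteq> carrier (dsum I N)"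
      by (auto simp: carrier_dsum I PiE_iff lin_closed[OF h(1)])
    show "(\<lambda>f. \<lambda>i\<in>I. inv_into (carrier (M i)) (h i) (f i)) ` carrier (dsum I N) \<subseteq> carrier (dsum I M)"
      by (auto simp: carrier_dsum I PiE_iff k)
  qed
  ultimately show ?thesis unfolding module_iso_lin by blast
qed

lemma dsum_reindex:
  assumes J: "finite J" and b: "bij_betw \<pi> J I"
  shows "module_iso R (dsum I M) (dsum J (\<lambda>j. M (\<pi> j)))"
proof -
  have I: "finite I" using b J by (simp add: bij_betw_finite)
  have \<pi>: "\<pi> j \<in> I" if "j \<in> J" for j using b that by (auto simp: bij_betw_def)
  let ?g = "inv_into J \<pi>"
  have g: "?g i \<in> J" "\<pi> (?g i) = i" if "i \<in> I" for i
    using b that by (auto simp: bij_betw_def inv_into_into f_inv_into_f)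
  have g\<pi>: "?g (\<pi> j) = j" if "j \<in> J" for j using b that by (simp add: bij_betw_def)
  let ?h = "\<lambda>f. \<lambda>j\<in>J. f (\<pi> j)"
  have "lin R (dsum I M) (dsum J (\<lambda>j. M (\<pi> j))) ?h"
    by (rule linI) (auto simp: carrier_dsum I J PiE_iff \<pi> cong: restrict_cong)
  moreover have "bij_betw ?h (carrier (dsum I M)) (carrier (dsum J (\<lambda>j. M (\<pi> j))))"
  proof (rule bij_betw_byWitness[where f' = "\<lambda>f. \<lambda>i\<in>I. f (?g i)"])
    show "\<forall>f\<in>carrier (dsum I M). (\<lambda>i\<in>I. ?h f (?g i)) = f"
      by (auto simp: carrier_dsum I PiE_iff g extensional_def restrict_def fun_eq_iff)
    show "\<forall>f\<in>carrier (dsum J (\<lambda>j. M (\<pi> j))). ?h (\<lambda>i\<in>I. f (?g i)) = f"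
      by (auto simp: carrier_dsum J PiE_iff g\<pi> \<pi> extensional_def restrict_def fun_eq_iff)
    show "?h ` carrier (dsum I M) \<subseteq> carrier (dsum J (\<lambda>j. M (\<pi> j)))"
      by (auto simp: carrier_dsum I J PiE_iff \<pi>)
    show "(\<lambda>f. \<lambda>i\<in>I. f (?g i)) ` carrier (dsum J (\<lambda>j. M (\<pi> j))) \<subseteq> carrier (dsum I M)"
      by (auto simp: carrier_dsum I J PiE_iff) (metis g)
  qed
  ultimately show ?thesis unfolding module_iso_lin by blast
qed

lemma dsum_Sigma:
  assumes I: "finite I" and J: "\<And>i. i \<in> I \<Longrightarrow> finite (J i)"
  shows "module_iso R (dsum I (\<lambda>i. dsum (J i) (M i))) (dsum (Sigma I J) (\<lambda>(i, j). M i j))"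
proof -
  have IJ: "finite (Sigma I J)" using I J by auto
  let ?h = "\<lambda>f. \<lambda>(i, j)\<in>Sigma I J. f i j"
  let ?A = "dsum I (\<lambda>i. dsum (J i) (M i))" and ?B = "dsum (Sigma I J) (\<lambda>(i, j). M i j)"
  have "lin R ?A ?B ?h"
    by (rule linI) (auto simp: carrier_dsum I J IJ PiE_iff restrict_def fun_eq_iff extensional_def)
  moreover have "bij_betw ?h (carrier ?A) (carrier ?B)"
  proof (rule bij_betw_byWitness[where f' = "\<lambda>f. \<lambda>i\<in>I. \<lambda>j\<in>J i. f (i, j)"])
    show "\<forall>f\<in>carrier ?A. (\<lambda>i\<in>I. \<lambda>j\<in>J i. ?h f (i, j)) = f"
      by (auto simp: carrier_dsum I J PiE_iff extensional_def restrict_def fun_eq_iff)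
    show "\<forall>f\<in>carrier ?B. ?h (\<lambda>i\<in>I. \<lambda>j\<in>J i. f (i, j)) = f"
      by (auto simp: carrier_dsum IJ PiE_iff extensional_def restrict_def fun_eq_iff)
    show "?h ` carrier ?A \<subseteq> carrier ?B" "(\<lambda>f. \<lambda>i\<in>I. \<lambda>j\<in>J i. f (i, j)) ` carrier ?B \<subseteq> carrier ?A"
      by (auto simp: carrier_dsum I J IJ PiE_iff extensional_def restrict_def split: if_splits)
  qed
  ultimately show ?thesis unfolding module_iso_lin by blast
qed

lemma dsum_free:
  assumes I: "finite I" and B: "\<And>i. i \<in> I \<Longrightarrow> finite (B i)"
  shows "module_iso R (dsum I (\<lambda>i. Fr (B i))) (Fr (Sigma I B))"
proof -
  have IB: "finite (Sigma I B)" using I B by auto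
  let ?h = "\<lambda>f (i, b). if i \<in> I then f i b else \<zero>"
  let ?A = "dsum I (\<lambda>i. Fr (B i))"
  have "lin R ?A (Fr (Sigma I B)) ?h"
    by (rule linI) (auto simp: carrier_dsum I B IB PiE_iff free_mod_carrier_fin fun_eq_iff split: if_splits)
  moreover have "bij_betw ?h (carrier ?A) (vec (Sigma I B))"
  proof (rule bij_betw_byWitness[where f' = "\<lambda>f. \<lambda>i\<in>I. \<lambda>b. f (i, b)"])
    show "\<forall>f\<in>carrier ?A. (\<lambda>i\<in>I. \<lambda>b. ?h f (i, b)) = f"
      by (auto simp: carrier_dsum I PiE_iff extensional_def restrict_def fun_eq_iff)
    show "\<forall>f\<in>vec (Sigma I B). ?h (\<lambda>i\<in>I. \<lambda>b. f (i, b)) = f"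
      by (auto simp: free_mod_carrier_fin IB fun_eq_iff)
    show "?h ` carrier ?A \<subseteq> vec (Sigma I B)"
      by (auto simp: carrier_dsum I B IB PiE_iff free_mod_carrier_fin)
    show "(\<lambda>f. \<lambda>i\<in>I. \<lambda>b. f (i, b)) ` vec (Sigma I B) \<subseteq> carrier ?A"
      by (auto simp: carrier_dsum I B IB PiE_iff free_mod_carrier_fin)
  qed
  ultimately show ?thesis unfolding module_iso_lin by blast
qed

subsection \<open>Tensor products with free modules\<close>

lemma subm_span:
  assumes "module R F" "G \<subseteq> carrier F"
  shows "subm R F (mod_span R F G)" "G \<subseteq> mod_span R F G" "\<And>P. subm R F P \<Longrightarrow> G \<subseteq> P \<Longrightarrow> mod_span R F G \<subseteq> P"
proof -
  have e: "mod_span R F G = \<Inter>{N. subm R F N \<and> G \<subseteq> N}"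
    by (simp add: mod_span_def subm_submodule[OF assms(1)])
  have c: "subm R F (carrier F)" by (rule subm_carrier[OF assms(1)])
  show "subm R F (mod_span R F G)" "G \<subseteq> mod_span R F G" "\<And>P. subm R F P \<Longrightarrow> G \<subseteq> P \<Longrightarrow> mod_span R F G \<subseteq> P"
    unfolding e using c assms(2) by (auto simp: subm_def)
qed

text \<open>To recognise \<open>N\<close> as the module with generators \<open>S\<close> and relations \<open>G\<close> it suffices that the elements \<open>\<phi> s\<close>
  satisfy the relations and span \<open>N\<close>, and that some linear \<open>\<psi>\<close> sends them back to the generators: a combination of
  generators that vanishes in \<open>N\<close> is then zero already modulo the relations.\<close>

lemma quot_span_iso:
  fixes S :: "'s set"
  defines "F \<equiv> Fr S"
  assumes G: "G \<subseteq> carrier F" and N: "module R N" and \<phi>: "\<phi> \<in> S \<rightarrow> carrier N"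
    and rel: "\<And>r. r \<in> G \<Longrightarrow> free_ext N \<phi> r = \<zero>\<^bsub>N\<^esub>"
    and surj: "\<And>P. subm R N P \<Longrightarrow> \<phi> ` S \<subseteq> P \<Longrightarrow> carrier N \<subseteq> P"
    and \<psi>: "lin R N (quot_mod F (mod_span R F G)) \<psi>"
      "\<And>s. s \<in> S \<Longrightarrow> \<psi> (\<phi> s) = mod_span R F G +>\<^bsub>F\<^esub> free_gen R s"
  shows "module_iso R (quot_mod F (mod_span R F G)) N"
proof -
  let ?Q = "mod_span R F G"
  have F: "module R F" unfolding F_def by (rule module_free)
  have pr: "presents R F (\<lambda>x. ?Q +>\<^bsub>F\<^esub> x) (quot_mod F ?Q) ?Q"
    by (rule presents_quot[OF F subm_span(1)[OF F G]])
  have l: "lin R F N (free_ext N \<phi>)" unfolding F_def by (rule free_ext_lin[OF N \<phi>])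
  have "?Q \<subseteq> {x\<in>carrier F. free_ext N \<phi> x \<in> {\<zero>\<^bsub>N\<^esub>}}"
    by (rule subm_span(3)[OF F G subm_kernel[OF F N l subm_zero[OF N]]]) (use G rel in auto)
  moreover have "x \<in> ?Q" if x: "x \<in> carrier F" "free_ext N \<phi> x = \<zero>\<^bsub>N\<^esub>" for x
  proof -
    have mq: "module R (quot_mod F ?Q)" and lq: "lin R F (quot_mod F ?Q) (\<lambda>x. ?Q +>\<^bsub>F\<^esub> x)"
      using pr by (auto simp: presents_def)
    have "\<psi> (free_ext N \<phi> x) = ?Q +>\<^bsub>F\<^esub> x"
      by (rule lin_eq_on_gens[OF mq[unfolded F_def], where S = S and f = "\<lambda>x. \<psi> (free_ext N \<phi> x)", folded F_def])
        (use lin_comp[OF l \<psi>(1)] lq x(1) in \<open>simp_all add: free_ext_gen[OF N \<phi>] \<psi>(2)\<close>)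
    moreover have "\<psi> \<zero>\<^bsub>N\<^esub> = \<zero>\<^bsub>quot_mod F ?Q\<^esub>" by (rule lin_zero[OF \<psi>(1) N mq])
    ultimately show ?thesis using x pr by (auto simp: presents_def)
  qed
  ultimately have ker: "{x\<in>carrier F. free_ext N \<phi> x = \<zero>\<^bsub>N\<^esub>} = ?Q" by auto
  have "carrier N \<subseteq> free_ext N \<phi> ` carrier F"
  proof (rule surj[OF subm_image[OF F N l subm_carrier[OF F]]])
    show "\<phi> ` S \<subseteq> free_ext N \<phi> ` carrier F"
      using free_ext_gen[OF N \<phi>] free_gen_carrier by (force simp: F_def)
  qed
  hence "free_ext N \<phi> ` carrier F = carrier N" using lin_closed[OF l] by auto
  hence "presents R F (free_ext N \<phi>) N ?Q"
    using F N l ker by (simp add: presents_def)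
  thus ?thesis by (rule presents_iso[OF pr])
qed

text \<open>In terms of the basis \<open>y\<close> of \<open>N\<close>, the map \<open>\<phi>\<close> takes \<open>x \<otimes> z\<close> to the coordinates of \<open>z\<close> times \<open>x\<close>, and \<open>\<psi>\<close> takes a
  family \<open>u\<close> to the sum of all \<open>u b \<otimes> y b\<close>.  By bilinearity \<open>\<psi>\<close> has to be checked only on \<open>x \<otimes> y c\<close>.\<close>

lemma tensor_free:
  assumes M: "module R M" and N: "module R N" and B: "finite B"
    and iso: "module_iso R N (Fr B)"
  shows "module_iso R (tensor R M N) (dsum B (\<lambda>_. M))"
proof -
  interpret M: module R M by fact
  interpret N: module R N by fact
  define S where "S = carrier M \<times> carrier N"
  define F where "F = Fr S"
  define G where "G = tensor_rels R M N"
  define Q where "Q = mod_span R F G"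
  let ?g = "free_gen R :: _ \<Rightarrow> _ \<Rightarrow> 'a"
  have F: "module R F" unfolding F_def by (rule module_free)
  interpret F: module R F by fact
  obtain \<nu> where \<nu>: "lin R N (Fr B) \<nu>" "bij_betw \<nu> (carrier N) (vec B)"
    using iso unfolding module_iso_lin by blast
  define y where "y b = inv_into (carrier N) \<nu> (?g b)" for b
  have y: "y b \<in> carrier N" "\<nu> (y b) = ?g b" if "b \<in> B" for b
    using \<nu>(2) free_gen_carrier[OF that] by (auto simp: y_def bij_betw_def inv_into_into f_inv_into_f)
  define D where "D = dsum B (\<lambda>_. M)"
  have D: "module R D" unfolding D_def by (rule module_dsum[OF B M])
  interpret D: module R D by fact
  have cD: "carrier D = (\<Pi>\<^sub>E b\<in>B. carrier M)" by (simp add: D_def carrier_dsum B)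
  define \<phi> where "\<phi> p = (\<lambda>b\<in>B. \<nu> (snd p) b \<odot>\<^bsub>M\<^esub> fst p)" for p
  have \<nu>c: "\<nu> z b \<in> carrier R" if "z \<in> carrier N" for z b
    using lin_closed[OF \<nu>(1) that] by (simp add: free_mod_carrier)
  have \<phi>: "\<phi> \<in> S \<rightarrow> carrier D" by (auto simp: cD \<phi>_def S_def \<nu>c)
  have \<phi>D: "\<phi> (x, z) \<in> carrier D" if "x \<in> carrier M" "z \<in> carrier N" for x z
    using \<phi> that by (auto simp: S_def)
  have l: "lin R F D (free_ext D \<phi>)" unfolding F_def by (rule free_ext_lin[OF D \<phi>])
  have eg: "free_ext D \<phi> (?g (x, z)) = \<phi> (x, z)" "?g (x, z) \<in> carrier F"
    if "x \<in> carrier M" "z \<in> carrier N" for x z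
    using free_ext_gen[OF D \<phi>, of "(x, z)"] free_gen_carrier[of "(x, z)" S] that by (auto simp: S_def F_def)
  have Dop: "u \<oplus>\<^bsub>D\<^esub> v = (\<lambda>b\<in>B. u b \<oplus>\<^bsub>M\<^esub> v b)" "a \<odot>\<^bsub>D\<^esub> u = (\<lambda>b\<in>B. a \<odot>\<^bsub>M\<^esub> u b)"
    "\<zero>\<^bsub>D\<^esub> = (\<lambda>b\<in>B. \<zero>\<^bsub>M\<^esub>)" for u v a by (simp_all add: D_def)
  have bil1: "\<phi> (x \<oplus>\<^bsub>M\<^esub> x', z) = \<phi> (x, z) \<oplus>\<^bsub>D\<^esub> \<phi> (x', z)"
    if "x \<in> carrier M" "x' \<in> carrier M" "z \<in> carrier N" for x x' z
    using that by (auto simp: \<phi>_def Dop \<nu>c M.smult_r_distr intro!: restrict_ext)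
  have bil2: "\<phi> (x, z \<oplus>\<^bsub>N\<^esub> z') = \<phi> (x, z) \<oplus>\<^bsub>D\<^esub> \<phi> (x, z')"
    if "x \<in> carrier M" "z \<in> carrier N" "z' \<in> carrier N" for x z z'
    using that by (auto simp: \<phi>_def Dop \<nu>c lin_add[OF \<nu>(1)] M.smult_l_distr intro!: restrict_ext)
  have bil3: "\<phi> (a \<odot>\<^bsub>M\<^esub> x, z) = a \<odot>\<^bsub>D\<^esub> \<phi> (x, z)"
    if "x \<in> carrier M" "z \<in> carrier N" "a \<in> carrier R" for x z a
    using that m_comm[OF \<nu>c, of z a]
    by (auto simp: \<phi>_def Dop \<nu>c simp flip: M.smult_assoc1 intro!: restrict_ext)
  have bil4: "\<phi> (x, a \<odot>\<^bsub>N\<^esub> z) = a \<odot>\<^bsub>D\<^esub> \<phi> (x, z)"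
    if "x \<in> carrier M" "z \<in> carrier N" "a \<in> carrier R" for x z a
    using that by (auto simp: \<phi>_def Dop \<nu>c lin_smult[OF \<nu>(1)] M.smult_assoc1 intro!: restrict_ext)
  note bil = bil1 bil2 bil3 bil4
  note G_unfold = G_def tensor_rels_def Let_def S_def[symmetric] F_def[symmetric]
  have Gc: "G \<subseteq> carrier F"
    using eg(2) by (auto simp: G_unfold intro!: F.M.minus_closed simp del: free_mod_simps)
  have rel: "free_ext D \<phi> r = \<zero>\<^bsub>D\<^esub>" if "r \<in> G" for r
    using that
    by (auto simp: eg bil \<phi>D G_unfold lin_minus[OF l F D]
        lin_add[OF l] lin_smult[OF l] module_minus_eq_zero[OF D])
  have pr: "presents R F (\<lambda>x. Q +>\<^bsub>F\<^esub> x) (quot_mod F Q) Q"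
    unfolding Q_def by (rule presents_quot[OF F subm_span(1)[OF F Gc]])
  define T where "T = quot_mod F Q"
  define \<tau> where "\<tau> x z = Q +>\<^bsub>F\<^esub> ?g (x, z)" for x z
  have T: "module R T" and lq: "lin R F T (\<lambda>x. Q +>\<^bsub>F\<^esub> x)" using pr by (auto simp: presents_def T_def)
  interpret T: module R T by fact
  have qeq: "Q +>\<^bsub>F\<^esub> u = Q +>\<^bsub>F\<^esub> v" if "u \<ominus>\<^bsub>F\<^esub> v \<in> G" "u \<in> carrier F" "v \<in> carrier F" for u v
    using presents_eq_iff[OF pr that(2,3)] that(1) subm_span(2)[OF F Gc] by (auto simp: Q_def)
  have \<tau>c: "\<tau> x z \<in> carrier T" if "x \<in> carrier M" "z \<in> carrier N" for x z
    using lin_closed[OF lq eg(2)[OF that]] by (simp add: \<tau>_def)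
  have \<tau>1: "\<tau> (x \<oplus>\<^bsub>M\<^esub> x') z = \<tau> x z \<oplus>\<^bsub>T\<^esub> \<tau> x' z"
    if h: "x \<in> carrier M" "x' \<in> carrier M" "z \<in> carrier N" for x x' z
  proof -
    have "?g (x \<oplus>\<^bsub>M\<^esub> x', z) \<ominus>\<^bsub>F\<^esub> (?g (x, z) \<oplus>\<^bsub>F\<^esub> ?g (x', z)) \<in> G"
      unfolding G_unfold using h by blast
    hence "Q +>\<^bsub>F\<^esub> ?g (x \<oplus>\<^bsub>M\<^esub> x', z) = Q +>\<^bsub>F\<^esub> (?g (x, z) \<oplus>\<^bsub>F\<^esub> ?g (x', z))"
      by (rule qeq) (use h eg(2) in \<open>auto simp del: free_mod_simps\<close>)
    thus ?thesis using h lin_add[OF lq eg(2) eg(2)] by (simp add: \<tau>_def)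
  qed
  have \<tau>2: "\<tau> x (z \<oplus>\<^bsub>N\<^esub> z') = \<tau> x z \<oplus>\<^bsub>T\<^esub> \<tau> x z'"
    if h: "x \<in> carrier M" "z \<in> carrier N" "z' \<in> carrier N" for x z z'
  proof -
    have "?g (x, z \<oplus>\<^bsub>N\<^esub> z') \<ominus>\<^bsub>F\<^esub> (?g (x, z) \<oplus>\<^bsub>F\<^esub> ?g (x, z')) \<in> G"
      unfolding G_unfold using h by blast
    hence "Q +>\<^bsub>F\<^esub> ?g (x, z \<oplus>\<^bsub>N\<^esub> z') = Q +>\<^bsub>F\<^esub> (?g (x, z) \<oplus>\<^bsub>F\<^esub> ?g (x, z'))"
      by (rule qeq) (use h eg(2) in \<open>auto simp del: free_mod_simps\<close>)
    thus ?thesis using h lin_add[OF lq eg(2) eg(2)] by (simp add: \<tau>_def)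
  qed
  have \<tau>3: "\<tau> (a \<odot>\<^bsub>M\<^esub> x) z = a \<odot>\<^bsub>T\<^esub> \<tau> x z"
    if h: "x \<in> carrier M" "z \<in> carrier N" "a \<in> carrier R" for x z a
  proof -
    have "?g (a \<odot>\<^bsub>M\<^esub> x, z) \<ominus>\<^bsub>F\<^esub> (a \<odot>\<^bsub>F\<^esub> ?g (x, z)) \<in> G"
      unfolding G_unfold using h by blast
    hence "Q +>\<^bsub>F\<^esub> ?g (a \<odot>\<^bsub>M\<^esub> x, z) = Q +>\<^bsub>F\<^esub> (a \<odot>\<^bsub>F\<^esub> ?g (x, z))"
      by (rule qeq) (use h eg(2) in \<open>auto simp del: free_mod_simps\<close>)
    thus ?thesis using h lin_smult[OF lq _ eg(2)] by (simp add: \<tau>_def)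
  qed
  have \<tau>4: "\<tau> x (a \<odot>\<^bsub>N\<^esub> z) = a \<odot>\<^bsub>T\<^esub> \<tau> x z"
    if h: "x \<in> carrier M" "z \<in> carrier N" "a \<in> carrier R" for x z a
  proof -
    have "?g (x, a \<odot>\<^bsub>N\<^esub> z) \<ominus>\<^bsub>F\<^esub> (a \<odot>\<^bsub>F\<^esub> ?g (x, z)) \<in> G"
      unfolding G_unfold using h by blast
    hence "Q +>\<^bsub>F\<^esub> ?g (x, a \<odot>\<^bsub>N\<^esub> z) = Q +>\<^bsub>F\<^esub> (a \<odot>\<^bsub>F\<^esub> ?g (x, z))"
      by (rule qeq) (use h eg(2) in \<open>auto simp del: free_mod_simps\<close>)
    thus ?thesis using h lin_smult[OF lq _ eg(2)] by (simp add: \<tau>_def)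
  qed
  define \<psi> where "\<psi> u = finsum T (\<lambda>b. \<tau> (u b) (y b)) B" for u
  have \<psi>l: "lin R D T \<psi>"
  proof (rule linI)
    fix u assume u: "u \<in> carrier D"
    thus "\<psi> u \<in> carrier T" unfolding \<psi>_def by (intro T.finsum_closed) (auto simp: cD PiE_iff \<tau>c y)
    fix v assume v: "v \<in> carrier D"
    have "\<psi> (u \<oplus>\<^bsub>D\<^esub> v) = finsum T (\<lambda>b. \<tau> (u b) (y b) \<oplus>\<^bsub>T\<^esub> \<tau> (v b) (y b)) B"
      unfolding \<psi>_def by (rule T.finsum_cong') (use u v in \<open>simp_all add: cD PiE_iff \<tau>c y \<tau>1 Dop\<close>)
    thus "\<psi> (u \<oplus>\<^bsub>D\<^esub> v) = \<psi> u \<oplus>\<^bsub>T\<^esub> \<psi> v"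
      unfolding \<psi>_def by (subst (asm) T.finsum_addf) (use u v in \<open>auto simp: cD PiE_iff \<tau>c y\<close>)
  next
    fix a u assume a: "a \<in> carrier R" "u \<in> carrier D"
    have "\<psi> (a \<odot>\<^bsub>D\<^esub> u) = finsum T (\<lambda>b. a \<odot>\<^bsub>T\<^esub> \<tau> (u b) (y b)) B"
      unfolding \<psi>_def by (rule T.finsum_cong') (use a in \<open>simp_all add: cD PiE_iff \<tau>c y \<tau>3 Dop\<close>)
    thus "\<psi> (a \<odot>\<^bsub>D\<^esub> u) = a \<odot>\<^bsub>T\<^esub> \<psi> u"
      unfolding \<psi>_def using a by (subst T.finsum_smult_ldistr) (auto simp: B cD PiE_iff \<tau>c y)
  qed
  have \<tau>0: "\<tau> \<zero>\<^bsub>M\<^esub> z = \<zero>\<^bsub>T\<^esub>" "\<tau> x \<zero>\<^bsub>N\<^esub> = \<zero>\<^bsub>T\<^esub>" if "z \<in> carrier N" "x \<in> carrier M" for x z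
    using \<tau>3[of x z \<zero>] \<tau>4[of x z \<zero>] that \<tau>c by simp_all
  have \<psi>y: "\<psi> (\<phi> (x, y c)) = \<tau> x (y c)" if x: "x \<in> carrier M" and c: "c \<in> B" for x c
  proof -
    have "\<psi> (\<phi> (x, y c)) = finsum T (\<lambda>b. if c = b then \<tau> x (y b) else \<zero>\<^bsub>T\<^esub>) B"
      unfolding \<psi>_def
      by (rule T.finsum_cong') (use x c in \<open>auto simp: \<phi>_def y free_gen_def \<tau>0 \<tau>c\<close>)
    also have "\<dots> = \<tau> x (y c)"
      by (rule T.finsum_singleton[OF c B]) (use x y \<tau>c in auto)
    finally show ?thesis .
  qed
  have \<psi>\<phi>: "\<psi> (\<phi> (x, z)) = \<tau> x z" if x: "x \<in> carrier M" and z: "z \<in> carrier N" for x z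
  proof -
    let ?P = "{z\<in>carrier N. \<psi> (\<phi> (x, z)) = \<tau> x z}"
    have sP: "subm R N ?P"
    proof (rule submI)
      have "\<phi> (x, \<zero>\<^bsub>N\<^esub>) = \<zero>\<^bsub>D\<^esub>" using bil4[of x z \<zero>] x z \<phi>D by simp
      thus "\<zero>\<^bsub>N\<^esub> \<in> ?P" using \<tau>0(2)[OF z x] lin_zero[OF \<psi>l D T] by simp
    next
      fix z1 z2 assume "z1 \<in> ?P" "z2 \<in> ?P"
      thus "z1 \<oplus>\<^bsub>N\<^esub> z2 \<in> ?P"
        using x bil2[of x z1 z2] \<tau>2[of x z1 z2] lin_add[OF \<psi>l \<phi>D \<phi>D, of x z1 x z2] by simp
    next
      fix a z1 assume "a \<in> carrier R" "z1 \<in> ?P"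
      thus "a \<odot>\<^bsub>N\<^esub> z1 \<in> ?P"
        using x bil4[of x z1 a] \<tau>4[of x z1 a] lin_smult[OF \<psi>l _ \<phi>D, of a x z1] by simp
    qed auto
    have "\<nu> ` ?P = vec B"
    proof (rule free_span[OF subm_image[OF N module_free \<nu>(1) sP]])
      fix b assume b: "b \<in> B"
      show "?g b \<in> \<nu> ` ?P" by (rule image_eqI[of _ _ "y b"]) (use y b \<psi>y x in auto)
    qed
    hence "\<nu> z \<in> \<nu> ` ?P" using lin_closed[OF \<nu>(1) z] by simp
    thus ?thesis using inj_onD[OF bij_betw_imp_inj_on[OF \<nu>(2)]] z by blast
  qed
  have "module_iso R (quot_mod (Fr S) (mod_span R (Fr S) G)) D"
  proof (rule quot_span_iso[where \<phi> = \<phi> and \<psi> = \<psi>, OF Gc[unfolded F_def] D \<phi> rel])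
    fix P assume P: "subm R D P" "\<phi> ` S \<subseteq> P"
    have "u \<in> P" if u: "u \<in> carrier D" for u
    proof -
      define W where "W B' b = (if b \<in> B then if b \<in> B' then u b else \<zero>\<^bsub>M\<^esub> else undefined)" for B' b
      have uM: "u b \<in> carrier M" if "b \<in> B" for b using u that by (auto simp: cD)
      have k: "W B' \<in> P" if "finite B'" "B' \<subseteq> B" for B'
        using that
      proof (induction B' rule: finite_induct)
        case empty
        have "W {} = \<zero>\<^bsub>D\<^esub>" by (auto simp: W_def Dop restrict_def)
        thus ?case using P(1) by (simp add: subm_def)
      next
        case (insert c B')
        have "\<phi> (u c, y c) \<in> P" using P(2) insert.prems uM y by (auto simp: S_def)
        hence "W B' \<oplus>\<^bsub>D\<^esub> \<phi> (u c, y c) \<in> P"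
          using insert P(1) by (simp add: subm_def)
        moreover have "W B' \<oplus>\<^bsub>D\<^esub> \<phi> (u c, y c) = W (insert c B')"
          using insert.hyps insert.prems by (auto simp: Dop W_def \<phi>_def y free_gen_def uM)
        ultimately show ?case by simp
      qed
      have "W B = u" using u by (auto simp: cD W_def PiE_iff extensional_def)
      thus ?thesis using k[OF B] by simp
    qed
    thus "carrier D \<subseteq> P" by blast
  next
    show "lin R D (quot_mod (Fr S) (mod_span R (Fr S) G)) \<psi>"
      using \<psi>l by (simp add: T_def Q_def F_def)
    fix s assume "s \<in> S"
    thus "\<psi> (\<phi> s) = mod_span R (Fr S) G +>\<^bsub>Fr S\<^esub> ?g s"
      using \<psi>\<phi> by (auto simp: S_def \<tau>_def Q_def F_def)
  qed
  thus ?thesis by (simp add: tensor_def Let_def S_def D_def G_def)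
qed

lemma module_tensor: "module R M \<Longrightarrow> module R N \<Longrightarrow> module R (tensor R M N)"
proof -
  assume M: "module R M" and N: "module R N"
  interpret M: module R M by fact
  interpret N: module R N by fact
  let ?S = "carrier M \<times> carrier N"
  interpret F: module R "free_mod R ?S" by (rule module_free)
  have g: "free_gen R (x, z) \<in> carrier (free_mod R ?S)" if "x \<in> carrier M" "z \<in> carrier N" for x z
    using free_gen_carrier[of "(x, z)" ?S] that by simp
  have "tensor_rels R M N \<subseteq> carrier (free_mod R ?S)"
    using g by (auto simp: tensor_rels_def Let_def intro!: F.M.minus_closed simp del: free_mod_simps)
  thus ?thesis
    unfolding tensor_def Let_def by (intro module_quot[OF module_free] subm_span module_free)
qed

text \<open>The coordinates of a pure tensor are the products of the coordinates of its entries.  The inverse \<open>\<psi>\<close> is correct on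
  tuples of basis elements, and an induction releases the entries from the bases one position at a time.\<close>

lemma tensor_fam_free:
  assumes I: "finite I" and M: "\<And>i. i \<in> I \<Longrightarrow> module R (M i)" and B: "\<And>i. i \<in> I \<Longrightarrow> finite (B i)"
    and iso: "\<And>i. i \<in> I \<Longrightarrow> module_iso R (M i) (Fr (B i))"
  shows "module_iso R (tensor_fam R I M) (Fr (\<Pi>\<^sub>E i\<in>I. B i))"
proof -
  define S where "S = (\<Pi>\<^sub>E i\<in>I. carrier (M i))"
  define F where "F = Fr S"
  define G where "G = tensor_fam_rels R I M"
  define Q where "Q = mod_span R F G"
  let ?g = "free_gen R :: _ \<Rightarrow> _ \<Rightarrow> 'a"
  have F: "module R F" unfolding F_def by (rule module_free)
  interpret F: module R F by fact
  obtain \<nu> where \<nu>: "\<And>i. i \<in> I \<Longrightarrow> lin R (M i) (Fr (B i)) (\<nu> i)"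
    "\<And>i. i \<in> I \<Longrightarrow> bij_betw (\<nu> i) (carrier (M i)) (vec (B i))"
    using iso unfolding module_iso_lin by metis
  define y where "y i b = inv_into (carrier (M i)) (\<nu> i) (?g b)" for i b
  have y: "y i b \<in> carrier (M i)" "\<nu> i (y i b) = ?g b" if "i \<in> I" "b \<in> B i" for i b
    using \<nu>(2)[OF that(1)] free_gen_carrier[OF that(2)]
    by (auto simp: y_def bij_betw_def inv_into_into f_inv_into_f)
  define E where "E = (\<Pi>\<^sub>E i\<in>I. B i)"
  have Efin: "finite E" unfolding E_def by (rule finite_PiE[OF I B])
  define D where "D = Fr E"
  have D: "module R D" unfolding D_def by (rule module_free)
  interpret D: module R D by fact
  define \<phi> where "\<phi> x \<beta> = (if \<beta> \<in> E then \<Otimes>i\<in>I. \<nu> i (x i) (\<beta> i) else \<zero>)" for x \<beta>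
  have \<nu>c: "\<nu> i z b \<in> carrier R" if "i \<in> I" "z \<in> carrier (M i)" for i z b
    using lin_closed[OF \<nu>(1)[OF that(1)] that(2)] by (simp add: free_mod_carrier)
  have xup: "x(i := z) \<in> S" if "x \<in> S" "i \<in> I" "z \<in> carrier (M i)" for x i z
    using that by (auto simp: S_def PiE_iff extensional_def)
  have xc: "x i \<in> carrier (M i)" if "x \<in> S" "i \<in> I" for x i using that by (auto simp: S_def)
  have \<phi>: "\<phi> \<in> S \<rightarrow> carrier D"
    by (auto simp: D_def free_mod_carrier_fin Efin \<phi>_def intro!: finprod_closed \<nu>c xc)
  have \<phi>D: "\<phi> x \<in> carrier D" if "x \<in> S" for x using \<phi> that by auto
  have l: "lin R F D (free_ext D \<phi>)" unfolding F_def by (rule free_ext_lin[OF D \<phi>])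
  have eg: "free_ext D \<phi> (?g x) = \<phi> x" "?g x \<in> carrier F" if "x \<in> S" for x
    using free_ext_gen[OF D \<phi> that] free_gen_carrier[OF that] by (auto simp: F_def)
  have \<phi>up: "\<phi> (x(i := z)) \<beta> = \<nu> i z (\<beta> i) \<otimes> (\<Otimes>j\<in>I-{i}. \<nu> j (x j) (\<beta> j))"
    if "x \<in> S" "i \<in> I" "z \<in> carrier (M i)" "\<beta> \<in> E" for x i z \<beta>
  proof -
    have "\<phi> (x(i := z)) \<beta> = (\<Otimes>j\<in>insert i (I-{i}). \<nu> j ((x(i := z)) j) (\<beta> j))"
      using that by (simp add: \<phi>_def insert_absorb)
    also have "\<dots> = \<nu> i z (\<beta> i) \<otimes> (\<Otimes>j\<in>I-{i}. \<nu> j ((x(i := z)) j) (\<beta> j))"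
      by (subst finprod_insert)
        (use that I \<nu>c[OF _ xc[OF xup[OF that(1-3)]]] in \<open>auto simp del: fun_upd_apply\<close>, simp)
    also have "(\<Otimes>j\<in>I-{i}. \<nu> j ((x(i := z)) j) (\<beta> j)) = (\<Otimes>j\<in>I-{i}. \<nu> j (x j) (\<beta> j))"
      by (rule finprod_cong') (use that in \<open>auto intro!: \<nu>c xc\<close>)
    finally show ?thesis .
  qed
  have prc: "(\<Otimes>j\<in>I-{i}. \<nu> j (x j) (\<beta> j)) \<in> carrier R" if "x \<in> S" for x i \<beta>
    by (rule finprod_closed) (auto intro!: \<nu>c xc that)
  have bil1: "\<phi> (x(i := z \<oplus>\<^bsub>M i\<^esub> z')) = \<phi> (x(i := z)) \<oplus>\<^bsub>D\<^esub> \<phi> (x(i := z'))"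
    if "x \<in> S" "i \<in> I" "z \<in> carrier (M i)" "z' \<in> carrier (M i)" for x i z z'
  proof
    fix \<beta>
    have "z \<oplus>\<^bsub>M i\<^esub> z' \<in> carrier (M i)" using that abelian_monoid.a_closed[OF abelian_group.axioms(1)[OF module.axioms(2)[OF M]]] by simp
    thus "\<phi> (x(i := z \<oplus>\<^bsub>M i\<^esub> z')) \<beta> = (\<phi> (x(i := z)) \<oplus>\<^bsub>D\<^esub> \<phi> (x(i := z'))) \<beta>"
      using that prc \<phi>up[OF that(1,2)] lin_add[OF \<nu>(1)[OF that(2)] that(3,4)]
      by (cases "\<beta> \<in> E") (auto simp: D_def \<nu>c l_distr, auto simp: \<phi>_def)
  qed
  have bil2: "\<phi> (x(i := a \<odot>\<^bsub>M i\<^esub> z)) = a \<odot>\<^bsub>D\<^esub> \<phi> (x(i := z))"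
    if "x \<in> S" "i \<in> I" "z \<in> carrier (M i)" "a \<in> carrier R" for x i z a
  proof
    fix \<beta>
    have "a \<odot>\<^bsub>M i\<^esub> z \<in> carrier (M i)" using that module.smult_closed[OF M] by simp
    thus "\<phi> (x(i := a \<odot>\<^bsub>M i\<^esub> z)) \<beta> = (a \<odot>\<^bsub>D\<^esub> \<phi> (x(i := z))) \<beta>"
      using that prc \<phi>up[OF that(1,2)] lin_smult[OF \<nu>(1)[OF that(2)] that(4,3)]
      by (cases "\<beta> \<in> E") (auto simp: D_def \<nu>c m_assoc, auto simp: \<phi>_def)
  qed
  have cl1: "z \<oplus>\<^bsub>M i\<^esub> z' \<in> carrier (M i)"
    if "i \<in> I" "z \<in> carrier (M i)" "z' \<in> carrier (M i)" for i z z'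
    using that abelian_monoid.a_closed[OF abelian_group.axioms(1)[OF module.axioms(2)[OF M]]] by auto
  have cl2: "a \<odot>\<^bsub>M i\<^esub> z \<in> carrier (M i)"
    if "i \<in> I" "z \<in> carrier (M i)" "a \<in> carrier R" for i z a
    using that module.smult_closed[OF M] by auto
  note cl = cl1 cl2
  note G_unfold = G_def tensor_fam_rels_def Let_def S_def[symmetric] F_def[symmetric]
  have Gc: "G \<subseteq> carrier F"
    using cl by (auto simp: G_unfold intro!: F.M.minus_closed eg(2) xup
        F.M.a_closed F.smult_closed simp del: free_mod_simps)
  have rel: "free_ext D \<phi> r = \<zero>\<^bsub>D\<^esub>" if "r \<in> G" for r
    using that cl
    by (auto simp: eg bil1 bil2 \<phi>D xup G_unfold lin_minus[OF l F D]
        lin_add[OF l] lin_smult[OF l] module_minus_eq_zero[OF D] simp del: free_mod_simps)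
  have pr: "presents R F (\<lambda>x. Q +>\<^bsub>F\<^esub> x) (quot_mod F Q) Q"
    unfolding Q_def by (rule presents_quot[OF F subm_span(1)[OF F Gc]])
  define T where "T = quot_mod F Q"
  define \<tau> where "\<tau> x = Q +>\<^bsub>F\<^esub> ?g x" for x
  have T: "module R T" and lq: "lin R F T (\<lambda>x. Q +>\<^bsub>F\<^esub> x)" using pr by (auto simp: presents_def T_def)
  interpret T: module R T by fact
  have qeq: "Q +>\<^bsub>F\<^esub> u = Q +>\<^bsub>F\<^esub> v" if "u \<ominus>\<^bsub>F\<^esub> v \<in> G" "u \<in> carrier F" "v \<in> carrier F" for u v
    using presents_eq_iff[OF pr that(2,3)] that(1) subm_span(2)[OF F Gc] by (auto simp: Q_def)
  have \<tau>c: "\<tau> x \<in> carrier T" if "x \<in> S" for x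
    using lin_closed[OF lq eg(2)[OF that]] by (simp add: \<tau>_def)
  have \<tau>1: "\<tau> (x(i := z \<oplus>\<^bsub>M i\<^esub> z')) = \<tau> (x(i := z)) \<oplus>\<^bsub>T\<^esub> \<tau> (x(i := z'))"
    if h: "x \<in> S" "i \<in> I" "z \<in> carrier (M i)" "z' \<in> carrier (M i)" for x i z z'
  proof -
    have "?g (x(i := z \<oplus>\<^bsub>M i\<^esub> z')) \<ominus>\<^bsub>F\<^esub> (?g (x(i := z)) \<oplus>\<^bsub>F\<^esub> ?g (x(i := z'))) \<in> G"
      unfolding G_unfold using h by blast
    hence "Q +>\<^bsub>F\<^esub> ?g (x(i := z \<oplus>\<^bsub>M i\<^esub> z')) = Q +>\<^bsub>F\<^esub> (?g (x(i := z)) \<oplus>\<^bsub>F\<^esub> ?g (x(i := z')))"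
      by (rule qeq) (use h cl eg(2) xup in \<open>auto simp del: free_mod_simps\<close>)
    thus ?thesis using h lin_add[OF lq eg(2) eg(2)] xup by (simp add: \<tau>_def)
  qed
  have \<tau>2: "\<tau> (x(i := a \<odot>\<^bsub>M i\<^esub> z)) = a \<odot>\<^bsub>T\<^esub> \<tau> (x(i := z))"
    if h: "x \<in> S" "i \<in> I" "z \<in> carrier (M i)" "a \<in> carrier R" for x i z a
  proof -
    have "?g (x(i := a \<odot>\<^bsub>M i\<^esub> z)) \<ominus>\<^bsub>F\<^esub> (a \<odot>\<^bsub>F\<^esub> ?g (x(i := z))) \<in> G"
      unfolding G_unfold using h by blast
    hence "Q +>\<^bsub>F\<^esub> ?g (x(i := a \<odot>\<^bsub>M i\<^esub> z)) = Q +>\<^bsub>F\<^esub> (a \<odot>\<^bsub>F\<^esub> ?g (x(i := z)))"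
      by (rule qeq) (use h cl eg(2) xup in \<open>auto simp del: free_mod_simps\<close>)
    thus ?thesis using h lin_smult[OF lq _ eg(2)] xup by (simp add: \<tau>_def)
  qed
  define e where "e \<beta> = (\<lambda>i\<in>I. y i (\<beta> i))" for \<beta>
  have eS: "e \<beta> \<in> S" if "\<beta> \<in> E" for \<beta> using that y by (auto simp: e_def S_def E_def)
  have \<phi>e: "\<phi> (e \<beta>) = ?g \<beta>" if \<beta>: "\<beta> \<in> E" for \<beta>
  proof
    fix \<gamma>
    show "\<phi> (e \<beta>) \<gamma> = ?g \<beta> \<gamma>"
    proof (cases "\<gamma> = \<beta> \<or> \<gamma> \<notin> E")
      case True
      have "(\<Otimes>i\<in>I. \<nu> i (e \<beta> i) (\<beta> i)) = \<one>"
        by (rule finprod_one_eqI) (use \<beta> y in \<open>auto simp: e_def E_def free_gen_def PiE_iff\<close>)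
      thus ?thesis using True \<beta> by (auto simp: \<phi>_def free_gen_def)
    next
      case False
      then obtain i where i: "i \<in> I" "\<gamma> i \<noteq> \<beta> i" using \<beta> PiE_ext[of \<gamma> I B \<beta>] unfolding E_def by blast
      have "e \<beta> = (e \<beta>)(i := y i (\<beta> i))" using i by (auto simp: e_def)
      hence "\<phi> (e \<beta>) \<gamma> = \<nu> i (y i (\<beta> i)) (\<gamma> i) \<otimes> (\<Otimes>j\<in>I-{i}. \<nu> j (e \<beta> j) (\<gamma> j))"
        using \<phi>up[OF eS[OF \<beta>] i(1) y(1), of "\<beta> i" \<gamma>] i \<beta> False by (simp add: E_def PiE_iff)
      also have "\<nu> i (y i (\<beta> i)) (\<gamma> i) = \<zero>"
        using i y(2)[OF i(1), of "\<beta> i"] \<beta> by (auto simp: E_def PiE_iff free_gen_def)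
      finally show ?thesis using False prc[OF eS[OF \<beta>]] by (auto simp: free_gen_def)
    qed
  qed
  define \<psi> where "\<psi> = free_ext T (\<lambda>\<beta>. \<tau> (e \<beta>))"
  have te: "(\<lambda>\<beta>. \<tau> (e \<beta>)) \<in> E \<rightarrow> carrier T" using \<tau>c eS by auto
  have \<psi>l: "lin R D T \<psi>" unfolding \<psi>_def D_def by (rule free_ext_lin[OF T te])
  have \<psi>\<phi>: "\<psi> (\<phi> x) = \<tau> x" if "x \<in> S" for x
  proof -
    have "\<psi> (\<phi> x) = \<tau> x" if "finite J" "J \<subseteq> I" "x \<in> S" "\<And>i. i \<in> I - J \<Longrightarrow> x i \<in> y i ` B i" for J x
      using that
    proof (induction J arbitrary: x rule: finite_induct)
      case empty
      define \<beta> where "\<beta> = (\<lambda>i\<in>I. SOME b. b \<in> B i \<and> x i = y i b)"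
      have s: "\<beta> i \<in> B i \<and> x i = y i (\<beta> i)" if "i \<in> I" for i
        using someI_ex[of "\<lambda>b. b \<in> B i \<and> x i = y i b"] empty.prems(3)[of i] that by (auto simp: \<beta>_def)
      have \<beta>: "\<beta> \<in> E" unfolding E_def by (rule PiE_I) (use s in \<open>auto simp: \<beta>_def\<close>)
      have "x = e \<beta>" using s empty.prems(2) by (auto simp: e_def S_def PiE_iff extensional_def fun_eq_iff)
      thus ?case using \<phi>e[OF \<beta>] free_ext_gen[OF T te \<beta>] by (simp add: \<psi>_def)
    next
      case (insert j J)
      hence j: "j \<in> I" by simp
      let ?P = "{z\<in>carrier (M j). \<psi> (\<phi> (x(j := z))) = \<tau> (x(j := z))}"
      note mj = M[OF j]
      interpret Mj: module R "M j" by (rule mj)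
      have xj: "x(j := z) \<in> S" if "z \<in> carrier (M j)" for z using xup[OF insert.prems(2) j that] .
      have sP: "subm R (M j) ?P"
      proof (rule submI)
        have "\<phi> (x(j := \<zero>\<^bsub>M j\<^esub>)) = \<zero>\<^bsub>D\<^esub>" "\<tau> (x(j := \<zero>\<^bsub>M j\<^esub>)) = \<zero>\<^bsub>T\<^esub>"
          using bil2[OF insert.prems(2) j Mj.M.zero_closed zero_closed] \<tau>2[OF insert.prems(2) j Mj.M.zero_closed zero_closed]
            xj[OF Mj.M.zero_closed] \<phi>D \<tau>c by simp_all
        thus "\<zero>\<^bsub>M j\<^esub> \<in> ?P" using lin_zero[OF \<psi>l D T] by simp
      next
        fix z1 z2 assume "z1 \<in> ?P" "z2 \<in> ?P"
        thus "z1 \<oplus>\<^bsub>M j\<^esub> z2 \<in> ?P"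
          using bil1[OF insert.prems(2) j, of z1 z2] \<tau>1[OF insert.prems(2) j, of z1 z2] lin_add[OF \<psi>l \<phi>D \<phi>D, OF xj xj, of z1 z2] by simp
      next
        fix a z1 assume "a \<in> carrier R" "z1 \<in> ?P"
        thus "a \<odot>\<^bsub>M j\<^esub> z1 \<in> ?P"
          using bil2[OF insert.prems(2) j, of z1 a] \<tau>2[OF insert.prems(2) j, of z1 a] lin_smult[OF \<psi>l _ \<phi>D, OF _ xj, of a z1] by simp
      qed auto
      have "\<nu> j ` ?P = vec (B j)"
      proof (rule free_span[OF subm_image[OF mj module_free \<nu>(1)[OF j] sP]])
        fix b assume b: "b \<in> B j"
        have "(x(j := y j b)) i \<in> y i ` B i" if "i \<in> I - J" for i
          using that insert.prems(3)[of i] b by auto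
        hence "\<psi> (\<phi> (x(j := y j b))) = \<tau> (x(j := y j b))"
          using insert.IH[OF _ xj[OF y(1)[OF j b]]] insert.prems(1) by blast
        thus "?g b \<in> \<nu> j ` ?P" using y[OF j b] by (intro image_eqI[of _ _ "y j b"]) auto
      qed
      moreover have xjc: "x j \<in> carrier (M j)" using xc[OF insert.prems(2) j] .
      ultimately have "\<nu> j (x j) \<in> \<nu> j ` ?P" using lin_closed[OF \<nu>(1)[OF j]] by simp
      hence "x j \<in> ?P" using inj_onD[OF bij_betw_imp_inj_on[OF \<nu>(2)[OF j]]] xjc by blast
      thus ?case by simp
    qed
    from this[OF I subset_refl that] show ?thesis by simp
  qed
  have "module_iso R (quot_mod (Fr S) (mod_span R (Fr S) G)) D"
  proof (rule quot_span_iso[where \<phi> = \<phi> and \<psi> = \<psi>, OF Gc[unfolded F_def] D \<phi> rel])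
    fix P assume P: "subm R D P" "\<phi> ` S \<subseteq> P"
    have "P = carrier D" unfolding D_def
    proof (rule free_span)
      show "subm R (Fr E) P" using P by (simp add: D_def)
      fix \<beta> assume "\<beta> \<in> E"
      thus "?g \<beta> \<in> P" using P(2) \<phi>e eS by (metis image_subset_iff)
    qed
    thus "carrier D \<subseteq> P" by blast
  next
    show "lin R D (quot_mod (Fr S) (mod_span R (Fr S) G)) \<psi>"
      using \<psi>l by (simp add: T_def Q_def F_def)
    fix s assume "s \<in> S"
    thus "\<psi> (\<phi> s) = mod_span R (Fr S) G +>\<^bsub>Fr S\<^esub> ?g s"
      using \<psi>\<phi> by (auto simp: \<tau>_def Q_def F_def)
  qed
  thus ?thesis by (simp add: tensor_fam_def Let_def S_def D_def G_def E_def)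
qed

lemma module_tensor_fam:
  assumes M: "\<And>i. i \<in> I \<Longrightarrow> module R (M i)"
  shows "module R (tensor_fam R I M)"
proof -
  let ?S = "\<Pi>\<^sub>E i\<in>I. carrier (M i)"
  interpret F: module R "free_mod R ?S" by (rule module_free)
  have cl1: "z \<oplus>\<^bsub>M i\<^esub> z' \<in> carrier (M i)"
    if "i \<in> I" "z \<in> carrier (M i)" "z' \<in> carrier (M i)" for i z z'
    using that abelian_monoid.a_closed[OF abelian_group.axioms(1)[OF module.axioms(2)[OF M]]] by auto
  have cl2: "a \<odot>\<^bsub>M i\<^esub> z \<in> carrier (M i)"
    if "i \<in> I" "z \<in> carrier (M i)" "a \<in> carrier R" for i z a
    using that module.smult_closed[OF M] by auto
  note cl = cl1 cl2
  have g: "free_gen R (x(i := z)) \<in> carrier (free_mod R ?S)" if "x \<in> ?S" "i \<in> I" "z \<in> carrier (M i)" for x i z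
    by (rule free_gen_carrier) (use that in \<open>auto simp: PiE_iff extensional_def\<close>)
  have "tensor_fam_rels R I M \<subseteq> carrier (free_mod R ?S)"
    unfolding tensor_fam_rels_def Let_def
    by (auto intro!: F.M.minus_closed g cl F.M.a_closed F.smult_closed simp del: free_mod_simps)
  thus ?thesis
    unfolding tensor_fam_def Let_def by (intro module_quot[OF module_free] subm_span module_free)
qed

end

section \<open>Based chain complexes\<close>

text \<open>A complex is given by its basis \<open>W q\<close> in each degree and one operator \<open>D\<close> for all degrees.\<close>

definition bhom ::
    "('r, 'x) ring_scheme \<Rightarrow> (nat \<Rightarrow> 'a set) \<Rightarrow> (('a \<Rightarrow> 'r) \<Rightarrow> ('a \<Rightarrow> 'r)) \<Rightarrow> ('r, ('a \<Rightarrow> 'r) set) gmodule"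
  where "bhom R W D q = subquot_mod (free_mod R (W q))
    {c \<in> carrier (free_mod R (W q)). D c = (\<lambda>w. \<zero>\<^bsub>R\<^esub>)} (D ` carrier (free_mod R (W (Suc q))))"

text \<open>Elements of a dual module are functions restricted to a carrier, hence the restriction in the composite.\<close>

definition pullback :: "'a set \<Rightarrow> ('a \<Rightarrow> 'b) \<Rightarrow> ('b \<Rightarrow> 'r) \<Rightarrow> ('a \<Rightarrow> 'r)"
  where "pullback S F f = (\<lambda>c\<in>S. f (F c))"

definition bcoh ::
    "('r, 'x) ring_scheme \<Rightarrow> (nat \<Rightarrow> 'a set) \<Rightarrow> (('a \<Rightarrow> 'r) \<Rightarrow> ('a \<Rightarrow> 'r)) \<Rightarrow> ('r, (('a \<Rightarrow> 'r) \<Rightarrow> 'r) set) gmodule"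
  where "bcoh R W D q = subquot_mod (dual_mod R (free_mod R (W q)))
    {f \<in> carrier (dual_mod R (free_mod R (W q))).
      pullback (carrier (free_mod R (W (Suc q)))) D f = \<zero>\<^bsub>dual_mod R (free_mod R (W (Suc q)))\<^esub>}
    (case q of 0 \<Rightarrow> {\<zero>\<^bsub>dual_mod R (free_mod R (W 0))\<^esub>}
     | Suc p \<Rightarrow> pullback (carrier (free_mod R (W (Suc p)))) D ` carrier (dual_mod R (free_mod R (W p))))"

context cring
begin

abbreviation covec :: "'s set \<Rightarrow> (('s \<Rightarrow> 'a) \<Rightarrow> 'a) set" where "covec S \<equiv> carrier (dual_mod R (free_mod R S))"
abbreviation Du :: "'s set \<Rightarrow> ('a, ('s \<Rightarrow> 'a) \<Rightarrow> 'a) module" where "Du S \<equiv> dual_mod R (free_mod R S)"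

lemma vec_zero [simp]: "(\<lambda>_. \<zero>) \<in> vec S"
  by (auto simp: free_mod_carrier)

lemma vec_add: "c \<in> vec S \<Longrightarrow> d \<in> vec S \<Longrightarrow> (\<lambda>x. c x \<oplus> d x) \<in> vec S"
  using abelian_monoid.a_closed[OF abelian_group.axioms(1)[OF module.axioms(2)[OF module_free]], of c S d] by simp

lemma vec_smult: "a \<in> carrier R \<Longrightarrow> c \<in> vec S \<Longrightarrow> (\<lambda>x. a \<otimes> c x) \<in> vec S"
  using module.smult_closed[OF module_free, of a c S] by simp

lemma vec_in [simp]: "c \<in> vec S \<Longrightarrow> c x \<in> carrier R"
  by (auto simp: free_mod_carrier)

lemma vec_out: "c \<in> vec S \<Longrightarrow> x \<notin> S \<Longrightarrow> c x = \<zero>"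
  by (auto simp: free_mod_carrier)

lemma vec_mono: "c \<in> vec S \<Longrightarrow> S \<subseteq> S' \<Longrightarrow> c \<in> vec S'"
  by (auto simp: free_mod_carrier)

lemma lvec: "lin R (Fr S) (Fr S') F \<Longrightarrow> c \<in> vec S \<Longrightarrow> F c \<in> vec S'"
  using lin_closed[of R "Fr S" "Fr S'" F c] by simp

lemma ladd: "lin R (Fr S) (Fr S') F \<Longrightarrow> c \<in> vec S \<Longrightarrow> d \<in> vec S \<Longrightarrow> F (\<lambda>x. c x \<oplus> d x) = (\<lambda>x. F c x \<oplus> F d x)"
  using lin_add[of R "Fr S" "Fr S'" F c d] by simp

lemma lsmult: "lin R (Fr S) (Fr S') F \<Longrightarrow> a \<in> carrier R \<Longrightarrow> c \<in> vec S \<Longrightarrow> F (\<lambda>x. a \<otimes> c x) = (\<lambda>x. a \<otimes> F c x)"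
  using lin_smult[of R "Fr S" "Fr S'" F a c] by simp

lemma lzero: "lin R (Fr S) (Fr S') F \<Longrightarrow> F (\<lambda>_. \<zero>) = (\<lambda>_. \<zero>)"
  using lin_zero[OF _ module_free module_free, of S S' F] by simp

lemma linFI:
  assumes "\<And>c. c \<in> vec S \<Longrightarrow> F c \<in> vec S'"
    and "\<And>c d. c \<in> vec S \<Longrightarrow> d \<in> vec S \<Longrightarrow> F (\<lambda>x. c x \<oplus> d x) = (\<lambda>x. F c x \<oplus> F d x)"
    and "\<And>a c. a \<in> carrier R \<Longrightarrow> c \<in> vec S \<Longrightarrow> F (\<lambda>x. a \<otimes> c x) = (\<lambda>x. a \<otimes> F c x)"
  shows "lin R (Fr S) (Fr S') F"
  by (rule linI) (use assms in auto)

lemma vec_finsum: "finite I \<Longrightarrow> (\<And>i. i \<in> I \<Longrightarrow> x i \<in> vec S) \<Longrightarrow> (\<lambda>s. \<Oplus>i\<in>I. x i s) \<in> vec S"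
proof (induction I rule: finite_induct)
  case (insert i I)
  thus ?case using vec_add[of "x i" S "\<lambda>s. \<Oplus>i\<in>I. x i s"] vec_in[OF insert.prems] by (simp add: Pi_iff)
qed simp

lemma lfinsum:
  assumes "lin R (Fr S) (Fr S') F" "finite I" "\<And>i. i \<in> I \<Longrightarrow> x i \<in> vec S"
  shows "F (\<lambda>s. \<Oplus>i\<in>I. x i s) = (\<lambda>s. \<Oplus>i\<in>I. F (x i) s)"
  using assms(2,3)
proof (induction I rule: finite_induct)
  case empty
  thus ?case by (simp add: lzero[OF assms(1)])
next
  case (insert i I)
  thus ?case using ladd[OF assms(1), of "x i" "\<lambda>s. \<Oplus>i\<in>I. x i s"] vec_finsum[of I x S]
    vec_in[OF insert.prems] vec_in[OF lvec[OF assms(1) insert.prems]] by (simp add: Pi_iff)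
qed

subsection \<open>Dual modules\<close>

lemma dual_mod_simps [simp]:
  "\<zero>\<^bsub>dual_mod R M\<^esub> = (\<lambda>x\<in>carrier M. \<zero>)"
  "f \<oplus>\<^bsub>dual_mod R M\<^esub> g = (\<lambda>x\<in>carrier M. f x \<oplus> g x)"
  "a \<odot>\<^bsub>dual_mod R M\<^esub> f = (\<lambda>x\<in>carrier M. a \<otimes> f x)"
  by (auto simp: dual_mod_def)

lemma dual_carrier: "f \<in> carrier (dual_mod R M) \<longleftrightarrow> f \<in> carrier M \<rightarrow>\<^sub>E carrier R
    \<and> (\<forall>x\<in>carrier M. \<forall>y\<in>carrier M. f (x \<oplus>\<^bsub>M\<^esub> y) = f x \<oplus> f y)
    \<and> (\<forall>a\<in>carrier R. \<forall>x\<in>carrier M. f (a \<odot>\<^bsub>M\<^esub> x) = a \<otimes> f x)"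
  by (simp add: dual_mod_def)

lemma module_dual:
  assumes "module R M"
  shows "module R (dual_mod R M)"
proof -
  interpret M: module R M by fact
  show ?thesis
  proof (rule moduleI)
    show "cring R" by (rule is_cring)
    show "abelian_group (dual_mod R M)"
    proof (rule abelian_groupI)
      fix f assume f: "f \<in> carrier (dual_mod R M)"
      have "(\<lambda>x\<in>carrier M. \<ominus> f x) \<in> carrier (dual_mod R M)"
        using f by (auto simp: dual_carrier PiE_iff minus_add r_minus)
      thus "\<exists>g\<in>carrier (dual_mod R M). g \<oplus>\<^bsub>dual_mod R M\<^esub> f = \<zero>\<^bsub>dual_mod R M\<^esub>"
        using f by (intro bexI[of _ "\<lambda>x\<in>carrier M. \<ominus> f x"]) (auto simp: dual_carrier PiE_iff l_neg cong: restrict_cong)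
    next
      fix f assume "f \<in> carrier (dual_mod R M)"
      thus "\<zero>\<^bsub>dual_mod R M\<^esub> \<oplus>\<^bsub>dual_mod R M\<^esub> f = f"
        by (auto simp: dual_carrier PiE_iff extensional_def restrict_def)
    next
      fix f g assume "f \<in> carrier (dual_mod R M)" "g \<in> carrier (dual_mod R M)"
      thus "f \<oplus>\<^bsub>dual_mod R M\<^esub> g = g \<oplus>\<^bsub>dual_mod R M\<^esub> f"
        by (auto simp: dual_carrier PiE_iff intro!: restrict_ext a_comm)
    qed (auto simp: dual_carrier PiE_iff a_ac r_distr cong: restrict_cong)
  qed (auto simp: dual_carrier PiE_iff m_assoc m_lcomm r_distr l_distr extensional_def restrict_def fun_eq_iff)
qed

lemma dual_in: "f \<in> carrier (dual_mod R M) \<Longrightarrow> x \<in> carrier M \<Longrightarrow> f x \<in> carrier R"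
  by (auto simp: dual_carrier)

lemma dual_ext: "f \<in> carrier (dual_mod R M) \<Longrightarrow> g \<in> carrier (dual_mod R M) \<Longrightarrow>
    (\<And>x. x \<in> carrier M \<Longrightarrow> f x = g x) \<Longrightarrow> f = g"
  by (auto simp: dual_carrier intro: PiE_ext)

lemma dual_minus:
  assumes "module R M" "f \<in> carrier (dual_mod R M)" "g \<in> carrier (dual_mod R M)"
  shows "f \<ominus>\<^bsub>dual_mod R M\<^esub> g = (\<lambda>x\<in>carrier M. f x \<ominus> g x)"
proof -
  have "\<ominus>\<^bsub>dual_mod R M\<^esub> g = (\<lambda>x\<in>carrier M. \<ominus> g x)"
    using module_uminus[OF module_dual[OF assms(1)] assms(3)] dual_in[OF assms(3)]
    by (auto simp: l_minus intro!: restrict_ext)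
  thus ?thesis by (auto simp: a_minus_def cong: restrict_cong)
qed

lemma dual_vec_add: "f \<in> covec S \<Longrightarrow> c \<in> vec S \<Longrightarrow> d \<in> vec S \<Longrightarrow> f (\<lambda>x. c x \<oplus> d x) = f c \<oplus> f d"
  by (auto simp: dual_carrier)

lemma dual_vec_zero:
  assumes "f \<in> covec S"
  shows "f (\<lambda>_. \<zero>) = \<zero>"
proof -
  have "f (\<zero> \<odot>\<^bsub>Fr S\<^esub> (\<lambda>_. \<zero>)) = \<zero> \<otimes> f (\<lambda>_. \<zero>)"
    using assms unfolding dual_carrier by (metis vec_zero zero_closed)
  thus ?thesis using dual_in[OF assms, of "\<lambda>_. \<zero>"] by simp
qed

lemma dual_finsum:
  assumes f: "f \<in> covec S" and "finite I" "\<And>i. i \<in> I \<Longrightarrow> x i \<in> vec S"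
  shows "f (\<lambda>s. \<Oplus>i\<in>I. x i s) = (\<Oplus>i\<in>I. f (x i))"
  using assms(2,3)
proof (induction I rule: finite_induct)
  case empty
  thus ?case by (simp add: dual_vec_zero[OF f])
next
  case (insert i I)
  thus ?case using dual_vec_add[OF f, of "x i" "\<lambda>s. \<Oplus>i\<in>I. x i s"] vec_finsum[of I x S]
    vec_in[OF insert.prems] by (simp add: Pi_iff dual_in[OF f])
qed

lemma pullback_lin:
  assumes "lin R M N F" "module R M"
  shows "lin R (dual_mod R N) (dual_mod R M) (pullback (carrier M) F)"
proof -
  interpret M: module R M by fact
  show ?thesis
    by (rule linI) (auto simp: pullback_def dual_carrier PiE_iff lin_closed[OF assms(1)] lin_add[OF assms(1)]
      lin_smult[OF assms(1)] cong: restrict_cong)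
qed

lemma pullback_closed:
  "lin R M N F \<Longrightarrow> module R M \<Longrightarrow> f \<in> carrier (dual_mod R N) \<Longrightarrow> pullback (carrier M) F f \<in> carrier (dual_mod R M)"
  by (rule lin_closed[OF pullback_lin])

lemma pullback_apply [simp]: "c \<in> S \<Longrightarrow> pullback S F f c = f (F c)"
  by (simp add: pullback_def)

subsection \<open>Complexes and homotopy equivalences\<close>

definition is_cpx :: "(nat \<Rightarrow> 's set) \<Rightarrow> (('s \<Rightarrow> 'a) \<Rightarrow> ('s \<Rightarrow> 'a)) \<Rightarrow> bool"
  where "is_cpx W D \<longleftrightarrow> (\<forall>q. finite (W q)) \<and> (\<forall>q. lin R (Fr (W (Suc q))) (Fr (W q)) D)
    \<and> (\<forall>c\<in>vec (W 0). D c = (\<lambda>_. \<zero>)) \<and> (\<forall>q. \<forall>c\<in>vec (W q). D (D c) = (\<lambda>_. \<zero>))"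

definition Zc where "Zc W D q = {c \<in> vec (W q). D c = (\<lambda>w. \<zero>)}"
definition Bc where "Bc W D q = D ` vec (W (Suc q))"
definition Zco where "Zco W D q = {f \<in> covec (W q).
      pullback (vec (W (Suc q))) D f = \<zero>\<^bsub>Du (W (Suc q))\<^esub>}"
definition Bco where "Bco W D q = (case q of 0 \<Rightarrow> {\<zero>\<^bsub>Du (W 0)\<^esub>}
     | Suc p \<Rightarrow> pullback (vec (W (Suc p))) D ` covec (W p))"

lemma bhom_eq: "bhom R W D q = subquot_mod (Fr (W q)) (Zc W D q) (Bc W D q)"
  by (simp add: bhom_def Zc_def Bc_def)

lemma bcoh_eq: "bcoh R W D q = subquot_mod (Du (W q)) (Zco W D q) (Bco W D q)"
  by (simp add: bcoh_def Zco_def Bco_def)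

lemma Zco_iff: "f \<in> Zco W D q \<longleftrightarrow> f \<in> covec (W q) \<and> (\<forall>c\<in>vec (W (Suc q)). f (D c) = \<zero>)"
  by (auto simp: Zco_def pullback_def fun_eq_iff restrict_def)

lemma Bco_iff:
  assumes "is_cpx W D"
  shows "f \<in> Bco W D q \<longleftrightarrow> f \<in> covec (W q) \<and>
    (\<exists>g\<in>covec (W (q - 1)). \<forall>c\<in>vec (W q). f c = g (D c))"
proof (cases q)
  case 0
  have z: "(\<lambda>x\<in>vec S. \<zero>) \<in> covec S" for S :: "'c set"
    using abelian_monoid.zero_closed[OF abelian_group.axioms(1)[OF module.axioms(2)[OF module_dual[OF module_free]]], of S] by simp
  have g0: "g (D c) = \<zero>" if "g \<in> covec (W 0)" "c \<in> vec (W 0)" for g c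
    using dual_vec_zero[OF that(1)] assms that(2) by (simp add: is_cpx_def)
  show ?thesis
  proof
    assume "f \<in> Bco W D q"
    hence "f = (\<lambda>x\<in>vec (W 0). \<zero>)" by (simp add: Bco_def 0)
    thus "f \<in> covec (W q) \<and>
      (\<exists>g\<in>covec (W (q - 1)). \<forall>c\<in>vec (W q). f c = g (D c))"
      using z[of "W 0"] g0[OF z[of "W 0"], symmetric] by (auto simp: 0 simp del: restrict_apply intro!: bexI[OF _ z]) simp
  next
    assume "f \<in> covec (W q) \<and>
      (\<exists>g\<in>covec (W (q - 1)). \<forall>c\<in>vec (W q). f c = g (D c))"
    then obtain g where f: "f \<in> covec (W 0)" and g: "g \<in> covec (W 0)"
      "\<And>c. c \<in> vec (W 0) \<Longrightarrow> f c = g (D c)" using 0 by auto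
    have f0: "f c = \<zero>" if "c \<in> vec (W 0)" for c using g(2)[OF that] g0[OF g(1) that] by simp
    have "f = (\<lambda>x\<in>vec (W 0). \<zero>)" by (rule dual_ext[OF f z]) (simp add: f0)
    thus "f \<in> Bco W D q" by (simp add: Bco_def 0)
  qed
next
  case (Suc p)
  have l: "lin R (Fr (W (Suc p))) (Fr (W p)) D" using assms by (simp add: is_cpx_def)
  show ?thesis
  proof
    assume "f \<in> Bco W D q"
    thus "f \<in> covec (W q) \<and>
      (\<exists>g\<in>covec (W (q - 1)). \<forall>c\<in>vec (W q). f c = g (D c))"
      using pullback_closed[OF l module_free] by (auto simp: Bco_def Suc)
  next
    assume "f \<in> covec (W q) \<and>
      (\<exists>g\<in>covec (W (q - 1)). \<forall>c\<in>vec (W q). f c = g (D c))"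
    then obtain g where f: "f \<in> covec (W q)"
      and g: "g \<in> covec (W p)" "\<And>c. c \<in> vec (W q) \<Longrightarrow> f c = g (D c)" using Suc by auto
    have "f = pullback (vec (W (Suc p))) D g"
      by (rule dual_ext[OF f]) (use g pullback_closed[OF l module_free] Suc in auto)
    thus "f \<in> Bco W D q" using g by (auto simp: Bco_def Suc)
  qed
qed

lemma cpx_subm:
  assumes "is_cpx W D"
  shows "subm R (Fr (W q)) (Zc W D q)" "subm R (Fr (W q)) (Bc W D q)" "Bc W D q \<subseteq> Zc W D q"
proof -
  have l: "lin R (Fr (W (Suc q))) (Fr (W q)) D" for q using assms by (simp add: is_cpx_def)
  show "subm R (Fr (W q)) (Bc W D q)"
    unfolding Bc_def by (rule subm_image[OF module_free module_free l subm_carrier[OF module_free]])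
  show "Bc W D q \<subseteq> Zc W D q"
    using assms lvec[OF l] by (auto simp: Bc_def Zc_def is_cpx_def)
  show "subm R (Fr (W q)) (Zc W D q)"
  proof (cases q)
    case 0
    hence "Zc W D q = vec (W q)" using assms by (auto simp: Zc_def is_cpx_def)
    thus ?thesis using subm_carrier[OF module_free] by simp
  next
    case (Suc p)
    thus ?thesis using subm_kernel[OF module_free module_free l[of p] subm_zero[OF module_free]] by (simp add: Zc_def)
  qed
qed

lemma cpx_subm_co:
  assumes "is_cpx W D"
  shows "subm R (Du (W q)) (Zco W D q)" "subm R (Du (W q)) (Bco W D q)" "Bco W D q \<subseteq> Zco W D q"
proof -
  have l: "lin R (Fr (W (Suc q))) (Fr (W q)) D" for q using assms by (simp add: is_cpx_def)
  note md = module_dual[OF module_free]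
  note pl = pullback_lin[OF l module_free]
  show "subm R (Du (W q)) (Bco W D q)"
    using subm_image[OF md md pl subm_carrier[OF md]] subm_zero[OF md[of "W 0"]]
    by (auto simp: Bco_def split: nat.split)
  show "Bco W D q \<subseteq> Zco W D q"
  proof
    fix f assume f: "f \<in> Bco W D q"
    then obtain g where g: "g \<in> covec (W (q - 1))" "\<And>c. c \<in> vec (W q) \<Longrightarrow> f c = g (D c)"
      using Bco_iff[OF assms] by blast
    have "f (D c) = \<zero>" if "c \<in> vec (W (Suc q))" for c
      using that assms g(2)[OF lvec[OF l that]] dual_vec_zero[OF g(1)] by (simp add: is_cpx_def)
    thus "f \<in> Zco W D q" using f Bco_iff[OF assms] by (auto simp: Zco_iff)
  qed
  show "subm R (Du (W q)) (Zco W D q)"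
    using subm_kernel[OF md md pl subm_zero[OF md]] by (simp add: Zco_def)
qed

lemma module_bhom: "is_cpx W D \<Longrightarrow> module R (bhom R W D q)"
  unfolding bhom_eq by (intro module_subquot module_free cpx_subm)

lemma module_bcoh: "is_cpx W D \<Longrightarrow> module R (bcoh R W D q)"
  unfolding bcoh_eq by (intro module_subquot module_dual module_free cpx_subm_co)

lemma presents_bhom:
  "is_cpx W D \<Longrightarrow> presents R (Fr (W q)\<lparr>carrier := Zc W D q\<rparr>) (\<lambda>x. Bc W D q +>\<^bsub>Fr (W q)\<^esub> x) (bhom R W D q) (Bc W D q)"
  unfolding bhom_eq by (intro presents_subquot module_free cpx_subm)

lemma presents_bcoh:
  "is_cpx W D \<Longrightarrow> presents R (Du (W q)\<lparr>carrier := Zco W D q\<rparr>)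
    (\<lambda>x. Bco W D q +>\<^bsub>Du (W q)\<^esub> x) (bcoh R W D q) (Bco W D q)"
  unfolding bcoh_eq by (intro presents_subquot module_dual module_free cpx_subm_co)

lemma subquot_iso:
  assumes M: "presents R (M\<lparr>carrier := P\<rparr>) p H Q" and N: "presents R (N\<lparr>carrier := P'\<rparr>) p' H' Q'"
    and mN: "module R N" and sN: "subm R N P'"
    and u: "lin R (M\<lparr>carrier := P\<rparr>) (N\<lparr>carrier := P'\<rparr>) u"
    and ker: "\<And>x. x \<in> P \<Longrightarrow> u x \<in> Q' \<longleftrightarrow> x \<in> Q"
    and surj: "\<And>y. y \<in> P' \<Longrightarrow> \<exists>x\<in>P. y \<ominus>\<^bsub>N\<^esub> u x \<in> Q'"
  shows "module_iso R H H'"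
proof -
  have Q: "Q \<subseteq> P" using M by (auto simp: presents_def)
  have up: "u x \<in> P'" if "x \<in> P" for x using u that by (auto simp: lin_def)
  have l: "lin R (M\<lparr>carrier := P\<rparr>) H' (\<lambda>x. p' (u x))"
    using lin_comp[OF u, of H' p'] N by (auto simp: presents_def)
  have "(\<lambda>x. p' (u x)) ` P = carrier H'"
  proof (intro equalityI subsetI)
    fix h assume "h \<in> carrier H'"
    then obtain y where y: "y \<in> P'" "h = p' y" using N by (auto simp: presents_def)
    then obtain x where x: "x \<in> P" "y \<ominus>\<^bsub>N\<^esub> u x \<in> Q'" using surj by blast
    hence "p' y = p' (u x)"
      using presents_eq_iff[OF N, of y "u x"] y up subm_minus_op[OF mN sN y(1) up[OF x(1)]] by simp
    thus "h \<in> (\<lambda>x. p' (u x)) ` P" using y x by auto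
  qed (use l in \<open>auto simp: lin_def\<close>)
  moreover have "{x\<in>P. p' (u x) = \<zero>\<^bsub>H'\<^esub>} = Q"
    using ker up N Q by (auto simp: presents_def)
  ultimately have "presents R (M\<lparr>carrier := P\<rparr>) (\<lambda>x. p' (u x)) H' Q"
    using l M N by (simp add: presents_def)
  thus ?thesis by (rule presents_iso[OF M])
qed

text \<open>\<open>F\<close> is a retraction with section \<open>G\<close>, and \<open>H\<close> is a homotopy between the identity and the composite of \<open>F\<close> and \<open>G\<close>.\<close>

definition hequiv ::
    "(nat \<Rightarrow> 's set) \<Rightarrow> (('s \<Rightarrow> 'a) \<Rightarrow> ('s \<Rightarrow> 'a)) \<Rightarrow> (nat \<Rightarrow> 't set) \<Rightarrow> (('t \<Rightarrow> 'a) \<Rightarrow> ('t \<Rightarrow> 'a))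
      \<Rightarrow> (('s \<Rightarrow> 'a) \<Rightarrow> ('t \<Rightarrow> 'a)) \<Rightarrow> (('t \<Rightarrow> 'a) \<Rightarrow> ('s \<Rightarrow> 'a)) \<Rightarrow> (('s \<Rightarrow> 'a) \<Rightarrow> ('s \<Rightarrow> 'a)) \<Rightarrow> bool"
  where "hequiv W D W' D' F G H \<longleftrightarrow>
    (\<forall>q. lin R (Fr (W q)) (Fr (W' q)) F) \<and> (\<forall>q. lin R (Fr (W' q)) (Fr (W q)) G)
    \<and> (\<forall>q. lin R (Fr (W q)) (Fr (W (Suc q))) H)
    \<and> (\<forall>q. \<forall>x\<in>vec (W q). F (D x) = D' (F x)) \<and> (\<forall>q. \<forall>y\<in>vec (W' q). G (D' y) = D (G y))
    \<and> (\<forall>q. \<forall>y\<in>vec (W' q). F (G y) = y)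
    \<and> (\<forall>q. \<forall>x\<in>vec (W q). x = (\<lambda>a. G (F x) a \<oplus> (D (H x) a \<oplus> H (D x) a)))"

lemma hequiv_cpx:
  assumes c: "is_cpx W D" and h: "hequiv W D W' D' F G H"
    and "\<And>q. finite (W' q)" "\<And>q. lin R (Fr (W' (Suc q))) (Fr (W' q)) D'"
  shows "is_cpx W' D'"
proof -
  have F: "lin R (Fr (W q)) (Fr (W' q)) F" and G: "lin R (Fr (W' q)) (Fr (W q)) G"
    and FD: "x \<in> vec (W q) \<Longrightarrow> F (D x) = D' (F x)" and FG: "y \<in> vec (W' q) \<Longrightarrow> F (G y) = y"
    for q x y using h unfolding hequiv_def by blast+
  have D: "lin R (Fr (W (Suc q))) (Fr (W q)) D" "\<And>c. c \<in> vec (W 0) \<Longrightarrow> D c = (\<lambda>_. \<zero>)"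
    "\<And>c. c \<in> vec (W q) \<Longrightarrow> D (D c) = (\<lambda>_. \<zero>)" for q using c unfolding is_cpx_def by blast+
  have 0: "D' y = F (D (G y))" if "y \<in> vec (W' q)" for q y
    using FD[OF lvec[OF G that]] FG[OF that] by simp
  have "D' y = (\<lambda>_. \<zero>)" if "y \<in> vec (W' 0)" for y
    using 0[OF that] D(2)[OF lvec[OF G that]] lzero[OF F] by simp
  moreover have "D' (D' y) = (\<lambda>_. \<zero>)" if y: "y \<in> vec (W' q)" for y q
  proof (cases q)
    case 0
    thus ?thesis using calculation y FD[of "\<lambda>_. \<zero>" 0] D(2)[of "\<lambda>_. \<zero>"] lzero[OF F] by simp
  next
    case (Suc p)
    have Gy: "G y \<in> vec (W (Suc p))" using lvec[OF G y] Suc by simp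
    have "D' (D' y) = D' (F (D (G y)))" using 0[OF y] by simp
    also have "\<dots> = F (D (D (G y)))" using FD[OF lvec[OF D(1) Gy]] by simp
    also have "\<dots> = (\<lambda>_. \<zero>)" using D(3)[OF Gy] lzero[OF F] by simp
    finally show ?thesis .
  qed
  ultimately show ?thesis using assms(3,4) unfolding is_cpx_def by blast
qed

lemma hequiv_hom:
  assumes c: "is_cpx W D" and c': "is_cpx W' D'" and h: "hequiv W D W' D' F G H"
  shows "module_iso R (bhom R W D q) (bhom R W' D' q)"
proof (rule subquot_iso[OF presents_bhom[OF c] presents_bhom[OF c'] module_free cpx_subm(1)[OF c'], where u = F])
  have F: "lin R (Fr (W q)) (Fr (W' q)) F" and G: "lin R (Fr (W' q)) (Fr (W q)) G"
    and H: "lin R (Fr (W q)) (Fr (W (Suc q))) H"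
    and FD: "x \<in> vec (W q) \<Longrightarrow> F (D x) = D' (F x)" and GD: "y \<in> vec (W' q) \<Longrightarrow> G (D' y) = D (G y)"
    and FG: "y \<in> vec (W' q) \<Longrightarrow> F (G y) = y"
    and hh: "x \<in> vec (W q) \<Longrightarrow> x = (\<lambda>a. G (F x) a \<oplus> (D (H x) a \<oplus> H (D x) a))"
    for q x y using h unfolding hequiv_def by blast+
  have D: "lin R (Fr (W (Suc q))) (Fr (W q)) D" for q using c unfolding is_cpx_def by blast
  have FZ: "F z \<in> Zc W' D' q" if "z \<in> Zc W D q" for z
    using that lvec[OF F] FD[of z q] lzero[OF F] by (auto simp: Zc_def)
  show "lin R (Fr (W q)\<lparr>carrier := Zc W D q\<rparr>) (Fr (W' q)\<lparr>carrier := Zc W' D' q\<rparr>) F"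
    using F FZ by (auto simp: lin_def Zc_def)
  show "\<exists>x\<in>Zc W D q. y \<ominus>\<^bsub>Fr (W' q)\<^esub> F x \<in> Bc W' D' q" if y: "y \<in> Zc W' D' q" for y
  proof (rule bexI[of _ "G y"])
    show "G y \<in> Zc W D q" using y lvec[OF G] GD[of y q] lzero[OF G] by (auto simp: Zc_def)
    have "y \<ominus>\<^bsub>Fr (W' q)\<^esub> F (G y) = \<zero>\<^bsub>Fr (W' q)\<^esub>"
      using y FG[of y q] module_minus_eq_zero[OF module_free, of y "W' q" y] by (simp add: Zc_def)
    thus "y \<ominus>\<^bsub>Fr (W' q)\<^esub> F (G y) \<in> Bc W' D' q"
      using cpx_subm(2)[OF c', of q] unfolding subm_def by simp
  qed
  show "F z \<in> Bc W' D' q \<longleftrightarrow> z \<in> Bc W D q" if z: "z \<in> Zc W D q" for z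
  proof
    assume "z \<in> Bc W D q"
    thus "F z \<in> Bc W' D' q" using FD lvec[OF F] by (auto simp: Bc_def)
  next
    assume "F z \<in> Bc W' D' q"
    then obtain w where w: "w \<in> vec (W' (Suc q))" "F z = D' w" by (auto simp: Bc_def)
    have zv: "z \<in> vec (W q)" "D z = (\<lambda>_. \<zero>)" using z by (auto simp: Zc_def)
    have "z = (\<lambda>a. D (G w) a \<oplus> D (H z) a)"
      using hh[OF zv(1)] zv(2) lzero[OF H] w GD[OF w(1)] lvec[OF D lvec[OF H zv(1)]]
      by simp
    also have "\<dots> = D (\<lambda>a. G w a \<oplus> H z a)"
      using ladd[OF D lvec[OF G w(1)] lvec[OF H zv(1)]] by simp
    finally show "z \<in> Bc W D q"
      using vec_add[OF lvec[OF G w(1)] lvec[OF H zv(1)]] by (auto simp: Bc_def)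
  qed
qed

lemma hequiv_coh:
  assumes c: "is_cpx W D" and c': "is_cpx W' D'" and h: "hequiv W D W' D' F G H"
  shows "module_iso R (bcoh R W D q) (bcoh R W' D' q)"
proof (rule subquot_iso[OF presents_bcoh[OF c] presents_bcoh[OF c'] module_dual[OF module_free] cpx_subm_co(1)[OF c'],
      where u = "pullback (vec (W' q)) G"])
  have F: "lin R (Fr (W q)) (Fr (W' q)) F" and G: "lin R (Fr (W' q)) (Fr (W q)) G"
    and H: "lin R (Fr (W q)) (Fr (W (Suc q))) H"
    and FD: "x \<in> vec (W q) \<Longrightarrow> F (D x) = D' (F x)" and GD: "y \<in> vec (W' q) \<Longrightarrow> G (D' y) = D (G y)"
    and FG: "y \<in> vec (W' q) \<Longrightarrow> F (G y) = y"
    and hh: "x \<in> vec (W q) \<Longrightarrow> x = (\<lambda>a. G (F x) a \<oplus> (D (H x) a \<oplus> H (D x) a))"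
    for q x y using h unfolding hequiv_def by blast+
  have D: "lin R (Fr (W (Suc q))) (Fr (W q)) D" "\<And>c. c \<in> vec (W 0) \<Longrightarrow> D c = (\<lambda>_. \<zero>)"
    for q using c unfolding is_cpx_def by blast+
  have D': "lin R (Fr (W' (Suc q))) (Fr (W' q)) D'" for q using c' unfolding is_cpx_def by blast
  let ?u = "pullback (vec (W' q)) G"
  have uZ: "?u f \<in> Zco W' D' q" if f: "f \<in> Zco W D q" for f
    using f pullback_closed[OF G module_free] lvec[OF D'] lvec[OF G] by (auto simp: Zco_iff GD)
  show "lin R (Du (W q)\<lparr>carrier := Zco W D q\<rparr>) (Du (W' q)\<lparr>carrier := Zco W' D' q\<rparr>) ?u"
    using pullback_lin[OF G[of q] module_free] uZ by (auto simp: lin_def Zco_iff)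
  show "\<exists>f\<in>Zco W D q. g \<ominus>\<^bsub>Du (W' q)\<^esub> ?u f \<in> Bco W' D' q" if g: "g \<in> Zco W' D' q" for g
  proof (rule bexI[of _ "pullback (vec (W q)) F g"])
    have gd: "g \<in> covec (W' q)" using g by (simp add: Zco_iff)
    show fz: "pullback (vec (W q)) F g \<in> Zco W D q"
      using g pullback_closed[OF F module_free gd] lvec[OF D(1)] lvec[OF F] by (auto simp: Zco_iff FD)
    have "?u (pullback (vec (W q)) F g) = g"
      by (rule dual_ext[OF _ gd]) (use uZ[OF fz] lvec[OF G] FG in \<open>auto simp: Zco_iff\<close>)
    hence "g \<ominus>\<^bsub>Du (W' q)\<^esub> ?u (pullback (vec (W q)) F g) = \<zero>\<^bsub>Du (W' q)\<^esub>"
      using module_minus_eq_zero[OF module_dual[OF module_free] gd gd] by simp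
    thus "g \<ominus>\<^bsub>Du (W' q)\<^esub> ?u (pullback (vec (W q)) F g) \<in> Bco W' D' q"
      using cpx_subm_co(2)[OF c', of q] unfolding subm_def by simp
  qed
  show "?u f \<in> Bco W' D' q \<longleftrightarrow> f \<in> Bco W D q" if f: "f \<in> Zco W D q" for f
  proof
    have fd: "f \<in> covec (W q)" and f0: "\<And>c. c \<in> vec (W (Suc q)) \<Longrightarrow> f (D c) = \<zero>"
      using f by (auto simp: Zco_iff)
    have Dm: "D x \<in> vec (W (q - 1))" if "x \<in> vec (W q)" for x
      using that lvec[OF D(1)[of "q - 1"], of x] D(2) by (cases q) auto
    have Dm': "D' x \<in> vec (W' (q - 1))" if "x \<in> vec (W' q)" for x
      using that lvec[OF D'[of "q - 1"], of x] c' by (cases q) (auto simp: is_cpx_def)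
    {
      assume "f \<in> Bco W D q"
      then obtain g where g: "g \<in> covec (W (q - 1))" "\<And>c. c \<in> vec (W q) \<Longrightarrow> f c = g (D c)"
        using Bco_iff[OF c] by blast
      show "?u f \<in> Bco W' D' q" unfolding Bco_iff[OF c']
        using pullback_closed[OF G module_free fd] pullback_closed[OF G[of "q - 1"] module_free g(1)] g(2) lvec[OF G] GD Dm'
        by (auto intro!: bexI[of _ "pullback (vec (W' (q - 1))) G g"])
    next
      assume "?u f \<in> Bco W' D' q"
      then obtain g where g: "g \<in> covec (W' (q - 1))" "\<And>c. c \<in> vec (W' q) \<Longrightarrow> f (G c) = g (D' c)"
        unfolding Bco_iff[OF c'] by auto
      \<comment> \<open>in degree \<open>0\<close> there are no chains one degree lower, and the homotopy is applied to \<open>D x = 0\<close> only\<close>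
      have Hl: "\<exists>H'. lin R (Fr (W (q - 1))) (Fr (W q)) H' \<and> (\<forall>x\<in>vec (W q). H' (D x) = H (D x))"
      proof (cases q)
        case 0
        have "lin R (Fr (W 0)) (Fr (W 0)) (\<lambda>x. (\<lambda>_. \<zero>))" by (rule linFI) auto
        thus ?thesis using 0 D(2) lzero[OF H] by auto
      qed (use H in auto)
      then obtain H' where H': "lin R (Fr (W (q - 1))) (Fr (W q)) H'" "\<And>x. x \<in> vec (W q) \<Longrightarrow> H' (D x) = H (D x)" by blast
      let ?g = "pullback (vec (W (q - 1))) F g \<oplus>\<^bsub>Du (W (q - 1))\<^esub> pullback (vec (W (q - 1))) H' f"
      have gd: "?g \<in> covec (W (q - 1))"
        by (rule abelian_monoid.a_closed[OF abelian_group.axioms(1)[OF module.axioms(2)[OF module_dual[OF module_free]]]])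
          (intro pullback_closed[OF F module_free g(1)] pullback_closed[OF H'(1) module_free fd])+
      have "f x = ?g (D x)" if x: "x \<in> vec (W q)" for x
      proof -
        have v: "G (F x) \<in> vec (W q)" "D (H x) \<in> vec (W q)" "H (D x) \<in> vec (W q)"
          using lvec[OF G lvec[OF F x]] lvec[OF D(1) lvec[OF H x]] lvec[OF H'(1) Dm[OF x]] H'(2)[OF x] by auto
        have "f x = f (\<lambda>a. G (F x) a \<oplus> (D (H x) a \<oplus> H (D x) a))" using hh[OF x] by simp
        also have "\<dots> = f (G (F x)) \<oplus> (f (D (H x)) \<oplus> f (H (D x)))"
          using v by (simp add: dual_vec_add[OF fd] vec_add)
        also have "f (D (H x)) = \<zero>" by (rule f0[OF lvec[OF H x]])
        finally show ?thesis
          using g(2)[OF lvec[OF F x]] FD[OF x] Dm[OF x] H'(2)[OF x] v dual_in[OF fd] by simp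
      qed
      thus "f \<in> Bco W D q" unfolding Bco_iff[OF c] using fd gd by blast
    }
  qed
qed

subsection \<open>Splitting a complex into shifted blocks\<close>

text \<open>The complex \<open>W\<close> is the direct sum of the complexes \<open>W' b\<close>, shifted up by \<open>e b\<close>, with projections \<open>r b\<close> and
  injections \<open>j b\<close>; the blocks share the operator \<open>D'\<close>.\<close>

definition splits ::
    "(nat \<Rightarrow> 's set) \<Rightarrow> (('s \<Rightarrow> 'a) \<Rightarrow> ('s \<Rightarrow> 'a)) \<Rightarrow> 'i set \<Rightarrow> ('i \<Rightarrow> nat)
      \<Rightarrow> ('i \<Rightarrow> nat \<Rightarrow> 't set) \<Rightarrow> (('t \<Rightarrow> 'a) \<Rightarrow> ('t \<Rightarrow> 'a))
      \<Rightarrow> ('i \<Rightarrow> ('s \<Rightarrow> 'a) \<Rightarrow> ('t \<Rightarrow> 'a)) \<Rightarrow> ('i \<Rightarrow> ('t \<Rightarrow> 'a) \<Rightarrow> ('s \<Rightarrow> 'a)) \<Rightarrow> bool"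
  where "splits W D Bt e W' D' r j \<longleftrightarrow> finite Bt
    \<and> (\<forall>b\<in>Bt. \<forall>q. lin R (Fr (W (q + e b))) (Fr (W' b q)) (r b))
    \<and> (\<forall>b\<in>Bt. \<forall>q. lin R (Fr (W' b q)) (Fr (W (q + e b))) (j b))
    \<and> (\<forall>b\<in>Bt. \<forall>q. \<forall>x\<in>vec (W (Suc q + e b)). r b (D x) = D' (r b x))
    \<and> (\<forall>b\<in>Bt. \<forall>q. \<forall>y\<in>vec (W' b q). j b (D' y) = D (j b y))
    \<and> (\<forall>b\<in>Bt. \<forall>q. \<forall>y\<in>vec (W' b q). r b (j b y) = y)
    \<and> (\<forall>b\<in>Bt. \<forall>c\<in>Bt. \<forall>q. \<forall>y\<in>vec (W' b q). b \<noteq> c \<longrightarrow> r c (j b y) = (\<lambda>_. \<zero>))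
    \<and> (\<forall>q. \<forall>x\<in>vec (W q). x = (\<lambda>a. \<Oplus>b\<in>{b\<in>Bt. e b \<le> q}. j b (r b x) a))"

lemma additive_finsum:
  assumes M: "abelian_group M" and N: "abelian_group N" and f: "\<And>x. x \<in> carrier M \<Longrightarrow> f x \<in> carrier N" "f \<zero>\<^bsub>M\<^esub> = \<zero>\<^bsub>N\<^esub>"
    "\<And>x y. x \<in> carrier M \<Longrightarrow> y \<in> carrier M \<Longrightarrow> f (x \<oplus>\<^bsub>M\<^esub> y) = f x \<oplus>\<^bsub>N\<^esub> f y"
    and "finite I" and g: "\<And>i. i \<in> I \<Longrightarrow> g i \<in> carrier M"
  shows "f (finsum M g I) = finsum N (\<lambda>i. f (g i)) I"
  using assms(6) g
proof (induction I rule: finite_induct)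
  case empty
  interpret M: abelian_group M by fact
  interpret N: abelian_group N by fact
  show ?case using f(2) by simp
next
  case (insert i I)
  interpret M: abelian_group M by fact
  interpret N: abelian_group N by fact
  show ?case using insert f(1,3) by (simp add: Pi_iff)
qed

text \<open>Orthogonal projections \<open>u\<close> and injections \<open>v\<close> that add up to the identity split \<open>M\<close>; as they respect the submodules
  that are divided out, they split the quotient in the same way.\<close>

lemma presents_dsum:
  assumes I: "finite I" and M: "presents R M p H Q" and N: "\<And>b. b \<in> I \<Longrightarrow> presents R (N b) (p' b) (H' b) (Q' b)"
    and u: "\<And>b. b \<in> I \<Longrightarrow> lin R M (N b) (u b)" "\<And>b x. b \<in> I \<Longrightarrow> x \<in> Q \<Longrightarrow> u b x \<in> Q' b"
    and v: "\<And>b. b \<in> I \<Longrightarrow> lin R (N b) M (v b)" "\<And>b y. b \<in> I \<Longrightarrow> y \<in> Q' b \<Longrightarrow> v b y \<in> Q"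
    and uv: "\<And>b y. b \<in> I \<Longrightarrow> y \<in> carrier (N b) \<Longrightarrow> u b (v b y) = y"
    and uv0: "\<And>b c y. b \<in> I \<Longrightarrow> c \<in> I \<Longrightarrow> b \<noteq> c \<Longrightarrow> y \<in> carrier (N b) \<Longrightarrow> u c (v b y) = \<zero>\<^bsub>N c\<^esub>"
    and vu: "\<And>x. x \<in> carrier M \<Longrightarrow> x = finsum M (\<lambda>b. v b (u b x)) I"
  shows "module_iso R H (dsum I H')"
proof -
  have mM: "module R M" "module R H" and mN: "\<And>b. b \<in> I \<Longrightarrow> module R (N b)" "\<And>b. b \<in> I \<Longrightarrow> module R (H' b)"
    using M N by (auto simp: presents_def)
  have p: "lin R M H p" "\<And>x. x \<in> carrier M \<Longrightarrow> p x = \<zero>\<^bsub>H\<^esub> \<longleftrightarrow> x \<in> Q" "Q \<subseteq> carrier M"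
    using M by (auto simp: presents_def)
  have p': "b \<in> I \<Longrightarrow> lin R (N b) (H' b) (p' b)" "b \<in> I \<Longrightarrow> p' b ` carrier (N b) = carrier (H' b)"
    "b \<in> I \<Longrightarrow> y \<in> carrier (N b) \<Longrightarrow> p' b y = \<zero>\<^bsub>H' b\<^esub> \<longleftrightarrow> y \<in> Q' b" for b y
    using N by (auto simp: presents_def)
  have lu: "lin R M (H' b) (\<lambda>x. p' b (u b x))" if "b \<in> I" for b by (rule lin_comp[OF u(1) p'(1)]; fact)
  let ?h = "\<lambda>x. \<lambda>b\<in>I. p' b (u b x)"
  have l: "lin R M (dsum I H') ?h"
    by (rule linI) (auto simp: carrier_dsum I lin_closed[OF lu] lin_add[OF lu] lin_smult[OF lu] intro!: restrict_ext)
  have "?h ` carrier M = carrier (dsum I H')"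
  proof (intro equalityI subsetI)
    fix h assume h: "h \<in> carrier (dsum I H')"
    have "h b \<in> p' b ` carrier (N b)" if "b \<in> I" for b
      using h p'(2)[OF that] that by (auto simp: carrier_dsum I)
    hence "\<forall>b\<in>I. \<exists>y. y \<in> carrier (N b) \<and> p' b y = h b" by (metis imageE)
    then obtain y where y: "\<And>b. b \<in> I \<Longrightarrow> y b \<in> carrier (N b) \<and> p' b (y b) = h b" by metis
    have vy: "v b (y b) \<in> carrier M" if "b \<in> I" for b using lin_closed[OF v(1)] y that by blast
    let ?x = "finsum M (\<lambda>b. v b (y b)) I"
    interpret M: module R M by (rule mM)
    have x: "?x \<in> carrier M" using vy by (intro M.finsum_closed) auto
    have "u c ?x = y c" if c: "c \<in> I" for c
    proof -
      interpret N: module R "N c" by (rule mN[OF c])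
      have "u c ?x = finsum (N c) (\<lambda>b. u c (v b (y b))) I"
        by (rule additive_finsum[OF module.axioms(2)[OF mM(1)] module.axioms(2)[OF mN(1)[OF c]] lin_closed[OF u(1)[OF c]]
            lin_zero[OF u(1)[OF c] mM(1) mN(1)[OF c]] lin_add[OF u(1)[OF c]] I vy])
      also have "\<dots> = finsum (N c) (\<lambda>b. if c = b then y c else \<zero>\<^bsub>N c\<^esub>) I"
        by (rule N.finsum_cong') (use uv uv0 y c in auto)
      also have "\<dots> = y c" using y c by (intro N.finsum_singleton[OF c I]) auto
      finally show ?thesis .
    qed
    hence "h = ?h ?x" using h y by (auto simp: carrier_dsum I PiE_iff extensional_def restrict_def)
    thus "h \<in> ?h ` carrier M" using x by blast
  qed (use l in \<open>auto simp: lin_def\<close>)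
  moreover have "?h x = \<zero>\<^bsub>dsum I H'\<^esub> \<longleftrightarrow> x \<in> Q" if x: "x \<in> carrier M" for x
  proof -
    have ub: "u b x \<in> carrier (N b)" if "b \<in> I" for b using lin_closed[OF u(1)[OF that] x] .
    have "x \<in> Q" if q: "\<And>b. b \<in> I \<Longrightarrow> u b x \<in> Q' b"
    proof -
      interpret H: module R H by (rule mM)
      have vb: "v b (u b x) \<in> carrier M" if "b \<in> I" for b using lin_closed[OF v(1)[OF that] ub[OF that]] .
      have "p x = p (finsum M (\<lambda>b. v b (u b x)) I)" using vu[OF x] by simp
      also have "\<dots> = finsum H (\<lambda>b. p (v b (u b x))) I"
        by (rule additive_finsum[OF module.axioms(2)[OF mM(1)] module.axioms(2)[OF mM(2)] lin_closed[OF p(1)]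
            lin_zero[OF p(1) mM] lin_add[OF p(1)] I vb])
      also have "\<dots> = finsum H (\<lambda>b. \<zero>\<^bsub>H\<^esub>) I" by (rule H.finsum_cong') (use p(2)[OF vb] v(2) q in auto)
      finally show ?thesis using p(2)[OF x] by simp
    qed
    hence "x \<in> Q \<longleftrightarrow> (\<forall>b\<in>I. u b x \<in> Q' b)" using u(2) by blast
    thus ?thesis using p'(3)[OF _ ub] by (auto simp: restrict_def fun_eq_iff)
  qed
  hence "{x\<in>carrier M. ?h x = \<zero>\<^bsub>dsum I H'\<^esub>} = Q" using p(3) by blast
  ultimately have "presents R M ?h (dsum I H') Q"
    using l mM module_dsum[OF I mN(2)] by (simp add: presents_def)
  thus ?thesis by (rule presents_iso[OF M])
qed

text \<open>A chain map consists of one map per degree: \<open>u\<close> acts on the degree of \<open>f\<close>, and \<open>u'\<close> one degree above it for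
  cocycles, one degree below it for coboundaries.\<close>

lemma Zco_pullback:
  assumes f: "f \<in> Zco W2 D2 q" and u: "lin R (Fr (W1 p)) (Fr (W2 q)) u" and D1: "\<And>x. x \<in> vec (W1 (Suc p)) \<Longrightarrow> D1 x \<in> vec (W1 p)"
    and u': "\<And>x. x \<in> vec (W1 (Suc p)) \<Longrightarrow> u' x \<in> vec (W2 (Suc q)) \<and> u (D1 x) = D2 (u' x)"
  shows "pullback (vec (W1 p)) u f \<in> Zco W1 D1 p"
  using assms pullback_closed[OF u module_free] by (simp add: Zco_iff)

lemma Bco_pullback:
  assumes c: "is_cpx W1 D1" "is_cpx W2 D2" and f: "f \<in> Bco W2 D2 q" and u: "lin R (Fr (W1 p)) (Fr (W2 q)) u"
    and u': "lin R (Fr (W1 (p - 1))) (Fr (W2 (q - 1))) u'" "\<And>x. x \<in> vec (W1 p) \<Longrightarrow> D2 (u x) = u' (D1 x)"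
  shows "pullback (vec (W1 p)) u f \<in> Bco W1 D1 p"
proof -
  obtain g where g: "f \<in> covec (W2 q)" "g \<in> covec (W2 (q - 1))"
    "\<And>y. y \<in> vec (W2 q) \<Longrightarrow> f y = g (D2 y)" using f unfolding Bco_iff[OF c(2)] by blast
  have D1: "D1 x \<in> vec (W1 (p - 1))" if "x \<in> vec (W1 p)" for x
    using that c(1) by (cases p) (auto simp: is_cpx_def dest: lvec)
  show ?thesis unfolding Bco_iff[OF c(1)]
    using pullback_closed[OF u module_free g(1)] pullback_closed[OF u'(1) module_free g(2)] g(3)[OF lvec[OF u]] u'(2) D1
    by (auto intro!: bexI[of _ "pullback (vec (W1 (p - 1))) u' g"])
qed

context
  fixes W :: "nat \<Rightarrow> 's set" and D and Bt :: "'i set" and e and W' :: "'i \<Rightarrow> nat \<Rightarrow> 't set" and D' r j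
  assumes c: "is_cpx W D" and c': "\<And>b. b \<in> Bt \<Longrightarrow> is_cpx (W' b) D'" and s: "splits W D Bt e W' D' r j"
begin

lemma splits_rules:
  shows fBt: "finite Bt"
    and rl: "b \<in> Bt \<Longrightarrow> lin R (Fr (W (q + e b))) (Fr (W' b q)) (r b)"
    and jl: "b \<in> Bt \<Longrightarrow> lin R (Fr (W' b q)) (Fr (W (q + e b))) (j b)"
    and rD: "b \<in> Bt \<Longrightarrow> x \<in> vec (W (Suc q + e b)) \<Longrightarrow> r b (D x) = D' (r b x)"
    and jD: "b \<in> Bt \<Longrightarrow> y \<in> vec (W' b q) \<Longrightarrow> j b (D' y) = D (j b y)"
    and rj: "b \<in> Bt \<Longrightarrow> y \<in> vec (W' b q) \<Longrightarrow> r b (j b y) = y"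
    and rj0: "b \<in> Bt \<Longrightarrow> d \<in> Bt \<Longrightarrow> y \<in> vec (W' b q) \<Longrightarrow> b \<noteq> d \<Longrightarrow> r d (j b y) = (\<lambda>_. \<zero>)"
    and sumj: "x \<in> vec (W q) \<Longrightarrow> x = (\<lambda>a. \<Oplus>b\<in>{b\<in>Bt. e b \<le> q}. j b (r b x) a)"
  using s unfolding splits_def by blast+

lemma cDl: "lin R (Fr (W (Suc q))) (Fr (W q)) D" and cD0: "x \<in> vec (W 0) \<Longrightarrow> D x = (\<lambda>_. \<zero>)"
  and cDl': "b \<in> Bt \<Longrightarrow> lin R (Fr (W' b (Suc q))) (Fr (W' b q)) D'"
  and cD0': "b \<in> Bt \<Longrightarrow> y \<in> vec (W' b 0) \<Longrightarrow> D' y = (\<lambda>_. \<zero>)"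
  using c c' unfolding is_cpx_def by blast+

lemma rl': "b \<in> Bt \<Longrightarrow> e b \<le> q \<Longrightarrow> lin R (Fr (W q)) (Fr (W' b (q - e b))) (r b)"
  using rl[of b "q - e b"] by simp

lemma jl': "b \<in> Bt \<Longrightarrow> e b \<le> q \<Longrightarrow> lin R (Fr (W' b (q - e b))) (Fr (W q)) (j b)"
  using jl[of b "q - e b"] by simp

lemma r_cycle:
  assumes b: "b \<in> Bt" "e b \<le> q" and x: "x \<in> vec (W q)" "D x = (\<lambda>_. \<zero>)"
  shows "D' (r b x) = (\<lambda>_. \<zero>)"
proof (cases "q - e b")
  case 0
  thus ?thesis using cD0'[OF b(1)] lvec[OF rl'[OF b] x(1)] by simp
next
  case (Suc p)
  hence "q = Suc p + e b" using b by simp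
  thus ?thesis using rD[OF b(1), of x p] x lzero[OF rl[OF b(1)]] by simp
qed

lemma finsum_free: "finite I \<Longrightarrow> (\<And>i. i \<in> I \<Longrightarrow> g i \<in> P) \<Longrightarrow> subm R (Fr S) P \<Longrightarrow>
    finsum (Fr S\<lparr>carrier := P\<rparr>) g I = (\<lambda>a. \<Oplus>i\<in>I. g i a)"
proof
  fix a assume I: "finite I" "\<And>i. i \<in> I \<Longrightarrow> g i \<in> P" and P: "subm R (Fr S) P"
  have v: "x \<in> P \<Longrightarrow> x \<in> vec S" for x using P by (auto simp: subm_def)
  have m: "abelian_group (Fr S\<lparr>carrier := P\<rparr>)" using module.axioms(2)[OF module_subm[OF module_free P]] .
  show "finsum (Fr S\<lparr>carrier := P\<rparr>) g I a = (\<Oplus>i\<in>I. g i a)"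
    by (rule additive_finsum[OF m is_abelian_group, of "\<lambda>x. x a"]) (use I vec_in[OF v] in auto)
qed

lemma splits_hom: "module_iso R (bhom R W D q) (dsum {b\<in>Bt. e b \<le> q} (\<lambda>b. bhom R (W' b) D' (q - e b)))"
proof (rule presents_dsum[OF _ presents_bhom[OF c] presents_bhom[OF c'], where u = r and v = j])
  let ?I = "{b\<in>Bt. e b \<le> q}"
  show fI: "finite ?I" using fBt by simp
  have jZ: "j b y \<in> Zc W D q" if b: "b \<in> Bt" "e b \<le> q" and y: "y \<in> Zc (W' b) D' (q - e b)" for b y
    using y lvec[OF jl'[OF b]] jD[OF b(1), of y "q - e b"] lzero[OF jl[OF b(1)]] by (simp add: Zc_def)
  have rZ: "r b z \<in> Zc (W' b) D' (q - e b)" if b: "b \<in> Bt" "e b \<le> q" and z: "z \<in> Zc W D q" for b z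
    using z lvec[OF rl'[OF b]] r_cycle[OF b, of z] by (auto simp: Zc_def)
  fix b assume "b \<in> ?I"
  hence b: "b \<in> Bt" "e b \<le> q" by auto
  show "b \<in> Bt" by (rule b)
  show "lin R (Fr (W q)\<lparr>carrier := Zc W D q\<rparr>) (Fr (W' b (q - e b))\<lparr>carrier := Zc (W' b) D' (q - e b)\<rparr>) (r b)"
    using rl'[OF b] rZ[OF b] by (auto simp: lin_def Zc_def)
  show "lin R (Fr (W' b (q - e b))\<lparr>carrier := Zc (W' b) D' (q - e b)\<rparr>) (Fr (W q)\<lparr>carrier := Zc W D q\<rparr>) (j b)"
    using jl'[OF b] jZ[OF b] by (auto simp: lin_def Zc_def)
  show "r b x \<in> Bc (W' b) D' (q - e b)" if x: "x \<in> Bc W D q" for x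
  proof -
    have e: "Suc (q - e b) + e b = Suc q" using b by simp
    obtain w where w: "w \<in> vec (W (Suc (q - e b) + e b))" "x = D w" using x unfolding Bc_def e by blast
    thus ?thesis using rD[OF b(1) w(1)] lvec[OF rl[OF b(1)] w(1)] by (auto simp: Bc_def)
  qed
  show "j b y \<in> Bc W D q" if y: "y \<in> Bc (W' b) D' (q - e b)" for y
  proof -
    obtain w where w: "w \<in> vec (W' b (Suc (q - e b)))" "y = D' w" using y unfolding Bc_def by blast
    thus ?thesis using jD[OF b(1) w(1)] lvec[OF jl[OF b(1)] w(1)] b by (auto simp: Bc_def)
  qed
  fix y assume "y \<in> carrier (Fr (W' b (q - e b))\<lparr>carrier := Zc (W' b) D' (q - e b)\<rparr>)"
  hence y: "y \<in> vec (W' b (q - e b))" by (simp add: Zc_def)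
  show "r b (j b y) = y" by (rule rj[OF b(1) y])
  show "r d (j b y) = \<zero>\<^bsub>Fr (W' d (q - e d))\<lparr>carrier := Zc (W' d) D' (q - e d)\<rparr>\<^esub>" if "d \<in> ?I" "b \<noteq> d" for d
    using rj0[OF b(1) _ y] that by simp
next
  let ?I = "{b\<in>Bt. e b \<le> q}"
  fix x assume "x \<in> carrier (Fr (W q)\<lparr>carrier := Zc W D q\<rparr>)"
  hence x: "x \<in> Zc W D q" "x \<in> vec (W q)" by (auto simp: Zc_def)
  have "j b (r b x) \<in> Zc W D q" if "b \<in> ?I" for b
    using that x jD[of b "r b x" "q - e b"] r_cycle[of b q x] lvec[OF rl'[of b q] x(2)] lvec[OF jl'[of b q]] lzero[OF jl[of b]]
    by (auto simp: Zc_def)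
  thus "x = finsum (Fr (W q)\<lparr>carrier := Zc W D q\<rparr>) (\<lambda>b. j b (r b x)) ?I"
    using sumj[OF x(2)] finsum_free[OF _ _ cpx_subm(1)[OF c, of q], of ?I "\<lambda>b. j b (r b x)"] fBt by simp
qed

lemma splits_coh: "module_iso R (bcoh R W D q) (dsum {b\<in>Bt. e b \<le> q} (\<lambda>b. bcoh R (W' b) D' (q - e b)))"
proof (rule presents_dsum[OF _ presents_bcoh[OF c] presents_bcoh[OF c'],
      where u = "\<lambda>b. pullback (vec (W' b (q - e b))) (j b)" and v = "\<lambda>b. pullback (vec (W q)) (r b)"])
  let ?I = "{b\<in>Bt. e b \<le> q}"
  let ?j = "\<lambda>b. pullback (vec (W' b (q - e b))) (j b)" and ?r = "\<lambda>b. pullback (vec (W q)) (r b)"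
  have jZ: "?j b f \<in> Zco (W' b) D' (q - e b)" if b: "b \<in> ?I" and f: "f \<in> Zco W D q" for b f
    by (rule Zco_pullback[where u' = "j b", OF f]) (use b jl'[of b q] jD[of b] lvec[OF jl[of b "Suc (q - e b)"]] lvec[OF cDl'] in auto)
  have rZ: "?r b g \<in> Zco W D q" if b: "b \<in> ?I" and g: "g \<in> Zco (W' b) D' (q - e b)" for b g
    by (rule Zco_pullback[where u' = "r b", OF g])
      (use b rl'[of b q] rD[of b _ "q - e b"] lvec[OF rl[of b "Suc (q - e b)"]] lvec[OF cDl] in auto)
  show fI: "finite ?I" using fBt by simp
  {
    fix f assume "f \<in> carrier (Du (W q)\<lparr>carrier := Zco W D q\<rparr>)"
    hence fZ: "f \<in> Zco W D q" and f: "f \<in> covec (W q)" by (auto simp: Zco_iff)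
    let ?M = "Du (W q)\<lparr>carrier := Zco W D q\<rparr>"
    have k: "?r b (?j b f) \<in> Zco W D q" if "b \<in> ?I" for b by (rule rZ[OF that jZ[OF that fZ]])
    have m: "abelian_group ?M" using module.axioms(2)[OF module_subm[OF module_dual[OF module_free] cpx_subm_co(1)[OF c]]] .
    show "f = finsum ?M (\<lambda>b. ?r b (?j b f)) ?I"
    proof (rule dual_ext[OF f])
      show "finsum ?M (\<lambda>b. ?r b (?j b f)) ?I \<in> covec (W q)"
        using abelian_monoid.finsum_closed[OF abelian_group.axioms(1)[OF m], of "\<lambda>b. ?r b (?j b f)" ?I] k by (auto simp: Zco_iff)
      fix x assume x: "x \<in> vec (W q)"
      have rx: "r b x \<in> vec (W' b (q - e b))" if "b \<in> ?I" for b using lvec[OF rl'[of b q] x] that by auto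
      have "finsum ?M (\<lambda>b. ?r b (?j b f)) ?I x = (\<Oplus>b\<in>?I. ?r b (?j b f) x)"
        by (rule additive_finsum[OF m is_abelian_group, of "\<lambda>f. f x"]) (use x k fI dual_in[OF _ x] in \<open>auto simp: Zco_iff\<close>)
      also have "\<dots> = (\<Oplus>b\<in>?I. f (j b (r b x)))"
        by (rule add.finprod_cong') (use x rx dual_in[OF f lvec[OF jl' rx]] in auto)
      also have "\<dots> = f x"
        using dual_finsum[OF f fI, of "\<lambda>b. j b (r b x)"] lvec[OF jl' rx] sumj[OF x] by simp
      finally show "f x = finsum ?M (\<lambda>b. ?r b (?j b f)) ?I x" by simp
    qed
  }
  fix b assume bI: "b \<in> ?I"
  hence b: "b \<in> Bt" "e b \<le> q" by auto
  show "b \<in> Bt" by (rule b)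
  show "lin R (Du (W q)\<lparr>carrier := Zco W D q\<rparr>)
      (Du (W' b (q - e b))\<lparr>carrier := Zco (W' b) D' (q - e b)\<rparr>) (?j b)"
    using pullback_lin[OF jl'[OF b] module_free] jZ[OF bI] by (auto simp: lin_def Zco_iff)
  show "lin R (Du (W' b (q - e b))\<lparr>carrier := Zco (W' b) D' (q - e b)\<rparr>)
      (Du (W q)\<lparr>carrier := Zco W D q\<rparr>) (?r b)"
    using pullback_lin[OF rl'[OF b] module_free] rZ[OF bI] by (auto simp: lin_def Zco_iff)
  have zl: "lin R (Fr S) (Fr S') (\<lambda>_ _. \<zero>)" for S :: "'x set" and S' :: "'z set" by (rule linFI) auto
  show "?j b f \<in> Bco (W' b) D' (q - e b)" if f: "f \<in> Bco W D q" for f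
  proof (cases "q - e b")
    case 0
    thus ?thesis
      using Bco_pullback[OF c'[OF b(1)] c f jl'[OF b] zl] jD[OF b(1), of _ 0] cD0'[OF b(1)] lzero[OF jl[OF b(1)]] by auto
  next
    case (Suc p)
    thus ?thesis
      by (intro Bco_pullback[OF c'[OF b(1)] c f jl'[OF b] jl'[of b "q - 1", unfolded diff_commute[of q 1]]]) (use b jD[OF b(1)] in auto)
  qed
  show "?r b g \<in> Bco W D q" if g: "g \<in> Bco (W' b) D' (q - e b)" for g
  proof (cases "q - e b")
    case 0
    thus ?thesis
      using Bco_pullback[OF c c'[OF b(1)] g rl'[OF b] zl] cD0'[OF b(1)] lvec[OF rl'[OF b]] by auto
  next
    case (Suc p)
    have q: "q = Suc p + e b" using Suc b by simp
    show ?thesis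
      by (intro Bco_pullback[OF c c'[OF b(1)] g rl'[OF b] rl'[of b "q - 1", unfolded diff_commute[of q 1]]]) (use b rD[OF b(1), of _ p] q in auto)
  qed
  fix g assume "g \<in> carrier (Du (W' b (q - e b))\<lparr>carrier := Zco (W' b) D' (q - e b)\<rparr>)"
  hence gZ: "g \<in> Zco (W' b) D' (q - e b)" and g: "g \<in> covec (W' b (q - e b))" by (auto simp: Zco_iff)
  show "?j b (?r b g) = g"
    by (rule dual_ext[OF _ g]) (use jZ[OF bI rZ[OF bI gZ]] lvec[OF jl'[OF b]] rj[OF b(1)] in \<open>auto simp: Zco_iff\<close>)
  show "?j d (?r b g) = \<zero>\<^bsub>Du (W' d (q - e d))\<lparr>carrier := Zco (W' d) D' (q - e d)\<rparr>\<^esub>" if d: "d \<in> ?I" "b \<noteq> d" for d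
    using d lvec[OF jl'[of d q]] rj0[of d b _ "q - e d"] b dual_vec_zero[OF g] by (auto simp: pullback_def intro!: restrict_ext)
qed

end

end

section \<open>Tensor complexes over a simplicial complex\<close>

context cring
begin

definition sg :: "nat \<Rightarrow> 'a" where "sg n = (if even n then \<one> else \<ominus> \<one>)"

lemma sg_pow: "(\<ominus> \<one>) [^] (n::nat) = sg n"
  by (induction n) (auto simp: sg_def l_minus)

lemma sg_carrier [simp]: "sg n \<in> carrier R" by (simp add: sg_def)

lemma sg_add: "sg (m + n) = sg m \<otimes> sg n" by (auto simp: sg_def l_minus)

lemma sg_sq: "x \<in> carrier R \<Longrightarrow> sg n \<otimes> (sg n \<otimes> x) = x" by (auto simp: sg_def l_minus)

lemma finsum_zero_eq: "(\<And>i. i \<in> J \<Longrightarrow> f i = \<zero>) \<Longrightarrow> (\<Oplus>i\<in>J. f i) = \<zero>"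
  by (rule add.finprod_one_eqI)

lemma lin_expand:
  assumes F: "lin R (Fr S) (Fr S') F" and S: "finite S" and y: "y \<in> vec S"
  shows "F y = (\<lambda>b. \<Oplus>a\<in>S. y a \<otimes> F (free_gen R a) b)"
proof -
  have g: "(\<lambda>s. y a \<otimes> free_gen R a s) \<in> vec S" if "a \<in> S" for a
    using vec_smult[OF vec_in[OF y] free_gen_carrier[OF that]] .
  have "y s = (\<Oplus>a\<in>S. y a \<otimes> free_gen R a s)" for s
  proof -
    have "(\<Oplus>a\<in>S. y a \<otimes> free_gen R a s) = (\<Oplus>a\<in>S. if s = a then y a else \<zero>)"
      by (rule add.finprod_cong') (use vec_in[OF y] in \<open>auto simp: free_gen_def\<close>)
    also have "\<dots> = y s"
      using add.finprod_singleton[of s S y] S vec_in[OF y] vec_out[OF y, of s]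
      by (cases "s \<in> S") (auto intro!: finsum_zero_eq)
    finally show ?thesis by simp
  qed
  hence "F y = F (\<lambda>s. \<Oplus>a\<in>S. y a \<otimes> free_gen R a s)" by (intro arg_cong[of _ _ F] ext)
  also have "\<dots> = (\<lambda>b. \<Oplus>a\<in>S. F (\<lambda>s. y a \<otimes> free_gen R a s) b)"
    by (rule lfinsum[OF F S g])
  also have "\<dots> = (\<lambda>b. \<Oplus>a\<in>S. y a \<otimes> F (free_gen R a) b)"
  proof (intro ext add.finprod_cong')
    fix b a assume a: "a \<in> S"
    show "F (\<lambda>s. y a \<otimes> free_gen R a s) b = y a \<otimes> F (free_gen R a) b"
      using lsmult[OF F vec_in[OF y] free_gen_carrier[OF a]] by simp
  qed (use vec_in[OF y] vec_in[OF lvec[OF F free_gen_carrier]] in auto)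
  finally show ?thesis .
qed

text \<open>Operators on different variables commute: expand the one over the finite set \<open>S\<close> and use linearity of the other.\<close>

lemma lin_swap:
  assumes F: "lin R (Fr S) (Fr S') F" and G: "lin R (Fr T) (Fr T') G" and S: "finite S"
    and x: "\<And>a. x a \<in> vec T" "\<And>b. (\<lambda>a. x a b) \<in> vec S"
  shows "F (\<lambda>a. G (x a) b') a' = G (\<lambda>b. F (\<lambda>a. x a b) a') b'"
proof -
  have f: "F (free_gen R a) a' \<in> carrier R" if "a \<in> S" for a
    using vec_in[OF lvec[OF F free_gen_carrier[OF that]]] .
  have xz: "x a = (\<lambda>_. \<zero>)" if "a \<notin> S" for a using vec_out[OF x(2) that] by auto
  have y: "(\<lambda>a. G (x a) b') \<in> vec S"
    using vec_in[OF lvec[OF G x(1)]] lzero[OF G] xz S by (auto simp: free_mod_carrier_fin)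
  have e: "(\<lambda>b. F (\<lambda>a. x a b) a') = (\<lambda>b. \<Oplus>a\<in>S. F (free_gen R a) a' \<otimes> x a b)"
  proof
    fix b
    have "F (\<lambda>a. x a b) a' = (\<Oplus>a\<in>S. x a b \<otimes> F (free_gen R a) a')"
      using lin_expand[OF F S x(2), of b] by simp
    also have "\<dots> = (\<Oplus>a\<in>S. F (free_gen R a) a' \<otimes> x a b)"
      by (rule add.finprod_cong') (use f vec_in[OF x(1)] in \<open>auto simp: m_comm\<close>)
    finally show "F (\<lambda>a. x a b) a' = (\<Oplus>a\<in>S. F (free_gen R a) a' \<otimes> x a b)" .
  qed
  have "G (\<lambda>b. F (\<lambda>a. x a b) a') b' = (\<Oplus>a\<in>S. G (\<lambda>b. F (free_gen R a) a' \<otimes> x a b) b')"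
    unfolding e using lfinsum[OF G S, of "\<lambda>a b. F (free_gen R a) a' \<otimes> x a b"] vec_smult[OF f x(1)] by simp
  also have "\<dots> = (\<Oplus>a\<in>S. G (x a) b' \<otimes> F (free_gen R a) a')"
    by (rule add.finprod_cong')
      (use f vec_in[OF lvec[OF G x(1)]] lsmult[OF G f x(1)] in \<open>auto simp: m_comm\<close>)
  also have "\<dots> = F (\<lambda>a. G (x a) b') a'"
    using lin_expand[OF F S y] by simp
  finally show ?thesis by simp
qed

end

text \<open>The operator \<open>F\<close> acting on the variable \<open>k\<close> of a function of words, with the other letters of \<open>w\<close> held fixed.\<close>

definition lift :: "'k \<Rightarrow> (('s \<Rightarrow> 'r) \<Rightarrow> 's \<Rightarrow> 'r) \<Rightarrow> (('k \<Rightarrow> 's) \<Rightarrow> 'r) \<Rightarrow> ('k \<Rightarrow> 's) \<Rightarrow> 'r"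
  where "lift k F c w = F (\<lambda>a. c (w(k := a))) (w k)"

text \<open>The tensor product over \<open>K\<close> of based complexes.  The bases \<open>S k\<close> of the factors are arguments of the constants
  below, while degrees, differentials and the parts \<open>A k\<close> belong to an ambient type.  Thus two choices of bases can be
  compared, and exchanged one position at a time, inside one interpretation.\<close>

locale tensor_complex = cring R for R (structure) +
  fixes I :: "'k::linorder set" and K :: "'k set set" and A :: "'k \<Rightarrow> 's set"
    and dg :: "'k \<Rightarrow> 's \<Rightarrow> nat" and D :: "'k \<Rightarrow> ('s \<Rightarrow> 'a) \<Rightarrow> ('s \<Rightarrow> 'a)"
  assumes fI: "finite I" and K: "\<tau> \<in> K \<Longrightarrow> \<rho> \<subseteq> \<tau> \<Longrightarrow> \<rho> \<in> K"
begin

text \<open>A homogeneous operator of degree \<open>e1 - e2\<close> that respects the span of \<open>A k\<close>.  The degree is a difference because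
  all degrees are natural numbers.\<close>

definition gop where "gop k S S' e1 e2 F \<longleftrightarrow> lin R (Fr S) (Fr S') F
  \<and> (\<forall>p. \<forall>c\<in>vec {a\<in>S. dg k a = p}. \<forall>b. F c b \<noteq> \<zero> \<longrightarrow> p + e1 = dg k b + e2)
  \<and> (\<forall>c\<in>vec (S \<inter> A k). F c \<in> vec (S' \<inter> A k))"

text \<open>These words form the basis of the sum over \<open>\<tau> \<in> K\<close> of the tensor products whose factors are spanned by \<open>S k\<close> for
  \<open>k \<in> \<tau>\<close> and by \<open>S k \<inter> A k\<close> otherwise.\<close>

definition words where "words S = {w \<in> \<Pi>\<^sub>E k\<in>I. S k. {k\<in>I. w k \<notin> A k} \<in> K}"

definition wdeg where "wdeg w = (\<Sum>k\<in>I. dg k (w k))"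

definition wordsq where "wordsq S q = {w \<in> words S. wdeg w = q}"

definition eps where "eps k w = sg (\<Sum>l\<in>{l\<in>I. l < k}. dg l (w l))"

definition dterm where "dterm k c w = eps k w \<otimes> lift k (D k) c w"

lemma dterm_eq: "dterm k c = (\<lambda>w. eps k w \<otimes> lift k (D k) c w)"
  by (simp add: dterm_def fun_eq_iff)

definition dtot where "dtot c = (\<lambda>w. \<Oplus>k\<in>I. dterm k c w)"

definition rest where "rest k w = (\<Sum>l\<in>I-{k}. dg l (w l))"

lemma wdeg_split: "k \<in> I \<Longrightarrow> wdeg w = dg k (w k) + rest k w"
  unfolding wdeg_def rest_def using fI by (simp add: sum.remove)

lemma rest_upd [simp]: "rest k (w(k := a)) = rest k w"
  unfolding rest_def by (rule sum.cong) auto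

lemma finite_wordsq: "(\<And>k. k \<in> I \<Longrightarrow> finite (S k)) \<Longrightarrow> finite (wordsq S q)"
  by (rule finite_subset[of _ "\<Pi>\<^sub>E k\<in>I. S k"]) (auto simp: wordsq_def words_def intro: finite_PiE fI)

lemma wordsq_words: "c \<in> vec (wordsq S q) \<Longrightarrow> c \<in> vec (words S)"
  by (rule vec_mono) (auto simp: wordsq_def)

lemma slice:
  assumes "c \<in> vec (words S)" "k \<in> I" "finite (S k)"
  shows "(\<lambda>a. c (w(k := a))) \<in> vec (S k)"
proof -
  have "c (w(k := a)) = \<zero>" if "a \<notin> S k" for a
  proof (rule vec_out[OF assms(1)])
    show "w(k := a) \<notin> words S" using that assms(2) by (auto simp: words_def PiE_iff dest!: bspec[of _ _ k])
  qed
  thus ?thesis using assms vec_in[OF assms(1)] by (simp add: free_mod_carrier_fin)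
qed

lemma slice_deg:
  assumes "c \<in> vec (wordsq S q)" "k \<in> I" "finite (S k)"
  shows "(\<lambda>a. c (w(k := a))) \<in> vec {a\<in>S k. dg k a = q - rest k w}"
proof -
  have "c (w(k := a)) = \<zero>" if "a \<notin> {a\<in>S k. dg k a = q - rest k w}" for a
  proof (rule vec_out[OF assms(1)])
    show "w(k := a) \<notin> wordsq S q"
      using that assms(2) wdeg_split[OF assms(2), of "w(k := a)"]
      by (auto simp: wordsq_def words_def PiE_iff dest!: bspec[of _ _ k])
  qed
  thus ?thesis using assms vec_in[OF assms(1)] by (simp add: free_mod_carrier_fin)
qed

text \<open>When a letter outside \<open>A k\<close> at position \<open>k\<close> would leave \<open>K\<close>, only letters of \<open>A k\<close> occur there.  An operator that
  respects \<open>A k\<close> therefore maps words over \<open>K\<close> to words over \<open>K\<close>.\<close>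

lemma slice_A:
  assumes "c \<in> vec (words S)" "k \<in> I" "finite (S k)" "insert k {l\<in>I-{k}. w l \<notin> A l} \<notin> K"
  shows "(\<lambda>a. c (w(k := a))) \<in> vec (S k \<inter> A k)"
proof -
  have "c (w(k := a)) = \<zero>" if "a \<notin> A k" for a
  proof (rule vec_out[OF assms(1)])
    have "{l\<in>I. (w(k := a)) l \<notin> A l} = insert k {l\<in>I-{k}. w l \<notin> A l}" using that assms(2) by auto
    thus "w(k := a) \<notin> words S" using assms(4) by (auto simp: words_def simp del: fun_upd_apply)
  qed
  thus ?thesis using slice[OF assms(1-3), of w] assms(3) by (auto simp: free_mod_carrier_fin)
qed

lemma lift_support:
  assumes F: "gop k (S k) T e1 e2 F" and k: "k \<in> I" and fin: "finite (S k)"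
    and c: "c \<in> vec (wordsq S q)" and nz: "lift k F c w \<noteq> \<zero>"
  shows "w \<in> words (S(k := T))" "q + e1 = wdeg w + e2"
proof -
  let ?y = "\<lambda>a. c (w(k := a))"
  have Fl: "lin R (Fr (S k)) (Fr T) F" using F by (simp add: gop_def)
  have cw: "c \<in> vec (words S)" by (rule wordsq_words[OF c])
  have "?y \<noteq> (\<lambda>_. \<zero>)" using nz lzero[OF Fl] by (auto simp: lift_def)
  then obtain a where "c (w(k := a)) \<noteq> \<zero>" by auto
  hence wa: "w(k := a) \<in> wordsq S q" using vec_out[OF c] by blast
  have y: "?y \<in> vec (S k)" by (rule slice[OF cw k fin])
  have wkT: "w k \<in> T" using vec_out[OF lvec[OF Fl y], of "w k"] nz by (auto simp: lift_def)
  have "q - rest k w + e1 = dg k (w k) + e2"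
    using F slice_deg[OF c k fin, of w] nz unfolding gop_def lift_def by blast
  moreover have "rest k w \<le> q" using wa wdeg_split[OF k, of "w(k := a)"] by (simp add: wordsq_def)
  ultimately show "q + e1 = wdeg w + e2" using wdeg_split[OF k, of w] by simp
  have pi: "w \<in> (\<Pi>\<^sub>E l\<in>I. (S(k := T)) l)"
    using wa wkT k by (auto simp: wordsq_def words_def PiE_iff extensional_def split: if_splits)
  have KK: "{l\<in>I. (w(k := a)) l \<notin> A l} \<in> K" using wa by (simp add: wordsq_def words_def del: fun_upd_apply)
  have "{l\<in>I. w l \<notin> A l} \<in> K"
  proof (cases "w k \<in> A k")
    case True
    hence "{l\<in>I. w l \<notin> A l} \<subseteq> {l\<in>I. (w(k := a)) l \<notin> A l}" by auto
    thus ?thesis using K[OF KK] by blast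
  next
    case False
    have e: "{l\<in>I. w l \<notin> A l} = insert k {l\<in>I-{k}. w l \<notin> A l}" using False k by auto
    show ?thesis
    proof (rule ccontr)
      assume "\<not> ?thesis"
      hence "?y \<in> vec (S k \<inter> A k)" using slice_A[OF cw k fin] e by simp
      hence "F ?y \<in> vec (T \<inter> A k)" using F by (simp add: gop_def)
      thus False using vec_out[of "F ?y" "T \<inter> A k" "w k"] False nz by (simp add: lift_def)
    qed
  qed
  thus "w \<in> words (S(k := T))" using pi by (simp add: words_def)
qed

lemma lift_carrier:
  assumes F: "gop k (S k) T e1 e2 F" and k: "k \<in> I" and fin: "finite (S k)" and c: "c \<in> vec (words S)"
  shows "lift k F c w \<in> carrier R"
  using vec_in[OF lvec[OF _ slice[OF c k fin]]] F by (auto simp: lift_def gop_def)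

lemma lift_vec:
  assumes F: "gop k (S k) T e1 e2 F" and k: "k \<in> I" and fin: "\<And>l. l \<in> I \<Longrightarrow> finite (S l)" "finite T"
    and c: "c \<in> vec (wordsq S q)" and q: "q + e1 = q' + e2"
  shows "lift k F c \<in> vec (wordsq (S(k := T)) q')"
proof -
  have "finite (wordsq (S(k := T)) q')" by (rule finite_wordsq) (use fin in auto)
  moreover have "lift k F c w = \<zero>" if "w \<notin> wordsq (S(k := T)) q'" for w
    using lift_support[OF F k fin(1)[OF k] c] that q by (auto simp: wordsq_def)
  ultimately show ?thesis
    using lift_carrier[OF F k fin(1)[OF k] wordsq_words[OF c]] by (simp add: free_mod_carrier_fin)
qed

lemma lift_add:
  assumes F: "gop k (S k) T e1 e2 F" and k: "k \<in> I" and fin: "finite (S k)" and c: "c \<in> vec (words S)" "d \<in> vec (words S)"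
  shows "lift k F (\<lambda>w. c w \<oplus> d w) = (\<lambda>w. lift k F c w \<oplus> lift k F d w)"
proof
  fix w
  show "lift k F (\<lambda>w. c w \<oplus> d w) w = lift k F c w \<oplus> lift k F d w"
    using ladd[OF _ slice[where S = S, OF c(1) k fin, of w] slice[where S = S, OF c(2) k fin, of w], of T F] F
    by (simp add: lift_def gop_def)
qed

lemma lift_smult:
  assumes F: "gop k (S k) T e1 e2 F" and k: "k \<in> I" and fin: "finite (S k)" and c: "c \<in> vec (words S)" "a \<in> carrier R"
  shows "lift k F (\<lambda>w. a \<otimes> c w) = (\<lambda>w. a \<otimes> lift k F c w)"
proof
  fix w
  show "lift k F (\<lambda>w. a \<otimes> c w) w = a \<otimes> lift k F c w"
    using lsmult[OF _ c(2) slice[where S = S, OF c(1) k fin, of w], of T F] F by (simp add: lift_def gop_def)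
qed

lemma lift_lin:
  assumes F: "gop k (S k) T e1 e2 F" and k: "k \<in> I" and fin: "\<And>l. l \<in> I \<Longrightarrow> finite (S l)" "finite T"
    and q: "q + e1 = q' + e2"
  shows "lin R (Fr (wordsq S q)) (Fr (wordsq (S(k := T)) q')) (lift k F)"
  by (rule linFI) (use lift_vec[where S = S, OF F k fin _ q] lift_add[where S = S, OF F k fin(1)[OF k]]
      lift_smult[where S = S, OF F k fin(1)[OF k]] wordsq_words in auto)

lemma lift_finsum:
  assumes F: "gop k (S k) T e1 e2 F" and k: "k \<in> I" and fin: "finite (S k)" and J: "finite J"
    and c: "\<And>i. i \<in> J \<Longrightarrow> c i \<in> vec (words S)"
  shows "lift k F (\<lambda>w. \<Oplus>i\<in>J. c i w) w = (\<Oplus>i\<in>J. lift k F (c i) w)"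
proof -
  have Fl: "lin R (Fr (S k)) (Fr T) F" using F by (simp add: gop_def)
  show ?thesis
    using lfinsum[OF Fl J, of "\<lambda>i a. c i (w(k := a))"] slice[OF c k fin] by (simp add: lift_def)
qed

lemma lift_comp: "lift k F (lift k G c) = lift k (\<lambda>y. F (G y)) c"
  by (simp add: lift_def fun_eq_iff)

lemma lift_commute:
  assumes F: "gop k (S k) T e1 e2 F" and G: "gop l (S l) T' e1' e2' G" and kl: "k \<in> I" "l \<in> I" "k \<noteq> l"
    and fin: "finite (S k)" "finite (S l)" and c: "c \<in> vec (words S)"
  shows "lift k F (lift l G c) w = lift l G (lift k F c) w"
proof -
  have Fl: "lin R (Fr (S k)) (Fr T) F" and Gl: "lin R (Fr (S l)) (Fr T') G"
    using F G by (simp_all add: gop_def)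
  have tw: "w(k := a, l := b) = w(l := b, k := a)" for a b using kl(3) by (simp add: fun_upd_twist)
  have "(\<lambda>b. c (w(k := a, l := b))) \<in> vec (S l)" for a using slice[OF c kl(2) fin(2), of "w(k := a)"] by simp
  moreover have "(\<lambda>a. c (w(k := a, l := b))) \<in> vec (S k)" for b
    unfolding tw using slice[OF c kl(1) fin(1), of "w(l := b)"] by simp
  ultimately have "F (\<lambda>a. G (\<lambda>b. c (w(k := a, l := b))) (w l)) (w k)
      = G (\<lambda>b. F (\<lambda>a. c (w(k := a, l := b))) (w k)) (w l)"
    by (rule lin_swap[OF Fl Gl fin(1)])
  thus ?thesis using kl(3) by (simp add: lift_def tw del: fun_upd_apply add: fun_upd_other)
qed

lemma eps_carrier [simp]: "eps k w \<in> carrier R" by (simp add: eps_def)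

lemma eps_sq: "x \<in> carrier R \<Longrightarrow> eps k w \<otimes> (eps k w \<otimes> x) = x"
  unfolding eps_def by (rule sg_sq)

lemma eps_vec: "c \<in> vec (wordsq S q) \<Longrightarrow> (\<lambda>w. eps k w \<otimes> c w) \<in> vec (wordsq S q)"
  by (auto simp: free_mod_carrier elim!: finite_subset[rotated])

text \<open>The Koszul sign picked up when an operator passes the variables in front of it.\<close>

lemma lift_eps:
  assumes F: "gop k (S k) T e1 e2 F" and k: "k \<in> I" and fin: "finite (S k)" and x: "x \<in> vec (wordsq S q)"
  shows "lift k F (\<lambda>w. eps l w \<otimes> x w) w
    = (if k < l then sg (e1 + e2) else \<one>) \<otimes> (eps l w \<otimes> lift k F x w)"
proof -
  have Fl: "lin R (Fr (S k)) (Fr T) F" using F by (simp add: gop_def)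
  let ?y = "\<lambda>a. x (w(k := a))"
  have y: "?y \<in> vec (S k)" by (rule slice[OF wordsq_words[OF x] k fin])
  have Fy: "F ?y (w k) \<in> carrier R" using vec_in[OF lvec[OF Fl y]] .
  let ?J = "{j\<in>I. j < l}"
  show ?thesis
  proof (cases "k < l")
    case False
    have "eps l (w(k := a)) = eps l w" for a
      unfolding eps_def by (rule arg_cong[of _ _ sg], rule sum.cong) (use False in auto)
    thus ?thesis using lsmult[OF Fl _ y, of "eps l w"] False Fy by (simp add: lift_def)
  next
    case True
    define p where "p = q - rest k w"
    have yp: "?y \<in> vec {a\<in>S k. dg k a = p}" unfolding p_def by (rule slice_deg[OF x k fin])
    define r where "r = (\<Sum>j\<in>?J-{k}. dg j (w j))"
    have e: "eps l v = sg (dg k (v k) + r)" if "\<And>j. j \<noteq> k \<Longrightarrow> v j = w j" for v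
    proof -
      have "(\<Sum>j\<in>?J. dg j (v j)) = dg k (v k) + (\<Sum>j\<in>?J-{k}. dg j (v j))"
        by (rule sum.remove) (use True k fI in auto)
      also have "(\<Sum>j\<in>?J-{k}. dg j (v j)) = r" unfolding r_def by (rule sum.cong) (use that in auto)
      finally show ?thesis by (simp add: eps_def)
    qed
    have "(\<lambda>a. eps l (w(k := a)) \<otimes> x (w(k := a))) = (\<lambda>a. sg (p + r) \<otimes> ?y a)"
    proof
      fix a
      show "eps l (w(k := a)) \<otimes> x (w(k := a)) = sg (p + r) \<otimes> ?y a"
      proof (cases "?y a = \<zero>")
        case False
        hence "dg k a = p" using vec_out[OF yp, of a] by auto
        thus ?thesis using e[of "w(k := a)"] by simp
      qed simp
    qed
    hence L: "lift k F (\<lambda>w. eps l w \<otimes> x w) w = sg (p + r) \<otimes> F ?y (w k)"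
      using lsmult[OF Fl _ y, of "sg (p + r)"] by (simp add: lift_def)
    show ?thesis
    proof (cases "F ?y (w k) = \<zero>")
      case True thus ?thesis using L by (simp add: lift_def)
    next
      case False
      hence pe: "p + e1 = dg k (w k) + e2" using F yp unfolding gop_def by blast
      have "sg (p + r) = sg (e1 + e2) \<otimes> eps l w"
      proof -
        have "even (p + r) \<longleftrightarrow> even (e1 + e2 + (dg k (w k) + r))" using pe by presburger
        thus ?thesis using e[of w] sg_add[of "e1 + e2" "dg k (w k) + r"] by (simp add: sg_def)
      qed
      thus ?thesis using L True Fy by (simp add: lift_def m_assoc)
    qed
  qed
qed

definition admissible where "admissible S \<longleftrightarrow> (\<forall>k\<in>I. finite (S k) \<and> gop k (S k) (S k) 0 1 (D k))"

context
  fixes S assumes S: "admissible S"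
begin

lemma adm_fin: "k \<in> I \<Longrightarrow> finite (S k)" and adm_gop: "k \<in> I \<Longrightarrow> gop k (S k) (S k) 0 1 (D k)"
  using S by (auto simp: admissible_def)

lemma lift_D_vec: "k \<in> I \<Longrightarrow> c \<in> vec (wordsq S (Suc q)) \<Longrightarrow> lift k (D k) c \<in> vec (wordsq S q)"
  using lift_vec[where S = S and k = k and c = c and q = "Suc q" and q' = q, OF adm_gop _ adm_fin adm_fin] by simp

lemma lift_D_zero: "k \<in> I \<Longrightarrow> c \<in> vec (wordsq S 0) \<Longrightarrow> lift k (D k) c = (\<lambda>_. \<zero>)"
  using lift_support(2)[where S = S and k = k and c = c and q = 0, OF adm_gop _ adm_fin] by fastforce

lemma dterm_vec: "k \<in> I \<Longrightarrow> c \<in> vec (wordsq S (Suc q)) \<Longrightarrow> dterm k c \<in> vec (wordsq S q)"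
  using eps_vec[OF lift_D_vec, of k c q k] by (simp add: dterm_eq)

lemma dtot_zero: "c \<in> vec (wordsq S 0) \<Longrightarrow> dtot c = (\<lambda>_. \<zero>)"
  by (auto simp: dtot_def dterm_def lift_D_zero intro!: finsum_zero_eq)

lemma dterm_vec': "k \<in> I \<Longrightarrow> c \<in> vec (wordsq S q) \<Longrightarrow> dterm k c \<in> vec (wordsq S (q - 1))"
  using dterm_vec[of k c "q - 1"] lift_D_zero[of k c] by (cases q) (auto simp: dterm_eq)

lemma dtot_vec: "c \<in> vec (wordsq S (Suc q)) \<Longrightarrow> dtot c \<in> vec (wordsq S q)"
  unfolding dtot_def by (rule vec_finsum[OF fI dterm_vec])

lemma dterm_carrier: "k \<in> I \<Longrightarrow> c \<in> vec (words S) \<Longrightarrow> dterm k c w \<in> carrier R"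
  using lift_carrier[where S = S and k = k, OF adm_gop _ adm_fin] by (simp add: dterm_def)

lemma dtot_lin: "lin R (Fr (wordsq S (Suc q))) (Fr (wordsq S q)) dtot"
proof (rule linFI)
  fix c d assume "c \<in> vec (wordsq S (Suc q))" "d \<in> vec (wordsq S (Suc q))"
  hence c: "c \<in> vec (words S)" "d \<in> vec (words S)" by (auto intro: wordsq_words)
  show "dtot (\<lambda>x. c x \<oplus> d x) = (\<lambda>x. dtot c x \<oplus> dtot d x)"
  proof
    fix w
    have "(\<Oplus>k\<in>I. dterm k (\<lambda>x. c x \<oplus> d x) w) = (\<Oplus>k\<in>I. dterm k c w \<oplus> dterm k d w)"
    proof (rule add.finprod_cong', goal_cases)
      case (3 k)
      thus ?case using lift_add[where S = S and k = k, OF adm_gop _ adm_fin c]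
        lift_carrier[where S = S and k = k, OF adm_gop _ adm_fin c(1), of w]
        lift_carrier[where S = S and k = k, OF adm_gop _ adm_fin c(2), of w] by (simp add: dterm_def r_distr)
    qed (use dterm_carrier c in auto)
    thus "dtot (\<lambda>x. c x \<oplus> d x) w = dtot c w \<oplus> dtot d w"
      using dterm_carrier c by (simp add: dtot_def finsum_addf Pi_iff)
  qed
next
  fix a c assume a: "a \<in> carrier R" and "c \<in> vec (wordsq S (Suc q))"
  hence c: "c \<in> vec (words S)" by (auto intro: wordsq_words)
  show "dtot (\<lambda>x. a \<otimes> c x) = (\<lambda>x. a \<otimes> dtot c x)"
  proof
    fix w
    have "(\<Oplus>k\<in>I. dterm k (\<lambda>x. a \<otimes> c x) w) = (\<Oplus>k\<in>I. a \<otimes> dterm k c w)"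
    proof (rule add.finprod_cong', goal_cases)
      case (3 k)
      thus ?case using lift_smult[where S = S and k = k, OF adm_gop _ adm_fin c a]
        lift_carrier[where S = S and k = k, OF adm_gop _ adm_fin c, of w] a
        by (simp add: dterm_def m_lcomm)
    qed (use dterm_carrier c a in auto)
    thus "dtot (\<lambda>x. a \<otimes> c x) w = a \<otimes> dtot c w"
      using dterm_carrier c a fI by (simp add: dtot_def finsum_rdistr Pi_iff)
  qed
qed (rule dtot_vec)

end

text \<open>A deformation retraction of the factor with basis \<open>T\<close> onto the factor with basis \<open>T'\<close>.  All three maps respect the
  span of \<open>A k\<close>, so they act on the words over \<open>K\<close>.\<close>

definition factor_equiv where
  "factor_equiv k T T' F G H \<longleftrightarrow> gop k T T' 0 0 F \<and> gop k T' T 0 0 G \<and> gop k T T 1 0 H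
    \<and> (\<forall>p. \<forall>x\<in>vec {a\<in>T. dg k a = p}. F (D k x) = D k (F x) \<and> x = (\<lambda>a. G (F x) a \<oplus> (D k (H x) a \<oplus> H (D k x) a)))
    \<and> (\<forall>p. \<forall>y\<in>vec {a\<in>T'. dg k a = p}. G (D k y) = D k (G y) \<and> F (G y) = y)"

lemma lift_chain_map:
  assumes S: "admissible S" and S': "admissible (S(k := T'))" and k: "k \<in> I"
    and F: "gop k (S k) T' 0 0 F"
    and FD: "\<And>p x. x \<in> vec {a\<in>S k. dg k a = p} \<Longrightarrow> F (D k x) = D k (F x)"
    and c: "c \<in> vec (wordsq S q)"
  shows "lift k F (dtot c) = dtot (lift k F c)"
proof
  fix w
  have fin: "finite (S k)" using S k by (simp add: admissible_def)
  have finT: "finite T'" using S' k by (auto simp: admissible_def)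
  have cw: "c \<in> vec (words S)" by (rule wordsq_words[OF c])
  have "lift k F (dtot c) w = (\<Oplus>l\<in>I. lift k F (dterm l c) w)"
    unfolding dtot_def by (rule lift_finsum[where S = S, OF F k fin fI]) (rule wordsq_words[OF dterm_vec'[OF S _ c]])
  also have "\<dots> = (\<Oplus>l\<in>I. dterm l (lift k F c) w)"
  proof (rule add.finprod_cong', goal_cases)
    have Fc: "lift k F c \<in> vec (wordsq (S(k := T')) q)"
      by (rule lift_vec[where S = S, OF F k]) (use S finT c in \<open>auto simp: admissible_def\<close>)
    case 2
    show ?case using dterm_carrier[OF S' _ wordsq_words[OF Fc]] by auto
  next
    case (3 l)
    have Dl: "gop l (S l) (S l) 0 1 (D l)" "finite (S l)" using S 3 by (auto simp: admissible_def)
    have Dc: "lift l (D l) c \<in> vec (wordsq S (q - 1))"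
      using lift_D_vec[OF S 3, of c "q - 1"] lift_D_zero[OF S 3, of c] c by (cases q) auto
    have "lift k F (dterm l c) w = eps l w \<otimes> lift k F (lift l (D l) c) w"
      using lift_eps[where S = S, OF F k fin Dc, of l w] lift_carrier[where S = S, OF F k fin wordsq_words[OF Dc], of w]
      by (simp add: dterm_eq sg_def)
    also have "lift k F (lift l (D l) c) w = lift l (D l) (lift k F c) w"
    proof (cases "l = k")
      case True
      thus ?thesis using FD[OF slice_deg[OF c k fin, of w]] by (simp add: lift_comp) (simp add: lift_def)
    qed (use lift_commute[where S = S, OF F Dl(1) k 3 _ fin Dl(2) cw] in auto)
    finally show ?case by (simp only: dterm_eq)
  qed simp
  finally show "lift k F (dtot c) w = dtot (lift k F c) w" by (simp add: dtot_def)
qed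

text \<open>The homotopy carries the Koszul sign \<open>eps k\<close>.  With this sign the terms of the differential at positions other than
  \<open>k\<close> cancel in \<open>D H + H D\<close>, and position \<open>k\<close> contributes the homotopy identity of the factor.\<close>

lemma hequiv_factor:
  assumes S: "admissible S" and S': "admissible (S(k := T'))" and k: "k \<in> I"
    and fe: "factor_equiv k (S k) T' F G H"
  shows "hequiv (wordsq S) dtot (wordsq (S(k := T'))) dtot (lift k F) (lift k G) (\<lambda>c w. eps k w \<otimes> lift k H c w)"
proof -
  have F: "gop k (S k) T' 0 0 F" and G: "gop k T' (S k) 0 0 G" and H: "gop k (S k) (S k) 1 0 H"
    and FD: "x \<in> vec {a\<in>S k. dg k a = p} \<Longrightarrow> F (D k x) = D k (F x)"
    and hom: "x \<in> vec {a\<in>S k. dg k a = p} \<Longrightarrow> x = (\<lambda>a. G (F x) a \<oplus> (D k (H x) a \<oplus> H (D k x) a))"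
    and GD: "y \<in> vec {a\<in>T'. dg k a = p} \<Longrightarrow> G (D k y) = D k (G y)"
    and FG: "y \<in> vec {a\<in>T'. dg k a = p} \<Longrightarrow> F (G y) = y" for x y p
    using fe unfolding factor_equiv_def by blast+
  have fin: "finite (S l)" if "l \<in> I" for l using S that by (simp add: admissible_def)
  have finT: "finite T'" using S' k by (auto simp: admissible_def)
  have fin': "finite ((S(k := T')) l)" if "l \<in> I" for l using S' that by (auto simp: admissible_def)
  have SS: "(S(k := T'))(k := S k) = S" by simp
  let ?H = "\<lambda>c w. eps k w \<otimes> lift k H c w"
  have HL: "lift k H c \<in> vec (wordsq S (Suc q))" if "c \<in> vec (wordsq S q)" for c q
    using lift_vec[where S = S, OF H k fin fin[OF k] that, of "Suc q"] by simp
  have Hlin: "lin R (Fr (wordsq S q)) (Fr (wordsq S (Suc q))) ?H" for q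
  proof (rule linFI)
    fix c assume c: "c \<in> vec (wordsq S q)"
    show "?H c \<in> vec (wordsq S (Suc q))" by (rule eps_vec[OF HL[OF c]])
    fix d assume d: "d \<in> vec (wordsq S q)"
    show "?H (\<lambda>x. c x \<oplus> d x) = (\<lambda>x. ?H c x \<oplus> ?H d x)"
      using lift_add[where S = S, OF H k fin[OF k] wordsq_words[OF c] wordsq_words[OF d]]
        vec_in[OF HL[OF c]] vec_in[OF HL[OF d]] by (simp add: r_distr)
  next
    fix a c assume a: "a \<in> carrier R" and c: "c \<in> vec (wordsq S q)"
    show "?H (\<lambda>x. a \<otimes> c x) = (\<lambda>x. a \<otimes> ?H c x)"
      using lift_smult[where S = S, OF H k fin[OF k] wordsq_words[OF c] a] vec_in[OF HL[OF c]] a by (simp add: m_lcomm)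
  qed
  have G': "gop k ((S(k := T')) k) (S k) 0 0 G" using G by simp
  show ?thesis unfolding hequiv_def
  proof (intro conjI allI ballI)
    show "lin R (Fr (wordsq S q)) (Fr (wordsq (S(k := T')) q)) (lift k F)" for q
      by (rule lift_lin[where S = S, OF F k fin finT]) auto
    show "lin R (Fr (wordsq (S(k := T')) q)) (Fr (wordsq S q)) (lift k G)" for q
      using lift_lin[where S = "S(k := T')", OF G' k fin' fin[OF k], of q q] by simp
    show "lin R (Fr (wordsq S q)) (Fr (wordsq S (Suc q))) ?H" for q by (rule Hlin)
  next
    fix q c assume c: "c \<in> vec (wordsq S q)"
    show "lift k F (dtot c) = dtot (lift k F c)" by (rule lift_chain_map[where S = S, OF S S' k F FD c])
  next
    fix q c assume c: "c \<in> vec (wordsq (S(k := T')) q)"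
    show "lift k G (dtot c) = dtot (lift k G c)"
      by (rule lift_chain_map[where S = "S(k := T')", OF S' _ k G' _ c]) (use S GD in auto)
    have "F (G (\<lambda>a. c (w(k := a)))) = (\<lambda>a. c (w(k := a)))" for w
      using FG[of "\<lambda>a. c (w(k := a))"] slice_deg[OF c k fin'[OF k], of w] by simp
    hence "lift k F (lift k G c) w = c w" for w unfolding lift_comp by (simp add: lift_def)
    thus "lift k F (lift k G c) = c" by (rule ext)
  next
    fix q c assume c: "c \<in> vec (wordsq S q)"
    have cw: "c \<in> vec (words S)" by (rule wordsq_words[OF c])
    show "c = (\<lambda>w. lift k G (lift k F c) w \<oplus> (dtot (?H c) w \<oplus> ?H (dtot c) w))"
    proof
      fix w
      let ?y = "\<lambda>a. c (w(k := a))"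
      have y: "?y \<in> vec {a\<in>S k. dg k a = q - rest k w}" by (rule slice_deg[OF c k fin[OF k]])
      have y': "?y \<in> vec (S k)" by (rule slice[OF cw k fin[OF k]])
      have Dk: "lin R (Fr (S k)) (Fr (S k)) (D k)" using S k by (simp add: admissible_def gop_def)
      have Hk: "lin R (Fr (S k)) (Fr (S k)) H" using H by (simp add: gop_def)
      define t1 where "t1 l = dterm l (?H c) w" for l
      define t2 where "t2 l = eps k w \<otimes> lift k H (dterm l c) w" for l
      have t1c: "t1 l \<in> carrier R" if "l \<in> I" for l
        unfolding t1_def by (rule dterm_carrier[OF S that wordsq_words[OF eps_vec[OF HL[OF c]]]])
      have dc: "dterm l c \<in> vec (wordsq S (q - 1))" if "l \<in> I" for l by (rule dterm_vec'[OF S that c])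
      have t2c: "t2 l \<in> carrier R" if "l \<in> I" for l
        unfolding t2_def using lift_carrier[where S = S, OF H k fin[OF k] wordsq_words[OF dc[OF that]]] by simp
      have a: "dtot (?H c) w = (\<Oplus>l\<in>I. t1 l)" by (simp add: dtot_def t1_def)
      have "lift k H (dtot c) w = (\<Oplus>l\<in>I. lift k H (dterm l c) w)"
        unfolding dtot_def by (rule lift_finsum[where S = S, OF H k fin[OF k] fI wordsq_words[OF dc]])
      hence b: "?H (dtot c) w = (\<Oplus>l\<in>I. t2 l)"
        using lift_carrier[where S = S, OF H k fin[OF k] wordsq_words[OF dc]] fI
        by (simp add: t2_def finsum_rdistr Pi_iff)
      have key: "t1 l \<oplus> t2 l = (if k = l then D k (H ?y) (w k) \<oplus> H (D k ?y) (w k) else \<zero>)" if l: "l \<in> I" for l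
      proof -
        have Dl: "gop l (S l) (S l) 0 1 (D l)" using S l by (simp add: admissible_def)
        have Dc: "lift l (D l) c \<in> vec (wordsq S (q - 1))"
          using lift_D_vec[OF S l, of c "q - 1"] lift_D_zero[OF S l, of c] c by (cases q) auto
        define u where "u = lift l (D l) (lift k H c) w"
        define v where "v = lift k H (lift l (D l) c) w"
        have uc: "u \<in> carrier R" unfolding u_def
          by (rule lift_carrier[where S = S, OF Dl l fin[OF l] wordsq_words[OF HL[OF c]]])
        have vc: "v \<in> carrier R" unfolding v_def
          by (rule lift_carrier[where S = S, OF H k fin[OF k] wordsq_words[OF Dc]])
        have 1: "t1 l = eps l w \<otimes> ((if l < k then sg 1 else \<one>) \<otimes> (eps k w \<otimes> u))"
          using lift_eps[where S = S, OF Dl l fin[OF l] HL[OF c], of k w] by (simp add: t1_def dterm_def u_def)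
        have 2: "t2 l = eps k w \<otimes> ((if k < l then sg 1 else \<one>) \<otimes> (eps l w \<otimes> v))"
          using lift_eps[where S = S, OF H k fin[OF k] Dc, of l w] by (simp add: t2_def dterm_eq v_def)
        show ?thesis
        proof (cases "k = l")
          case True
          have "u = D k (H ?y) (w k)" "v = H (D k ?y) (w k)"
            using True by (simp_all add: u_def v_def lift_comp) (simp_all add: lift_def)
          thus ?thesis using 1 2 True uc vc by (simp add: eps_sq)
        next
          case False
          have uv: "u = v" unfolding u_def v_def
            by (rule lift_commute[where S = S, OF Dl H l k _ fin[OF l] fin[OF k] cw]) (use False in auto)
          have "l < k \<or> k < l" using False by auto
          thus ?thesis using 1 2 uv uc False
            by (auto simp: sg_def l_minus r_minus m_lcomm[of "eps k w"] l_neg r_neg)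
        qed
      qed
      have cl: "D k (H ?y) (w k) \<in> carrier R" "H (D k ?y) (w k) \<in> carrier R"
        using vec_in[OF lvec[OF Dk lvec[OF Hk y']]] vec_in[OF lvec[OF Hk lvec[OF Dk y']]] by auto
      have "dtot (?H c) w \<oplus> ?H (dtot c) w = (\<Oplus>l\<in>I. t1 l \<oplus> t2 l)"
        unfolding a b using t1c t2c by (simp add: finsum_addf Pi_iff)
      also have "\<dots> = (\<Oplus>l\<in>I. if k = l then D k (H ?y) (w k) \<oplus> H (D k ?y) (w k) else \<zero>)"
        by (rule add.finprod_cong') (use key cl in auto)
      also have "\<dots> = D k (H ?y) (w k) \<oplus> H (D k ?y) (w k)"
        by (rule add.finprod_singleton[OF k fI]) (use cl in auto)
      finally have "lift k G (lift k F c) w \<oplus> (dtot (?H c) w \<oplus> ?H (dtot c) w)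
          = (\<lambda>a. G (F ?y) a \<oplus> (D k (H ?y) a \<oplus> H (D k ?y) a)) (w k)"
        unfolding lift_comp by (simp add: lift_def)
      also have "\<dots> = ?y (w k)" using hom[OF y] by metis
      finally show "c w = lift k G (lift k F c) w \<oplus> (dtot (?H c) w \<oplus> ?H (dtot c) w)" by simp
    qed
  qed
qed

text \<open>The factors are exchanged one at a time; \<open>J\<close> is the set of positions already exchanged.\<close>

lemma tensor_equiv:
  assumes S: "admissible S" and S': "admissible S'" and cpx: "is_cpx (wordsq S) dtot"
    and fe: "\<And>k. k \<in> I \<Longrightarrow> \<exists>F G H. factor_equiv k (S k) (S' k) F G H"
  shows "is_cpx (wordsq S') dtot" "module_iso R (bhom R (wordsq S) dtot q) (bhom R (wordsq S') dtot q)"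
    "module_iso R (bcoh R (wordsq S) dtot q) (bcoh R (wordsq S') dtot q)"
proof -
  let ?S = "\<lambda>J k. if k \<in> J then S' k else S k"
  have adm: "admissible (?S J)" for J using S S' by (auto simp: admissible_def)
  have *: "is_cpx (wordsq (?S J)) dtot \<and> module_iso R (bhom R (wordsq S) dtot q) (bhom R (wordsq (?S J)) dtot q)
    \<and> module_iso R (bcoh R (wordsq S) dtot q) (bcoh R (wordsq (?S J)) dtot q)" if "finite J" "J \<subseteq> I" for J
    using that
  proof (induction J rule: finite_induct)
    case empty
    thus ?case using cpx by (simp add: module_iso_refl)
  next
    case (insert k J)
    hence k: "k \<in> I" by simp
    obtain F G H where fk: "factor_equiv k (S k) (S' k) F G H" using fe[OF k] by blast
    have e: "?S (insert k J) = (?S J)(k := S' k)" by (rule ext) simp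
    have h: "hequiv (wordsq (?S J)) dtot (wordsq (?S (insert k J))) dtot (lift k F) (lift k G) (\<lambda>c w. eps k w \<otimes> lift k H c w)"
      unfolding e by (rule hequiv_factor[where S = "?S J", OF adm _ k]) (use adm[of "insert k J", unfolded e] fk insert.hyps in auto)
    note IH = insert.IH[OF order_trans[OF subset_insertI insert.prems]]
    have c: "is_cpx (wordsq (?S J)) dtot" using IH by simp
    have c': "is_cpx (wordsq (?S (insert k J))) dtot"
      by (rule hequiv_cpx[OF c h]) (use finite_wordsq[of "?S (insert k J)"] dtot_lin[OF adm[of "insert k J"]] adm[of "insert k J"] in \<open>auto simp: admissible_def\<close>)
    show ?case
      using c' module_iso_trans[OF conjunct1[OF conjunct2[OF IH]] hequiv_hom[OF c c' h, of q]]
        module_iso_trans[OF conjunct2[OF conjunct2[OF IH]] hequiv_coh[OF c c' h, of q]] by blast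
  qed
  have w: "wordsq (?S I) = wordsq S'"
    by (auto simp: wordsq_def words_def PiE_iff fun_eq_iff)
  show "is_cpx (wordsq S') dtot" "module_iso R (bhom R (wordsq S) dtot q) (bhom R (wordsq S') dtot q)"
    "module_iso R (bcoh R (wordsq S) dtot q) (bcoh R (wordsq S') dtot q)"
    using *[OF fI] by (simp_all add: w)
qed

end

section \<open>Splitting over a principal ideal domain\<close>

lemma principal_domain_field_or_int:
  assumes R: "cring R" and "field R \<or> R \<simeq> \<Z>"
  shows "principal_domain R"
  using assms(2)
proof
  assume "field R"
  then interpret field R .
  show ?thesis by (rule principal_domain_axioms)
next
  assume "R \<simeq> \<Z>"
  then obtain h where h: "h \<in> ring_iso R \<Z>" by (auto simp: is_ring_iso_def)
  interpret cring R by fact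
  have hm: "h (x \<otimes>\<^bsub>R\<^esub> y) = h x * h y" and ha: "h (x \<oplus>\<^bsub>R\<^esub> y) = h x + h y"
    if "x \<in> carrier R" "y \<in> carrier R" for x y
    using ring_iso_memE(2,3)[OF h that] by auto
  have h1: "h \<one>\<^bsub>R\<^esub> = 1" using ring_iso_memE(4)[OF h] by simp
  have inj: "inj_on h (carrier R)" and surj: "h ` carrier R = UNIV"
    using ring_iso_memE(5)[OF h] by (auto simp: bij_betw_def)
  have h0: "h \<zero>\<^bsub>R\<^esub> = 0" using ha[of "\<zero>\<^bsub>R\<^esub>" "\<zero>\<^bsub>R\<^esub>"] by simp
  have hz: "h x = 0 \<longleftrightarrow> x = \<zero>\<^bsub>R\<^esub>" if "x \<in> carrier R" for x
    using inj_onD[OF inj, of x "\<zero>\<^bsub>R\<^esub>"] that h0 by auto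
  interpret domain R
  proof (rule domain.intro[OF R], unfold_locales)
    show "\<one>\<^bsub>R\<^esub> \<noteq> \<zero>\<^bsub>R\<^esub>" using h0 h1 by force
    fix a b assume ab: "a \<otimes>\<^bsub>R\<^esub> b = \<zero>\<^bsub>R\<^esub>" "a \<in> carrier R" "b \<in> carrier R"
    hence "h a * h b = 0" using hm[of a b] h0 by simp
    thus "a = \<zero>\<^bsub>R\<^esub> \<or> b = \<zero>\<^bsub>R\<^esub>" using hz ab by simp
  qed
  have "euclidean_domain R (\<lambda>x. nat \<bar>h x\<bar>)"
  proof (rule euclidean_domainI)
    fix a b assume ab: "a \<in> carrier R - {\<zero>\<^bsub>R\<^esub>}" "b \<in> carrier R - {\<zero>\<^bsub>R\<^esub>}"
    obtain q r where qr: "q \<in> carrier R" "h q = h a div h b" "r \<in> carrier R" "h r = h a mod h b"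
      using surj by (metis UNIV_I imageE)
    have bq: "b \<otimes>\<^bsub>R\<^esub> q \<in> carrier R" using ab qr(1) by simp
    have "h (b \<otimes>\<^bsub>R\<^esub> q \<oplus>\<^bsub>R\<^esub> r) = h b * h q + h r" using ha[OF bq qr(3)] hm[of b q] ab qr(1) by simp
    also have "\<dots> = h a" unfolding qr(2,4) by (rule mult_div_mod_eq)
    finally have "h a = h (b \<otimes>\<^bsub>R\<^esub> q \<oplus>\<^bsub>R\<^esub> r)" by simp
    hence "a = b \<otimes>\<^bsub>R\<^esub> q \<oplus>\<^bsub>R\<^esub> r" using ab bq qr(3) by (intro inj_onD[OF inj]) auto
    moreover have "nat \<bar>h r\<bar> < nat \<bar>h b\<bar>"
      using qr hz[of b] ab by (simp add: abs_mod_less)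
    ultimately show "\<exists>q r. q \<in> carrier R \<and> r \<in> carrier R \<and> a = b \<otimes>\<^bsub>R\<^esub> q \<oplus>\<^bsub>R\<^esub> r \<and>
        (r = \<zero>\<^bsub>R\<^esub> \<or> nat \<bar>h r\<bar> < nat \<bar>h b\<bar>)" using qr by blast
  qed
  then interpret euclidean_domain R "\<lambda>x. nat \<bar>h x\<bar>" .
  show ?thesis by (rule principal_domain_axioms)
qed

context cring
begin

text \<open>All vectors over one index type form a single free module.  Taking submodules and linear maps inside it makes a
  vector of the subcomplex literally a vector of the whole complex, with inclusions given by the identity.\<close>

definition vsub :: "('s \<Rightarrow> 'a) set \<Rightarrow> bool" where "vsub P \<longleftrightarrow> subm R (Fr UNIV) P"

definition vl :: "('s \<Rightarrow> 'a) set \<Rightarrow> ('t \<Rightarrow> 'a) set \<Rightarrow> (('s \<Rightarrow> 'a) \<Rightarrow> ('t \<Rightarrow> 'a)) \<Rightarrow> bool" where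
  "vl P P' f \<longleftrightarrow> lin R (Fr UNIV\<lparr>carrier := P\<rparr>) (Fr UNIV\<lparr>carrier := P'\<rparr>) f"

definition vdiff :: "('s \<Rightarrow> 'a) \<Rightarrow> ('s \<Rightarrow> 'a) \<Rightarrow> 's \<Rightarrow> 'a" where "vdiff x y = (\<lambda>a. x a \<ominus> y a)"
definition vplus :: "('s \<Rightarrow> 'a) \<Rightarrow> ('s \<Rightarrow> 'a) \<Rightarrow> 's \<Rightarrow> 'a" where "vplus x y = (\<lambda>a. x a \<oplus> y a)"

abbreviation vzero :: "'s \<Rightarrow> 'a" where "vzero \<equiv> (\<lambda>_. \<zero>)"

lemma vsub_iff: "vsub P \<longleftrightarrow> P \<subseteq> vec UNIV \<and> vzero \<in> P \<and> (\<forall>x\<in>P. \<forall>y\<in>P. vplus x y \<in> P)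
    \<and> (\<forall>a\<in>carrier R. \<forall>x\<in>P. (\<lambda>s. a \<otimes> x s) \<in> P)"
  by (simp add: vsub_def subm_def vplus_def)

lemma vsubD: assumes "vsub P"
  shows "x \<in> P \<Longrightarrow> x \<in> vec UNIV" "vzero \<in> P" "x \<in> P \<Longrightarrow> y \<in> P \<Longrightarrow> vplus x y \<in> P"
    "a \<in> carrier R \<Longrightarrow> x \<in> P \<Longrightarrow> (\<lambda>s. a \<otimes> x s) \<in> P" "x \<in> P \<Longrightarrow> y \<in> P \<Longrightarrow> vdiff x y \<in> P" "x \<in> P \<Longrightarrow> x s \<in> carrier R"
proof -
  show *: "x \<in> P \<Longrightarrow> x \<in> vec UNIV" for x using assms by (auto simp: vsub_iff)
  show "x \<in> P \<Longrightarrow> x s \<in> carrier R" using vec_in[OF *] .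
  show "x \<in> P \<Longrightarrow> y \<in> P \<Longrightarrow> vdiff x y \<in> P"
    using subm_minus[OF module_free assms[unfolded vsub_def], of x y] free_minus[OF * *, of x y] by (simp add: vdiff_def)
qed (use assms in \<open>auto simp: vsub_iff\<close>)

lemma vsub_vec [simp]: "vsub (vec S)"
  by (auto simp: vsub_iff vplus_def vec_add vec_smult intro: vec_mono)

lemma vsub_of_subm: "subm R (Fr S) P \<Longrightarrow> vsub P"
  by (auto simp: vsub_def subm_def intro: vec_mono)

lemma vlI:
  assumes "\<And>x. x \<in> P \<Longrightarrow> f x \<in> P'" "\<And>x y. x \<in> P \<Longrightarrow> y \<in> P \<Longrightarrow> f (vplus x y) = vplus (f x) (f y)"
    "\<And>a x. a \<in> carrier R \<Longrightarrow> x \<in> P \<Longrightarrow> f (\<lambda>s. a \<otimes> x s) = (\<lambda>s. a \<otimes> f x s)"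
  shows "vl P P' f"
  unfolding vl_def by (rule linI) (use assms in \<open>auto simp: vplus_def\<close>)

lemma vlD: assumes "vl P P' f"
  shows "x \<in> P \<Longrightarrow> f x \<in> P'" "x \<in> P \<Longrightarrow> y \<in> P \<Longrightarrow> f (vplus x y) = vplus (f x) (f y)"
    "a \<in> carrier R \<Longrightarrow> x \<in> P \<Longrightarrow> f (\<lambda>s. a \<otimes> x s) = (\<lambda>s. a \<otimes> f x s)"
  using assms unfolding vl_def lin_def by (auto simp: vplus_def)

lemma vl_lin: "vl (vec S) (vec S') f \<longleftrightarrow> lin R (Fr S) (Fr S') f"
  by (simp add: vl_def lin_def)

lemma vl_lin': "vl P P' f \<longleftrightarrow> lin R (Fr S\<lparr>carrier := P\<rparr>) (Fr S'\<lparr>carrier := P'\<rparr>) f"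
  by (simp add: vl_def lin_def)

lemma vl_zero: assumes "vl P P' f" "vsub P" "vsub P'" shows "f vzero = vzero"
  using lin_zero[OF assms(1)[unfolded vl_def] module_subm[OF module_free] module_subm[OF module_free]] assms(2,3) by (simp add: vsub_def)

lemma vl_diff: assumes f: "vl P P' f" and P: "vsub P" "vsub P'" and x: "x \<in> P" "y \<in> P"
  shows "f (vdiff x y) = vdiff (f x) (f y)"
proof -
  have e: "x \<ominus>\<^bsub>Fr UNIV\<lparr>carrier := P\<rparr>\<^esub> y = vdiff x y" if "vsub P" "x \<in> P" "y \<in> P" for P x y
    using subm_minus_op[OF module_free that(1)[unfolded vsub_def] that(2,3)] vsubD(1)[OF that(1)] that
    by (simp add: free_minus vdiff_def)
  show ?thesis
    using lin_minus[OF f[unfolded vl_def] module_subm[OF module_free] module_subm[OF module_free], of x y] P x e[OF P(1) x] e[OF P(2) vlD(1)[OF f] vlD(1)[OF f]]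
    by (simp add: vsub_def)
qed

lemma vl_comp: "vl P P' f \<Longrightarrow> vl P' P'' g \<Longrightarrow> vl P P'' (\<lambda>x. g (f x))"
  unfolding vl_def
  using lin_comp[of R "Fr UNIV\<lparr>carrier := P\<rparr>" "Fr UNIV\<lparr>carrier := P'\<rparr>" f "Fr UNIV\<lparr>carrier := P''\<rparr>" g] by simp

lemma vl_range: "vl P P' f \<Longrightarrow> (\<And>x. x \<in> P \<Longrightarrow> f x \<in> P'') \<Longrightarrow> vl P P'' f"
  by (intro vlI) (auto dest: vlD)

lemma vl_mono: "vl P P' f \<Longrightarrow> P0 \<subseteq> P \<Longrightarrow> P' \<subseteq> P0' \<Longrightarrow> vl P0 P0' f"
  by (intro vlI) (auto dest: vlD)

lemma vl_id: "P \<subseteq> P' \<Longrightarrow> vl P P' (\<lambda>x. x)"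
  by (intro vlI) auto

lemma vl_plus:
  assumes f: "vl P P' f" and g: "vl P P' g" and P': "vsub P'"
  shows "vl P P' (\<lambda>x. vplus (f x) (g x))"
proof (rule vlI)
  fix x y assume xy: "x \<in> P" "y \<in> P"
  show "vplus (f (vplus x y)) (g (vplus x y)) = vplus (vplus (f x) (g x)) (vplus (f y) (g y))"
    using vlD(1)[OF f xy(1), THEN vsubD(6)[OF P']] vlD(1)[OF f xy(2), THEN vsubD(6)[OF P']]
      vlD(1)[OF g xy(1), THEN vsubD(6)[OF P']] vlD(1)[OF g xy(2), THEN vsubD(6)[OF P']]
    by (simp add: vlD(2)[OF f xy] vlD(2)[OF g xy]) (simp add: vplus_def a_ac)
next
  fix a x assume ax: "a \<in> carrier R" "x \<in> P"
  show "vplus (f (\<lambda>s. a \<otimes> x s)) (g (\<lambda>s. a \<otimes> x s)) = (\<lambda>s. a \<otimes> vplus (f x) (g x) s)"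
    using vlD(1)[OF f ax(2), THEN vsubD(6)[OF P']] vlD(1)[OF g ax(2), THEN vsubD(6)[OF P']] ax
    by (simp add: vlD(3)[OF f ax] vlD(3)[OF g ax]) (simp add: vplus_def r_distr)
qed (use vlD(1)[OF f] vlD(1)[OF g] vsubD(3)[OF P'] in auto)

lemma vl_minus:
  assumes f: "vl P P' f" and g: "vl P P' g" and P': "vsub P'"
  shows "vl P P' (\<lambda>x. vdiff (f x) (g x))"
proof (rule vlI)
  fix x y assume xy: "x \<in> P" "y \<in> P"
  show "vdiff (f (vplus x y)) (g (vplus x y)) = vplus (vdiff (f x) (g x)) (vdiff (f y) (g y))"
    using vlD(1)[OF f xy(1), THEN vsubD(6)[OF P']] vlD(1)[OF f xy(2), THEN vsubD(6)[OF P']]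
      vlD(1)[OF g xy(1), THEN vsubD(6)[OF P']] vlD(1)[OF g xy(2), THEN vsubD(6)[OF P']]
    by (simp add: vlD(2)[OF f xy] vlD(2)[OF g xy]) (simp add: vdiff_def vplus_def a_minus_def minus_add a_ac)
next
  fix a x assume ax: "a \<in> carrier R" "x \<in> P"
  show "vdiff (f (\<lambda>s. a \<otimes> x s)) (g (\<lambda>s. a \<otimes> x s)) = (\<lambda>s. a \<otimes> vdiff (f x) (g x) s)"
    using vlD(1)[OF f ax(2), THEN vsubD(6)[OF P']] vlD(1)[OF g ax(2), THEN vsubD(6)[OF P']] ax
    by (simp add: vlD(3)[OF f ax] vlD(3)[OF g ax]) (simp add: vdiff_def a_minus_def r_distr r_minus)
qed (use vlD(1)[OF f] vlD(1)[OF g] vsubD(5)[OF P'] in auto)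

end

context principal_domain
begin

text \<open>Submodules of a free module of finite rank are projective and finitely generated; both are
  proved by induction on the rank, splitting off one coordinate whose values form a principal ideal.\<close>

lemma split_image:
  assumes "finite T"
  shows "module R M \<Longrightarrow> lin R M (Fr T) p \<Longrightarrow>
    (\<exists>\<sigma>. lin R (Fr T\<lparr>carrier := p ` carrier M\<rparr>) M \<sigma> \<and> (\<forall>y\<in>p ` carrier M. p (\<sigma> y) = y))
    \<and> (\<exists>Y. finite Y \<and> Y \<subseteq> p ` carrier M \<and> (\<forall>P. vsub P \<longrightarrow> Y \<subseteq> P \<longrightarrow> p ` carrier M \<subseteq> P))"
  using assms
proof (induction T arbitrary: M p rule: finite_induct)
  case empty
  interpret M: module R M by (rule empty.prems(1))
  have "p m = vzero" if "m \<in> carrier M" for m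
    using lin_closed[OF empty.prems(2) that] by (auto simp: free_mod_carrier_fin)
  hence im: "p ` carrier M = {vzero}" using M.M.zero_closed by (auto intro!: image_eqI[of _ p "\<zero>\<^bsub>M\<^esub>"])
  have "lin R (Fr {}\<lparr>carrier := p ` carrier M\<rparr>) M (\<lambda>_. \<zero>\<^bsub>M\<^esub>)"
    by (rule linI) auto
  moreover have "p \<zero>\<^bsub>M\<^esub> = vzero" using lin_zero[OF empty.prems(2,1) module_free] by simp
  ultimately show ?case unfolding im by (auto intro!: exI[of _ "\<lambda>_. \<zero>\<^bsub>M\<^esub>"] exI[of _ "{}"] simp: vsubD(2))
next
  case (insert x T)
  note M = insert.prems(1) and p = insert.prems(2)
  interpret M: module R M by (rule M)
  let ?J = "(\<lambda>m. p m x) ` carrier M"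
  have pc: "p m \<in> vec (insert x T)" if "m \<in> carrier M" for m using lin_closed[OF p that] .
  have pa: "p (m \<oplus>\<^bsub>M\<^esub> m') = (\<lambda>s. p m s \<oplus> p m' s)" if "m \<in> carrier M" "m' \<in> carrier M" for m m'
    using lin_add[OF p that] by simp
  have ps: "p (c \<odot>\<^bsub>M\<^esub> m) = (\<lambda>s. c \<otimes> p m s)" if "c \<in> carrier R" "m \<in> carrier M" for c m
    using lin_smult[OF p that] by simp
  have "ideal ?J R"
  proof (rule idealI)
    show "ring R" by (rule ring_axioms)
    show "subgroup ?J (add_monoid R)"
    proof (rule subgroup.intro)
      show "?J \<subseteq> carrier (add_monoid R)" using vec_in[OF pc] by auto
      show "u \<otimes>\<^bsub>add_monoid R\<^esub> v \<in> ?J" if uv: "u \<in> ?J" "v \<in> ?J" for u v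
      proof -
        from uv obtain m m' where m: "m \<in> carrier M" "u = p m x" "m' \<in> carrier M" "v = p m' x" by blast
        thus ?thesis using pa[of m m'] by (auto intro!: image_eqI[of _ _ "m \<oplus>\<^bsub>M\<^esub> m'"])
      qed
      show "\<one>\<^bsub>add_monoid R\<^esub> \<in> ?J"
        using lin_zero[OF p M module_free] by (auto simp: image_iff intro!: bexI[of _ "\<zero>\<^bsub>M\<^esub>"])
      show "inv\<^bsub>add_monoid R\<^esub> u \<in> ?J" if u: "u \<in> ?J" for u
      proof -
        from u obtain m where m: "m \<in> carrier M" "u = p m x" by blast
        hence "\<ominus> u = p ((\<ominus> \<one>) \<odot>\<^bsub>M\<^esub> m) x" using ps[of "\<ominus> \<one>" m] vec_in[OF pc] by (simp add: l_minus)
        thus ?thesis using m by (auto simp: a_inv_def[symmetric])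
      qed
    qed
  next
    fix u c assume u: "u \<in> ?J" "c \<in> carrier R"
    then obtain m where m: "m \<in> carrier M" "u = p m x" by auto
    thus "c \<otimes> u \<in> ?J" using ps[of c m] u by (auto intro!: image_eqI[of _ _ "c \<odot>\<^bsub>M\<^esub> m"])
    thus "u \<otimes> c \<in> ?J" using u m vec_in[OF pc] by (simp add: m_comm)
  qed
  then obtain a where a: "a \<in> carrier R" "?J = PIdl a" using exists_gen by blast
  show ?case
  proof (cases "a = \<zero>")
    case True
    hence px: "p m x = \<zero>" if "m \<in> carrier M" for m using a(2) that by (auto simp: cgenideal_def)
    have "p m \<in> vec T" if "m \<in> carrier M" for m
    proof -
      have "p m s = \<zero>" if "s \<notin> T" for s
        using pc[OF \<open>m \<in> carrier M\<close>] px[OF \<open>m \<in> carrier M\<close>] that insert.hyps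
        by (cases "s = x") (auto simp: free_mod_carrier_fin)
      thus ?thesis using pc[OF that] insert.hyps by (auto simp: free_mod_carrier_fin)
    qed
    hence "lin R M (Fr T) p" using p by (auto simp: lin_def)
    from insert.IH[OF M this] show ?thesis by (simp add: lin_def)
  next
    case False
    have "a \<in> ?J" using cgenideal_self[OF a(1)] a(2) by simp
    then obtain m0 where m0: "m0 \<in> carrier M" "p m0 x = a" by auto
    let ?M = "M\<lparr>carrier := {m\<in>carrier M. p m x = \<zero>}\<rparr>"
    have sM: "subm R M {m\<in>carrier M. p m x = \<zero>}"
      using lin_zero[OF p M module_free] by (intro submI) (auto simp: pa ps)
    have M': "module R ?M" by (rule module_subm[OF M sM])
    have "p m \<in> vec T" if "m \<in> carrier M" "p m x = \<zero>" for m
    proof -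
      have "p m s = \<zero>" if "s \<notin> T" for s
        using pc[OF \<open>m \<in> carrier M\<close>] \<open>p m x = \<zero>\<close> that insert.hyps
        by (cases "s = x") (auto simp: free_mod_carrier_fin)
      thus ?thesis using pc[OF that(1)] insert.hyps by (auto simp: free_mod_carrier_fin)
    qed
    hence "lin R ?M (Fr T) p" using p by (auto simp: lin_def)
    note ih = insert.IH[OF M' this]
    from ih[THEN conjunct1] obtain \<sigma> where
      \<sigma>: "lin R (Fr T\<lparr>carrier := p ` carrier ?M\<rparr>) ?M \<sigma>" "\<forall>y\<in>p ` carrier ?M. p (\<sigma> y) = y" by (elim exE conjE)
    from ih[THEN conjunct2] obtain Y where
      Y: "finite Y" "Y \<subseteq> p ` carrier ?M" "\<forall>P. vsub P \<longrightarrow> Y \<subseteq> P \<longrightarrow> p ` carrier ?M \<subseteq> P" by (elim exE conjE)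
    let ?N = "p ` carrier M" and ?N' = "p ` {m\<in>carrier M. p m x = \<zero>}"
    have "\<exists>r. r \<in> carrier R \<and> y x = r \<otimes> a" if "y \<in> ?N" for y
      using that a(2) by (auto simp: cgenideal_def)
    then obtain r where r: "\<And>y. y \<in> ?N \<Longrightarrow> r y \<in> carrier R \<and> y x = r y \<otimes> a" by metis
    have runiq: "r y = c" if "y \<in> ?N" "c \<in> carrier R" "y x = c \<otimes> a" for y c
      using r[OF that(1)] that a(1) False m_rcancel by metis
    define y0 where "y0 = p m0"
    define t where "t y = (\<lambda>s. y s \<ominus> r y \<otimes> y0 s)" for y
    have y0: "y0 \<in> vec (insert x T)" "y0 x = a" using pc m0 by (auto simp: y0_def)
    have N: "vsub ?N"
      by (rule vsub_of_subm[OF subm_image[OF M module_free p subm_carrier[OF M]]])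
    have N': "vsub ?N'"
      by (rule vsub_of_subm[OF subm_image[OF M module_free p sM]])
    have tN': "t y \<in> ?N'" if y: "y \<in> ?N" for y
    proof -
      obtain m where m: "m \<in> carrier M" "y = p m" using y by auto
      let ?m = "m \<oplus>\<^bsub>M\<^esub> ((\<ominus> r y) \<odot>\<^bsub>M\<^esub> m0)"
      have mm: "?m \<in> carrier M" using m m0 r[OF y] by simp
      have e: "p ?m = t y" using m m0 r[OF y] vec_in[OF pc[OF m0(1)]]
        by (simp add: pa ps t_def y0_def a_minus_def l_minus)
      moreover have "t y x = \<zero>" using r[OF y] y0 a(1) by (simp add: t_def a_minus_def r_neg)
      ultimately show ?thesis using mm by (metis (mono_tags, lifting) image_eqI mem_Collect_eq)
    qed
    have y0c: "y0 s \<in> carrier R" for s using vec_in[OF y0(1)] .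
    have yc: "y s \<in> carrier R" if "y \<in> ?N" for y s using vsubD(6)[OF N that] .
    have rdec: "y = (\<lambda>s. t y s \<oplus> r y \<otimes> y0 s)" if "y \<in> ?N" for y
      using yc[OF that] r[OF that] y0c by (simp add: t_def a_minus_def a_assoc l_neg)
    have radd: "r (\<lambda>s. y s \<oplus> z s) = r y \<oplus> r z" if "y \<in> ?N" "z \<in> ?N" for y z
      by (rule runiq) (use that vsubD(3)[OF N that] r a(1) in \<open>auto simp: vplus_def l_distr\<close>)
    have rsm: "r (\<lambda>s. c \<otimes> y s) = c \<otimes> r y" if "y \<in> ?N" "c \<in> carrier R" for y c
      by (rule runiq) (use that vsubD(4)[OF N] r a(1) in \<open>auto simp: m_assoc\<close>)
    have tadd: "t (\<lambda>s. y s \<oplus> z s) = (\<lambda>s. t y s \<oplus> t z s)" if "y \<in> ?N" "z \<in> ?N" for y z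
      using yc[OF that(1)] yc[OF that(2)] y0c r[OF that(1)] r[OF that(2)] radd[OF that]
      by (simp add: t_def a_minus_def l_distr minus_add a_ac)
    have tsm: "t (\<lambda>s. c \<otimes> y s) = (\<lambda>s. c \<otimes> t y s)" if "y \<in> ?N" "c \<in> carrier R" for y c
      using yc[OF that(1)] y0c r[OF that(1)] rsm[OF that] that
      by (simp add: t_def a_minus_def r_distr r_minus m_assoc)
    let ?\<sigma> = "\<lambda>y. \<sigma> (t y) \<oplus>\<^bsub>M\<^esub> (r y \<odot>\<^bsub>M\<^esub> m0)"
    have \<sigma>c: "\<sigma> z \<in> carrier M" if "z \<in> ?N'" for z using lin_closed[OF \<sigma>(1)] that by auto
    have "lin R (Fr (insert x T)\<lparr>carrier := ?N\<rparr>) M ?\<sigma>"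
    proof (rule linI)
      fix y assume "y \<in> carrier (Fr (insert x T)\<lparr>carrier := ?N\<rparr>)"
      hence y: "y \<in> ?N" by simp
      show "?\<sigma> y \<in> carrier M" using \<sigma>c[OF tN'[OF y]] r[OF y] m0 by simp
      fix z assume "z \<in> carrier (Fr (insert x T)\<lparr>carrier := ?N\<rparr>)"
      hence z: "z \<in> ?N" by simp
      show "?\<sigma> (y \<oplus>\<^bsub>Fr (insert x T)\<lparr>carrier := ?N\<rparr>\<^esub> z) = ?\<sigma> y \<oplus>\<^bsub>M\<^esub> ?\<sigma> z"
        using radd[OF y z] tadd[OF y z] lin_add[OF \<sigma>(1), of "t y" "t z"] tN'[OF y] tN'[OF z] \<sigma>c[OF tN'[OF y]] \<sigma>c[OF tN'[OF z]] r[OF y] r[OF z] m0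
        by (simp add: M.smult_l_distr M.M.a_ac)
    next
      fix c y assume c: "c \<in> carrier R" and "y \<in> carrier (Fr (insert x T)\<lparr>carrier := ?N\<rparr>)"
      hence y: "y \<in> ?N" by simp
      show "?\<sigma> (c \<odot>\<^bsub>Fr (insert x T)\<lparr>carrier := ?N\<rparr>\<^esub> y) = c \<odot>\<^bsub>M\<^esub> ?\<sigma> y"
        using rsm[OF y c] tsm[OF y c] lin_smult[OF \<sigma>(1) c, of "t y"] tN'[OF y] \<sigma>c[OF tN'[OF y]] r[OF y] m0 c
        by (simp add: M.smult_r_distr M.smult_assoc1)
    qed
    moreover have "p (?\<sigma> y) = y" if y: "y \<in> ?N" for y
      using rdec[OF y] \<sigma>(2)[rule_format, of "t y"] tN'[OF y] \<sigma>c[OF tN'[OF y]] r[OF y] m0 by (simp add: pa ps y0_def[symmetric])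
    moreover have "finite (insert y0 Y)" "insert y0 Y \<subseteq> ?N" using Y m0 by (auto simp: y0_def)
    moreover have "?N \<subseteq> P" if P: "vsub P" "insert y0 Y \<subseteq> P" for P
    proof
      fix y assume y: "y \<in> ?N"
      have "t y \<in> P" using Y(3)[rule_format, OF P(1)] P(2) tN'[OF y] by auto
      hence "vplus (t y) (\<lambda>s. r y \<otimes> y0 s) \<in> P"
        using P r[OF y] by (intro vsubD(3)[OF P(1)] vsubD(4)[OF P(1)]) auto
      thus "y \<in> P" using rdec[OF y] by (simp add: vplus_def)
    qed
    ultimately show ?thesis by blast
  qed
qed

lemma split_onto:
  assumes "finite T" "vsub P" "P \<subseteq> vec S" "vl P (vec T) p"
  obtains \<sigma> where "vl (p ` P) P \<sigma>" "\<And>y. y \<in> p ` P \<Longrightarrow> p (\<sigma> y) = y"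
proof -
  have m: "module R (Fr UNIV\<lparr>carrier := P\<rparr>)" using assms(2) module_subm[OF module_free] by (simp add: vsub_def)
  have l: "lin R (Fr UNIV\<lparr>carrier := P\<rparr>) (Fr T) p" using assms(4) by (simp add: vl_def lin_def)
  from split_image[OF assms(1) m l] obtain \<sigma> where
    s: "lin R (Fr T\<lparr>carrier := p ` P\<rparr>) (Fr UNIV\<lparr>carrier := P\<rparr>) \<sigma>" "\<forall>y\<in>p ` P. p (\<sigma> y) = y"
    by (elim conjE exE) simp
  show ?thesis by (rule that[of \<sigma>]) (use s(1) s(2)[rule_format] in \<open>simp_all only: vl_lin'[symmetric]\<close>)
qed

lemma split_onto_ex:
  assumes "finite T" "vsub P" "P \<subseteq> vec S" "vl P (vec T) p" "N = p ` P"
  shows "\<exists>\<sigma>. vl N P \<sigma> \<and> (\<forall>y\<in>N. p (\<sigma> y) = y)"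
  unfolding assms(5) by (rule split_onto[OF assms(1-4)]) (intro exI conjI ballI)

text \<open>Finitely many generators involve only finitely many coordinates.\<close>

lemma finite_basis:
  assumes T: "finite T" and P: "vsub P" "P \<subseteq> vec T" and f: "vl P (vec B) f" and im: "f ` P = vec B"
  shows "finite B"
proof -
  have m: "module R (Fr UNIV\<lparr>carrier := P\<rparr>)" using P module_subm[OF module_free] by (simp add: vsub_def)
  have l: "lin R (Fr UNIV\<lparr>carrier := P\<rparr>) (Fr T) (\<lambda>x. x)" using P by (auto simp: lin_def)
  from split_image[OF T m l] obtain Y where Y: "finite Y" "Y \<subseteq> P" "\<forall>Q. vsub Q \<longrightarrow> Y \<subseteq> Q \<longrightarrow> P \<subseteq> Q"
    by (elim conjE exE) simp
  define U where "U = (\<Union>y\<in>Y. {b. f y b \<noteq> \<zero>})"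
  have U: "finite U" unfolding U_def using Y(1,2) vlD(1)[OF f] by (auto simp: free_mod_carrier)
  let ?Q = "{y\<in>P. \<forall>b. b \<notin> U \<longrightarrow> f y b = \<zero>}"
  have "vsub ?Q" unfolding vsub_iff
    using vsubD[OF P(1)] vlD[OF f] vl_zero[OF f P(1)] by (auto simp: vplus_def)
  moreover have "Y \<subseteq> ?Q" using Y(2) by (auto simp: U_def)
  ultimately have PQ: "P \<subseteq> ?Q" by (rule Y(3)[rule_format])
  have "B \<subseteq> U"
  proof
    fix b assume b: "b \<in> B"
    obtain y where y: "y \<in> P" "f y = free_gen R b" using free_gen_carrier[OF b] im by (metis imageE)
    hence "f y b \<noteq> \<zero>" by (simp add: free_gen_def)
    moreover have "\<forall>c. c \<notin> U \<longrightarrow> f y c = \<zero>" using PQ y(1) by blast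
    ultimately show "b \<in> U" by blast
  qed
  thus ?thesis using U finite_subset by blast
qed

end

section \<open>The minimal model of a densely split pair\<close>

fun letters :: "xsym \<Rightarrow> tgen set"
  where "letters Xe = {Te}" | "letters Xn = {Tn, Tnbar}" | "letters Xi = {Ti}"

text \<open>A basis element of the minimal model is a class, given by its kind, degree and name, with a letter of its kind.\<close>

type_synonym 'y label = "(xsym \<times> nat \<times> 'y) \<times> tgen"

definition model :: "(xsym \<Rightarrow> nat \<Rightarrow> 'y set) \<Rightarrow> 'y label set"
  where "model B = {((\<kappa>, q, b), l). b \<in> B \<kappa> q \<and> l \<in> letters \<kappa>}"

definition model_A :: "'y label set" where "model_A = {((\<kappa>, q, b), l). l \<in> {Tn, Ti}}"

fun model_deg :: "'y label \<Rightarrow> nat" where "model_deg ((\<kappa>, q, b), l) = q + tdeg l"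

definition level :: "('s \<Rightarrow> nat) \<Rightarrow> 's set \<Rightarrow> nat \<Rightarrow> 's set"
  where "level dg S q = {a\<in>S. dg a = q}"

lemma model_iff [simp]: "((\<kappa>, q, b), l) \<in> model B \<longleftrightarrow> b \<in> B \<kappa> q \<and> l \<in> letters \<kappa>"
  by (simp add: model_def)

lemma model_A_iff [simp]: "(\<beta>, l) \<in> model_A \<longleftrightarrow> l \<in> {Tn, Ti}"
  by (cases \<beta>) (simp add: model_A_def)

lemma level_iff: "a \<in> level dg S q \<longleftrightarrow> a \<in> S \<and> dg a = q"
  by (simp add: level_def)

lemma level_mono: "S \<subseteq> S' \<Longrightarrow> level dg S q \<subseteq> level dg S' q"
  by (auto simp: level_def)

context cring begin

lemma vplus_apply: "vplus x y a = x a \<oplus> y a" by (simp add: vplus_def)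

fun model_D :: "('y label \<Rightarrow> 'a) \<Rightarrow> 'y label \<Rightarrow> 'a"
  where "model_D y (\<beta>, l) = (if l = Tn then y (\<beta>, Tnbar) else \<zero>)"

end

text \<open>A complex with basis \<open>S\<close> and the subcomplex spanned by \<open>A\<close>.  The maps \<open>\<phi>\<close> present the cokernel, kernel and coimage
  of the induced map in homology, for the kinds \<open>Xe\<close>, \<open>Xn\<close> and \<open>Xi\<close>, as free modules on the sets \<open>B\<close>.\<close>

locale split_pair = principal_domain R for R (structure) +
  fixes S A :: "'s set" and dg :: "'s \<Rightarrow> nat" and D :: "('s \<Rightarrow> 'a) \<Rightarrow> ('s \<Rightarrow> 'a)"
    and B :: "xsym \<Rightarrow> nat \<Rightarrow> 'y set" and \<phi> :: "xsym \<Rightarrow> nat \<Rightarrow> ('s \<Rightarrow> 'a) \<Rightarrow> ('y \<Rightarrow> 'a)"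
  assumes fS: "finite S"
    and cX: "is_cpx (level dg S) D"
    and cA: "is_cpx (level dg (S \<inter> A)) D"
    and pe: "presents R (Fr (level dg S q)\<lparr>carrier := Zc (level dg S) D q\<rparr>) (\<phi> Xe q) (Fr (B Xe q))
      {z \<in> Zc (level dg S) D q. \<exists>y\<in>Zc (level dg (S \<inter> A)) D q. vdiff z y \<in> Bc (level dg S) D q}"
    and pn: "presents R (Fr (level dg S q)\<lparr>carrier := {z \<in> Zc (level dg (S \<inter> A)) D q. z \<in> Bc (level dg S) D q}\<rparr>)
      (\<phi> Xn q) (Fr (B Xn q)) (Bc (level dg (S \<inter> A)) D q)"
    and pi: "presents R (Fr (level dg S q)\<lparr>carrier := Zc (level dg (S \<inter> A)) D q\<rparr>) (\<phi> Xi q) (Fr (B Xi q))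
      {z \<in> Zc (level dg (S \<inter> A)) D q. z \<in> Bc (level dg S) D q}"
begin

abbreviation SX where "SX \<equiv> level dg S"
abbreviation SA where "SA \<equiv> level dg (S \<inter> A)"
abbreviation ZX where "ZX q \<equiv> Zc SX D q"
abbreviation ZA where "ZA q \<equiv> Zc SA D q"
abbreviation BX where "BX q \<equiv> Bc SX D q"
abbreviation BA where "BA q \<equiv> Bc SA D q"
abbreviation FB where "FB \<kappa> q \<equiv> vec (B \<kappa> q)"
abbreviation MS where "MS \<equiv> level model_deg (model B)"
abbreviation MA where "MA \<equiv> level model_deg (model B \<inter> model_A)"

text \<open>The cycles of the subcomplex that bound in the whole complex, and the cycles homologous to one of the subcomplex.\<close>

definition Wz where "Wz q = {z \<in> ZA q. z \<in> BX q}"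
definition Kz where "Kz q = {z \<in> ZX q. \<exists>y\<in>ZA q. vdiff z y \<in> BX q}"

lemma fin [simp]: "finite (SX q)" "finite (SA q)" using fS by (auto simp: level_def)

lemma D_vl: "vl (vec (SX (Suc q))) (vec (SX q)) D" "vl (vec (SA (Suc q))) (vec (SA q)) D"
  using cX cA by (simp_all add: vl_lin is_cpx_def)

lemma D0: "x \<in> vec (SX 0) \<Longrightarrow> D x = vzero" using cX by (simp add: is_cpx_def)

lemma DD: "x \<in> vec (SX q) \<Longrightarrow> D (D x) = vzero" using cX by (simp add: is_cpx_def)

lemma Dm: "vl (vec (SX q)) (vec (SX (q - 1))) D"
  using D_vl(1)[of "q - 1"] D0 by (cases q) (auto intro!: vlI simp: vplus_def vec_add vec_smult D0)

lemma DmA: "x \<in> vec (SA q) \<Longrightarrow> D x \<in> vec (SA (q - 1))"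
  using vlD(1)[OF D_vl(2)[of "q - 1"]] D0[OF vec_mono[of x "SA 0" "SX 0"]] level_mono[of "S \<inter> A" S dg 0] by (cases q) auto

lemma AX: "x \<in> vec (SA q) \<Longrightarrow> x \<in> vec (SX q)" by (erule vec_mono) (auto simp: level_def)

lemma vs [simp]: "vsub (ZX q)" "vsub (ZA q)" "vsub (BX q)" "vsub (BA q)" "vsub (Wz q)"
proof -
  show "vsub (ZX q)" "vsub (ZA q)" "vsub (BX q)" "vsub (BA q)"
    by (rule vsub_of_subm[OF cpx_subm(1)[OF cX]] vsub_of_subm[OF cpx_subm(1)[OF cA]]
        vsub_of_subm[OF cpx_subm(2)[OF cX]] vsub_of_subm[OF cpx_subm(2)[OF cA]])+
  thus "vsub (Wz q)" unfolding vsub_iff Wz_def by blast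
qed

lemma ZXv: "z \<in> ZX q \<Longrightarrow> z \<in> vec (SX q)" and ZAv: "z \<in> ZA q \<Longrightarrow> z \<in> vec (SA q)"
  and ZXD: "z \<in> ZX q \<Longrightarrow> D z = vzero" and ZAD: "z \<in> ZA q \<Longrightarrow> D z = vzero"
  by (auto simp: Zc_def)

lemma ZAX: "z \<in> ZA q \<Longrightarrow> z \<in> ZX q" by (auto simp: Zc_def AX)

lemma BXZ: "z \<in> BX q \<Longrightarrow> z \<in> ZX q" and BAZ: "z \<in> BA q \<Longrightarrow> z \<in> ZA q"
  using cpx_subm(3)[OF cX] cpx_subm(3)[OF cA] by auto

lemma BAX: "z \<in> BA q \<Longrightarrow> z \<in> BX q" by (auto simp: Bc_def intro: AX)

lemma BAW: "z \<in> BA q \<Longrightarrow> z \<in> Wz q" by (simp add: Wz_def BAZ BAX)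

lemma fe: "vl (ZX q) (FB Xe q) (\<phi> Xe q)" "\<phi> Xe q ` ZX q = FB Xe q" "z \<in> ZX q \<Longrightarrow> \<phi> Xe q z = vzero \<longleftrightarrow> z \<in> Kz q"
  using pe[of q] by (auto simp: presents_def vl_def lin_def Kz_def)

lemma fn: "vl (Wz q) (FB Xn q) (\<phi> Xn q)" "\<phi> Xn q ` Wz q = FB Xn q" "z \<in> Wz q \<Longrightarrow> \<phi> Xn q z = vzero \<longleftrightarrow> z \<in> BA q"
  using pn[of q] unfolding Wz_def[symmetric] by (auto simp: presents_def vl_def lin_def)

lemma fi: "vl (ZA q) (FB Xi q) (\<phi> Xi q)" "\<phi> Xi q ` ZA q = FB Xi q" "z \<in> ZA q \<Longrightarrow> \<phi> Xi q z = vzero \<longleftrightarrow> z \<in> Wz q"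
  using pi[of q] unfolding Wz_def[symmetric] by (auto simp: presents_def vl_def lin_def)

lemma finite_B: "finite (B \<kappa> q)"
proof (cases \<kappa>)
  case Xe thus ?thesis using finite_basis[OF fin(1) vs(1) _ fe(1,2)] ZXv by blast
next
  case Xn thus ?thesis using finite_basis[OF fin(2) vs(5) _ fn(1,2)] ZAv by (auto simp: Wz_def)
next
  case Xi thus ?thesis using finite_basis[OF fin(2) vs(2) _ fi(1,2)] ZAv by blast
qed

lemma B_empty:
  assumes "SX q = {}"
  shows "B \<kappa> q = {}"
proof -
  have z: "z = vzero" if "z \<in> vec (SX q)" for z
    using that unfolding assms by (auto simp: free_mod_carrier)
  have "FB \<kappa> q \<subseteq> {vzero}"
  proof (cases \<kappa>)
    case Xe
    have "\<phi> Xe q z = vzero" if "z \<in> ZX q" for z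
      using z[OF ZXv[OF that]] vl_zero[OF fe(1)] by simp
    thus ?thesis using Xe fe(2)[of q] by auto
  next
    case Xn
    have "\<phi> Xn q z = vzero" if "z \<in> Wz q" for z
      using z[OF AX[OF ZAv]] that vl_zero[OF fn(1) vs(5) vsub_vec] by (auto simp: Wz_def)
    thus ?thesis using Xn fn(2)[of q] by auto
  next
    case Xi
    have "\<phi> Xi q z = vzero" if "z \<in> ZA q" for z
      using z[OF AX[OF ZAv[OF that]]] vl_zero[OF fi(1)] by simp
    thus ?thesis using Xi fi(2)[of q] by auto
  qed
  hence "free_gen R b = vzero" if "b \<in> B \<kappa> q" for b using free_gen_carrier[OF that] by auto
  hence "free_gen R b b = \<zero>" if "b \<in> B \<kappa> q" for b using that by (metis (full_types))
  thus ?thesis by (auto simp: free_gen_def)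
qed

lemma finite_model: "finite (model B)"
proof -
  define Q where "Q = dg ` S"
  have "model B \<subseteq> (\<lambda>(\<kappa>, q, b, l). ((\<kappa>, q, b), l)) ` (SIGMA \<kappa>:UNIV. SIGMA q:Q. B \<kappa> q \<times> UNIV)"
  proof
    fix m assume "m \<in> model B"
    then obtain \<kappa> q b l where m: "m = ((\<kappa>, q, b), l)" "b \<in> B \<kappa> q" by (auto simp: model_def)
    hence "q \<in> Q" using B_empty[of q \<kappa>] by (auto simp: Q_def level_def)
    thus "m \<in> (\<lambda>(\<kappa>, q, b, l). ((\<kappa>, q, b), l)) ` (SIGMA \<kappa>:UNIV. SIGMA q:Q. B \<kappa> q \<times> UNIV)"
      using m by (auto intro!: image_eqI[of _ _ "(\<kappa>, q, b, l)"])
  qed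
  moreover have "finite (UNIV :: xsym set)"
    by (rule finite_subset[of _ "{Xe, Xn, Xi}"]) (use xsym.exhaust in auto)
  moreover have "finite (UNIV :: tgen set)"
    by (rule finite_subset[of _ "{Te, Tn, Ti, Tnbar}"]) (use tgen.exhaust in auto)
  moreover have "finite Q" using fS by (simp add: Q_def)
  ultimately show ?thesis by (elim finite_subset) (intro finite_imageI finite_SigmaI finite_cartesian_product finite_B)
qed

definition prj where "prj x = (\<lambda>a. if a \<in> A then \<zero> else x a)"

lemma prj_vl: "vl (vec (SX q)) (vec (SX q - A)) prj"
  by (rule vlI) (auto simp: prj_def vplus_def free_mod_carrier_fin)

lemma prj_zero: "x \<in> vec (SX q) \<Longrightarrow> prj x = vzero \<longleftrightarrow> x \<in> vec (SA q)"
  by (auto simp: prj_def free_mod_carrier_fin fun_eq_iff level_iff)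

text \<open>The boundaries of the quotient complex.\<close>

definition Nq where "Nq q = (\<lambda>x. prj (D x)) ` vec (SX (Suc q))"

lemma section_A: "\<exists>s. vl (BA q) (vec (SA (Suc q))) s \<and> (\<forall>y\<in>BA q. D (s y) = y)"
  by (rule split_onto_ex[OF fin(2) vsub_vec order_refl D_vl(2)]) (simp add: Bc_def)

lemma section_quotient: "\<exists>s. vl (Nq q) (vec (SX (Suc q))) s \<and> (\<forall>y\<in>Nq q. prj (D (s y)) = y)"
  by (rule split_onto_ex[OF _ vsub_vec order_refl vl_comp[OF D_vl(1) prj_vl]]) (simp_all add: Nq_def)

lemma section_e: "\<exists>s. vl (FB Xe q) (ZX q) s \<and> (\<forall>y\<in>FB Xe q. \<phi> Xe q (s y) = y)"
  by (rule split_onto_ex[OF finite_B vs(1) _ fe(1), where S = "SX q"]) (use ZXv fe(2) in auto)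

lemma section_i: "\<exists>s. vl (FB Xi q) (ZA q) s \<and> (\<forall>y\<in>FB Xi q. \<phi> Xi q (s y) = y)"
  by (rule split_onto_ex[OF finite_B vs(2) _ fi(1), where S = "SA q"]) (use ZAv fi(2) in auto)

lemma section_n: "\<exists>s. vl (FB Xn q) {x\<in>vec (SX (Suc q)). D x \<in> Wz q} s \<and> (\<forall>y\<in>FB Xn q. \<phi> Xn q (D (s y)) = y)"
proof -
  let ?P = "{x\<in>vec (SX (Suc q)). D x \<in> Wz q}"
  have P: "vsub ?P" unfolding vsub_iff
    using vlD[OF D_vl(1)[of q]] vl_zero[OF D_vl(1)[of q]] vsubD[OF vs(5)[of q]] vsubD[OF vsub_vec[of "SX (Suc q)"]] by auto
  have l: "vl ?P (FB Xn q) (\<lambda>x. \<phi> Xn q (D x))"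
    by (rule vl_comp[OF vl_range[OF vl_mono[OF D_vl(1)[of q]]] fn(1)]) auto
  have im: "FB Xn q = (\<lambda>x. \<phi> Xn q (D x)) ` ?P"
  proof (intro equalityI subsetI)
    fix c assume "c \<in> FB Xn q"
    then obtain w where w: "w \<in> Wz q" "c = \<phi> Xn q w" using fn(2)[of q] by blast
    then obtain x where "x \<in> vec (SX (Suc q))" "w = D x" by (auto simp: Wz_def Bc_def)
    thus "c \<in> (\<lambda>x. \<phi> Xn q (D x)) ` ?P" using w by auto
  qed (use vlD(1)[OF l] in auto)
  show ?thesis by (rule split_onto_ex[OF finite_B P _ l im, where S = "SX (Suc q)"]) auto
qed

text \<open>A strong deformation retraction of the pair onto its minimal model, degree by degree.  In degree \<open>0\<close> the index
  \<open>q - 1\<close> is \<open>0\<close> again, which is harmless because \<open>D x\<close> is zero there.\<close>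

definition retraction where "retraction F G H \<longleftrightarrow>
  (\<forall>q. vl (vec (SX q)) (vec (MS q)) (F q) \<and> vl (vec (MS q)) (vec (SX q)) (G q) \<and> vl (vec (SX q)) (vec (SX (Suc q))) (H q)
    \<and> (\<forall>x\<in>vec (SA q). F q x \<in> vec (MA q)) \<and> (\<forall>y\<in>vec (MA q). G q y \<in> vec (SA q)) \<and> (\<forall>x\<in>vec (SA q). H q x \<in> vec (SA (Suc q)))
    \<and> (\<forall>x\<in>vec (SX q). F (q - 1) (D x) = model_D (F q x)) \<and> (\<forall>y\<in>vec (MS q). G (q - 1) (model_D y) = D (G q y))
    \<and> (\<forall>y\<in>vec (MS q). F q (G q y) = y)
    \<and> (\<forall>x\<in>vec (SX q). x = vplus (G q (F q x)) (vplus (D (H q x)) (H (q - 1) (D x)))))"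

lemma vplus_in: "vsub P \<Longrightarrow> x \<in> P \<Longrightarrow> y \<in> P \<Longrightarrow> vplus x y \<in> P" by (rule vsubD(3))

end

text \<open>\<open>ge\<close> and \<open>gi\<close> choose representatives of the classes of kinds \<open>Xe\<close> and \<open>Xi\<close>, and \<open>gb\<close> chooses chains whose
  boundaries \<open>gn\<close> represent the classes of kind \<open>Xn\<close>.  The maps \<open>sA\<close> and \<open>sc\<close> are sections of the differentials of
  the subcomplex and of the quotient complex.\<close>

locale split_sections = split_pair R S A dg D B \<phi>
  for R (structure) and S A :: "'s set" and dg :: "'s \<Rightarrow> nat" and D :: "('s \<Rightarrow> 'a) \<Rightarrow> ('s \<Rightarrow> 'a)"
    and B :: "xsym \<Rightarrow> nat \<Rightarrow> 'y set" and \<phi> :: "xsym \<Rightarrow> nat \<Rightarrow> ('s \<Rightarrow> 'a) \<Rightarrow> ('y \<Rightarrow> 'a)" +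
  fixes sA sc :: "nat \<Rightarrow> ('s \<Rightarrow> 'a) \<Rightarrow> ('s \<Rightarrow> 'a)" and ge gi gb :: "nat \<Rightarrow> ('y \<Rightarrow> 'a) \<Rightarrow> ('s \<Rightarrow> 'a)"
  assumes sA: "vl (BA q) (vec (SA (Suc q))) (sA q)" "y \<in> BA q \<Longrightarrow> D (sA q y) = y"
    and sc: "vl (Nq q) (vec (SX (Suc q))) (sc q)" "c \<in> Nq q \<Longrightarrow> prj (D (sc q c)) = c"
    and ge: "vl (FB Xe q) (ZX q) (ge q)" "b \<in> FB Xe q \<Longrightarrow> \<phi> Xe q (ge q b) = b"
    and gi: "vl (FB Xi q) (ZA q) (gi q)" "b \<in> FB Xi q \<Longrightarrow> \<phi> Xi q (gi q b) = b"
    and gb: "vl (FB Xn q) {x\<in>vec (SX (Suc q)). D x \<in> Wz q} (gb q)" "b \<in> FB Xn q \<Longrightarrow> \<phi> Xn q (D (gb q b)) = b"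
begin

definition gn where "gn q = (\<lambda>c. D (gb q c))"

lemma gn_eq: "gn q = (\<lambda>c. D (gb q c))"
  by (simp add: gn_def fun_eq_iff)

lemma WX: "vl (Wz q) (ZX q) (\<lambda>x. x)" "vl (ZA q) (ZX q) (\<lambda>x. x)" "vl (BA q) (Wz q) (\<lambda>x. x)" "vl (BX q) (ZX q) (\<lambda>x. x)" "vl (Wz q) (ZA q) (\<lambda>x. x)"
  by (rule vl_id, use ZAX BAW BXZ in \<open>auto simp: Wz_def\<close>)+

lemma ZXS: "vl (ZX q) (vec (SX q)) (\<lambda>x. x)"
  by (rule vl_id) (use ZXv in auto)

lemma DB: "vl (vec (SX (Suc q))) (BX q) D"
  by (rule vl_range[OF D_vl(1)]) (auto simp: Bc_def)

lemma gbX: "vl (FB Xn q) (vec (SX (Suc q))) (gb q)"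
  by (rule vl_mono[OF gb(1)]) auto

lemma gn: "vl (FB Xn q) (Wz q) (gn q)" "c \<in> FB Xn q \<Longrightarrow> \<phi> Xn q (gn q c) = c"
  using vl_range[OF vl_comp[OF gbX D_vl(1)], of q "Wz q"] vlD(1)[OF gb(1)] gb(2) by (auto simp: gn_eq)

lemma vN: "vsub (Nq q)"
  unfolding Nq_def using vsub_of_subm[OF subm_image[OF module_free module_free vl_comp[OF D_vl(1) prj_vl, unfolded vl_lin] subm_carrier[OF module_free]]] .

lemma corrected:
  assumes f: "vl P (FB \<kappa> d) f" and P: "vsub P" and g: "vl (FB \<kappa> d) P g" "\<And>c. c \<in> FB \<kappa> d \<Longrightarrow> f (g c) = c" and z: "z \<in> P"
  shows "f (vdiff z (g (f z))) = vzero"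
proof -
  have "f (vdiff z (g (f z))) = vdiff (f z) (f (g (f z)))"
    by (rule vl_diff[OF f P vsub_vec]) (use z vlD(1)[OF g(1) vlD(1)[OF f z]] in auto)
  thus ?thesis using g(2)[OF vlD(1)[OF f z]] vlD(1)[OF f z] by (auto simp: vdiff_def a_minus_def r_neg)
qed

text \<open>A cycle \<open>z\<close> is taken apart one kind at a time.  Removing its part of kind \<open>Xe\<close> gives \<open>ue\<close>, which is homologous to a
  cycle of the subcomplex; the chain \<open>w\<close> moves it there, giving \<open>v\<close>.  Removing the part of kind \<open>Xi\<close> leaves a cycle
  \<open>v2\<close> that bounds in the whole complex, and removing the part of kind \<open>Xn\<close> leaves a boundary \<open>v3\<close> of the
  subcomplex.  The decomposition \<open>dec\<close> records the parts, with a chain \<open>k\<close> whose boundary is the rest.\<close>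

definition ue where "ue q = (\<lambda>z. vdiff z (ge q (\<phi> Xe q z)))"

lemma uel: "vl (ZX q) (ZX q) (ue q)"
  unfolding ue_def by (rule vl_minus[OF vl_id[OF order_refl] vl_comp[OF fe(1) ge(1)] vs(1)])

lemma ueK:
  assumes z: "z \<in> ZX q"
  shows "ue q z \<in> Kz q"
  using fe(3)[OF vlD(1)[OF uel z]] corrected[OF fe(1) vs(1) ge z] by (simp add: ue_def)

lemma KN:
  assumes x: "x \<in> Kz q"
  shows "prj x \<in> Nq q"
proof -
  obtain y where y: "x \<in> ZX q" "y \<in> ZA q" "vdiff x y \<in> BX q" using x by (auto simp: Kz_def)
  have "prj (vdiff x y) = vdiff (prj x) (prj y)"
    by (rule vl_diff[OF prj_vl]) (use y ZXv ZAX in auto)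
  also have "prj y = vzero" using prj_zero[of y q] ZAv[OF y(2)] AX by auto
  also have "vdiff (prj x) vzero = prj x"
    using vec_in[OF vlD(1)[OF prj_vl ZXv[OF y(1)]]] by (auto simp: vdiff_def a_minus_def)
  finally have "prj x = prj (vdiff x y)" by simp
  thus ?thesis using y(3) by (auto simp: Nq_def Bc_def)
qed

lemma prN: "vl (ZX q) (Nq q) (\<lambda>z. prj (ue q z))"
  by (rule vl_range[OF vl_comp[OF vl_mono[OF uel order_refl] prj_vl]]) (use ZXv KN ueK in auto)

definition w where "w q = (\<lambda>z. sc q (prj (ue q z)))"

lemma wl: "vl (ZX q) (vec (SX (Suc q))) (w q)"
  unfolding w_def by (rule vl_comp[OF prN sc(1)])

definition v where "v q = (\<lambda>z. vdiff (ue q z) (D (w q z)))"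

lemma DwZ: "vl (ZX q) (ZX q) (\<lambda>z. D (w q z))"
  by (rule vl_comp[OF vl_comp[OF wl DB] WX(4)])

lemma vl0: "vl (ZX q) (ZX q) (v q)"
  unfolding v_def by (rule vl_minus[OF uel DwZ vs(1)])

lemma vZA:
  assumes z: "z \<in> ZX q"
  shows "v q z \<in> ZA q"
proof -
  have "prj (v q z) = vdiff (prj (ue q z)) (prj (D (w q z)))"
    unfolding v_def by (rule vl_diff[OF prj_vl]) (use vlD(1)[OF uel z] vlD(1)[OF DwZ z] ZXv in auto)
  also have "prj (D (w q z)) = prj (ue q z)" unfolding w_def by (rule sc(2)[OF vlD(1)[OF prN z]])
  finally have "prj (v q z) = vzero"
    using vec_in[OF vlD(1)[OF prj_vl ZXv[OF vlD(1)[OF uel z]]]] by (auto simp: vdiff_def a_minus_def r_neg)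
  hence "v q z \<in> vec (SA q)" using prj_zero[OF ZXv[OF vlD(1)[OF vl0 z]]] by simp
  thus ?thesis using ZXD[OF vlD(1)[OF vl0 z]] by (simp add: Zc_def)
qed

lemma vl1: "vl (ZX q) (ZA q) (v q)"
  by (rule vl_range[OF vl0 vZA])

definition v2 where "v2 q = (\<lambda>z. vdiff (v q z) (gi q (\<phi> Xi q (v q z))))"

lemma v2l0: "vl (ZX q) (ZA q) (v2 q)"
  unfolding v2_def by (rule vl_minus[OF vl1 vl_comp[OF vl_comp[OF vl1 fi(1)] gi(1)] vs(2)])

lemma v2W:
  assumes z: "z \<in> ZX q"
  shows "v2 q z \<in> Wz q"
  using fi(3)[OF vlD(1)[OF v2l0 z]] corrected[OF fi(1) vs(2) gi vZA[OF z]] by (simp add: v2_def)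

lemma v2l: "vl (ZX q) (Wz q) (v2 q)"
  by (rule vl_range[OF v2l0 v2W])

definition v3 where "v3 q = (\<lambda>z. vdiff (v2 q z) (gn q (\<phi> Xn q (v2 q z))))"

lemma v3l0: "vl (ZX q) (Wz q) (v3 q)"
  unfolding v3_def by (rule vl_minus[OF v2l vl_comp[OF vl_comp[OF v2l fn(1)] gn(1)] vs(5)])

lemma v3B:
  assumes z: "z \<in> ZX q"
  shows "v3 q z \<in> BA q"
  using fn(3)[OF vlD(1)[OF v3l0 z]] corrected[OF fn(1) vs(5) gn v2W[OF z]] by (simp add: v3_def)

lemma v3l: "vl (ZX q) (BA q) (v3 q)"
  by (rule vl_range[OF v3l0 v3B])

definition k where "k q = (\<lambda>z. vplus (w q z) (sA q (v3 q z)))"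

lemma sAX: "vl (BA q) (vec (SX (Suc q))) (sA q)"
  by (rule vl_mono[OF sA(1)]) (use AX in auto)

lemma kl: "vl (ZX q) (vec (SX (Suc q))) (k q)"
  unfolding k_def by (rule vl_plus[OF wl vl_comp[OF v3l sAX] vsub_vec])

lemma dec:
  assumes z: "z \<in> ZX q"
  shows "z = vplus (ge q (\<phi> Xe q z)) (vplus (gi q (\<phi> Xi q (v q z))) (vplus (gn q (\<phi> Xn q (v2 q z))) (D (k q z))))"
proof -
  have Dk: "D (k q z) = vplus (D (w q z)) (v3 q z)"
    unfolding k_def using vlD(2)[OF D_vl(1) vlD(1)[OF wl z] vlD(1)[OF sAX v3B[OF z]]] sA(2)[OF v3B[OF z]] by simp
  have c: "z a \<in> carrier R" "ge q (\<phi> Xe q z) a \<in> carrier R" "D (w q z) a \<in> carrier R"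
    "gi q (\<phi> Xi q (v q z)) a \<in> carrier R" "gn q (\<phi> Xn q (v2 q z)) a \<in> carrier R" for a
    using vsubD(6)[OF vs(1) z] vsubD(6)[OF vs(1) vlD(1)[OF vl_comp[OF fe(1) ge(1)] z]]
      vsubD(6)[OF vs(1) vlD(1)[OF DwZ z]] vsubD(6)[OF vs(2) vlD(1)[OF vl_comp[OF vl_comp[OF vl1 fi(1)] gi(1)] z]]
      vsubD(6)[OF vs(5) vlD(1)[OF vl_comp[OF vl_comp[OF v2l fn(1)] gn(1)] z]] by auto
  have "z a = ge q (\<phi> Xe q z) a \<oplus> (gi q (\<phi> Xi q (v q z)) a \<oplus> (gn q (\<phi> Xn q (v2 q z)) a \<oplus> (D (w q z) a \<oplus> v3 q z a)))" for a
  proof -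
    have 3: "v3 q z a = z a \<oplus> \<ominus> ge q (\<phi> Xe q z) a \<oplus> \<ominus> D (w q z) a \<oplus> \<ominus> gi q (\<phi> Xi q (v q z)) a \<oplus> \<ominus> gn q (\<phi> Xn q (v2 q z)) a"
      by (subst v3_def, subst (1) v2_def, subst (1) v_def, subst (1) ue_def) (simp add: vdiff_def a_minus_def)
    have alg: "x = e \<oplus> (i \<oplus> (n \<oplus> (d \<oplus> (x \<oplus> \<ominus> e \<oplus> \<ominus> d \<oplus> \<ominus> i \<oplus> \<ominus> n))))"
      if "x \<in> carrier R" "e \<in> carrier R" "i \<in> carrier R" "n \<in> carrier R" "d \<in> carrier R" for x e i n d
      using that by algebra
    show ?thesis unfolding 3 by (rule alg) (use c in auto)
  qed
  thus ?thesis unfolding Dk by (simp add: vplus_def fun_eq_iff)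
qed

lemma z0: "ge q vzero = vzero" "gi q vzero = vzero" "gn q vzero = vzero" "gb q vzero = vzero" "sc q vzero = vzero"
  "sA q vzero = vzero" "ue q vzero = vzero" "v q vzero = vzero" "v2 q vzero = vzero" "k q vzero = vzero"
  "\<phi> Xe q vzero = vzero" "\<phi> Xi q vzero = vzero" "\<phi> Xn q vzero = vzero" "D vzero = vzero" "prj vzero = vzero"
  using vl_zero[OF ge(1)] vl_zero[OF gi(1)] vl_zero[OF gn(1)] vl_zero[OF gbX] vl_zero[OF sc(1) vN] vl_zero[OF sA(1)]
    vl_zero[OF uel] vl_zero[OF vl0] vl_zero[OF v2l] vl_zero[OF kl] vl_zero[OF fe(1)] vl_zero[OF fi(1)] vl_zero[OF fn(1)]
    vl_zero[OF D_vl(1)] vl_zero[OF prj_vl] by simp_all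

lemma d0:
  assumes that: "x \<in> ZX q"
  shows "vdiff x vzero = x"
  using vsubD(6)[OF vs(1) that] by (auto simp: vdiff_def a_minus_def)

lemma p0:
  assumes that: "x \<in> vec UNIV"
  shows "vplus x vzero = x" "vplus vzero x = x"
  using vec_in[OF that] by (auto simp: vplus_def)

lemma BK:
  assumes that: "y \<in> BX q"
  shows "y \<in> Kz q"
  unfolding Kz_def using that BXZ[OF that] d0[OF BXZ[OF that]] vsubD(2)[OF vs(2)] by (auto intro!: bexI[of _ vzero])

lemma yB:
  assumes y: "y \<in> BX q"
  shows "\<phi> Xe q y = vzero" "ue q y = y" "v q y \<in> Wz q" "\<phi> Xi q (v q y) = vzero" "v2 q y = v q y"
proof -
  show e: "\<phi> Xe q y = vzero" using fe(3)[OF BXZ[OF y]] BK[OF y] by simp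
  thus u: "ue q y = y" using d0[OF BXZ[OF y]] z0 by (simp add: ue_def)
  have "v q y \<in> BX q" unfolding v_def u by (rule vsubD(5)[OF vs(3) y vlD(1)[OF DB vlD(1)[OF wl BXZ[OF y]]]])
  thus W: "v q y \<in> Wz q" using vZA[OF BXZ[OF y]] by (simp add: Wz_def)
  show i: "\<phi> Xi q (v q y) = vzero" using fi(3)[OF vZA[OF BXZ[OF y]]] W by simp
  show "v2 q y = v q y" unfolding v2_def i z0 using d0[OF ZAX[OF vZA[OF BXZ[OF y]]]] by simp
qed

text \<open>Boundaries of the subcomplex need no correction, so the construction does not leave the subcomplex.\<close>

lemma yA:
  assumes y: "y \<in> BA q"
  shows "w q y = vzero" "v q y = y" "\<phi> Xn q (v2 q y) = vzero" "k q y = sA q y"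
proof -
  have yX: "y \<in> BX q" by (rule BAX[OF y])
  have "prj y = vzero" using prj_zero[OF AX[OF ZAv[OF BAZ[OF y]]]] ZAv[OF BAZ[OF y]] by simp
  thus w0: "w q y = vzero" by (simp add: w_def yB(2)[OF yX] z0)
  show vy: "v q y = y" using d0[OF BXZ[OF yX]] by (simp add: v_def yB(2)[OF yX] w0 z0)
  show n0: "\<phi> Xn q (v2 q y) = vzero" using fn(3)[OF BAW[OF y]] y by (simp add: yB(5)[OF yX] vy)
  have "v3 q y = y" unfolding v3_def n0 z0 using d0[OF BXZ[OF yX]] by (simp add: yB(5)[OF yX] vy)
  thus "k q y = sA q y" unfolding k_def w0 using p0(2)[OF vec_mono[OF vlD(1)[OF sAX y]]] by simp
qed

text \<open>A section of the differential on all boundaries: on a boundary, \<open>k\<close> misses only the part of kind \<open>Xn\<close>.\<close>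

definition s where "s q = (\<lambda>y. vplus (k q y) (gb q (\<phi> Xn q (v2 q y))))"

lemma sl: "vl (BX q) (vec (SX (Suc q))) (s q)"
  unfolding s_def
  by (rule vl_plus[OF vl_comp[OF WX(4) kl] vl_comp[OF vl_comp[OF vl_comp[OF WX(4) v2l] fn(1)] gbX] vsub_vec])

lemma Ds:
  assumes y: "y \<in> BX q"
  shows "D (s q y) = y"
proof -
  have yZ: "y \<in> ZX q" by (rule BXZ[OF y])
  have n: "\<phi> Xn q (v2 q y) \<in> FB Xn q" by (rule vlD(1)[OF fn(1) v2W[OF yZ]])
  have "D (s q y) = vplus (D (k q y)) (gn q (\<phi> Xn q (v2 q y)))"
    unfolding s_def gn_def by (rule vlD(2)[OF D_vl(1) vlD(1)[OF kl yZ] vlD(1)[OF gbX n]])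
  also have "\<dots> = y"
  proof -
    have c: "D (k q y) \<in> vec UNIV" "gn q (\<phi> Xn q (v2 q y)) \<in> vec UNIV"
      using vsubD(1)[OF vs(3) vlD(1)[OF DB vlD(1)[OF kl yZ]]] vsubD(1)[OF vs(5) vlD(1)[OF gn(1) n]] by auto
    have "y = vplus (gn q (\<phi> Xn q (v2 q y))) (D (k q y))"
      using dec[OF yZ] yB(1,4)[OF y] z0 p0[OF vec_mono[OF vsubD(3)[OF vsub_vec c(2,1)]]] by (simp add: vplus_in)
    thus ?thesis using c by (auto simp: vplus_def a_comm)
  qed
  finally show ?thesis .
qed

text \<open>The projection of the chains onto the cycles along the image of \<open>s\<close>.\<close>

definition zz where "zz q = (\<lambda>x. vdiff x (s (q - 1) (D x)))"

lemma DBm: "vl (vec (SX q)) (BX (q - 1)) D"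
  using DB[of "q - 1"] D0 vsubD(2)[OF vs(3)] by (cases q) (auto intro!: vlI simp: vplus_def vec_add vec_smult)

lemma sDl: "vl (vec (SX q)) (vec (SX q)) (\<lambda>x. s (q - 1) (D x))"
proof (cases q)
  case 0
  have "s 0 (D x) = vzero" if "x \<in> vec (SX 0)" for x using D0[OF that] vl_zero[OF sl[of 0]] by simp
  thus ?thesis using 0 by (intro vlI) (auto simp: vplus_def vec_add vec_smult)
next
  case (Suc p)
  thus ?thesis using vl_comp[OF DB[of p] sl] by simp
qed

lemma zzl0: "vl (vec (SX q)) (vec (SX q)) (zz q)"
  unfolding zz_def by (rule vl_minus[OF vl_id[OF order_refl] sDl vsub_vec])

lemma zzZ:
  assumes x: "x \<in> vec (SX q)"
  shows "zz q x \<in> ZX q"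
proof -
  have "D (zz q x) = vdiff (D x) (D (s (q - 1) (D x)))"
    unfolding zz_def by (rule vl_diff[OF Dm]) (use x vlD(1)[OF sDl x] in auto)
  also have "\<dots> = vzero" unfolding Ds[OF vlD(1)[OF DBm x]] using vec_in[OF vlD(1)[OF Dm x]] by (auto simp: vdiff_def a_minus_def r_neg)
  finally show ?thesis using vlD(1)[OF zzl0 x] by (simp add: Zc_def)
qed

lemma zzl: "vl (vec (SX q)) (ZX q) (zz q)"
  by (rule vl_range[OF zzl0 zzZ])

lemma zzcyc:
  assumes z: "z \<in> ZX q"
  shows "zz q z = z"
  unfolding zz_def ZXD[OF z] using vl_zero[OF sl] d0[OF z] by simp

definition Fe where "Fe q = (\<lambda>x. \<phi> Xe q (zz q x))"

definition Fi where "Fi q = (\<lambda>x. \<phi> Xi q (v q (zz q x)))"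

definition Fn where "Fn q = (\<lambda>x. \<phi> Xn q (v2 q (zz q x)))"

definition Fb where "Fb q = (\<lambda>x. \<phi> Xn q (v2 q (D x)))"

lemma Fel: "vl (vec (SX q)) (FB Xe q) (Fe q)"
  unfolding Fe_def by (rule vl_comp[OF zzl fe(1)])

lemma Fil: "vl (vec (SX q)) (FB Xi q) (Fi q)"
  unfolding Fi_def by (rule vl_comp[OF vl_comp[OF zzl vl1] fi(1)])

lemma Fnl: "vl (vec (SX q)) (FB Xn q) (Fn q)"
  unfolding Fn_def by (rule vl_comp[OF vl_comp[OF zzl v2l] fn(1)])

lemma Fbl: "vl (vec (SX (Suc q))) (FB Xn q) (Fb q)"
  unfolding Fb_def by (rule vl_comp[OF vl_comp[OF vl_comp[OF DB WX(4)] v2l] fn(1)])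

text \<open>The coordinates of the cycle part of \<open>x\<close> at \<open>Te\<close>, \<open>Ti\<close>, \<open>Tn\<close>, and those of its boundary, one degree lower, at \<open>Tnbar\<close>.\<close>

definition F where "F q = (\<lambda>x. (\<lambda>((\<kappa>, d, b), l). case l of Te \<Rightarrow> (if \<kappa> = Xe \<and> d = q then Fe q x b else \<zero>)
  | Ti \<Rightarrow> (if \<kappa> = Xi \<and> d = q then Fi q x b else \<zero>) | Tn \<Rightarrow> (if \<kappa> = Xn \<and> d = q then Fn q x b else \<zero>)
  | Tnbar \<Rightarrow> (if \<kappa> = Xn \<and> Suc d = q then Fb d x b else \<zero>)))"

definition pr where "pr \<kappa> d l = (\<lambda>y. (\<lambda>b. y ((\<kappa>, d, b), l)))"

definition G where "G q = (\<lambda>y. vplus (vplus (ge q (pr Xe q Te y)) (gi q (pr Xi q Ti y)))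
  (vplus (gn q (pr Xn q Tn y)) (if q = 0 then vzero else gb (q - 1) (pr Xn (q - 1) Tnbar y))))"

definition H where "H q = (\<lambda>x. k q (zz q x))"

lemma fM: "finite (MS q)" "finite (MA q)"
  using finite_model by (auto simp: level_def)

lemma prl: "vl (vec (MS q)) (FB \<kappa> d) (pr \<kappa> d l)"
  by (rule vlI) (auto simp: pr_def free_mod_carrier_fin fM finite_B vplus_def level_iff)

lemma Fl: "vl (vec (SX q)) (vec (MS q)) (F q)"
proof (rule vlI)
  fix x assume x: "x \<in> vec (SX q)"
  show "F q x \<in> vec (MS q)"
    unfolding free_mod_carrier_fin[OF fM(1)]
  proof (intro conjI allI impI)
    have cc: "Fe q x b \<in> carrier R" "Fi q x b \<in> carrier R" "Fn q x b \<in> carrier R" "q = Suc d \<Longrightarrow> Fb d x b \<in> carrier R" for b d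
      using vec_in[OF vlD(1)[OF Fel x]] vec_in[OF vlD(1)[OF Fil x]] vec_in[OF vlD(1)[OF Fnl x]] vec_in[OF vlD(1)[OF Fbl]] x by auto
    show "F q x m \<in> carrier R" for m by (auto simp: F_def cc split: prod.splits tgen.splits)
    have oo: "b \<notin> B Xe q \<Longrightarrow> Fe q x b = \<zero>" "b \<notin> B Xi q \<Longrightarrow> Fi q x b = \<zero>" "b \<notin> B Xn q \<Longrightarrow> Fn q x b = \<zero>"
      "q = Suc d \<Longrightarrow> b \<notin> B Xn d \<Longrightarrow> Fb d x b = \<zero>" for b d
      using vec_out[OF vlD(1)[OF Fel x]] vec_out[OF vlD(1)[OF Fil x]] vec_out[OF vlD(1)[OF Fnl x]] vec_out[OF vlD(1)[OF Fbl]] x by auto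
    show "F q x m = \<zero>" if "m \<notin> MS q" for m
      using that oo by (auto simp: F_def level_iff split: prod.splits tgen.splits)
  qed
  fix y assume y: "y \<in> vec (SX q)"
  have "Fb d (vplus x y) = vplus (Fb d x) (Fb d y)" if "q = Suc d" for d using vlD(2)[OF Fbl] x y that by simp
  hence e: "Fe q (vplus x y) b = Fe q x b \<oplus> Fe q y b" "Fi q (vplus x y) b = Fi q x b \<oplus> Fi q y b"
    "Fn q (vplus x y) b = Fn q x b \<oplus> Fn q y b" "q = Suc d \<Longrightarrow> Fb d (vplus x y) b = Fb d x b \<oplus> Fb d y b" for b d
    using vlD(2)[OF Fel x y] vlD(2)[OF Fil x y] vlD(2)[OF Fnl x y] by (simp_all add: vplus_apply)
  show "F q (vplus x y) = vplus (F q x) (F q y)"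
  proof
    fix m :: "(xsym \<times> nat \<times> 'y) \<times> tgen"
    obtain \<kappa> d b l where m: "m = ((\<kappa>, d, b), l)" by (metis prod.collapse)
    show "F q (vplus x y) m = vplus (F q x) (F q y) m"
      by (cases l) (auto simp: m F_def vplus_apply e)
  qed
next
  fix a x assume ax: "a \<in> carrier R" "x \<in> vec (SX q)"
  have "Fb d (\<lambda>s. a \<otimes> x s) = (\<lambda>s. a \<otimes> Fb d x s)" if "q = Suc d" for d using vlD(3)[OF Fbl] ax that by simp
  hence e: "q = Suc d \<Longrightarrow> Fb d (\<lambda>s. a \<otimes> x s) b = a \<otimes> Fb d x b" for b d by simp
  show "F q (\<lambda>s. a \<otimes> x s) = (\<lambda>s. a \<otimes> F q x s)"
  proof
    fix m :: "(xsym \<times> nat \<times> 'y) \<times> tgen"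
    obtain \<kappa> d b l where m: "m = ((\<kappa>, d, b), l)" by (metis prod.collapse)
    show "F q (\<lambda>s. a \<otimes> x s) m = a \<otimes> F q x m"
      using ax(1) by (cases l) (auto simp: m F_def e vlD(3)[OF Fel ax] vlD(3)[OF Fil ax] vlD(3)[OF Fnl ax])
  qed
qed

lemma geS: "vl (FB Xe q) (vec (SX q)) (ge q)" "vl (FB Xi q) (vec (SX q)) (gi q)" "vl (FB Xn q) (vec (SX q)) (gn q)"
  using vl_comp[OF ge(1) ZXS] vl_comp[OF vl_comp[OF gi(1) WX(2)] ZXS] vl_comp[OF vl_comp[OF gn(1) WX(1)] ZXS] by auto

lemma gbm: "vl (vec (MS q)) (vec (SX q)) (\<lambda>y. if q = 0 then vzero else gb (q - 1) (pr Xn (q - 1) Tnbar y))"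
proof (cases q)
  case 0 thus ?thesis by (intro vlI) (auto simp: vplus_def)
next
  case (Suc p) thus ?thesis using vl_comp[OF prl gbX, of q p] by simp
qed

lemma Gl: "vl (vec (MS q)) (vec (SX q)) (G q)"
  unfolding G_def by (intro vl_plus vl_comp[OF prl geS(1)] vl_comp[OF prl geS(2)] vl_comp[OF prl geS(3)] gbm vsub_vec)

lemma Hl: "vl (vec (SX q)) (vec (SX (Suc q))) (H q)"
  unfolding H_def by (rule vl_comp[OF zzl kl])

lemma prF: "pr Xe q Te (F q x) = Fe q x" "pr Xi q Ti (F q x) = Fi q x" "pr Xn q Tn (F q x) = Fn q x"
  "pr Xn d Tnbar (F (Suc d) x) = Fb d x"
  by (auto simp: pr_def F_def)

lemma fA:
  assumes x: "x \<in> vec (SA q)"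
  shows "zz q x \<in> ZA q" "D x \<in> BA (q - 1)" "s (q - 1) (D x) \<in> vec (SA q)"
proof -
  show DxB: "D x \<in> BA (q - 1)"
    using x D0[OF AX] vsubD(2)[OF vs(4)] by (cases q) (auto simp: Bc_def)
  show sA': "s (q - 1) (D x) \<in> vec (SA q)"
  proof (cases q)
    case 0
    thus ?thesis using D0[OF AX] x vl_zero[OF sl[of 0]] by simp
  next
    case (Suc p)
    hence "s p (D x) = sA p (D x)"
      using yA[of "D x" p] DxB z0(4) p0(1)[OF vec_mono[OF vlD(1)[OF sAX]]] by (simp add: s_def)
    thus ?thesis using Suc vlD(1)[OF sA(1)] DxB by simp
  qed
  have "zz q x \<in> vec (SA q)" unfolding zz_def by (rule vsubD(5)[OF vsub_vec x sA'])
  thus "zz q x \<in> ZA q" using zzZ[OF AX[OF x]] by (simp add: Zc_def)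
qed

lemma AK:
  assumes z: "z \<in> ZA q"
  shows "\<phi> Xe q z = vzero" "ue q z = z" "w q z = vzero"
proof -
  have "vdiff z z = vzero" using vsubD(6)[OF vs(2) z] by (auto simp: vdiff_def a_minus_def r_neg)
  hence "z \<in> Kz q" using z ZAX[OF z] vsubD(2)[OF vs(3)] by (auto simp: Kz_def intro!: bexI[of _ z])
  thus e: "\<phi> Xe q z = vzero" using fe(3)[OF ZAX[OF z]] by simp
  thus u: "ue q z = z" using d0[OF ZAX[OF z]] z0 by (simp add: ue_def)
  show "w q z = vzero" using prj_zero[OF AX[OF ZAv[OF z]]] ZAv[OF z] by (simp add: w_def u z0)
qed

lemma retract_A:
  assumes x: "x \<in> vec (SA q)"
  shows "F q x \<in> vec (MA q)" "H q x \<in> vec (SA (Suc q))"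
proof -
  have z: "zz q x \<in> ZA q" by (rule fA(1)[OF x])
  have e: "Fe q x = vzero" by (simp add: Fe_def AK(1)[OF z])
  have b: "Fb d x = vzero" if "q = Suc d" for d using yA(3)[of "D x" d] fA(2)[OF x] that by (simp add: Fb_def)
  have "F q x m = \<zero>" if "m \<notin> MA q" for m
  proof (cases "m \<in> model_A")
    case True
    hence "m \<notin> MS q" using that by (auto simp: level_iff)
    thus ?thesis using vec_out[OF vlD(1)[OF Fl AX[OF x]]] by blast
  next
    case False
    thus ?thesis by (auto simp: F_def e b split: prod.splits tgen.splits)
  qed
  thus "F q x \<in> vec (MA q)"
    using vec_in[OF vlD(1)[OF Fl AX[OF x]]] by (simp add: free_mod_carrier_fin[OF fM(2)])
  have "k q (zz q x) = sA q (v3 q (zz q x))"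
    unfolding k_def AK(3)[OF z] using p0(2)[OF vec_mono[OF vlD(1)[OF sAX v3B[OF ZAX[OF z]]]]] by simp
  thus "H q x \<in> vec (SA (Suc q))" unfolding H_def using vlD(1)[OF sA(1) v3B[OF ZAX[OF z]]] by simp
qed

lemma include_A:
  assumes y: "y \<in> vec (MA q)"
  shows "G q y \<in> vec (SA q)"
proof -
  have yM: "y \<in> vec (MS q)" by (rule vec_mono[OF y]) (auto simp: level_iff)
  have y0: "pr \<kappa> d Te y = vzero" "pr \<kappa> d Tnbar y = vzero" for \<kappa> d
    using vec_out[OF y] by (auto simp: pr_def level_iff)
  have "gi q (pr Xi q Ti y) \<in> vec (SA q)" using ZAv[OF vlD(1)[OF gi(1) vlD(1)[OF prl yM]]] .
  moreover have "gn q (pr Xn q Tn y) \<in> vec (SA q)"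
    using vlD(1)[OF gn(1) vlD(1)[OF prl yM]] ZAv by (auto simp: Wz_def)
  ultimately show "G q y \<in> vec (SA q)"
    unfolding G_def y0 z0 by (auto intro!: vsubD(3)[OF vsub_vec])
qed

lemma retract_chain:
  assumes x: "x \<in> vec (SX q)"
  shows "F (q - 1) (D x) = model_D (F q x)" and "x = vplus (G q (F q x)) (vplus (D (H q x)) (H (q - 1) (D x)))"
proof -
  have DxB: "D x \<in> BX (q - 1)" by (rule vlD(1)[OF DBm x])
  have zD: "zz (q - 1) (D x) = D x" by (rule zzcyc[OF BXZ[OF DxB]])
  show "F (q - 1) (D x) = model_D (F q x)"
  proof (cases q)
    case 0
    have "F 0 vzero = vzero" using vl_zero[OF Fl] by simp
    moreover have "model_D (F 0 x) = vzero" by (auto simp: F_def fun_eq_iff)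
    ultimately show ?thesis using 0 D0 x by simp
  next
    case (Suc p)
    have e: "Fe p (D x) = vzero" "Fi p (D x) = vzero" "Fn p (D x) = Fb p x" "\<And>d. Fb d (D x) = vzero"
      using zD yB[OF DxB] DD[OF x] Suc z0 by (auto simp: Fe_def Fi_def Fn_def Fb_def)
    show ?thesis using Suc by (auto simp: F_def fun_eq_iff e split: tgen.splits)
  qed
  have zx: "zz q x \<in> ZX q" by (rule zzZ[OF x])
  have GF: "G q (F q x) = vplus (vplus (ge q (Fe q x)) (gi q (Fi q x)))
    (vplus (gn q (Fn q x)) (if q = 0 then vzero else gb (q - 1) (Fb (q - 1) x)))"
    unfolding G_def prF by (cases q) (auto simp: prF)
  have HD: "H (q - 1) (D x) = k (q - 1) (D x)" unfolding H_def zD ..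
  have sD: "s (q - 1) (D x) = vplus (k (q - 1) (D x)) (if q = 0 then vzero else gb (q - 1) (Fb (q - 1) x))"
  proof (cases q)
    case 0
    thus ?thesis using D0 x z0 by (simp add: s_def)
  next
    case (Suc p) thus ?thesis by (simp add: s_def Fb_def)
  qed
  have DHx: "D (H q x) = D (k q (zz q x))" by (simp add: H_def)
  have dz: "zz q x = vplus (ge q (Fe q x)) (vplus (gi q (Fi q x)) (vplus (gn q (Fn q x)) (D (k q (zz q x)))))"
    unfolding Fe_def Fi_def Fn_def by (rule dec[OF zx])
  show "x = vplus (G q (F q x)) (vplus (D (H q x)) (H (q - 1) (D x)))"
  proof
    fix a
    let ?b = "(if q = 0 then vzero else gb (q - 1) (Fb (q - 1) x))"
    have bc: "?b a \<in> carrier R"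
    proof (cases q)
      case (Suc p) thus ?thesis using vec_in[OF vlD(1)[OF gbX vlD(1)[OF Fbl]]] x by simp
    qed simp
    have kc: "k (q - 1) (D x) a \<in> carrier R" using vec_in[OF vlD(1)[OF kl BXZ[OF DxB]]] .
    have c: "ge q (Fe q x) a \<in> carrier R" "gi q (Fi q x) a \<in> carrier R" "gn q (Fn q x) a \<in> carrier R"
      "D (k q (zz q x)) a \<in> carrier R" "x a \<in> carrier R"
      using vec_in[OF vlD(1)[OF geS(1) vlD(1)[OF Fel x]]] vec_in[OF vlD(1)[OF geS(2) vlD(1)[OF Fil x]]]
        vec_in[OF vlD(1)[OF geS(3) vlD(1)[OF Fnl x]]] vec_in[OF vlD(1)[OF D_vl(1) vlD(1)[OF kl zx]]] vec_in[OF x] by auto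
    have alg: "u = e \<oplus> i \<oplus> (n \<oplus> b) \<oplus> (d \<oplus> g)"
      if "u \<ominus> (g \<oplus> b) = e \<oplus> (i \<oplus> (n \<oplus> d))" "u \<in> carrier R" "e \<in> carrier R" "i \<in> carrier R" "n \<in> carrier R"
        "b \<in> carrier R" "d \<in> carrier R" "g \<in> carrier R" for u e i n b d g
    proof -
      have "u = (u \<ominus> (g \<oplus> b)) \<oplus> (g \<oplus> b)" using that(2-) by algebra
      thus ?thesis unfolding that(1) using that(2-) by (simp add: a_ac)
    qed
    have "zz q x a = x a \<ominus> (k (q - 1) (D x) a \<oplus> ?b a)" unfolding zz_def vdiff_def sD by (simp only: vplus_apply)
    moreover have "zz q x a = ge q (Fe q x) a \<oplus> (gi q (Fi q x) a \<oplus> (gn q (Fn q x) a \<oplus> D (k q (zz q x)) a))"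
      using fun_cong[OF dz, of a] by (simp add: vplus_def)
    ultimately have "x a = ge q (Fe q x) a \<oplus> gi q (Fi q x) a \<oplus> (gn q (Fn q x) a \<oplus> ?b a)
        \<oplus> (D (k q (zz q x)) a \<oplus> k (q - 1) (D x) a)"
      by (intro alg) (use bc kc c in auto)
    thus "x a = vplus (G q (F q x)) (vplus (D (H q x)) (H (q - 1) (D x))) a"
      unfolding GF HD DHx by (simp add: vplus_def)
  qed
qed

lemma include_chain:
  assumes y: "y \<in> vec (MS q)"
  shows "G (q - 1) (model_D y) = D (G q y)" and "F q (G q y) = y"
proof -
  note prc = vlD(1)[OF prl y]
  have eZ: "ge q (pr Xe q Te y) \<in> ZX q" by (rule vlD(1)[OF ge(1) prc])
  have iZ: "gi q (pr Xi q Ti y) \<in> ZA q" by (rule vlD(1)[OF gi(1) prc])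
  have nW: "gn q (pr Xn q Tn y) \<in> Wz q" by (rule vlD(1)[OF gn(1) prc])
  let ?b = "(if q = 0 then vzero else gb (q - 1) (pr Xn (q - 1) Tnbar y))"
  have bS: "?b \<in> vec (SX q)" by (rule vlD(1)[OF gbm y])
  have eS: "ge q (pr Xe q Te y) \<in> vec (SX q)" "gi q (pr Xi q Ti y) \<in> vec (SX q)" "gn q (pr Xn q Tn y) \<in> vec (SX q)"
    using ZXv[OF eZ] ZXv[OF ZAX[OF iZ]] nW ZXv ZAX by (auto simp: Wz_def)
  have Dz: "D (ge q (pr Xe q Te y)) = vzero" "D (gi q (pr Xi q Ti y)) = vzero" "D (gn q (pr Xn q Tn y)) = vzero"
    using ZXD[OF eZ] ZAD[OF iZ] nW ZAD by (auto simp: Wz_def)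
  have DG: "D (G q y) = D ?b"
  proof -
    have "D (G q y) = vplus (D (vplus (ge q (pr Xe q Te y)) (gi q (pr Xi q Ti y)))) (D (vplus (gn q (pr Xn q Tn y)) ?b))"
      unfolding G_def by (rule vlD(2)[OF Dm vsubD(3)[OF vsub_vec eS(1,2)] vsubD(3)[OF vsub_vec eS(3) bS]])
    also have "\<dots> = vplus (vplus vzero vzero) (vplus vzero (D ?b))"
      unfolding vlD(2)[OF Dm eS(1,2)] vlD(2)[OF Dm eS(3) bS] Dz ..
    finally have "D (G q y) = vplus (vplus vzero vzero) (vplus vzero (D ?b))" .
    thus ?thesis using vec_in[OF vlD(1)[OF Dm bS]] by (simp add: vplus_def)
  qed
  have Db: "D ?b = (if q = 0 then vzero else gn (q - 1) (pr Xn (q - 1) Tnbar y))"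
    using z0 by (simp add: gn_def)
  have prD: "pr Xe d Te (model_D y) = vzero" "pr Xi d Ti (model_D y) = vzero" "pr Xn d Tnbar (model_D y) = vzero"
    "pr Xn d Tn (model_D y) = pr Xn d Tnbar y" for d by (auto simp: pr_def)
  show "G (q - 1) (model_D y) = D (G q y)"
  proof (cases q)
    case 0
    have "pr Xn 0 Tnbar y = vzero" using vec_out[OF y] 0 by (auto simp: pr_def level_iff)
    thus ?thesis unfolding DG Db using 0 by (simp add: G_def prD z0 vplus_def)
  next
    case (Suc p)
    have "gn p (pr Xn p Tnbar y) \<in> vec UNIV" using vsubD(1)[OF vs(5) vlD(1)[OF gn(1) prc]] .
    thus ?thesis unfolding DG Db using Suc by (simp add: G_def prD z0 p0 cong: if_cong)
  qed
  show "F q (G q y) = y"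
  proof -
    have eqs: "Fe q (G q y) = pr Xe q Te y" "Fi q (G q y) = pr Xi q Ti y" "Fn q (G q y) = pr Xn q Tn y"
    proof -
      define z where "z = vplus (vplus (ge q (pr Xe q Te y)) (gi q (pr Xi q Ti y))) (gn q (pr Xn q Tn y))"
      have nZ: "gn q (pr Xn q Tn y) \<in> ZA q" "gn q (pr Xn q Tn y) \<in> BX q" using nW by (auto simp: Wz_def)
      have zZ: "z \<in> ZX q" unfolding z_def by (intro vsubD(3)[OF vs(1)] eZ ZAX[OF iZ] ZAX[OF nZ(1)])
      \<comment> \<open>the section of the differential sends the boundary of the \<open>Tnbar\<close> part back to it\<close>
      have zG: "zz q (G q y) = z"
      proof -
        have sb: "s (q - 1) (D (G q y)) = ?b"
        proof (cases q)
          case 0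
          thus ?thesis unfolding DG Db using vl_zero[OF sl] by simp
        next
          case (Suc p)
          let ?c = "pr Xn p Tnbar y"
          have cB: "?c \<in> FB Xn p" by (rule prc)
          have gW: "gn p ?c \<in> Wz p" by (rule vlD(1)[OF gn(1) cB])
          have gA: "gn p ?c \<in> ZA p" "gn p ?c \<in> BX p" using gW by (auto simp: Wz_def)
          have vg: "v p (gn p ?c) = gn p ?c" using AK(2,3)[OF gA(1)] d0[OF ZAX[OF gA(1)]] by (simp add: v_def z0)
          have v2g: "v2 p (gn p ?c) = gn p ?c" using yB(5)[OF gA(2)] vg by simp
          have ng: "\<phi> Xn p (v2 p (gn p ?c)) = ?c" unfolding v2g by (rule gn(2)[OF cB])
          have "v3 p (gn p ?c) = vzero" unfolding v3_def v2g gn(2)[OF cB] using vsubD(6)[OF vs(5) gW] by (auto simp: vdiff_def a_minus_def r_neg)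
          hence "k p (gn p ?c) = vzero" by (simp add: k_def AK(3)[OF gA(1)] z0 vplus_def)
          hence "s p (gn p ?c) = gb p ?c" unfolding s_def ng using p0(2)[OF vec_mono[OF vlD(1)[OF gbX cB]]] by simp
          thus ?thesis unfolding DG Db using Suc by simp
        qed
        show ?thesis
        proof
          fix a
          have alg: "e \<oplus> i \<oplus> (n \<oplus> b) \<ominus> b = e \<oplus> i \<oplus> n"
            if "e \<in> carrier R" "i \<in> carrier R" "n \<in> carrier R" "b \<in> carrier R" for e i n b using that by algebra
          show "zz q (G q y) a = z a"
            unfolding zz_def sb unfolding z_def vdiff_def G_def vplus_def
            by (rule alg) (use vec_in[OF eS(1)] vec_in[OF eS(2)] vec_in[OF eS(3)] vec_in[OF bS] in simp_all)
        qed
      qed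
      have e1: "\<phi> Xe q z = pr Xe q Te y"
      proof -
        have "\<phi> Xe q z = vplus (vplus (\<phi> Xe q (ge q (pr Xe q Te y))) (\<phi> Xe q (gi q (pr Xi q Ti y)))) (\<phi> Xe q (gn q (pr Xn q Tn y)))"
          unfolding z_def using eZ ZAX[OF iZ] ZAX[OF nZ(1)] by (simp only: vlD(2)[OF fe(1)] vsubD(3)[OF vs(1)])
        thus ?thesis using ge(2)[OF prc] AK(1)[OF iZ] AK(1)[OF nZ(1)] p0[OF vec_mono[OF prc]] by simp
      qed
      define z1 where "z1 = vplus (gi q (pr Xi q Ti y)) (gn q (pr Xn q Tn y))"
      have z1A: "z1 \<in> ZA q" unfolding z1_def by (rule vsubD(3)[OF vs(2) iZ nZ(1)])
      have u: "ue q z = z1"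
      proof
        fix a
        have alg: "e \<oplus> i \<oplus> n \<ominus> e = i \<oplus> n" if "e \<in> carrier R" "i \<in> carrier R" "n \<in> carrier R" for e i n using that by algebra
        show "ue q z a = z1 a" unfolding ue_def e1 z1_def unfolding z_def vdiff_def vplus_def
          by (rule alg) (use vec_in[OF eS(1)] vec_in[OF eS(2)] vec_in[OF eS(3)] in simp_all)
      qed
      have vz: "v q z = z1"
      proof -
        have "w q z = vzero" using prj_zero[OF AX[OF ZAv[OF z1A]]] ZAv[OF z1A] by (simp add: w_def u z0)
        thus ?thesis using d0[OF ZAX[OF z1A]] by (simp add: v_def u z0)
      qed
      have e2: "\<phi> Xi q z1 = pr Xi q Ti y"
      proof -
        have "\<phi> Xi q z1 = vplus (\<phi> Xi q (gi q (pr Xi q Ti y))) (\<phi> Xi q (gn q (pr Xn q Tn y)))"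
          unfolding z1_def by (rule vlD(2)[OF fi(1) iZ nZ(1)])
        moreover have "\<phi> Xi q (gn q (pr Xn q Tn y)) = vzero" using fi(3)[OF nZ(1)] nW by simp
        ultimately show ?thesis using gi(2)[OF prc] p0[OF vec_mono[OF prc]] by simp
      qed
      have v2z: "v2 q z = gn q (pr Xn q Tn y)"
      proof
        fix a
        have alg: "i \<oplus> n \<ominus> i = n" if "i \<in> carrier R" "n \<in> carrier R" for i n using that by algebra
        show "v2 q z a = gn q (pr Xn q Tn y) a" unfolding v2_def vz e2 unfolding z1_def vdiff_def vplus_def
          by (rule alg) (use vec_in[OF eS(1)] vec_in[OF eS(2)] vec_in[OF eS(3)] in simp_all)
      qed
      show "Fe q (G q y) = pr Xe q Te y" "Fi q (G q y) = pr Xi q Ti y" "Fn q (G q y) = pr Xn q Tn y"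
        unfolding Fe_def Fi_def Fn_def zG vz v2z e1 e2 using gn(2)[OF prc] by auto
    qed
    have eb: "Fb p (G q y) = pr Xn p Tnbar y" if q: "q = Suc p" for p
    proof -
      let ?c = "pr Xn p Tnbar y"
      have gW: "gn p ?c \<in> Wz p" by (rule vlD(1)[OF gn(1) prc])
      have gA: "gn p ?c \<in> ZA p" "gn p ?c \<in> BX p" using gW by (auto simp: Wz_def)
      have "v2 p (gn p ?c) = gn p ?c"
        using yB(5)[OF gA(2)] AK(2,3)[OF gA(1)] d0[OF ZAX[OF gA(1)]] by (simp add: v_def z0)
      thus ?thesis unfolding Fb_def DG Db using q gn(2)[OF prc] by simp
    qed
    show ?thesis
    proof
      fix m :: "(xsym \<times> nat \<times> 'y) \<times> tgen"
      obtain \<kappa> d b l where m: "m = ((\<kappa>, d, b), l)" by (metis prod.collapse)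
      show "F q (G q y) m = y m"
      proof (cases "m \<in> MS q")
        case False
        thus ?thesis using vec_out[OF y False] vec_out[OF vlD(1)[OF Fl vlD(1)[OF Gl y]] False] by simp
      next
        case True
        thus ?thesis using eqs eb
          by (cases l; cases \<kappa>) (auto simp: m F_def level_iff pr_def)
      qed
    qed
  qed
qed

lemma sections_retraction: "retraction F G H"
  unfolding retraction_def using Fl Gl Hl retract_A include_A retract_chain include_chain by blast

end

lemma (in split_pair) retraction_exists: "\<exists>F G H. retraction F G H"
proof -
  obtain sA where sA': "\<forall>q. vl (BA q) (vec (SA (Suc q))) (sA q) \<and> (\<forall>y\<in>BA q. D (sA q y) = y)"
    using choice[of "\<lambda>q s. vl (BA q) (vec (SA (Suc q))) s \<and> (\<forall>y\<in>BA q. D (s y) = y)"] section_A by blast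
  obtain sc where sc': "\<forall>q. vl (Nq q) (vec (SX (Suc q))) (sc q) \<and> (\<forall>y\<in>Nq q. prj (D (sc q y)) = y)"
    using choice[of "\<lambda>q s. vl (Nq q) (vec (SX (Suc q))) s \<and> (\<forall>y\<in>Nq q. prj (D (s y)) = y)"] section_quotient by blast
  obtain ge where ge': "\<forall>q. vl (FB Xe q) (ZX q) (ge q) \<and> (\<forall>y\<in>FB Xe q. \<phi> Xe q (ge q y) = y)"
    using choice[of "\<lambda>q s. vl (FB Xe q) (ZX q) s \<and> (\<forall>y\<in>FB Xe q. \<phi> Xe q (s y) = y)"] section_e by blast
  obtain gi where gi': "\<forall>q. vl (FB Xi q) (ZA q) (gi q) \<and> (\<forall>y\<in>FB Xi q. \<phi> Xi q (gi q y) = y)"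
    using choice[of "\<lambda>q s. vl (FB Xi q) (ZA q) s \<and> (\<forall>y\<in>FB Xi q. \<phi> Xi q (s y) = y)"] section_i by blast
  obtain gb where gb': "\<forall>q. vl (FB Xn q) {x\<in>vec (SX (Suc q)). D x \<in> Wz q} (gb q) \<and> (\<forall>y\<in>FB Xn q. \<phi> Xn q (D (gb q y)) = y)"
    using choice[of "\<lambda>q s. vl (FB Xn q) {x\<in>vec (SX (Suc q)). D x \<in> Wz q} s \<and> (\<forall>y\<in>FB Xn q. \<phi> Xn q (D (s y)) = y)"] section_n by blast
  have "split_sections R S A dg D B \<phi> sA sc ge gi gb"
    by unfold_locales (use sA' sc' ge' gi' gb' in blast)+
  thus ?thesis using split_sections.sections_retraction by blast
qed

subsection \<open>Cohomology of a densely split pair\<close>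

lemma subm_Int: "subm R M P \<Longrightarrow> subm R M Q \<Longrightarrow> subm R M (P \<inter> Q)"
  unfolding subm_def by blast

context cring begin

lemma dual_vanish:
  assumes f: "f \<in> covec S" and T: "T \<subseteq> S" and z: "\<And>\<mu>. \<mu> \<in> T \<Longrightarrow> f (free_gen R \<mu>) = \<zero>"
    and c: "c \<in> vec T"
  shows "f c = \<zero>"
proof -
  have TS: "x \<in> vec S" if "x \<in> vec T" for x by (rule vec_mono[OF that T])
  have "subm R (Fr T) {x\<in>vec T. f x = \<zero>}"
    by (rule submI) (use f TS dual_vec_zero[OF f] vec_add vec_smult in \<open>auto simp: dual_carrier\<close>)
  hence "{x\<in>vec T. f x = \<zero>} = vec T"
    by (rule free_span) (use z free_gen_carrier in auto)
  thus ?thesis using c by blast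
qed

lemma dual_vplus: "f \<in> covec S \<Longrightarrow> c \<in> vec S \<Longrightarrow> d \<in> vec S \<Longrightarrow> f (vplus c d) = f c \<oplus> f d"
  unfolding vplus_def by (rule dual_vec_add)

lemma pullback_vl: "vl (vec S) (vec S') u \<Longrightarrow> f \<in> covec S' \<Longrightarrow> pullback (vec S) u f \<in> covec S"
  by (rule pullback_closed[OF _ module_free]) (simp add: vl_lin)

end

context split_pair
begin

fun lt :: "xsym \<Rightarrow> tgen" where "lt Xe = Te" | "lt Xn = Tn" | "lt Xi = Ti"

lemma lt_letters [simp]: "lt \<kappa> \<in> letters \<kappa>" "tdeg (lt \<kappa>) = 0" "lt \<kappa> \<noteq> Tnbar" by (cases \<kappa>; simp)+

context
  fixes F G H assumes ret: "retraction F G H"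
begin

lemma ret_rules:
  shows Fl: "vl (vec (SX q)) (vec (MS q)) (F q)" and Gl: "vl (vec (MS q)) (vec (SX q)) (G q)"
    and Hl: "vl (vec (SX q)) (vec (SX (Suc q))) (H q)"
    and FA: "x \<in> vec (SA q) \<Longrightarrow> F q x \<in> vec (MA q)" and GA: "y \<in> vec (MA q) \<Longrightarrow> G q y \<in> vec (SA q)"
    and HA: "x \<in> vec (SA q) \<Longrightarrow> H q x \<in> vec (SA (Suc q))"
    and FD: "x \<in> vec (SX q) \<Longrightarrow> F (q - 1) (D x) = model_D (F q x)"
    and GD: "y \<in> vec (MS q) \<Longrightarrow> G (q - 1) (model_D y) = D (G q y)"
    and FG: "y \<in> vec (MS q) \<Longrightarrow> F q (G q y) = y"
    and hom: "x \<in> vec (SX q) \<Longrightarrow> x = vplus (G q (F q x)) (vplus (D (H q x)) (H (q - 1) (D x)))"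
  using ret unfolding retraction_def by blast+

lemma fMS [simp]: "finite (MS q)" "finite (MA q)" using finite_model by (auto simp: level_def)

lemma MAS: "y \<in> vec (MA q) \<Longrightarrow> y \<in> vec (MS q)" by (erule vec_mono) (rule level_mono, auto)

context fixes q :: nat begin

text \<open>The homotopy that ends in degree \<open>q\<close>.  In degree \<open>0\<close> it has to be zero, whereas \<open>H (q - 1)\<close> is \<open>H 0\<close>.\<close>

definition Hm where "Hm x = (if q = 0 then vzero else H (q - 1) x)"

lemma Hm_eq: "Hm = (\<lambda>x. if q = 0 then vzero else H (q - 1) x)"
  by (simp add: Hm_def fun_eq_iff)

lemma Hm_vl: "vl (vec (SX (q - 1))) (vec (SX q)) Hm"
  unfolding Hm_eq
proof (cases q)
  case 0 thus "vl (vec (SX (q - 1))) (vec (SX q)) (\<lambda>x. if q = 0 then vzero else H (q - 1) x)"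
    by (intro vlI) (auto simp: vplus_def)
next
  case (Suc p) thus "vl (vec (SX (q - 1))) (vec (SX q)) (\<lambda>x. if q = 0 then vzero else H (q - 1) x)"
    using Hl[of p] by simp
qed

lemma Hm_A: "vl (vec (SA (q - 1))) (vec (SA q)) Hm"
  unfolding Hm_eq
proof (cases q)
  case 0 thus "vl (vec (SA (q - 1))) (vec (SA q)) (\<lambda>x. if q = 0 then vzero else H (q - 1) x)"
    by (intro vlI) (auto simp: vplus_def)
next
  case (Suc p)
  have "vl (vec (SA p)) (vec (SA (Suc p))) (H p)"
    by (rule vl_range[OF vl_mono[OF Hl _ order_refl]]) (use AX HA in auto)
  thus "vl (vec (SA (q - 1))) (vec (SA q)) (\<lambda>x. if q = 0 then vzero else H (q - 1) x)"
    using Suc by simp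
qed

lemma HmD: "x \<in> vec (SX q) \<Longrightarrow> H (q - 1) (D x) = Hm (D x)"
  using D0[of x] vl_zero[OF Hl[of 0]] by (auto simp: Hm_def)

lemma co_hom:
  assumes f: "f \<in> covec (SX q)" and x: "x \<in> vec (SX q)" and 0: "f (D (H q x)) = \<zero>"
  shows "f x = f (G q (F q x)) \<oplus> f (Hm (D x))"
proof -
  have v: "G q (F q x) \<in> vec (SX q)" "D (H q x) \<in> vec (SX q)" "Hm (D x) \<in> vec (SX q)"
    using vlD(1)[OF Gl vlD(1)[OF Fl x]] vlD(1)[OF D_vl(1) vlD(1)[OF Hl x]] vlD(1)[OF Hm_vl vlD(1)[OF Dm x]] by auto
  have "f x = f (vplus (G q (F q x)) (vplus (D (H q x)) (Hm (D x))))" using hom[OF x] HmD[OF x] by simp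
  also have "\<dots> = f (G q (F q x)) \<oplus> (\<zero> \<oplus> f (Hm (D x)))"
    using v vsubD(3)[OF vsub_vec v(2,3)] by (simp add: dual_vplus[OF f] 0)
  finally show ?thesis using dual_in[OF f v(1)] dual_in[OF f v(3)] by simp
qed

lemma co_hom_A:
  assumes f: "f \<in> covec (SA q)" and x: "x \<in> vec (SA q)" and 0: "f (D (H q x)) = \<zero>"
  shows "f x = f (G q (F q x)) \<oplus> f (Hm (D x))"
proof -
  have v: "G q (F q x) \<in> vec (SA q)" "D (H q x) \<in> vec (SA q)" "Hm (D x) \<in> vec (SA q)"
    using GA[OF FA[OF x]] vlD(1)[OF D_vl(2) HA[OF x]] vlD(1)[OF Hm_A DmA[OF x]] by auto
  have "f x = f (vplus (G q (F q x)) (vplus (D (H q x)) (Hm (D x))))" using hom[OF AX[OF x]] HmD[OF AX[OF x]] by simp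
  also have "\<dots> = f (G q (F q x)) \<oplus> (\<zero> \<oplus> f (Hm (D x)))"
    using v vsubD(3)[OF vsub_vec v(2,3)] by (simp add: dual_vplus[OF f] 0)
  finally show ?thesis using dual_in[OF f v(1)] dual_in[OF f v(3)] by simp
qed

text \<open>The representative of the class \<open>b\<close>.\<close>

definition gen where "gen \<kappa> b = G q (free_gen R ((\<kappa>, q, b), lt \<kappa>))"

lemma delta_in: "b \<in> B \<kappa> q \<Longrightarrow> free_gen R ((\<kappa>, q, b), lt \<kappa>) \<in> vec (MS q)"
  by (rule free_gen_carrier) (simp add: level_iff)

lemma delta_in_A: "b \<in> B \<kappa> q \<Longrightarrow> \<kappa> \<noteq> Xe \<Longrightarrow> free_gen R ((\<kappa>, q, b), lt \<kappa>) \<in> vec (MA q)"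
  by (rule free_gen_carrier) (cases \<kappa>; simp add: level_iff)

lemma gen_in: "b \<in> B \<kappa> q \<Longrightarrow> gen \<kappa> b \<in> vec (SX q)" unfolding gen_def by (rule vlD(1)[OF Gl delta_in])

lemma gen_in_A: "b \<in> B \<kappa> q \<Longrightarrow> \<kappa> \<noteq> Xe \<Longrightarrow> gen \<kappa> b \<in> vec (SA q)" unfolding gen_def by (rule GA[OF delta_in_A])

lemma gen_cycle: assumes "b \<in> B \<kappa> q" shows "D (gen \<kappa> b) = vzero"
proof -
  have "model_D (free_gen R ((\<kappa>, q, b), lt \<kappa>)) = vzero"
    using lt_letters(3)[of \<kappa>] lt_letters(3)[of \<kappa>, symmetric] by (auto simp: fun_eq_iff free_gen_def)
  thus ?thesis using GD[OF delta_in[OF assms]] vl_zero[OF Gl] by (simp add: gen_def)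
qed

lemma gen_n_boundary:
  assumes b: "b \<in> B Xn q"
  shows "gen Xn b = D (G (Suc q) (free_gen R ((Xn, q, b), Tnbar)))"
    and "G (Suc q) (free_gen R ((Xn, q, b), Tnbar)) \<in> vec (SX (Suc q))"
proof -
  have d: "free_gen R ((Xn, q, b), Tnbar) \<in> vec (MS (Suc q))"
    by (rule free_gen_carrier) (simp add: level_iff b)
  have "model_D (free_gen R ((Xn, q, b), Tnbar)) = free_gen R ((Xn, q, b), Tn)"
    by (auto simp: fun_eq_iff free_gen_def)
  thus "gen Xn b = D (G (Suc q) (free_gen R ((Xn, q, b), Tnbar)))"
    using GD[OF d] by (simp add: gen_def)
  show "G (Suc q) (free_gen R ((Xn, q, b), Tnbar)) \<in> vec (SX (Suc q))" by (rule vlD(1)[OF Gl d])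
qed

definition ev where "ev \<kappa> f = (\<lambda>b. if b \<in> B \<kappa> q then f (gen \<kappa> b) else \<zero>)"

lemma ev_zero: "ev \<kappa> f = vzero \<longleftrightarrow> (\<forall>b\<in>B \<kappa> q. f (gen \<kappa> b) = \<zero>)"
  by (auto simp: ev_def fun_eq_iff)

lemma ev_lin:
  assumes P: "P \<subseteq> covec T" and T: "\<And>b. b \<in> B \<kappa> q \<Longrightarrow> gen \<kappa> b \<in> vec T"
  shows "lin R (Du T\<lparr>carrier := P\<rparr>) (Fr (B \<kappa> q)) (ev \<kappa>)"
proof (rule linI)
  fix f assume "f \<in> carrier (Du T\<lparr>carrier := P\<rparr>)"
  hence f: "f \<in> covec T" using P by auto
  show "ev \<kappa> f \<in> carrier (Fr (B \<kappa> q))"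
    using dual_in[OF f T] by (auto simp: free_mod_carrier_fin finite_B ev_def)
qed (use T in \<open>auto simp: ev_def fun_eq_iff\<close>)

text \<open>The functional on the model with values \<open>y\<close> on the classes of kind \<open>\<kappa>\<close> and zero on all others.  Its composite with
  the retraction is a cochain with prescribed values on the representatives.\<close>

definition yh where "yh \<kappa> y = (\<lambda>c\<in>vec (MS q). \<Oplus>b\<in>B \<kappa> q. y b \<otimes> c ((\<kappa>, q, b), lt \<kappa>))"

lemma yh_dual:
  assumes y: "y \<in> FB \<kappa> q"
  shows "yh \<kappa> y \<in> covec (MS q)"
  unfolding dual_carrier
proof (intro conjI ballI)
  note yc = vec_in[OF y]
  show "yh \<kappa> y \<in> vec (MS q) \<rightarrow>\<^sub>E carrier R"
    using yc by (auto simp: yh_def intro!: finsum_closed)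
  fix c d assume c: "c \<in> vec (MS q)" and d: "d \<in> vec (MS q)"
  have "(\<Oplus>b\<in>B \<kappa> q. y b \<otimes> (c ((\<kappa>, q, b), lt \<kappa>) \<oplus> d ((\<kappa>, q, b), lt \<kappa>)))
      = (\<Oplus>b\<in>B \<kappa> q. y b \<otimes> c ((\<kappa>, q, b), lt \<kappa>) \<oplus> y b \<otimes> d ((\<kappa>, q, b), lt \<kappa>))"
    by (rule add.finprod_cong') (use yc vec_in[OF c] vec_in[OF d] in \<open>auto simp: r_distr\<close>)
  thus "yh \<kappa> y (c \<oplus>\<^bsub>Fr (MS q)\<^esub> d) = yh \<kappa> y c \<oplus> yh \<kappa> y d"
    using c d vec_add[OF c d] yc vec_in[OF c] vec_in[OF d] by (simp add: yh_def finsum_addf Pi_iff)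
next
  note yc = vec_in[OF y]
  fix a c assume a: "a \<in> carrier R" and c: "c \<in> vec (MS q)"
  have "(\<Oplus>b\<in>B \<kappa> q. y b \<otimes> (a \<otimes> c ((\<kappa>, q, b), lt \<kappa>))) = (\<Oplus>b\<in>B \<kappa> q. a \<otimes> (y b \<otimes> c ((\<kappa>, q, b), lt \<kappa>)))"
    by (rule add.finprod_cong') (use yc vec_in[OF c] a in \<open>auto simp: m_lcomm\<close>)
  thus "yh \<kappa> y (a \<odot>\<^bsub>Fr (MS q)\<^esub> c) = a \<otimes> yh \<kappa> y c"
    using a c vec_smult[OF a c] yc vec_in[OF c] finite_B by (simp add: yh_def finsum_rdistr Pi_iff)
qed

lemma yh_delta:
  assumes y: "y \<in> FB \<kappa> q" and b: "b \<in> B \<kappa> q"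
  shows "yh \<kappa> y (free_gen R ((\<kappa>, q, b), lt \<kappa>)) = y b"
proof -
  have "(\<Oplus>d\<in>B \<kappa> q. y d \<otimes> free_gen R ((\<kappa>, q, b), lt \<kappa>) ((\<kappa>, q, d), lt \<kappa>)) = (\<Oplus>d\<in>B \<kappa> q. if b = d then y d else \<zero>)"
    by (rule add.finprod_cong') (use vec_in[OF y] in \<open>auto simp: free_gen_def\<close>)
  also have "\<dots> = y b" by (rule add.finprod_singleton[OF b finite_B]) (use vec_in[OF y] in auto)
  finally show ?thesis using delta_in[OF b] by (simp add: yh_def)
qed

lemma yh_vanish:
  assumes "y \<in> FB \<kappa> q" "c \<in> vec (MS q)" "\<And>b. b \<in> B \<kappa> q \<Longrightarrow> c ((\<kappa>, q, b), lt \<kappa>) = \<zero>"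
  shows "yh \<kappa> y c = \<zero>"
  using assms vec_in[OF assms(1)] by (auto simp: yh_def intro!: finsum_zero_eq)

lemma ev_yh:
  assumes y: "y \<in> FB \<kappa> q" and T: "\<And>b. b \<in> B \<kappa> q \<Longrightarrow> gen \<kappa> b \<in> vec T"
  shows "ev \<kappa> (pullback (vec T) (F q) (yh \<kappa> y)) = y"
proof
  fix b
  show "ev \<kappa> (pullback (vec T) (F q) (yh \<kappa> y)) b = y b"
  proof (cases "b \<in> B \<kappa> q")
    case True
    thus ?thesis using T[OF True] yh_delta[OF y True] FG[OF delta_in[OF True]] by (simp add: ev_def gen_def)
  qed (use vec_out[OF y] in \<open>simp add: ev_def\<close>)
qed

lemma yh_cocycle:
  assumes y: "y \<in> FB \<kappa> q" and k: "\<kappa> \<noteq> Xn"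
  shows "pullback (vec (SX q)) (F q) (yh \<kappa> y) \<in> Zco SX D q"
  unfolding Zco_iff
proof (intro conjI ballI)
  show "pullback (vec (SX q)) (F q) (yh \<kappa> y) \<in> covec (SX q)"
    by (rule pullback_vl[OF Fl yh_dual[OF y]])
  fix c assume c: "c \<in> vec (SX (Suc q))"
  have Dc: "D c \<in> vec (SX q)" by (rule vlD(1)[OF D_vl(1) c])
  have FDc: "F q (D c) = model_D (F (Suc q) c)" using FD[OF c] by simp
  have "yh \<kappa> y (F q (D c)) = \<zero>"
    by (rule yh_vanish[OF y vlD(1)[OF Fl Dc]]) (use k in \<open>cases \<kappa>; simp add: FDc\<close>)
  thus "pullback (vec (SX q)) (F q) (yh \<kappa> y) (D c) = \<zero>" using Dc by simp
qed

lemma restrict_pullback: "restrict f (vec (SA q)) = pullback (vec (SA q)) (\<lambda>x. x) f"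
  by (simp add: pullback_def)

lemma res_lin: "lin R (Du (SX q)) (Du (SA q)) (\<lambda>f. restrict f (vec (SA q)))"
  unfolding restrict_pullback
  by (rule pullback_lin[OF _ module_free]) (use AX in \<open>auto simp: vl_lin[symmetric] intro!: vl_id\<close>)

lemma res_dual: "f \<in> covec (SX q) \<Longrightarrow> restrict f (vec (SA q)) \<in> covec (SA q)"
  by (rule lin_closed[OF res_lin])

lemma res_Zco: "f \<in> Zco SX D q \<Longrightarrow> restrict f (vec (SA q)) \<in> Zco SA D q"
  unfolding Zco_iff using res_dual vlD(1)[OF D_vl(2)[of q]] AX[of _ "Suc q"] by (auto simp del: restrict_apply) (simp)

lemma res_Bco: "f \<in> Bco SX D q \<Longrightarrow> restrict f (vec (SA q)) \<in> Bco SA D q"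
proof -
  assume f: "f \<in> Bco SX D q"
  then obtain g where g: "f \<in> covec (SX q)" "g \<in> covec (SX (q - 1))"
    "\<And>c. c \<in> vec (SX q) \<Longrightarrow> f c = g (D c)" unfolding Bco_iff[OF cX] by blast
  have "pullback (vec (SA (q - 1))) (\<lambda>x. x) g \<in> covec (SA (q - 1))"
    by (rule pullback_vl[OF vl_id g(2)]) (use AX in auto)
  thus ?thesis unfolding Bco_iff[OF cA]
    using res_dual[OF g(1)] g(3) AX DmA by (auto intro!: bexI[of _ "pullback (vec (SA (q - 1))) (\<lambda>x. x) g"])
qed

lemma ker_sub: "subm R (Du (SX q)) {f \<in> Zco SX D q. restrict f (vec (SA q)) \<in> Bco SA D q}"
proof -
  note md = module_dual[OF module_free]
  have "subm R (Du (SX q)) {f \<in> covec (SX q). restrict f (vec (SA q)) \<in> Bco SA D q}"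
    by (rule subm_kernel[OF md md res_lin cpx_subm_co(2)[OF cA]])
  hence "subm R (Du (SX q)) (Zco SX D q \<inter> {f \<in> covec (SX q). restrict f (vec (SA q)) \<in> Bco SA D q})"
    by (rule subm_Int[OF cpx_subm_co(1)[OF cX]])
  moreover have "Zco SX D q \<inter> {f \<in> covec (SX q). restrict f (vec (SA q)) \<in> Bco SA D q}
      = {f \<in> Zco SX D q. restrict f (vec (SA q)) \<in> Bco SA D q}"
    unfolding Zco_iff set_eq_iff Int_iff mem_Collect_eq by blast
  ultimately show ?thesis by simp
qed

lemma Bco_gen: "f \<in> Bco SX D q \<Longrightarrow> b \<in> B \<kappa> q \<Longrightarrow> f (gen \<kappa> b) = \<zero>"
  unfolding Bco_iff[OF cX] using gen_in[of b \<kappa>] gen_cycle[of b \<kappa>] dual_vec_zero by auto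

lemma Bco_gen_A: "f \<in> Bco SA D q \<Longrightarrow> b \<in> B \<kappa> q \<Longrightarrow> \<kappa> \<noteq> Xe \<Longrightarrow> f (gen \<kappa> b) = \<zero>"
  unfolding Bco_iff[OF cA] using gen_in_A[of b \<kappa>] gen_cycle[of b \<kappa>] dual_vec_zero by auto

lemma Zco_gen_n: "f \<in> Zco SX D q \<Longrightarrow> b \<in> B Xn q \<Longrightarrow> f (gen Xn b) = \<zero>"
  unfolding Zco_iff using gen_n_boundary by simp

text \<open>The retract of the subcomplex has the representatives of kinds \<open>Xn\<close> and \<open>Xi\<close> as basis.  If a cocycle vanishes on
  them, the homotopy identity leaves only the term in which it is composed with the homotopy, evaluated at \<open>D x\<close>.\<close>

lemma coboundary_A:
  assumes f: "f \<in> Zco SA D q" and z: "\<And>b. b \<in> B Xn q \<Longrightarrow> f (gen Xn b) = \<zero>" "\<And>b. b \<in> B Xi q \<Longrightarrow> f (gen Xi b) = \<zero>"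
  shows "f \<in> Bco SA D q"
proof -
  have fd: "f \<in> covec (SA q)" and f0: "\<And>c. c \<in> vec (SA (Suc q)) \<Longrightarrow> f (D c) = \<zero>"
    using f by (auto simp: Zco_iff)
  have GAl: "vl (vec (MA q)) (vec (SA q)) (G q)"
    by (rule vl_range[OF vl_mono[OF Gl _ order_refl] GA]) (use MAS in auto)
  have fG: "f (G q y) = \<zero>" if y: "y \<in> vec (MA q)" for y
  proof -
    have "pullback (vec (MA q)) (G q) f y = \<zero>"
    proof (rule dual_vanish[OF pullback_vl[OF GAl fd] order_refl _ y])
      fix \<mu> assume m: "\<mu> \<in> MA q"
      obtain \<kappa> d b l where \<mu>: "\<mu> = ((\<kappa>, d, b), l)" by (metis prod.collapse)
      hence "\<mu> = ((Xn, q, b), Tn) \<and> b \<in> B Xn q \<or> \<mu> = ((Xi, q, b), Ti) \<and> b \<in> B Xi q"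
        using m by (cases \<kappa>) (auto simp: level_iff)
      hence "f (G q (free_gen R \<mu>)) = \<zero>" using z by (auto simp: gen_def)
      thus "pullback (vec (MA q)) (G q) f (free_gen R \<mu>) = \<zero>" using free_gen_carrier[OF m] by simp
    qed
    thus ?thesis using y by simp
  qed
  have "f x = pullback (vec (SA (q - 1))) Hm f (D x)" if x: "x \<in> vec (SA q)" for x
    using co_hom_A[OF fd x f0[OF HA[OF x]]] fG[OF FA[OF x]] DmA[OF x] dual_in[OF fd vlD(1)[OF Hm_A DmA[OF x]]] by simp
  thus ?thesis unfolding Bco_iff[OF cA] using fd pullback_vl[OF Hm_A fd] by blast
qed

text \<open>A cocycle of the whole complex vanishes on the representatives of kind \<open>Xn\<close>, since these bound.  So it restricts to a
  coboundary iff it vanishes on kind \<open>Xi\<close>.\<close>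

lemma coh_im: "presents R (Du (SX q)\<lparr>carrier := Zco SX D q\<rparr>) (ev Xi) (Fr (B Xi q))
    {f \<in> Zco SX D q. restrict f (vec (SA q)) \<in> Bco SA D q}"
  unfolding presents_def
proof (intro conjI)
  note md = module_dual[OF module_free]
  show "Module.module R (Du (SX q)\<lparr>carrier := Zco SX D q\<rparr>)" by (rule module_subm[OF md cpx_subm_co(1)[OF cX]])
  show "Module.module R (Fr (B Xi q))" by (rule module_free)
  show l: "lin R (Du (SX q)\<lparr>carrier := Zco SX D q\<rparr>) (Fr (B Xi q)) (ev Xi)"
    by (rule ev_lin) (auto simp: Zco_iff gen_in)
  have "y \<in> ev Xi ` Zco SX D q" if y: "y \<in> FB Xi q" for y
    by (rule image_eqI[OF _ yh_cocycle[OF y]]) (use ev_yh[OF y gen_in] in auto)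
  thus "ev Xi ` carrier (Du (SX q)\<lparr>carrier := Zco SX D q\<rparr>) = carrier (Fr (B Xi q))"
    using lin_closed[OF l] by auto
  have "ev Xi f = vzero \<longleftrightarrow> restrict f (vec (SA q)) \<in> Bco SA D q" if f: "f \<in> Zco SX D q" for f
  proof
    assume e: "ev Xi f = vzero"
    show "restrict f (vec (SA q)) \<in> Bco SA D q"
      by (rule coboundary_A[OF res_Zco[OF f]]) (use e Zco_gen_n[OF f] gen_in_A in \<open>auto simp: ev_zero\<close>)
  next
    assume "restrict f (vec (SA q)) \<in> Bco SA D q"
    thus "ev Xi f = vzero" unfolding ev_zero using Bco_gen_A[of _ _ Xi] gen_in_A[of _ Xi] by fastforce
  qed
  thus "{f \<in> carrier (Du (SX q)\<lparr>carrier := Zco SX D q\<rparr>). ev Xi f = \<zero>\<^bsub>Fr (B Xi q)\<^esub>}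
      = {f \<in> Zco SX D q. restrict f (vec (SA q)) \<in> Bco SA D q}" by auto
qed

text \<open>If the restriction is a coboundary, the values on kinds \<open>Xn\<close> and \<open>Xi\<close> vanish, and those on \<open>Xe\<close> determine the class.\<close>

lemma coh_ker: "presents R (Du (SX q)\<lparr>carrier := {f \<in> Zco SX D q. restrict f (vec (SA q)) \<in> Bco SA D q}\<rparr>)
    (ev Xe) (Fr (B Xe q)) (Bco SX D q)"
  unfolding presents_def
proof (intro conjI)
  note md = module_dual[OF module_free]
  let ?P = "{f \<in> Zco SX D q. restrict f (vec (SA q)) \<in> Bco SA D q}"
  show "Module.module R (Du (SX q)\<lparr>carrier := ?P\<rparr>)" by (rule module_subm[OF md ker_sub])
  show "Module.module R (Fr (B Xe q))" by (rule module_free)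
  show l: "lin R (Du (SX q)\<lparr>carrier := ?P\<rparr>) (Fr (B Xe q)) (ev Xe)"
    by (rule ev_lin) (auto simp: Zco_iff gen_in)
  have "y \<in> ev Xe ` ?P" if y: "y \<in> FB Xe q" for y
  proof (rule image_eqI)
    let ?f = "pullback (vec (SX q)) (F q) (yh Xe y)"
    show "y = ev Xe ?f" using ev_yh[OF y gen_in] by simp
    have fd: "?f \<in> Zco SX D q" by (rule yh_cocycle[OF y]) simp
    have "?f x = \<zero>" if x: "x \<in> vec (SA q)" for x
    proof -
      have "yh Xe y (F q x) = \<zero>"
        by (rule yh_vanish[OF y MAS[OF FA[OF x]]]) (use vec_out[OF FA[OF x]] in \<open>simp add: level_iff\<close>)
      thus ?thesis using AX[OF x] by simp
    qed
    hence "restrict ?f (vec (SA q)) = (\<lambda>x\<in>vec (SA q). \<zero>)" by (intro restrict_ext)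
    also have "\<dots> \<in> Bco SA D q" using cpx_subm_co(2)[OF cA, of q] by (simp add: subm_def)
    finally show "?f \<in> ?P" using fd by simp
  qed
  thus "ev Xe ` carrier (Du (SX q)\<lparr>carrier := ?P\<rparr>) = carrier (Fr (B Xe q))"
    using lin_closed[OF l] by auto
  have "ev Xe f = vzero \<longleftrightarrow> f \<in> Bco SX D q" if f: "f \<in> ?P" for f
  proof
    assume e: "ev Xe f = vzero"
    have fd: "f \<in> covec (SX q)" and f0: "\<And>c. c \<in> vec (SX (Suc q)) \<Longrightarrow> f (D c) = \<zero>"
      using f by (auto simp: Zco_iff)
    have fB: "restrict f (vec (SA q)) \<in> Bco SA D q" using f by simp
    let ?fG = "pullback (vec (MS q)) (G q) f"
    have fG: "?fG \<in> covec (MS q)" by (rule pullback_vl[OF Gl fd])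
    let ?T = "{m\<in>MS q. snd m \<noteq> Tnbar}"
    define up where "up c = (\<lambda>m :: (xsym \<times> nat \<times> 'y) \<times> tgen. if q \<noteq> 0 \<and> snd m = Tnbar then c (fst m, Tn) else \<zero>)" for c :: "_ \<Rightarrow> 'a"
    have up: "vl (vec (MS (q - 1))) (vec (MS q)) up"
    proof (rule vlI)
      fix c assume c: "c \<in> vec (MS (q - 1))"
      have "up c ((\<kappa>, d, b), l) = \<zero>" if n: "((\<kappa>, d, b), l) \<notin> MS q" for \<kappa> d b l
      proof -
        have "d \<noteq> q - Suc 0" if "q \<noteq> 0" "Suc d \<noteq> q" using that by arith
        thus ?thesis using n vec_out[OF c, of "((\<kappa>, d, b), Tn)"] by (cases \<kappa>) (auto simp: up_def level_iff)
      qed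
      thus "up c \<in> vec (MS q)" using vec_in[OF c] by (auto simp: free_mod_carrier_fin) (auto simp: up_def)
    qed (auto simp: up_def vplus_def fun_eq_iff)
    have low: "?fG y = \<zero>" if y: "y \<in> vec ?T" for y
    proof (rule dual_vanish[OF fG _ _ y])
      fix \<mu> assume m: "\<mu> \<in> ?T"
      obtain \<kappa> d b l where \<mu>: "\<mu> = ((\<kappa>, d, b), l)" by (metis prod.collapse)
      hence m': "d = q" "b \<in> B \<kappa> q" "l = lt \<kappa>" using m by (cases \<kappa>; auto simp: level_iff)+
      have "f (gen \<kappa> b) = \<zero>"
      proof (cases "\<kappa> = Xe")
        case True thus ?thesis using e m' by (simp add: ev_zero)
      next
        case False thus ?thesis using Bco_gen_A[OF fB m'(2) False] gen_in_A[OF m'(2) False] by simp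
      qed
      thus "?fG (free_gen R \<mu>) = \<zero>" using m' \<mu> delta_in[OF m'(2)] by (simp add: gen_def)
    qed auto
    have split: "?fG y = ?fG (up (model_D y))" if y: "y \<in> vec (MS q)" for y
    proof -
      define t where "t = (\<lambda>m. if snd m = Tnbar then \<zero> else y m)"
      have t: "t \<in> vec ?T" using vec_in[OF y] vec_out[OF y] by (auto simp: t_def free_mod_carrier_fin)
      have q0: "y (\<beta>, Tnbar) = \<zero>" if "q = 0" for \<beta>
        using vec_out[OF y, of "(\<beta>, Tnbar)"] that by (cases \<beta>) (auto simp: level_iff)
      have e: "y = vplus t (up (model_D y))"
      proof
        fix m :: "(xsym \<times> nat \<times> 'y) \<times> tgen"
        obtain \<beta> l where m: "m = (\<beta>, l)" by (cases m)
        show "y m = vplus t (up (model_D y)) m"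
          using vec_in[OF y] q0 by (auto simp: m t_def up_def vplus_def)
      qed
      have uv: "up (model_D y) \<in> vec (MS q)"
      proof -
        have "up (model_D y) = vdiff y t" using e vec_in[OF y] q0 by (auto simp: vdiff_def t_def up_def fun_eq_iff a_minus_def r_neg)
        thus ?thesis using vsubD(5)[OF vsub_vec y vec_mono[OF t]] by auto
      qed
      have "?fG y = ?fG (vplus t (up (model_D y)))" using e by simp
      also have "\<dots> = ?fG t \<oplus> ?fG (up (model_D y))"
        by (rule dual_vplus[OF fG vec_mono[OF t] uv]) auto
      finally show ?thesis using low[OF t] dual_in[OF fG uv] by simp
    qed
    let ?g1 = "pullback (vec (SX (q - 1))) (\<lambda>x. up (F (q - 1) x)) ?fG" and ?g2 = "pullback (vec (SX (q - 1))) Hm f"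
    have g: "?g1 \<in> covec (SX (q - 1))" "?g2 \<in> covec (SX (q - 1))"
      by (rule pullback_vl[OF vl_comp[OF Fl up] fG], rule pullback_vl[OF Hm_vl fd])
    have gg: "?g1 \<oplus>\<^bsub>Du (SX (q - 1))\<^esub> ?g2 \<in> covec (SX (q - 1))"
      by (rule abelian_monoid.a_closed[OF abelian_group.axioms(1)[OF Module.module.axioms(2)[OF md]] g])
    have "f x = (?g1 \<oplus>\<^bsub>Du (SX (q - 1))\<^esub> ?g2) (D x)" if x: "x \<in> vec (SX q)" for x
    proof -
      have Fx: "F q x \<in> vec (MS q)" by (rule vlD(1)[OF Fl x])
      have "f (G q (F q x)) = ?fG (up (model_D (F q x)))" using split[OF Fx] Fx by simp
      also have "\<dots> = ?g1 (D x)" using vlD(1)[OF Dm x] FD[OF x] by simp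
      finally have "f (G q (F q x)) = ?g1 (D x)" .
      thus ?thesis using co_hom[OF fd x f0[OF vlD(1)[OF Hl x]]] vlD(1)[OF Dm x] by simp
    qed
    thus "f \<in> Bco SX D q" unfolding Bco_iff[OF cX] using fd gg by blast
  qed (use Bco_gen[of f _ Xe] in \<open>auto simp: ev_zero\<close>)
  moreover have "Bco SX D q \<subseteq> ?P" using cpx_subm_co(3)[OF cX] res_Bco by auto
  ultimately show "{f \<in> carrier (Du (SX q)\<lparr>carrier := ?P\<rparr>). ev Xe f = \<zero>\<^bsub>Fr (B Xe q)\<^esub>} = Bco SX D q" by auto
qed

text \<open>The values on kind \<open>Xi\<close> can be removed by restricting a cocycle of the whole complex, those on kind \<open>Xn\<close> cannot.\<close>

lemma coh_coker: "presents R (Du (SA q)\<lparr>carrier := Zco SA D q\<rparr>) (ev Xn) (Fr (B Xn q))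
    {f \<in> Zco SA D q. \<exists>h\<in>Zco SX D q. f \<ominus>\<^bsub>Du (SA q)\<^esub> restrict h (vec (SA q)) \<in> Bco SA D q}"
  unfolding presents_def
proof (intro conjI)
  note md = module_dual[OF module_free]
  show "Module.module R (Du (SA q)\<lparr>carrier := Zco SA D q\<rparr>)" by (rule module_subm[OF md cpx_subm_co(1)[OF cA]])
  show "Module.module R (Fr (B Xn q))" by (rule module_free)
  show l: "lin R (Du (SA q)\<lparr>carrier := Zco SA D q\<rparr>) (Fr (B Xn q)) (ev Xn)"
    by (rule ev_lin) (auto simp: Zco_iff gen_in_A)
  have FAS: "vl (vec (SA q)) (vec (MS q)) (F q)"
    by (rule vl_mono[OF Fl _ order_refl]) (use AX in auto)
  have "y \<in> ev Xn ` Zco SA D q" if y: "y \<in> FB Xn q" for y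
  proof (rule image_eqI)
    let ?f = "pullback (vec (SA q)) (F q) (yh Xn y)"
    show "y = ev Xn ?f" using ev_yh[OF y gen_in_A] by simp
    show "?f \<in> Zco SA D q" unfolding Zco_iff
    proof (intro conjI ballI)
      show "?f \<in> covec (SA q)" by (rule pullback_vl[OF FAS yh_dual[OF y]])
      fix c assume c: "c \<in> vec (SA (Suc q))"
      have "F q (D c) = model_D (F (Suc q) c)" using FD[OF AX[OF c]] by simp
      also have "\<dots> = vzero" using vec_out[OF FA[OF c]] by (auto simp: fun_eq_iff level_iff)
      finally show "?f (D c) = \<zero>" using vlD(1)[OF D_vl(2) c] dual_vec_zero[OF yh_dual[OF y]] by simp
    qed
  qed
  thus "ev Xn ` carrier (Du (SA q)\<lparr>carrier := Zco SA D q\<rparr>) = carrier (Fr (B Xn q))"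
    using lin_closed[OF l] by auto
  have "ev Xn f = vzero \<longleftrightarrow> (\<exists>h\<in>Zco SX D q. f \<ominus>\<^bsub>Du (SA q)\<^esub> restrict h (vec (SA q)) \<in> Bco SA D q)"
    if f: "f \<in> Zco SA D q" for f
  proof
    have fd: "f \<in> covec (SA q)" using f by (simp add: Zco_iff)
    {
      assume e: "ev Xn f = vzero"
      define y where "y = ev Xi f"
      have y: "y \<in> FB Xi q"
        using dual_in[OF fd gen_in_A[of _ Xi]] by (auto simp: y_def ev_def free_mod_carrier_fin finite_B)
      let ?h = "pullback (vec (SX q)) (F q) (yh Xi y)"
      have h: "?h \<in> Zco SX D q" by (rule yh_cocycle[OF y]) simp
      have hA: "restrict ?h (vec (SA q)) \<in> Zco SA D q" by (rule res_Zco[OF h])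
      have dz: "f \<ominus>\<^bsub>Du (SA q)\<^esub> restrict ?h (vec (SA q)) \<in> Zco SA D q"
        by (rule subm_minus[OF md cpx_subm_co(1)[OF cA] f hA])
      have hd: "restrict ?h (vec (SA q)) \<in> covec (SA q)" using hA by (simp add: Zco_iff)
      have val: "(f \<ominus>\<^bsub>Du (SA q)\<^esub> restrict ?h (vec (SA q))) x = f x \<ominus> ?h x" if "x \<in> vec (SA q)" for x
        using that by (simp add: dual_minus[OF module_free fd hd])
      have "f \<ominus>\<^bsub>Du (SA q)\<^esub> restrict ?h (vec (SA q)) \<in> Bco SA D q"
      proof (rule coboundary_A[OF dz])
        fix b assume b: "b \<in> B Xn q"
        thus "(f \<ominus>\<^bsub>Du (SA q)\<^esub> restrict ?h (vec (SA q))) (gen Xn b) = \<zero>"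
          using val[OF gen_in_A[OF b]] e Zco_gen_n[OF h b] by (simp add: ev_zero a_minus_def)
      next
        fix b assume b: "b \<in> B Xi q"
        have gb: "gen Xi b \<in> vec (SA q)" by (rule gen_in_A[OF b]) simp
        have "?h (gen Xi b) = f (gen Xi b)"
          using fun_cong[OF ev_yh[OF y gen_in], of b] b by (simp add: y_def ev_def)
        thus "(f \<ominus>\<^bsub>Du (SA q)\<^esub> restrict ?h (vec (SA q))) (gen Xi b) = \<zero>"
          using val[OF gb] dual_in[OF fd gb] by (simp add: a_minus_def r_neg)
      qed
      thus "\<exists>h\<in>Zco SX D q. f \<ominus>\<^bsub>Du (SA q)\<^esub> restrict h (vec (SA q)) \<in> Bco SA D q" using h by blast
    next
      assume "\<exists>h\<in>Zco SX D q. f \<ominus>\<^bsub>Du (SA q)\<^esub> restrict h (vec (SA q)) \<in> Bco SA D q"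
      then obtain h where h: "h \<in> Zco SX D q" "f \<ominus>\<^bsub>Du (SA q)\<^esub> restrict h (vec (SA q)) \<in> Bco SA D q" by blast
      have hd: "restrict h (vec (SA q)) \<in> covec (SA q)" using res_Zco[OF h(1)] by (simp add: Zco_iff)
      have "f (gen Xn b) = \<zero>" if b: "b \<in> B Xn q" for b
      proof -
        have gb: "gen Xn b \<in> vec (SA q)" by (rule gen_in_A[OF b]) simp
        have "f (gen Xn b) \<ominus> h (gen Xn b) = \<zero>"
          using Bco_gen_A[OF h(2) b] gb by (simp add: dual_minus[OF module_free fd hd])
        thus ?thesis using Zco_gen_n[OF h(1) b] dual_in[OF fd gb] by (simp add: a_minus_def)
      qed
      thus "ev Xn f = vzero" by (simp add: ev_zero)
    }
  qed
  thus "{f \<in> carrier (Du (SA q)\<lparr>carrier := Zco SA D q\<rparr>). ev Xn f = \<zero>\<^bsub>Fr (B Xn q)\<^esub>}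
      = {f \<in> Zco SA D q. \<exists>h\<in>Zco SX D q. f \<ominus>\<^bsub>Du (SA q)\<^esub> restrict h (vec (SA q)) \<in> Bco SA D q}" by auto
qed

end
end
end

section \<open>Differentials, blocks and factors of tensor complexes\<close>

context cring begin

lemma antisym_sum:
  assumes "finite I" and f: "\<And>k l. f k l \<in> carrier R" and d: "\<And>k. f k k = \<zero>"
    and a: "\<And>k l. k \<noteq> l \<Longrightarrow> f k l \<oplus> f l k = \<zero>"
  shows "(\<Oplus>k\<in>I. \<Oplus>l\<in>I. f k l) = \<zero>"
  using assms(1)
proof (induction I rule: finite_induct)
  case (insert i J)
  have ni: "k \<noteq> i" if "k \<in> J" for k using insert that by auto
  have "(\<Oplus>k\<in>insert i J. \<Oplus>l\<in>insert i J. f k l) = (\<Oplus>l\<in>J. f i l) \<oplus> (\<Oplus>k\<in>J. f k i \<oplus> (\<Oplus>l\<in>J. f k l))"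
    using insert f d by (simp add: Pi_iff a_comm)
  also have "\<dots> = (\<Oplus>l\<in>J. f i l) \<oplus> ((\<Oplus>k\<in>J. f k i) \<oplus> (\<Oplus>k\<in>J. \<Oplus>l\<in>J. f k l))"
    using f by (simp add: finsum_addf Pi_iff)
  also have "\<dots> = (\<Oplus>k\<in>J. f i k \<oplus> f k i)" using insert f by (simp add: finsum_addf Pi_iff)
  also have "\<dots> = \<zero>" by (rule finsum_zero_eq) (use a ni in metis)
  finally show ?case .
qed simp

end

context tensor_complex begin

text \<open>The terms for two positions commute up to the Koszul sign, which is opposite for the two orders.\<close>

lemma dtot_sq:
  assumes S: "admissible S" and DD: "\<And>k p x. k \<in> I \<Longrightarrow> x \<in> vec {a\<in>S k. dg k a = p} \<Longrightarrow> D k (D k x) = (\<lambda>_. \<zero>)"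
    and c: "c \<in> vec (wordsq S q)"
  shows "dtot (dtot c) = (\<lambda>_. \<zero>)"
proof
  fix w
  note fin = adm_fin[OF S] and gp = adm_gop[OF S]
  have dv: "dterm l c \<in> vec (wordsq S (q - 1))" if "l \<in> I" for l by (rule dterm_vec'[OF S that c])
  have LD: "lift l (D l) c \<in> vec (wordsq S (q - 1))" if l: "l \<in> I" for l
    using lift_D_vec[OF S l, of c "q - 1"] lift_D_zero[OF S l, of c] c by (cases q) auto
  define f where "f k l = (if k \<in> I \<and> l \<in> I then dterm k (dterm l c) w else \<zero>)" for k l
  have fR: "f k l \<in> carrier R" for k l
    using dterm_carrier[OF S _ wordsq_words[OF dv]] by (simp add: f_def)
  have val: "dterm k (dterm l c) w = (if k < l then sg 1 else \<one>) \<otimes> (eps k w \<otimes> (eps l w \<otimes> lift k (D k) (lift l (D l) c) w))"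
    if k: "k \<in> I" and l: "l \<in> I" for k l
    using lift_eps[where S = S, OF gp[OF k] k fin[OF k] LD[OF l], of l w]
      lift_carrier[where S = S, OF gp[OF k] k fin[OF k] wordsq_words[OF LD[OF l]], of w]
    by (simp add: dterm_eq m_lcomm)
  have LL: "lift k (D k) (lift l (D l) c) w \<in> carrier R" if k: "k \<in> I" and l: "l \<in> I" for k l
    by (rule lift_carrier[where S = S, OF gp[OF k] k fin[OF k] wordsq_words[OF LD[OF l]]])
  have comm: "lift k (D k) (lift l (D l) c) w = lift l (D l) (lift k (D k) c) w" if "k \<in> I" "l \<in> I" "k \<noteq> l" for k l
    using lift_commute[where S = S, OF gp gp that fin fin wordsq_words[OF c]] that by blast
  have anti: "f k l \<oplus> f l k = \<zero>" if kl: "k < l" for k l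
  proof (cases "k \<in> I \<and> l \<in> I")
    case True
    thus ?thesis using kl LL[of k l] val[of k l] val[of l k] comm[of l k]
      by (auto simp: f_def sg_def l_minus r_minus m_lcomm l_neg)
  qed (auto simp: f_def)
  have "dtot (dtot c) w = (\<Oplus>k\<in>I. \<Oplus>l\<in>I. f k l)"
    unfolding dtot_def[of "dtot c"]
  proof (rule add.finprod_cong')
    fix k assume k: "k \<in> I"
    have "lift k (D k) (dtot c) w = (\<Oplus>l\<in>I. lift k (D k) (dterm l c) w)"
      unfolding dtot_def by (rule lift_finsum[where S = S, OF gp[OF k] k fin[OF k] fI wordsq_words[OF dv]])
    moreover have "lift k (D k) (dterm l c) w \<in> carrier R" if "l \<in> I" for l
      by (rule lift_carrier[where S = S, OF gp[OF k] k fin[OF k] wordsq_words[OF dv[OF that]]])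
    ultimately have "dterm k (dtot c) w = (\<Oplus>l\<in>I. dterm k (dterm l c) w)"
      using fI by (simp add: dterm_eq finsum_rdistr Pi_iff)
    also have "\<dots> = (\<Oplus>l\<in>I. f k l)"
      by (rule add.finprod_cong') (use k fR[of k] in \<open>auto simp: f_def\<close>)
    finally show "dterm k (dtot c) w = (\<Oplus>l\<in>I. f k l)" .
  qed (use fR in auto)
  also have "\<dots> = \<zero>"
  proof (rule antisym_sum[OF fI fR])
    fix k :: 'k
    show "f k k = \<zero>"
    proof (cases "k \<in> I")
      case True
      have "lift k (D k) (lift k (D k) c) w = \<zero>"
        unfolding lift_comp using DD[OF True slice_deg[where S = S, OF c True fin[OF True], of w]] by (simp add: lift_def)
      thus ?thesis using val[OF True True] by (simp add: f_def)
    qed (simp add: f_def)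
  next
    fix k l :: 'k assume "k \<noteq> l"
    thus "f k l \<oplus> f l k = \<zero>" using anti[of k l] anti[of l k] a_comm[OF fR fR, of k l l k] by (cases "k < l") auto
  qed
  finally show "dtot (dtot c) w = \<zero>" .
qed

lemma dtot_cpx:
  assumes S: "admissible S" and "\<And>k p x. k \<in> I \<Longrightarrow> x \<in> vec {a\<in>S k. dg k a = p} \<Longrightarrow> D k (D k x) = (\<lambda>_. \<zero>)"
  shows "is_cpx (wordsq S) dtot"
  unfolding is_cpx_def
proof (intro conjI allI ballI)
  show "finite (wordsq S q)" for q by (rule finite_wordsq) (rule adm_fin[OF S])
  show "dtot (dtot c) = (\<lambda>_. \<zero>)" if "c \<in> vec (wordsq S q)" for c q by (rule dtot_sq[OF S _ that]) (rule assms(2))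
qed (use dtot_lin[OF S] dtot_zero[OF S] in auto)

end

subsection \<open>Decomposition into blocks of words\<close>

context cring
begin

text \<open>\<open>mg b\<close> turns a word of the block \<open>b\<close> into a basis element of the complex, \<open>tag\<close> and \<open>rst\<close> recover the block and the
  word, and \<open>u\<close> is a sign by which the two bases differ.\<close>

definition block_r where "block_r U' mg u b c = (\<lambda>w. if w \<in> U' b then u b w \<otimes> c (mg b w) else \<zero>)"
definition block_j where "block_j U tag rst u b y = (\<lambda>x. if x \<in> U \<and> tag x = b then u b (rst x) \<otimes> y (rst x) else \<zero>)"

context
  fixes U :: "'s set" and dg :: "'s \<Rightarrow> nat" and Bt :: "'y set" and e :: "'y \<Rightarrow> nat"
    and U' :: "'y \<Rightarrow> 't set" and dg' :: "'t \<Rightarrow> nat" and mg :: "'y \<Rightarrow> 't \<Rightarrow> 's" and tag :: "'s \<Rightarrow> 'y" and rst :: "'s \<Rightarrow> 't"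
    and u :: "'y \<Rightarrow> 't \<Rightarrow> 'a" and D :: "('s \<Rightarrow> 'a) \<Rightarrow> ('s \<Rightarrow> 'a)" and D' :: "('t \<Rightarrow> 'a) \<Rightarrow> ('t \<Rightarrow> 'a)"
  assumes fBt: "finite Bt"
    and mg: "\<And>b w. b \<in> Bt \<Longrightarrow> w \<in> U' b \<Longrightarrow> mg b w \<in> U \<and> dg (mg b w) = dg' w + e b \<and> tag (mg b w) = b \<and> rst (mg b w) = w"
    and tg: "\<And>x. x \<in> U \<Longrightarrow> tag x \<in> Bt \<and> rst x \<in> U' (tag x) \<and> mg (tag x) (rst x) = x"
    and u: "\<And>b w. u b w \<in> carrier R" "\<And>b w. u b w \<otimes> u b w = \<one>"
    and cW: "is_cpx (level dg U) D" and cW': "\<And>b. b \<in> Bt \<Longrightarrow> is_cpx (level dg' (U' b)) D'"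
begin

abbreviation br where "br \<equiv> block_r U' mg u"
abbreviation bj where "bj \<equiv> block_j U tag rst u"

lemma u2: "x \<in> carrier R \<Longrightarrow> u b w \<otimes> (u b w \<otimes> x) = x"
  using u by (simp add: m_assoc[symmetric])

lemma fin_levels: "finite (level dg U q)" "b \<in> Bt \<Longrightarrow> finite (level dg' (U' b) q)"
  using cW cW' by (auto simp: is_cpx_def)

lemma block_r_lin:
  assumes b: "b \<in> Bt"
  shows "lin R (Fr (level dg U (q + e b))) (Fr (level dg' (U' b) q)) (br b)"
proof (rule linFI)
  fix c assume c: "c \<in> vec (level dg U (q + e b))"
  have "br b c w = \<zero>" if "w \<notin> level dg' (U' b) q" for w
    using that mg[OF b, of w] u vec_out[OF c, of "mg b w"] by (auto simp: block_r_def level_iff)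
  thus "br b c \<in> vec (level dg' (U' b) q)"
    using c u by (simp add: free_mod_carrier_fin fin_levels(2)[OF b]) (simp add: block_r_def)
qed (use u in \<open>auto simp: block_r_def r_distr m_lcomm fun_eq_iff\<close>)

lemma block_j_lin:
  assumes b: "b \<in> Bt"
  shows "lin R (Fr (level dg' (U' b) q)) (Fr (level dg U (q + e b))) (bj b)"
proof (rule linFI)
  fix y assume y: "y \<in> vec (level dg' (U' b) q)"
  have "bj b y x = \<zero>" if "x \<notin> level dg U (q + e b)" for x
    using that mg[OF b, of "rst x"] tg[of x] u vec_out[OF y, of "rst x"] by (auto simp: block_j_def level_iff)
  thus "bj b y \<in> vec (level dg U (q + e b))"
    using y u by (simp add: free_mod_carrier_fin fin_levels) (simp add: block_j_def)
qed (use u in \<open>auto simp: block_j_def r_distr m_lcomm fun_eq_iff\<close>)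

lemma block_rj: "b \<in> Bt \<Longrightarrow> y \<in> vec (level dg' (U' b) q) \<Longrightarrow> br b (bj b y) = y"
  using mg[of b] u2 vec_out[of y "level dg' (U' b) q"] by (auto simp: block_r_def block_j_def fun_eq_iff level_iff)

lemma block_rj0: "c \<in> Bt \<Longrightarrow> b \<noteq> c \<Longrightarrow> br c (bj b y) = (\<lambda>_. \<zero>)"
  using mg[of c] u by (auto simp: block_r_def block_j_def fun_eq_iff)

lemma block_sum:
  assumes x: "x \<in> vec (level dg U q)"
  shows "x = (\<lambda>a. \<Oplus>b\<in>{b\<in>Bt. e b \<le> q}. bj b (br b x) a)"
proof
  fix a
  have val: "bj b (br b x) a = (if tag a = b then x a else \<zero>)" if "b \<in> Bt" for b
    using tg[of a] u2 vec_in[OF x] vec_out[OF x, of a] by (auto simp: block_j_def block_r_def level_iff)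
  show "x a = (\<Oplus>b\<in>{b\<in>Bt. e b \<le> q}. bj b (br b x) a)"
  proof (cases "a \<in> level dg U q")
    case True
    have ta: "tag a \<in> {b\<in>Bt. e b \<le> q}" using True tg[of a] mg[of "tag a" "rst a"] by (auto simp: level_iff)
    have "(\<Oplus>b\<in>{b\<in>Bt. e b \<le> q}. bj b (br b x) a) = (\<Oplus>b\<in>{b\<in>Bt. e b \<le> q}. if tag a = b then x a else \<zero>)"
      by (rule add.finprod_cong') (use val vec_in[OF x] in auto)
    also have "\<dots> = x a" by (rule add.finprod_singleton[OF ta]) (use fBt vec_in[OF x] in auto)
    finally show ?thesis by simp
  next
    case False
    thus ?thesis using val vec_out[OF x False] by (auto intro!: finsum_zero_eq[symmetric])
  qed
qed

lemma block_ext: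
  assumes "x \<in> vec (level dg U q)" "x' \<in> vec (level dg U q)" "\<And>b. b \<in> Bt \<Longrightarrow> e b \<le> q \<Longrightarrow> br b x = br b x'"
  shows "x = x'"
proof -
  have "(\<Oplus>b\<in>{b\<in>Bt. e b \<le> q}. bj b (br b x) a) = (\<Oplus>b\<in>{b\<in>Bt. e b \<le> q}. bj b (br b x') a)" for a
    by (rule add.finprod_cong') (use assms(3) assms(2) u in \<open>auto simp: block_j_def block_r_def\<close>)
  thus ?thesis using block_sum[OF assms(1)] block_sum[OF assms(2)] by presburger
qed

text \<open>If every basis element of a complex is a word of one of the blocks, and the differential is that of the
  words up to the signs \<open>u\<close>, the complex is the direct sum of the shifted word complexes.\<close>

lemma block_splits:
  assumes rD: "\<And>b q x w. b \<in> Bt \<Longrightarrow> x \<in> vec (level dg U (Suc q + e b)) \<Longrightarrow> w \<in> level dg' (U' b) q \<Longrightarrow>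
    D' (br b x) w = u b w \<otimes> D x (mg b w)"
  shows "splits (level dg U) D Bt e (\<lambda>b. level dg' (U' b)) D' br bj"
proof -
  have Dl: "lin R (Fr (level dg U (Suc q))) (Fr (level dg U q)) D" and D0: "c \<in> vec (level dg U 0) \<Longrightarrow> D c = (\<lambda>_. \<zero>)" for c q
    using cW unfolding is_cpx_def by blast+
  have Dl': "b \<in> Bt \<Longrightarrow> lin R (Fr (level dg' (U' b) (Suc q))) (Fr (level dg' (U' b) q)) D'"
    and D0': "b \<in> Bt \<Longrightarrow> c \<in> vec (level dg' (U' b) 0) \<Longrightarrow> D' c = (\<lambda>_. \<zero>)" for c q b
    using cW' unfolding is_cpx_def by blast+
  have rD': "br b (D x) = D' (br b x)" if b: "b \<in> Bt" and x: "x \<in> vec (level dg U (Suc q + e b))" for b x q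
  proof
    fix w
    have Dx: "D x \<in> vec (level dg U (q + e b))" using lvec[OF Dl] x by simp
    show "br b (D x) w = D' (br b x) w"
    proof (cases "w \<in> level dg' (U' b) q")
      case True thus ?thesis using rD[OF b x True] by (simp add: block_r_def level_iff)
    next
      case False
      thus ?thesis
        using vec_out[OF lvec[OF block_r_lin[OF b] Dx]] vec_out[OF lvec[OF Dl'[OF b] lvec[OF block_r_lin[OF b] x]]] by simp
    qed
  qed
  have jD: "bj b (D' y) = D (bj b y)" if b: "b \<in> Bt" and y: "y \<in> vec (level dg' (U' b) q)" for b y q
  proof (cases "q + e b")
    case 0
    hence "bj b y \<in> vec (level dg U 0)" "y \<in> vec (level dg' (U' b) 0)" using lvec[OF block_j_lin[OF b] y] y by auto
    thus ?thesis using D0 D0'[OF b] u by (auto simp: block_j_def fun_eq_iff)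
  next
    case (Suc p)
    have jy: "bj b y \<in> vec (level dg U (Suc p))" using lvec[OF block_j_lin[OF b] y] Suc by simp
    have low: "bj b (D' y) = (\<lambda>_. \<zero>)" if "q = 0"
      using D0'[OF b] y that u by (auto simp: block_j_def fun_eq_iff)
    have high: "D' y \<in> vec (level dg' (U' b) q')" if "q = Suc q'" for q' using lvec[OF Dl'[OF b]] y that by blast
    show ?thesis
    proof (rule block_ext[of _ p])
      show "bj b (D' y) \<in> vec (level dg U p)"
      proof (cases q)
        case 0 thus ?thesis using low by simp
      next
        case (Suc q')
        hence "p = q' + e b" using \<open>q + e b = Suc p\<close> by simp
        thus ?thesis using lvec[OF block_j_lin[OF b] high[OF Suc]] by simp
      qed
      show "D (bj b y) \<in> vec (level dg U p)" by (rule lvec[OF Dl jy])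
      fix c assume c: "c \<in> Bt" "e c \<le> p"
      have r: "br c (D (bj b y)) = D' (br c (bj b y))"
        using rD'[OF c(1), of "bj b y" "p - e c"] jy c(2) by (simp add: Suc_diff_le)
      show "br c (bj b (D' y)) = br c (D (bj b y))"
      proof (cases "b = c")
        case True
        then obtain q' where q': "q = Suc q'" using Suc c(2) by (cases q) auto
        show ?thesis using r block_rj[OF b high[OF q']] block_rj[OF b y] True by simp
      next
        case False
        thus ?thesis using r block_rj0[OF c(1) False] lzero[OF Dl'[OF c(1)]] by simp
      qed
    qed
  qed
  show ?thesis unfolding splits_def
  proof (intro conjI ballI allI impI)
    show "finite Bt" by (rule fBt)
  next
    fix q x assume "x \<in> vec (level dg U q)"
    thus "x = (\<lambda>a. \<Oplus>b\<in>{b\<in>Bt. e b \<le> q}. bj b (br b x) a)" by (rule block_sum)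
  qed (rule block_r_lin block_j_lin rD' jD block_rj block_rj0; assumption)+
qed

end

text \<open>A single unshifted block amounts to an isomorphism of complexes, so the zero homotopy will do.\<close>

lemma splits_single:
  assumes s: "splits W D {b} e W' D' r j" and e: "e b = 0" and c: "is_cpx W D" and c': "is_cpx (W' b) D'"
  shows "hequiv W D (W' b) D' (r b) (j b) (\<lambda>_ _. \<zero>)"
proof -
  have c'': "x \<in> {b} \<Longrightarrow> is_cpx (W' x) D'" for x using c' by simp
  note ru = splits_rules[OF c c'' s]
  have f: "{x\<in>{b}. e x \<le> q} = {b}" for q using e by auto
  have rl: "lin R (Fr (W q)) (Fr (W' b q)) (r b)" and jl: "lin R (Fr (W' b q)) (Fr (W q)) (j b)" for q
    using ru(2)[of b q] ru(3)[of b q] e by simp_all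
  have Dz: "lin R (Fr (W (Suc q))) (Fr (W q)) D" for q using c by (simp add: is_cpx_def)
  have D0: "x \<in> vec (W 0) \<Longrightarrow> D x = (\<lambda>_. \<zero>)" "y \<in> vec (W' b 0) \<Longrightarrow> D' y = (\<lambda>_. \<zero>)" for x y
    using c c' unfolding is_cpx_def by blast+
  have sum: "x = j b (r b x)" if x: "x \<in> vec (W q)" for x q
    using ru(8)[OF _ x] vec_in[OF lvec[OF jl lvec[OF rl x]]] unfolding f by simp
  have rD: "r b (D x) = D' (r b x)" if x: "x \<in> vec (W q)" for x q
  proof (cases q)
    case 0
    thus ?thesis using D0 lvec[OF rl x] x lzero[OF rl] by simp
  next
    case (Suc p) thus ?thesis using ru(4)[of b x p] x e by simp
  qed
  have "lin R (Fr (W q)) (Fr (W (Suc q))) (\<lambda>_ _. \<zero>)" for q by (rule linFI) auto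
  moreover have "x = (\<lambda>a. j b (r b x) a \<oplus> (D (\<lambda>_. \<zero>) a \<oplus> \<zero>))" if x: "x \<in> vec (W q)" for x q
    using sum[OF x] lzero[OF Dz] vec_in[OF x] by simp
  ultimately show ?thesis unfolding hequiv_def using rl jl rD ru(5,6)
    by (intro conjI ballI allI) (assumption | blast)+
qed

subsection \<open>Assembling graded operators\<close>

text \<open>The operator on all vectors with the given values on homogeneous ones; \<open>F p\<close> sends degree \<open>p\<close> to the degree
  \<open>p'\<close> with \<open>p' + e2 = p + e1\<close>.\<close>

definition tot where "tot dg e1 e2 F c b = (if e1 \<le> dg b + e2
  then F (dg b + e2 - e1) (\<lambda>a. if dg a = dg b + e2 - e1 then c a else \<zero>) b else \<zero>)"

end

context tensor_complex begin

lemma tot_gop: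
  assumes fin: "finite S" "finite S'"
    and F: "\<And>p. lin R (Fr {a\<in>S. dg k a = p}) (Fr {b\<in>S'. dg k b + e2 = p + e1}) (F p)"
    and FA: "\<And>p c. c \<in> vec {a \<in> S \<inter> A k. dg k a = p} \<Longrightarrow> F p c \<in> vec (S' \<inter> A k)"
  shows tot_eq: "c \<in> vec {a\<in>S. dg k a = p} \<Longrightarrow> tot (dg k) e1 e2 F c = F p c"
    and "gop k S S' e1 e2 (tot (dg k) e1 e2 F)"
proof -
  define part where "part p c = (\<lambda>a. if dg k a = p then c a else \<zero>)" for p and c :: "'s \<Rightarrow> 'a"
  have tot: "tot (dg k) e1 e2 F c b = (if e1 \<le> dg k b + e2 then F (dg k b + e2 - e1) (part (dg k b + e2 - e1) c) b else \<zero>)" for c b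
    by (simp add: tot_def part_def)
  have pv: "part p c \<in> vec {a\<in>T. dg k a = p}" if "c \<in> vec T" "finite T" for p c T
    using vec_in[OF that(1)] vec_out[OF that(1)] that(2) by (auto simp: part_def free_mod_carrier_fin)
  have eq: "tot (dg k) e1 e2 F c = F p c" if c: "c \<in> vec {a\<in>S. dg k a = p}" for p c
  proof
    fix b
    have pc: "part r c = (if r = p then c else (\<lambda>_. \<zero>))" for r using vec_out[OF c] by (auto simp: part_def fun_eq_iff)
    have "F p c b = \<zero>" if "p + e1 \<noteq> dg k b + e2" using vec_out[OF lvec[OF F c], of b] that by auto
    thus "tot (dg k) e1 e2 F c b = F p c b" by (auto simp: tot pc lzero[OF F])
  qed
  thus "c \<in> vec {a\<in>S. dg k a = p} \<Longrightarrow> tot (dg k) e1 e2 F c = F p c" .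
  have "lin R (Fr S) (Fr S') (tot (dg k) e1 e2 F)"
  proof (rule linFI)
    fix c assume c: "c \<in> vec S"
    have "tot (dg k) e1 e2 F c b = \<zero>" if "b \<notin> S'" for b
      using that vec_out[OF lvec[OF F pv[OF c fin(1)]], of b] by (simp add: tot)
    moreover have "tot (dg k) e1 e2 F c b \<in> carrier R" for b
      using vec_in[OF lvec[OF F pv[OF c fin(1)]], of _ b] by (simp add: tot)
    ultimately show "tot (dg k) e1 e2 F c \<in> vec S'" using fin by (simp add: free_mod_carrier_fin)
  next
    fix c d assume c: "c \<in> vec S" "d \<in> vec S"
    have "part p (\<lambda>x. c x \<oplus> d x) = (\<lambda>x. part p c x \<oplus> part p d x)" for p by (auto simp: part_def)
    thus "tot (dg k) e1 e2 F (\<lambda>x. c x \<oplus> d x) = (\<lambda>x. tot (dg k) e1 e2 F c x \<oplus> tot (dg k) e1 e2 F d x)"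
      by (intro ext) (simp add: tot ladd[OF F pv[OF c(1) fin(1)] pv[OF c(2) fin(1)]])
  next
    fix a c assume a: "a \<in> carrier R" and c: "c \<in> vec S"
    have "part p (\<lambda>x. a \<otimes> c x) = (\<lambda>x. a \<otimes> part p c x)" for p using a by (auto simp: part_def)
    thus "tot (dg k) e1 e2 F (\<lambda>x. a \<otimes> c x) = (\<lambda>x. a \<otimes> tot (dg k) e1 e2 F c x)"
      using a by (intro ext) (simp add: tot lsmult[OF F a pv[OF c fin(1)]])
  qed
  moreover have "p + e1 = dg k b + e2" if c: "c \<in> vec {a\<in>S. dg k a = p}" and "tot (dg k) e1 e2 F c b \<noteq> \<zero>" for p c b
    using vec_out[OF lvec[OF F c], of b] that(2) unfolding eq[OF c] by fastforce
  moreover have "tot (dg k) e1 e2 F c \<in> vec (S' \<inter> A k)" if c: "c \<in> vec (S \<inter> A k)" for c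
  proof -
    have "tot (dg k) e1 e2 F c b = \<zero> \<or> b \<in> S' \<inter> A k" for b
      using vec_out[OF FA[OF pv[OF c]], of b] fin by (auto simp: tot)
    moreover have "tot (dg k) e1 e2 F c b \<in> carrier R" for b
      using vec_in[OF FA[OF pv[OF c]], of _ b] fin by (simp add: tot)
    ultimately show ?thesis using fin by (auto simp: free_mod_carrier_fin)
  qed
  ultimately show "gop k S S' e1 e2 (tot (dg k) e1 e2 F)" unfolding gop_def by blast
qed

end

subsection \<open>A pair and its minimal model as tensor factors of one complex\<close>

context cring begin

text \<open>A pair and its model are placed side by side in the disjoint sum of their bases.\<close>

definition injL :: "('s \<Rightarrow> 'a) \<Rightarrow> ('s + 't \<Rightarrow> 'a)" where "injL c = case_sum c (\<lambda>_. \<zero>)"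
definition injR :: "('t \<Rightarrow> 'a) \<Rightarrow> ('s + 't \<Rightarrow> 'a)" where "injR c = case_sum (\<lambda>_. \<zero>) c"
definition both_deg :: "('s \<Rightarrow> nat) \<Rightarrow> 's + 'y label \<Rightarrow> nat" where "both_deg dg = case_sum dg model_deg"
definition both_A :: "'s set \<Rightarrow> ('s + 'y label) set" where "both_A A = Inl ` A \<union> Inr ` model_A"
definition both_D where "both_D dg D = tot (both_deg dg) 0 1
  (\<lambda>_ c. case_sum (D (\<lambda>a. c (Inl a))) (model_D (\<lambda>m. c (Inr m))))"

lemma inj_simps [simp]: "injL c (Inl a) = c a" "injL c (Inr b) = \<zero>" "injR y (Inl a) = \<zero>" "injR y (Inr b) = y b"
  by (simp_all add: injL_def injR_def)

lemma both_simps [simp]: "both_deg dg (Inl a) = dg a" "both_deg dg (Inr m) = model_deg m"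
  "Inl a \<in> both_A A \<longleftrightarrow> a \<in> A" "Inr m \<in> both_A A \<longleftrightarrow> m \<in> model_A"
  by (auto simp: both_deg_def both_A_def)

lemma outL_lin: "lin R (Fr (Inl ` T)) (Fr T) (\<lambda>c a. c (Inl a))"
  and outR_lin: "lin R (Fr (Inr ` T')) (Fr T') (\<lambda>c a. c (Inr a))"
  by (rule linFI; auto simp: free_mod_carrier dest: finite_vimageI[of _ Inl] finite_vimageI[of _ Inr])+

lemma injL_lin: "finite T \<Longrightarrow> lin R (Fr T) (Fr (Inl ` T)) (injL :: _ \<Rightarrow> 's + 't \<Rightarrow> 'a)"
  and injR_lin: "finite T' \<Longrightarrow> lin R (Fr T') (Fr (Inr ` T')) (injR :: _ \<Rightarrow> 's + 't \<Rightarrow> 'a)"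
  by (rule linFI; auto simp: free_mod_carrier_fin injL_def injR_def fun_eq_iff split: sum.splits)+

lemma inj_out: "c \<in> vec (Inl ` T) \<Longrightarrow> c (Inr b) = \<zero>" "d \<in> vec (Inr ` T') \<Longrightarrow> d (Inl a) = \<zero>"
  by (auto intro: vec_out)

lemma injL_out: "c \<in> vec (Inl ` T) \<Longrightarrow> injL (\<lambda>a. c (Inl a)) = c"
  and injR_out: "d \<in> vec (Inr ` T') \<Longrightarrow> injR (\<lambda>a. d (Inr a)) = d"
  by (auto simp: fun_eq_iff injL_def injR_def inj_out split: sum.splits)

lemma model_D_lin:
  fixes M :: "'y label set"
  assumes "\<And>q. finite (level model_deg M q)" and M: "\<And>\<beta>. (\<beta>, Tnbar) \<in> M \<Longrightarrow> (\<beta>, Tn) \<in> M"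
  shows "lin R (Fr (level model_deg M p)) (Fr {b\<in>M. model_deg b + 1 = p}) model_D"
proof (rule linFI)
  fix c :: "'y label \<Rightarrow> 'a" assume c: "c \<in> vec (level model_deg M p)"
  have "{b\<in>M. model_deg b + 1 = p} \<subseteq> level model_deg M (p - 1)" by (auto simp: level_iff)
  hence f: "finite {b\<in>M. model_deg b + 1 = p}" using assms(1) by (rule finite_subset)
  have "model_D c m = \<zero>" if "m \<notin> {b\<in>M. model_deg b + 1 = p}" for m
  proof (cases m)
    case (Pair \<beta> l) thus ?thesis using that vec_out[OF c, of "(\<beta>, Tnbar)"] M by (cases \<beta>) (auto simp: level_iff)
  qed
  moreover have "model_D c m \<in> carrier R" for m using vec_in[OF c] by (cases m) auto
  ultimately show "model_D c \<in> vec {b\<in>M. model_deg b + 1 = p}" using f by (simp add: free_mod_carrier_fin)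
qed (auto simp: fun_eq_iff)

end

context cring begin

lemma pair_factor:
  fixes A :: "'k::linorder \<Rightarrow> ('s + 'y label) set"
  assumes tc: "tensor_complex R I K" and kI: "k \<in> I" and sp: "split_pair R S A0 dg0 D0 B \<phi>"
    and k: "A k = both_A A0" "dg k = both_deg dg0" "D k = both_D dg0 D0"
  shows "tensor_complex.gop R A dg k (Inl ` S) (Inl ` S) 0 1 (D k)" and "tensor_complex.gop R A dg k (Inr ` model B) (Inr ` model B) 0 1 (D k)"
    and "x \<in> vec (Inl ` level dg0 S p) \<Longrightarrow> D k x = injL (D0 (\<lambda>a. x (Inl a)))"
    and "y \<in> vec (Inr ` level model_deg (model B) p) \<Longrightarrow> D k y = injR (model_D (\<lambda>a. y (Inr a)))"
    and "\<exists>F G H. tensor_complex.factor_equiv R A dg D k (Inl ` S) (Inr ` model B) F G H"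
proof -
  interpret tensor_complex R I K A dg D by (rule tc)
  interpret sp: split_pair R S A0 dg0 D0 B \<phi> by (rule sp)
  note fS = sp.fS and fM = sp.finite_model
  have lv: "{a \<in> Inl ` S. dg k a = p} = Inl ` sp.SX p" "{a \<in> Inr ` model B. dg k a = p} = Inr ` sp.MS p"
    "{a \<in> Inl ` S \<inter> A k. dg k a = p} = Inl ` sp.SA p" "{a \<in> Inr ` model B \<inter> A k. dg k a = p} = Inr ` sp.MA p" for p
    by (auto simp: k level_iff)
  have lvs: "{b \<in> Inl ` S. dg k b + 1 = p} = Inl ` {b\<in>S. dg0 b + 1 = p}"
    "{b \<in> Inr ` model B. dg k b + 1 = p} = Inr ` {b\<in>model B. model_deg b + 1 = p}" for p
    by (auto simp: k)
  have iA: "Inl ` S \<inter> A k = Inl ` (S \<inter> A0)" "Inr ` model B \<inter> A k = Inr ` (model B \<inter> model_A)" by (auto simp: k)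
  let ?F = "\<lambda>_ c. case_sum (D0 (\<lambda>a. c (Inl a))) (model_D (\<lambda>m. c (Inr m)))"
  have Dk: "D k = tot (dg k) 0 1 ?F" by (simp add: k both_D_def)
  have D00: "D0 (\<lambda>_. \<zero>) = (\<lambda>_. \<zero>)" by (rule lzero[OF sp.D_vl(1)[unfolded vl_lin]])
  have M00: "model_D (\<lambda>_. \<zero>) = (\<lambda>_. \<zero> :: 'a)" by (auto simp: fun_eq_iff)
  have FL: "injL (D0 (\<lambda>a. c (Inl a))) = ?F p c" if "c \<in> vec (Inl ` T)" for c T p
    using inj_out(1)[OF that] M00 by (auto simp: fun_eq_iff injL_def split: sum.splits)
  have FR: "injR (model_D (\<lambda>a. c (Inr a))) = ?F p c" if "c \<in> vec (Inr ` T)" for c T p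
    using inj_out(2)[OF that] D00 by (auto simp: fun_eq_iff injR_def split: sum.splits)
  have Dl: "lin R (Fr (sp.SX p)) (Fr {b\<in>S. dg0 b + 1 = p}) D0" for p
  proof (cases p)
    case 0 thus ?thesis using sp.D0 by (intro linFI) (auto simp: vec_add vec_smult)
  next
    case (Suc q)
    hence "{b\<in>S. dg0 b + 1 = p} = sp.SX q" by (auto simp: level_iff)
    thus ?thesis using sp.D_vl(1)[of q] Suc by (simp add: vl_lin)
  qed
  have LL: "lin R (Fr {a \<in> Inl ` S. dg k a = p}) (Fr {b \<in> Inl ` S. dg k b + 1 = p}) (?F p)" for p
    unfolding lv lvs
    by (rule lin_cong[OF lin_comp[OF lin_comp[OF outL_lin Dl] injL_lin] module_free FL[symmetric]]) (use fS in auto)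
  have mb: "(\<beta>, Tnbar) \<in> model B \<Longrightarrow> (\<beta>, Tn) \<in> model B" for \<beta> by (cases \<beta>; cases "fst \<beta>") auto
  have fML: "finite (level model_deg (model B) p)" for p using fM by (simp add: level_def)
  note Ml = model_D_lin[OF fML mb]
  have Mm: "model_D y \<in> vec (sp.MS (p - 1))" if "y \<in> vec (sp.MS p)" for y p
    by (rule vec_mono[OF lvec[OF Ml that]]) (auto simp: level_iff)
  have fML': "finite {b \<in> model B. model_deg b + 1 = p}" for p using fM by simp
  have RR: "lin R (Fr {a \<in> Inr ` model B. dg k a = p}) (Fr {b \<in> Inr ` model B. dg k b + 1 = p}) (?F p)" for p
    unfolding lv lvs
    by (rule lin_cong[OF lin_comp[OF lin_comp[OF outR_lin Ml] injR_lin[OF fML']] module_free FR[symmetric]])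
  have LA: "?F p c \<in> vec (Inl ` S \<inter> A k)" if c: "c \<in> vec {a \<in> Inl ` S \<inter> A k. dg k a = p}" for p c
  proof -
    note c' = c[unfolded lv]
    have "D0 (\<lambda>a. c (Inl a)) \<in> vec (S \<inter> A0)"
      by (rule vec_mono[OF sp.DmA[OF lvec[OF outL_lin c']]]) (auto simp: level_iff)
    hence "injL (D0 (\<lambda>a. c (Inl a))) \<in> vec (Inl ` (S \<inter> A0) :: ('s + 'y label) set)"
      using lvec[OF injL_lin] fS by blast
    thus ?thesis unfolding iA FL[OF c'] .
  qed
  have RA: "?F p c \<in> vec (Inr ` model B \<inter> A k)" if c: "c \<in> vec {a \<in> Inr ` model B \<inter> A k. dg k a = p}" for p c
  proof -
    note c' = c[unfolded lv]
    have "c (Inr (\<beta>, Tnbar)) = \<zero>" for \<beta> by (rule vec_out[OF c']) (auto simp: level_iff)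
    hence "model_D (\<lambda>a. c (Inr a)) = (\<lambda>_. \<zero>)" by (auto simp: fun_eq_iff)
    moreover have "?F p c = injR (model_D (\<lambda>a. c (Inr a)))" by (rule FR[OF c', symmetric])
    ultimately have "?F p c = (\<lambda>_. \<zero>)" by (auto simp: injR_def fun_eq_iff split: sum.splits)
    thus ?thesis by simp
  qed
  have sS: "finite (Inl ` S :: ('s + 'y label) set)" "finite (Inr ` model B :: ('s + 'y label) set)" using fS fM by auto
  show "gop k (Inl ` S) (Inl ` S) 0 1 (D k)" unfolding Dk
    by (rule tot_gop(2)[OF sS(1) sS(1) _ LA]) (use LL in simp)
  show "gop k (Inr ` model B) (Inr ` model B) 0 1 (D k)" unfolding Dk
    by (rule tot_gop(2)[OF sS(2) sS(2) _ RA]) (use RR in simp)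
  have DL: "D k x = ?F p x" if x: "x \<in> vec {a \<in> Inl ` S. dg k a = p}" for x p
    unfolding Dk by (rule tot_gop(1)[OF sS(1) sS(1) _ LA x]) (use LL in simp)
  have DR: "D k y = ?F p y" if y: "y \<in> vec {a \<in> Inr ` model B. dg k a = p}" for y p
    unfolding Dk by (rule tot_gop(1)[OF sS(2) sS(2) _ RA y]) (use RR in simp)
  show eL: "D k x = injL (D0 (\<lambda>a. x (Inl a)))" if x: "x \<in> vec (Inl ` sp.SX p)" for x p
    using DL[unfolded lv, OF x] FL[OF x] by simp
  show eR: "D k y = injR (model_D (\<lambda>a. y (Inr a)))" if y: "y \<in> vec (Inr ` sp.MS p)" for y p
    using DR[unfolded lv, OF y] FR[OF y] by simp
  obtain F G H where ret: "sp.retraction F G H" using sp.retraction_exists by blast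
  note rr = sp.ret_rules[OF ret]
  let ?f = "\<lambda>p c. injR (F p (\<lambda>a. c (Inl a)))" and ?g = "\<lambda>p c. injL (G p (\<lambda>a. c (Inr a)))"
    and ?h = "\<lambda>p c. injL (H p (\<lambda>a. c (Inl a)))"
  have lv0: "{b \<in> Inl ` S. dg k b + 0 = p + e} = Inl ` sp.SX (p + e)" "{b \<in> Inr ` model B. dg k b + 0 = p + e} = Inr ` sp.MS (p + e)" for p e
    by (auto simp: k level_iff)
  have fl: "lin R (Fr {a \<in> Inl ` S. dg k a = p}) (Fr {b \<in> Inr ` model B. dg k b + 0 = p + 0}) (?f p)" for p
    unfolding lv lv0 add_0_right by (rule lin_comp[OF lin_comp[OF outL_lin rr(1)[unfolded vl_lin]] injR_lin[OF fML]])
  have gl: "lin R (Fr {a \<in> Inr ` model B. dg k a = p}) (Fr {b \<in> Inl ` S. dg k b + 0 = p + 0}) (?g p)" for p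
    unfolding lv lv0 add_0_right by (rule lin_comp[OF lin_comp[OF outR_lin rr(2)[unfolded vl_lin]] injL_lin[OF sp.fin(1)]])
  have hl: "lin R (Fr {a \<in> Inl ` S. dg k a = p}) (Fr {b \<in> Inl ` S. dg k b + 0 = p + 1}) (?h p)" for p
    unfolding lv lv0 using lin_comp[OF lin_comp[OF outL_lin rr(3)[unfolded vl_lin]] injL_lin[OF sp.fin(1)]] by simp
  have fA: "?f p c \<in> vec (Inr ` model B \<inter> A k)" if c: "c \<in> vec {a \<in> Inl ` S \<inter> A k. dg k a = p}" for p c
  proof -
    note c' = c[unfolded lv]
    have "F p (\<lambda>a. c (Inl a)) \<in> vec (model B \<inter> model_A)"
      by (rule vec_mono[OF rr(4)[OF lvec[OF outL_lin c']]]) (auto simp: level_iff)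
    thus ?thesis unfolding iA using lvec[OF injR_lin] fM by blast
  qed
  have gA: "?g p c \<in> vec (Inl ` S \<inter> A k)" if c: "c \<in> vec {a \<in> Inr ` model B \<inter> A k. dg k a = p}" for p c
  proof -
    note c' = c[unfolded lv]
    have "G p (\<lambda>a. c (Inr a)) \<in> vec (S \<inter> A0)"
      by (rule vec_mono[OF rr(5)[OF lvec[OF outR_lin c']]]) (auto simp: level_iff)
    thus ?thesis unfolding iA using lvec[OF injL_lin] fS by blast
  qed
  have hA: "?h p c \<in> vec (Inl ` S \<inter> A k)" if c: "c \<in> vec {a \<in> Inl ` S \<inter> A k. dg k a = p}" for p c
  proof -
    note c' = c[unfolded lv]
    have "H p (\<lambda>a. c (Inl a)) \<in> vec (S \<inter> A0)"
      by (rule vec_mono[OF rr(6)[OF lvec[OF outL_lin c']]]) (auto simp: level_iff)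
    thus ?thesis unfolding iA using lvec[OF injL_lin] fS by blast
  qed
  let ?F' = "tot (dg k) 0 0 ?f" and ?G' = "tot (dg k) 0 0 ?g" and ?H' = "tot (dg k) 1 0 ?h"
  have gops: "gop k (Inl ` S) (Inr ` model B) 0 0 ?F'" "gop k (Inr ` model B) (Inl ` S) 0 0 ?G'" "gop k (Inl ` S) (Inl ` S) 1 0 ?H'"
    by (rule tot_gop(2)[OF sS(1) sS(2) fl fA] tot_gop(2)[OF sS(2) sS(1) gl gA] tot_gop(2)[OF sS(1) sS(1) hl hA]; assumption)+
  have L: "injL x \<in> vec (Inl ` sp.SX p :: ('s + 'y label) set)" if "x \<in> vec (sp.SX p)" for x p by (rule lvec[OF injL_lin[OF sp.fin(1)] that])
  have R: "injR x \<in> vec (Inr ` sp.MS p :: ('s + 'y label) set)" if "x \<in> vec (sp.MS p)" for x p by (rule lvec[OF injR_lin[OF fML] that])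
  have F': "?F' (injL x) = injR (F p x)" and H': "?H' (injL x) = injL (H p x)" and DL': "D k (injL x) = injL (D0 x)" if x: "x \<in> vec (sp.SX p)" for x p
    using tot_gop(1)[OF sS(1) sS(2) fl fA, unfolded lv, OF _ L[OF x]] tot_gop(1)[OF sS(1) sS(1) hl hA, unfolded lv, OF _ L[OF x]] eL[OF L[OF x]] by simp_all
  have G': "?G' (injR y) = injL (G p y)" and DR': "D k (injR y) = injR (model_D y)" if y: "y \<in> vec (sp.MS p)" for y p
    using tot_gop(1)[OF sS(2) sS(1) gl gA, unfolded lv, OF _ R[OF y]] eR[OF R[OF y]] by simp_all
  show "\<exists>F G H. factor_equiv k (Inl ` S) (Inr ` model B) F G H"
    unfolding factor_equiv_def lv
  proof (rule exI[of _ ?F'], rule exI[of _ ?G'], rule exI[of _ ?H'], intro conjI allI ballI gops)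
    fix p and x :: "'s + 'y label \<Rightarrow> 'a" assume x: "x \<in> vec (Inl ` sp.SX p)"
    define z where "z = (\<lambda>a. x (Inl a))"
    have z: "z \<in> vec (sp.SX p)" unfolding z_def by (rule lvec[OF outL_lin x])
    have xz: "x = injL z" unfolding z_def by (rule injL_out[OF x, symmetric])
    note Dz = vlD(1)[OF sp.Dm z] and Fz = vlD(1)[OF rr(1) z] and Hz = vlD(1)[OF rr(3) z]
    show "?F' (D k x) = D k (?F' x)" unfolding xz DL'[OF z] F'[OF z] F'[OF Dz] DR'[OF Fz] rr(7)[OF z] ..
    have "injL z = (\<lambda>a. injL (G p (F p z)) a \<oplus> (injL (D0 (H p z)) a \<oplus> injL (H (p - 1) (D0 z)) a))"
    proof
      fix a show "injL z a = injL (G p (F p z)) a \<oplus> (injL (D0 (H p z)) a \<oplus> injL (H (p - 1) (D0 z)) a)"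
        using fun_cong[OF rr(10)[OF z]] by (cases a) (simp_all add: vplus_def)
    qed
    thus "x = (\<lambda>a. ?G' (?F' x) a \<oplus> (D k (?H' x) a \<oplus> ?H' (D k x) a))"
      unfolding xz DL'[OF z] F'[OF z] H'[OF z] G'[OF Fz] DL'[OF Hz] H'[OF Dz] .
  next
    fix p and y :: "'s + 'y label \<Rightarrow> 'a" assume y: "y \<in> vec (Inr ` sp.MS p)"
    define z where "z = (\<lambda>a. y (Inr a))"
    have z: "z \<in> vec (sp.MS p)" unfolding z_def by (rule lvec[OF outR_lin y])
    have yz: "y = injR z" unfolding z_def by (rule injR_out[OF y, symmetric])
    note Gz = vlD(1)[OF rr(2) z]
    show "?G' (D k y) = D k (?G' y)" unfolding yz DR'[OF z] G'[OF z] G'[OF Mm[OF z]] DL'[OF Gz] rr(8)[OF z] ..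
    show "?F' (?G' y) = y" unfolding yz G'[OF z] F'[OF Gz] rr(9)[OF z] ..
  qed
qed

end

section \<open>The word complexes of a simplicial complex\<close>

definition iwords :: "'v set \<Rightarrow> 'v set set \<Rightarrow> 'v xindex \<Rightarrow> ('v \<Rightarrow> tgen) set"
  where "iwords V K s = {w \<in> twords V K. word_index V w = s}"

abbreviation wds :: "'v set \<Rightarrow> 'v set set \<Rightarrow> 'v xindex \<Rightarrow> nat \<Rightarrow> ('v \<Rightarrow> tgen) set"
  where "wds V K s \<equiv> level (word_deg V) (iwords V K s)"

text \<open>The least possible \<open>\<tau>\<close> is the set of positions with letters other than \<open>Tn\<close> and \<open>Ti\<close>.\<close>

lemma twords_iff:
  assumes "simplicial_complex V K"
  shows "w \<in> twords V K \<longleftrightarrow> w \<in> V \<rightarrow>\<^sub>E UNIV \<and> {v\<in>V. w v \<notin> {Tn, Ti}} \<in> K"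
proof -
  have "(\<exists>\<tau>\<in>K. \<forall>v\<in>V. v \<notin> \<tau> \<longrightarrow> w v \<in> {Tn, Ti}) \<longleftrightarrow> {v\<in>V. w v \<notin> {Tn, Ti}} \<in> K"
  proof
    assume "\<exists>\<tau>\<in>K. \<forall>v\<in>V. v \<notin> \<tau> \<longrightarrow> w v \<in> {Tn, Ti}"
    then obtain \<tau> where "\<tau> \<in> K" "{v\<in>V. w v \<notin> {Tn, Ti}} \<subseteq> \<tau>" by auto
    thus "{v\<in>V. w v \<notin> {Tn, Ti}} \<in> K" using assms unfolding simplicial_complex_def by blast
  qed (rule bexI, auto)
  thus ?thesis by (simp add: twords_def)
qed

lemma letters_index:
  assumes s: "s \<in> xindices V"
  shows "(\<forall>v\<in>V. w v \<in> letters (xsym_at s v)) \<longleftrightarrow> word_index V w = s"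
proof -
  obtain \<sigma> \<omega> where so: "s = (\<sigma>, \<omega>)" "\<sigma> \<subseteq> V" "\<omega> \<subseteq> V" "\<sigma> \<inter> \<omega> = {}" using s by (auto simp: xindices_def)
  have l: "w v \<in> letters (xsym_at s v) \<longleftrightarrow> (v \<in> \<sigma> \<longleftrightarrow> w v = Te) \<and> (v \<in> \<omega> \<longleftrightarrow> w v \<in> {Tn, Tnbar})" for v
    using so(4) by (cases "w v") (auto simp: xsym_at_def so(1))
  show ?thesis unfolding l using so by (auto simp: word_index_def)
qed

lemma finite_tgen: "finite (UNIV :: tgen set)"
  by (rule finite_subset[of _ "{Te, Tn, Ti, Tnbar}"]) (use tgen.exhaust in auto)

context cring
begin

lemma is_cpx_cong:
  assumes c: "is_cpx W D" and e: "\<And>q c. c \<in> vec (W q) \<Longrightarrow> D' c = D c"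
  shows "is_cpx W D'"
  unfolding is_cpx_def
proof (intro conjI allI ballI)
  have c': "finite (W q)" "lin R (Fr (W (Suc q))) (Fr (W q)) D" "z \<in> vec (W 0) \<Longrightarrow> D z = (\<lambda>_. \<zero>)"
    "y \<in> vec (W q) \<Longrightarrow> D (D y) = (\<lambda>_. \<zero>)" for q z y using c unfolding is_cpx_def by blast+
  show "finite (W q)" for q by (rule c')
  show "lin R (Fr (W (Suc q))) (Fr (W q)) D'" for q by (rule lin_cong[OF c'(2) module_free e])
  show "D' z = (\<lambda>_. \<zero>)" if "z \<in> vec (W 0)" for z using e[OF that] c'(3)[OF that] by simp
  show "D' (D' y) = (\<lambda>_. \<zero>)" if y: "y \<in> vec (W q)" for q y
  proof (cases q)
    case 0
    thus ?thesis using e[OF y] c'(3) y e[of "\<lambda>_. \<zero>" 0] by simp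
  next
    case (Suc p)
    thus ?thesis using e[OF y] e[OF lvec[OF c'(2)]] c'(4)[OF y] y by simp
  qed
qed

definition tD :: "(tgen \<Rightarrow> 'a) \<Rightarrow> tgen \<Rightarrow> 'a" where "tD y l = (if l = Tn then y Tnbar else \<zero>)"

text \<open>The coefficient of the boundary at a word \<open>y\<close>: the words with \<open>y\<close> in their boundary arise from \<open>y\<close> by turning one
  letter \<open>Tn\<close> into \<open>Tnbar\<close>.\<close>

definition tb where
  "tb V c y = (\<Oplus>v\<in>V. sg (\<Sum>u\<in>{u\<in>V. u < v}. tdeg (y u)) \<otimes> (if y v = Tn then c (y(v := Tnbar)) else \<zero>))"

lemma tb_lin:
  fixes V :: "'v::linorder set"
  assumes V: "finite V"
  shows "lin R (Fr (V \<rightarrow>\<^sub>E UNIV)) (Fr (V \<rightarrow>\<^sub>E UNIV)) (tb V)"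
proof (rule linFI)
  have f: "finite (V \<rightarrow>\<^sub>E (UNIV :: tgen set))" by (rule finite_PiE[OF V finite_tgen])
  fix c :: "('v \<Rightarrow> tgen) \<Rightarrow> 'a" assume c: "c \<in> vec (V \<rightarrow>\<^sub>E UNIV)"
  have "tb V c y = \<zero>" if "y \<notin> V \<rightarrow>\<^sub>E UNIV" for y
  proof -
    have "c (y(v := Tnbar)) = \<zero>" if v: "v \<in> V" for v
      using \<open>y \<notin> _\<close> v by (intro vec_out[OF c]) (auto simp: PiE_iff extensional_def)
    thus ?thesis by (auto simp: tb_def intro!: finsum_zero_eq)
  qed
  thus "tb V c \<in> vec (V \<rightarrow>\<^sub>E UNIV)" using f vec_in[OF c] by (auto simp: free_mod_carrier_fin) (auto simp: tb_def intro!: finsum_closed)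
next
  fix c d :: "('v \<Rightarrow> tgen) \<Rightarrow> 'a" assume c: "c \<in> vec (V \<rightarrow>\<^sub>E UNIV)" "d \<in> vec (V \<rightarrow>\<^sub>E UNIV)"
  show "tb V (\<lambda>x. c x \<oplus> d x) = (\<lambda>x. tb V c x \<oplus> tb V d x)"
  proof
    fix y
    let ?s = "\<lambda>v. sg (\<Sum>u\<in>{u\<in>V. u < v}. tdeg (y u))"
    have "(\<Oplus>v\<in>V. ?s v \<otimes> (if y v = Tn then c (y(v := Tnbar)) \<oplus> d (y(v := Tnbar)) else \<zero>))
        = (\<Oplus>v\<in>V. ?s v \<otimes> (if y v = Tn then c (y(v := Tnbar)) else \<zero>) \<oplus> ?s v \<otimes> (if y v = Tn then d (y(v := Tnbar)) else \<zero>))"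
      by (rule add.finprod_cong') (use vec_in[OF c(1)] vec_in[OF c(2)] in \<open>auto simp: r_distr\<close>)
    also have "\<dots> = tb V c y \<oplus> tb V d y"
      unfolding tb_def by (rule finsum_addf) (use vec_in[OF c(1)] vec_in[OF c(2)] in auto)
    finally show "tb V (\<lambda>x. c x \<oplus> d x) y = tb V c y \<oplus> tb V d y" by (simp add: tb_def)
  qed
next
  fix a and c :: "('v \<Rightarrow> tgen) \<Rightarrow> 'a" assume a: "a \<in> carrier R" and c: "c \<in> vec (V \<rightarrow>\<^sub>E UNIV)"
  show "tb V (\<lambda>x. a \<otimes> c x) = (\<lambda>x. a \<otimes> tb V c x)"
    unfolding tb_def
    by (intro ext, subst finsum_rdistr)
      (use V a vec_in[OF c] in \<open>auto simp: m_lcomm intro!: add.finprod_cong'\<close>)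
qed

lemma finsum_filter:
  "finite V \<Longrightarrow> (\<And>v. v \<in> V \<Longrightarrow> P v \<Longrightarrow> f v \<in> carrier R) \<Longrightarrow> (\<Oplus>v\<in>{v\<in>V. P v}. f v) = (\<Oplus>v\<in>V. if P v then f v else \<zero>)"
proof (induction V rule: finite_induct)
  case (insert x V)
  have "{v \<in> insert x V. P v} = (if P x then insert x {v\<in>V. P v} else {v\<in>V. P v})" by auto
  thus ?case using insert by (auto simp: Pi_iff)
qed simp

lemma word_boundary_tb:
  assumes V: "finite V" and a: "a \<in> V \<rightarrow>\<^sub>E UNIV"
  shows "word_boundary R V a y = tb V (free_gen R a) y"
proof -
  have fg: "free_gen R x z \<in> carrier R" for x z :: "'v \<Rightarrow> tgen" by (simp add: free_gen_def)
  have "word_boundary R V a y = (\<Oplus>v\<in>V. if a v = Tnbar then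
      sg (\<Sum>u\<in>{u\<in>V. u < v}. tdeg (a u)) \<otimes> free_gen R (a(v := Tn)) y else \<zero>)"
    unfolding word_boundary_def sg_pow by (rule finsum_filter[OF V]) (simp add: fg)
  also have "\<dots> = tb V (free_gen R a) y" unfolding tb_def
  proof (rule add.finprod_cong')
    fix v assume v: "v \<in> V"
    have e: "y = a(v := Tn) \<and> a v = Tnbar \<longleftrightarrow> y v = Tn \<and> y(v := Tnbar) = a" by (auto simp: fun_eq_iff)
    have s: "(\<Sum>u\<in>{u\<in>V. u < v}. tdeg (a u)) = (\<Sum>u\<in>{u\<in>V. u < v}. tdeg (y u))" if "y = a(v := Tn)"
      by (rule sum.cong) (auto simp: that)
    show "(if a v = Tnbar then sg (\<Sum>u\<in>{u\<in>V. u < v}. tdeg (a u)) \<otimes> free_gen R (a(v := Tn)) y else \<zero>)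
        = sg (\<Sum>u\<in>{u\<in>V. u < v}. tdeg (y u)) \<otimes> (if y v = Tn then free_gen R a (y(v := Tnbar)) else \<zero>)"
      using e s by (auto simp: free_gen_def)
  qed (auto simp: fg)
  finally show ?thesis .
qed

lemma tboundary_tb:
  assumes V: "finite V" and c: "c \<in> vec (V \<rightarrow>\<^sub>E UNIV)"
  shows "tboundary R V c = tb V c"
proof
  fix y
  have "tb V c y = (\<Oplus>a\<in>V \<rightarrow>\<^sub>E UNIV. c a \<otimes> tb V (free_gen R a) y)"
    using lin_expand[OF tb_lin[OF V] finite_PiE[OF V finite_tgen] c] by (rule fun_cong)
  also have "\<dots> = tboundary R V c y" unfolding tboundary_def
    by (rule add.finprod_cong') (use vec_in[OF c] in \<open>auto simp: word_boundary_tb[OF V] intro!: finsum_closed simp: tb_def free_gen_def\<close>)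
  finally show "tboundary R V c y = tb V c y" by simp
qed

lemma vec_iwords: "c \<in> vec (level dg (iwords V K s) q) \<Longrightarrow> c \<in> vec (V \<rightarrow>\<^sub>E UNIV)"
  by (erule vec_mono) (auto simp: level_iff iwords_def twords_def)

text \<open>The complex of \<open>K\<close> at \<open>s\<close> is itself a tensor product over \<open>K\<close>, with the letters of the kind \<open>xsym_at s v\<close> as basis of the
  factor at \<open>v\<close>, so the differential squares to zero by \<open>dtot_sq\<close>.\<close>

lemma word_cpx:
  assumes V: "finite V" and K: "simplicial_complex V K" and s: "s \<in> xindices V"
  shows "is_cpx (wds V K s) (tboundary R V)"
proof -
  interpret tc: tensor_complex R V K "\<lambda>_. {Tn, Ti}" "\<lambda>_. tdeg" "\<lambda>_. tD"
    by unfold_locales (use V K in \<open>auto simp: simplicial_complex_def\<close>)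
  let ?S = "\<lambda>v. letters (xsym_at s v)"
  have W: "tc.wordsq ?S q = wds V K s q" for q
    using letters_index[OF s] twords_iff[OF K]
    by (auto simp: tc.wordsq_def tc.words_def tc.wdeg_def word_deg_def level_iff iwords_def PiE_iff)
  have Dt: "tc.dtot c = tb V c" for c
    by (simp add: tc.dtot_def tc.dterm_def tc.eps_def tb_def lift_def tD_def fun_eq_iff)
  have f: "finite (letters \<kappa>)" for \<kappa> by (cases \<kappa>) auto
  have lin: "lin R (Fr (letters \<kappa>)) (Fr (letters \<kappa>)) tD" for \<kappa>
  proof (rule linFI)
    fix c assume c: "c \<in> vec (letters \<kappa>)"
    thus "tD c \<in> vec (letters \<kappa>)" using f[of \<kappa>] vec_in[OF c] vec_out[OF c, of Tnbar]
      by (cases \<kappa>) (auto simp: free_mod_carrier_fin tD_def)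
  qed (auto simp: tD_def fun_eq_iff)
  have "tc.admissible ?S" unfolding tc.admissible_def tc.gop_def
  proof (intro ballI conjI allI impI f lin)
    fix v p c b assume c: "c \<in> vec {a \<in> ?S v. tdeg a = p}" and "tD c b \<noteq> \<zero>"
    thus "p + 0 = tdeg b + 1" using vec_out[OF c, of Tnbar] by (auto simp: tD_def split: if_splits)
  next
    fix v c assume c: "c \<in> vec (?S v \<inter> {Tn, Ti})"
    have "tD c = (\<lambda>_. \<zero>)" using vec_out[OF c, of Tnbar] by (auto simp: tD_def)
    thus "tD c \<in> vec (?S v \<inter> {Tn, Ti})" by simp
  qed
  hence "is_cpx (tc.wordsq ?S) tc.dtot" by (rule tc.dtot_cpx) (simp add: tD_def fun_eq_iff)
  moreover have "tc.wordsq ?S = wds V K s" "tc.dtot = tb V" using W Dt by (auto simp: fun_eq_iff)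
  ultimately have "is_cpx (wds V K s) (tb V)" by simp
  thus ?thesis by (rule is_cpx_cong) (rule tboundary_tb[OF V vec_iwords])
qed

lemma thom_bhom: "thom R V K s q = bhom R (wds V K s) (tboundary R V) q"
  and tcoh_bcoh: "tcoh R V K s q = bcoh R (wds V K s) (tboundary R V) q"
proof -
  have W: "{w \<in> twords V K. word_index V w = s \<and> word_deg V w = q} = wds V K s q" for q
    by (auto simp: level_iff iwords_def)
  show "thom R V K s q = bhom R (wds V K s) (tboundary R V) q"
    unfolding thom_def bhom_def tcycles_def tboundaries_def tchain_def W ..
  show "tcoh R V K s q = bcoh R (wds V K s) (tboundary R V) q"
    unfolding tcoh_def bcoh_def tcocycles_def tcoboundaries_def tcochain_def tcoboundary_def tchain_def pullback_def W ..
qed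

end

section \<open>The word complex of a polyhedral join\<close>

text \<open>The least possible \<open>\<tau>\<close> consists of the positions at which the simplex leaves \<open>A\<close>.\<close>

lemma polyhedral_join_iff:
  assumes K: "simplicial_complex {1..m} K" and AX: "\<And>k. k \<in> {1..m} \<Longrightarrow> A k \<subseteq> X k"
  shows "Sigma {1..m} f \<in> polyhedral_join m K X A \<longleftrightarrow> (\<forall>k\<in>{1..m}. f k \<in> X k) \<and> {k\<in>{1..m}. f k \<notin> A k} \<in> K"
proof
  assume "Sigma {1..m} f \<in> polyhedral_join m K X A"
  then obtain \<tau> \<sigma> where t: "\<tau> \<in> K" "Sigma {1..m} f = Sigma {1..m} \<sigma>" "\<forall>k\<in>{1..m}. \<sigma> k \<in> (if k \<in> \<tau> then X k else A k)"
    by (auto simp: polyhedral_join_def joins_def)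
  have "f k = \<sigma> k" if "k \<in> {1..m}" for k using t(2) that by (auto simp: set_eq_iff)
  hence *: "\<forall>k\<in>{1..m}. f k \<in> (if k \<in> \<tau> then X k else A k)" using t(3) by simp
  hence "{k\<in>{1..m}. f k \<notin> A k} \<subseteq> \<tau>" by (auto split: if_splits)
  hence "{k\<in>{1..m}. f k \<notin> A k} \<in> K" using t(1) K unfolding simplicial_complex_def by blast
  moreover have "f k \<in> X k" if "k \<in> {1..m}" for k using * AX[OF that] that by (auto split: if_splits)
  ultimately show "(\<forall>k\<in>{1..m}. f k \<in> X k) \<and> {k\<in>{1..m}. f k \<notin> A k} \<in> K" by blast
next
  assume "(\<forall>k\<in>{1..m}. f k \<in> X k) \<and> {k\<in>{1..m}. f k \<notin> A k} \<in> K"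
  thus "Sigma {1..m} f \<in> polyhedral_join m K X A"
    unfolding polyhedral_join_def joins_def by (intro UN_I[of "{k\<in>{1..m}. f k \<notin> A k}"]) auto
qed

lemma simplicial_polyhedral_join:
  assumes "\<And>k. k \<in> {1..m} \<Longrightarrow> simplicial_complex {1..n k} (X k)" "\<And>k. k \<in> {1..m} \<Longrightarrow> simplicial_complex {1..n k} (A k)"
  shows "simplicial_complex (vertices m n) (polyhedral_join m K X A)"
proof -
  have Y: "simplicial_complex {1..n k} (if k \<in> \<tau> then X k else A k)" if "k \<in> {1..m}" for k \<tau> using assms that by simp
  have "\<rho> \<in> polyhedral_join m K X A \<and> \<rho> \<subseteq> vertices m n" if r: "\<rho> \<subseteq> \<pi>" and p: "\<pi> \<in> polyhedral_join m K X A" for \<rho> \<pi>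
  proof -
    obtain \<tau> \<sigma> where t: "\<tau> \<in> K" "\<pi> = Sigma {1..m} \<sigma>" "\<forall>k\<in>{1..m}. \<sigma> k \<in> (if k \<in> \<tau> then X k else A k)"
      using p by (auto simp: polyhedral_join_def joins_def)
    have e: "\<rho> = Sigma {1..m} (\<lambda>k. \<rho> `` {k})" using r t(2) by auto
    have s: "\<rho> `` {k} \<subseteq> \<sigma> k" for k using r t(2) by auto
    have "\<rho> `` {k} \<in> (if k \<in> \<tau> then X k else A k)" if "k \<in> {1..m}" for k
      using Y[OF that, of \<tau>] t(3) s[of k] that unfolding simplicial_complex_def by blast
    hence "\<rho> \<in> polyhedral_join m K X A" using e t(1) unfolding polyhedral_join_def joins_def by blast
    moreover have "\<sigma> k \<subseteq> {1..n k}" if "k \<in> {1..m}" for k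
      using Y[OF that, of \<tau>] t(3) that unfolding simplicial_complex_def by blast
    hence "\<rho> \<subseteq> vertices m n" using r t(2) unfolding vertices_def by blast
    ultimately show ?thesis by blast
  qed
  thus ?thesis unfolding simplicial_complex_def by blast
qed

context cring begin

lemma finsum_Sigma:
  assumes "finite I" "\<And>k. k \<in> I \<Longrightarrow> finite (J k)" "\<And>k j. k \<in> I \<Longrightarrow> j \<in> J k \<Longrightarrow> f (k, j) \<in> carrier R"
  shows "(\<Oplus>v\<in>Sigma I J. f v) = (\<Oplus>k\<in>I. \<Oplus>j\<in>J k. f (k, j))"
  using assms
proof (induction I rule: finite_induct)
  case (insert i I)
  have e: "Sigma (insert i I) J = Pair i ` J i \<union> Sigma I J" by auto
  have "(\<Oplus>v\<in>Sigma (insert i I) J. f v) = (\<Oplus>v\<in>Pair i ` J i. f v) \<oplus> (\<Oplus>v\<in>Sigma I J. f v)"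
    unfolding e by (rule finsum_Un_disjoint) (use insert in auto)
  also have "(\<Oplus>v\<in>Pair i ` J i. f v) = (\<Oplus>j\<in>J i. f (i, j))"
    by (rule finsum_reindex) (use insert in \<open>auto simp: inj_on_def\<close>)
  also have "(\<Oplus>v\<in>Sigma I J. f v) = (\<Oplus>k\<in>I. \<Oplus>j\<in>J k. f (k, j))" using insert by simp
  finally show ?case using insert by (simp add: Pi_iff finsum_closed)
qed simp

end

text \<open>Keeps the intervals \<open>{1..m}\<close> from being rewritten to start at \<open>Suc 0\<close>.\<close>

declare One_nat_def [simp del]

locale join_data = principal_domain R for R (structure) +
  fixes m :: nat and n :: "nat \<Rightarrow> nat" and K :: "nat set set" and X A :: "nat \<Rightarrow> nat set set" and t :: "(nat \<times> nat) xindex"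
    and B :: "nat \<Rightarrow> xsym \<Rightarrow> nat \<Rightarrow> 'y set" and \<phi> :: "nat \<Rightarrow> xsym \<Rightarrow> nat \<Rightarrow> ((nat \<Rightarrow> tgen) \<Rightarrow> 'a) \<Rightarrow> ('y \<Rightarrow> 'a)"
  assumes sK: "simplicial_complex {1..m} K"
    and sX: "\<And>k. k \<in> {1..m} \<Longrightarrow> simplicial_complex {1..n k} (X k)"
    and sA: "\<And>k. k \<in> {1..m} \<Longrightarrow> simplicial_complex {1..n k} (A k)"
    and AX: "\<And>k. k \<in> {1..m} \<Longrightarrow> A k \<subseteq> X k"
    and t: "t \<in> xindices (vertices m n)"
    and sp: "\<And>k. k \<in> {1..m} \<Longrightarrow> split_pair R (iwords {1..n k} (X k) (xindex_part k t)) (twords {1..n k} (A k))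
        (word_deg {1..n k}) (tboundary R {1..n k}) (B k) (\<phi> k)"
begin

abbreviation I where "I \<equiv> {1..m}"
abbreviation N where "N k \<equiv> {1..n k}"
abbreviation V where "V \<equiv> vertices m n"
abbreviation Z where "Z \<equiv> polyhedral_join m K X A"
abbreviation S where "S k \<equiv> iwords (N k) (X k) (xindex_part k t)"

definition Ak :: "nat \<Rightarrow> ((nat \<Rightarrow> tgen) + 'y label) set" where "Ak k = both_A (twords (N k) (A k))"
definition dk :: "nat \<Rightarrow> (nat \<Rightarrow> tgen) + 'y label \<Rightarrow> nat" where "dk k = both_deg (word_deg (N k))"
definition Dk where "Dk k = both_D (word_deg (N k)) (tboundary R (N k))"

sublocale tc: tensor_complex R "{1..m}" K Ak dk Dk
  by unfold_locales (use sK in \<open>auto simp: simplicial_complex_def\<close>)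

definition S1 :: "nat \<Rightarrow> ((nat \<Rightarrow> tgen) + 'y label) set" where "S1 k = Inl ` S k"
definition S2 :: "nat \<Rightarrow> ((nat \<Rightarrow> tgen) + 'y label) set" where "S2 k = Inr ` model (B k)"

lemmas pf = pair_factor[where A = Ak and dg = dk and D = Dk, OF tc.tensor_complex_axioms _ sp Ak_def dk_def Dk_def]

lemma fin_factors: "k \<in> I \<Longrightarrow> finite (S k)" "k \<in> I \<Longrightarrow> finite (model (B k))"
  using split_pair.fS[OF sp] split_pair.finite_model[OF sp] by auto

lemma adm1: "tc.admissible S1" and adm2: "tc.admissible S2"
  unfolding tc.admissible_def S1_def S2_def using fin_factors pf(1,2) by auto

lemma part_index: "k \<in> I \<Longrightarrow> xindex_part k t \<in> xindices (N k)"
  using t by (auto simp: xindex_part_def xindices_def vertices_def)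

lemma cpx_factor: "k \<in> I \<Longrightarrow> is_cpx (level (word_deg (N k)) (S k)) (tboundary R (N k))"
  by (rule word_cpx[OF _ sX part_index]) auto

lemma cpx1: "is_cpx (tc.wordsq S1) tc.dtot"
proof (rule tc.dtot_cpx[OF adm1])
  fix k p x assume k: "k \<in> I" and "x \<in> vec {a \<in> S1 k. dk k a = p}"
  moreover have "{a \<in> S1 k. dk k a = p} = Inl ` level (word_deg (N k)) (S k) p" by (auto simp: S1_def dk_def level_iff)
  ultimately have x: "x \<in> vec (Inl ` level (word_deg (N k)) (S k) p)" by simp
  note c = cpx_factor[OF k]
  let ?y = "\<lambda>a. x (Inl a)"
  have y: "?y \<in> vec (level (word_deg (N k)) (S k) p)" by (rule lvec[OF outL_lin x])
  have Dy: "tboundary R (N k) ?y \<in> vec (level (word_deg (N k)) (S k) (p - 1))" by (rule split_pair.Dm[OF sp[OF k], THEN vlD(1), OF y])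
  hence "injL (tboundary R (N k) ?y) \<in> vec (Inl ` level (word_deg (N k)) (S k) (p - 1) :: ((nat \<Rightarrow> tgen) + 'y label) set)"
    by (rule lvec[OF injL_lin, rotated]) (use c in \<open>simp add: is_cpx_def\<close>)
  from pf(3)[OF k k this] have "Dk k (Dk k x) = injL (tboundary R (N k) (tboundary R (N k) ?y))"
    using pf(3)[OF k k x] by simp
  also have "\<dots> = (\<lambda>_. \<zero>)" using split_pair.DD[OF sp[OF k] y] by (auto simp: injL_def fun_eq_iff split: sum.splits)
  finally show "Dk k (Dk k x) = (\<lambda>_. \<zero>)" .
qed

lemma factors: "module_iso R (bhom R (tc.wordsq S1) tc.dtot q) (bhom R (tc.wordsq S2) tc.dtot q)"
    "module_iso R (bcoh R (tc.wordsq S1) tc.dtot q) (bcoh R (tc.wordsq S2) tc.dtot q)"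
  and cpx2: "is_cpx (tc.wordsq S2) tc.dtot"
proof -
  have fe: "k \<in> I \<Longrightarrow> \<exists>F G H. tc.factor_equiv k (S1 k) (S2 k) F G H" for k unfolding S1_def S2_def by (rule pf(5))
  note te = tc.tensor_equiv[OF adm1 adm2 cpx1 fe]
  show "module_iso R (bhom R (tc.wordsq S1) tc.dtot q) (bhom R (tc.wordsq S2) tc.dtot q)" by (rule te(2))
  show "module_iso R (bcoh R (tc.wordsq S1) tc.dtot q) (bcoh R (tc.wordsq S2) tc.dtot q)" by (rule te(3))
  show "is_cpx (tc.wordsq S2) tc.dtot" by (rule te(1))
qed

subsection \<open>Words of the join as words of words\<close>

text \<open>\<open>roll\<close> cuts a word on the vertices of the join into a tuple of words, tagged as elements of the pairs.\<close>

definition shape :: "(nat \<Rightarrow> (nat \<Rightarrow> tgen) + 'y label) set" where "shape = (\<Pi>\<^sub>E k\<in>I. Inl ` (N k \<rightarrow>\<^sub>E UNIV))"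
definition unroll :: "(nat \<Rightarrow> (nat \<Rightarrow> tgen) + 'y label) \<Rightarrow> (nat \<times> nat \<Rightarrow> tgen)" where "unroll w = (\<lambda>v\<in>V. projl (w (fst v)) (snd v))"
definition roll :: "(nat \<times> nat \<Rightarrow> tgen) \<Rightarrow> (nat \<Rightarrow> (nat \<Rightarrow> tgen) + 'y label)" where "roll z = (\<lambda>k\<in>I. Inl (\<lambda>j\<in>N k. z (k, j)))"

lemma V_iff: "(k, j) \<in> V \<longleftrightarrow> k \<in> I \<and> j \<in> N k" by (auto simp: vertices_def)

lemma finite_V: "finite V" by (simp add: vertices_def)

lemma roll: "z \<in> V \<rightarrow>\<^sub>E UNIV \<Longrightarrow> unroll (roll z) = z" "roll z \<in> shape"
  by (auto simp: roll_def unroll_def shape_def fun_eq_iff V_iff PiE_iff extensional_def)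

lemma unroll_in: "unroll w \<in> V \<rightarrow>\<^sub>E UNIV" by (auto simp: unroll_def)

lemma shapeD: assumes "w \<in> shape" "k \<in> I"
  shows "w k = Inl (projl (w k))" "projl (w k) \<in> N k \<rightarrow>\<^sub>E UNIV"
  using PiE_mem[OF assms(1)[unfolded shape_def] assms(2)] by auto

lemma unroll_at: "k \<in> I \<Longrightarrow> j \<in> N k \<Longrightarrow> unroll w (k, j) = projl (w k) j" by (simp add: unroll_def V_iff)

lemma roll_unroll:
  assumes w: "w \<in> shape"
  shows "roll (unroll w) = w"
proof
  fix k
  show "roll (unroll w) k = w k"
  proof (cases "k \<in> I")
    case True
    have "(\<lambda>j\<in>N k. unroll w (k, j)) = projl (w k)"
      using shapeD(2)[OF w True] unroll_at[OF True, of _ w] by (auto simp: fun_eq_iff PiE_iff extensional_def)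
    thus ?thesis using shapeD(1)[OF w True] True by (simp add: roll_def)
  next
    case False thus ?thesis using w by (auto simp: roll_def shape_def PiE_iff extensional_def)
  qed
qed

lemma words1_shape: "w \<in> tc.words S1 \<Longrightarrow> w \<in> shape"
  by (auto simp: tc.words_def shape_def S1_def PiE_iff iwords_def twords_def)

lemma simplicial_Z: "simplicial_complex V Z" by (rule simplicial_polyhedral_join[OF sX sA])

lemma unroll_words:
  assumes w: "w \<in> shape"
  shows "unroll w \<in> iwords V Z t \<longleftrightarrow> w \<in> tc.words S1"
proof -
  define f where "f k = {j\<in>N k. projl (w k) j \<notin> {Tn, Ti}}" for k
  have "{v\<in>V. unroll w v \<notin> {Tn, Ti}} = Sigma I f"
    using unroll_at[of _ _ w] by (auto simp: f_def V_iff)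
  hence tz: "unroll w \<in> twords V Z \<longleftrightarrow> (\<forall>k\<in>I. f k \<in> X k) \<and> {k\<in>I. f k \<notin> A k} \<in> K"
    using twords_iff[OF simplicial_Z] unroll_in polyhedral_join_iff[where f = f, OF sK AX] by simp
  have tx: "projl (w k) \<in> twords (N k) (X k) \<longleftrightarrow> f k \<in> X k" "projl (w k) \<in> twords (N k) (A k) \<longleftrightarrow> f k \<in> A k" if "k \<in> I" for k
    using twords_iff[OF sX[OF that]] twords_iff[OF sA[OF that]] shapeD(2)[OF w that] by (auto simp: f_def)
  have "word_index V (unroll w) = t \<longleftrightarrow> (\<forall>v\<in>V. unroll w v \<in> letters (xsym_at t v))" by (rule letters_index[OF t, symmetric])
  also have "\<dots> \<longleftrightarrow> (\<forall>k\<in>I. \<forall>j\<in>N k. unroll w (k, j) \<in> letters (xsym_at t (k, j)))"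
    unfolding vertices_def by blast
  also have "\<dots> \<longleftrightarrow> (\<forall>k\<in>I. \<forall>j\<in>N k. projl (w k) j \<in> letters (xsym_at (xindex_part k t) j))"
    by (intro ball_cong refl) (simp add: unroll_at xsym_at_def xindex_part_def)
  also have "\<dots> \<longleftrightarrow> (\<forall>k\<in>I. word_index (N k) (projl (w k)) = xindex_part k t)"
    using letters_index[OF part_index] by auto
  finally have ti: "word_index V (unroll w) = t \<longleftrightarrow> (\<forall>k\<in>I. word_index (N k) (projl (w k)) = xindex_part k t)" .
  have ws: "w \<in> (\<Pi>\<^sub>E k\<in>I. S1 k) \<longleftrightarrow> (\<forall>k\<in>I. projl (w k) \<in> S k)"
  proof -
    have "w k \<in> S1 k \<longleftrightarrow> projl (w k) \<in> S k" if "k \<in> I" for k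
      by (subst shapeD(1)[OF w that]) (auto simp: S1_def)
    thus ?thesis using w by (auto simp: PiE_iff shape_def)
  qed
  have wa: "w k \<in> Ak k \<longleftrightarrow> f k \<in> A k" if "k \<in> I" for k
    by (subst shapeD(1)[OF w that]) (simp add: Ak_def tx[OF that])
  have "{k\<in>I. w k \<notin> Ak k} = {k\<in>I. f k \<notin> A k}" using wa by auto
  hence "w \<in> tc.words S1 \<longleftrightarrow> (\<forall>k\<in>I. projl (w k) \<in> S k) \<and> {k\<in>I. f k \<notin> A k} \<in> K"
    unfolding tc.words_def using ws by simp
  moreover have "unroll w \<in> iwords V Z t \<longleftrightarrow> unroll w \<in> twords V Z \<and> word_index V (unroll w) = t"
    by (simp add: iwords_def)
  moreover have "projl (w k) \<in> S k \<longleftrightarrow> f k \<in> X k \<and> word_index (N k) (projl (w k)) = xindex_part k t" if "k \<in> I" for k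
    using tx[OF that] by (simp add: iwords_def)
  ultimately show ?thesis using tz ti by blast
qed

lemma unroll_deg:
  assumes w: "w \<in> shape"
  shows "word_deg V (unroll w) = tc.wdeg w"
proof -
  have "word_deg V (unroll w) = (\<Sum>k\<in>I. \<Sum>j\<in>N k. tdeg (unroll w (k, j)))"
    unfolding word_deg_def vertices_def by (simp add: sum.Sigma)
  also have "\<dots> = (\<Sum>k\<in>I. word_deg (N k) (projl (w k)))"
    unfolding word_deg_def by (intro sum.cong refl) (simp add: unroll_at)
  also have "\<dots> = tc.wdeg w" unfolding tc.wdeg_def
  proof (rule sum.cong[OF refl])
    fix k assume "k \<in> I"
    thus "word_deg (N k) (projl (w k)) = dk k (w k)" by (subst shapeD(1)[OF w], assumption) (simp add: dk_def)
  qed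
  finally show ?thesis .
qed

lemma eps_unroll:
  assumes w: "w \<in> shape" and k: "k \<in> I" and j: "j \<in> N k"
  shows "sg (\<Sum>u\<in>{u\<in>V. u < (k, j)}. tdeg (unroll w u)) = tc.eps k w \<otimes> sg (\<Sum>i\<in>{i\<in>N k. i < j}. tdeg (projl (w k) i))"
proof -
  let ?L = "Sigma {l\<in>I. l < k} N" and ?M = "Pair k ` {i\<in>N k. i < j}"
  have e: "{u\<in>V. u < (k, j)} = ?L \<union> ?M" using k by (auto simp: vertices_def less_prod_def)
  have "(\<Sum>u\<in>{u\<in>V. u < (k, j)}. tdeg (unroll w u)) = (\<Sum>u\<in>?L. tdeg (unroll w u)) + (\<Sum>u\<in>?M. tdeg (unroll w u))"
    unfolding e by (rule sum.union_disjoint) auto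
  also have "(\<Sum>u\<in>?M. tdeg (unroll w u)) = (\<Sum>i\<in>{i\<in>N k. i < j}. tdeg (projl (w k) i))"
    by (subst sum.reindex) (auto simp: inj_on_def unroll_at[OF k] intro!: sum.cong)
  also have "(\<Sum>u\<in>?L. tdeg (unroll w u)) = (\<Sum>l\<in>{l\<in>I. l < k}. \<Sum>i\<in>N l. tdeg (unroll w (l, i)))"
    by (simp add: sum.Sigma)
  also have "\<dots> = (\<Sum>l\<in>{l\<in>I. l < k}. dk l (w l))"
  proof (rule sum.cong[OF refl])
    fix l assume "l \<in> {l\<in>I. l < k}"
    hence l: "l \<in> I" by simp
    show "(\<Sum>i\<in>N l. tdeg (unroll w (l, i))) = dk l (w l)"
      by (subst shapeD(1)[OF w l]) (simp add: dk_def word_deg_def unroll_at[OF l])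
  qed
  finally show ?thesis by (simp add: sg_add tc.eps_def)
qed

lemma cpxZ: "is_cpx (wds V Z t) (tboundary R V)"
  by (rule word_cpx[OF finite_V simplicial_Z t])

lemma level_words1: "level tc.wdeg (tc.words T) q = tc.wordsq T q" by (auto simp: level_iff tc.wordsq_def)

text \<open>No signs are needed: the vertices of the join are ordered lexicographically, so the letters \<open>Tnbar\<close> in front of a
  vertex \<open>(k, j)\<close> are those of the parts before \<open>k\<close> and those in front of \<open>j\<close> in the part \<open>k\<close>.\<close>

lemma joins_roll:
  shows "\<exists>r j. splits (wds V Z t) (tboundary R V) {()} (\<lambda>_. 0) (\<lambda>_. tc.wordsq S1) tc.dtot r j"
proof -
  have u: "u \<in> shape" "unroll u \<in> iwords V Z t" if "u \<in> tc.words S1" for u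
    using words1_shape[OF that] unroll_words that by auto
  have z: "roll x \<in> tc.words S1 \<and> unroll (roll x) = x" if "x \<in> iwords V Z t" for x
  proof -
    have "x \<in> V \<rightarrow>\<^sub>E UNIV" using that by (auto simp: iwords_def twords_def)
    thus ?thesis using roll[of x] unroll_words[OF roll(2)[of x]] that by simp
  qed
  let ?r = "block_r (\<lambda>_. tc.words S1) (\<lambda>_. unroll) (\<lambda>_ _. \<one>)"
  have "splits (wds V Z t) (tboundary R V) {()} (\<lambda>_. 0) (\<lambda>b. level tc.wdeg (tc.words S1)) tc.dtot ?r
      (block_j (iwords V Z t) (\<lambda>_. ()) roll (\<lambda>_ _. \<one>))"
  proof (rule block_splits)
    fix b :: unit and q x w
    assume x: "x \<in> vec (wds V Z t (Suc q + 0))" and w': "w \<in> level tc.wdeg (tc.words S1) q"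
    have w: "w \<in> shape" using w' u by (simp add: level_iff)
    let ?y = "?r () x"
    have yval: "?y w' = x (unroll w')" if "w' \<in> shape" for w'
      using unroll_words[OF that] vec_out[OF x, of "unroll w'"] vec_in[OF x] by (auto simp: block_r_def level_iff)
    have y: "?y \<in> vec (tc.wordsq S1 (Suc q))"
    proof -
      have "finite (tc.wordsq S1 (Suc q))" using cpx1 by (simp add: is_cpx_def)
      moreover have "?y w' = \<zero>" if "w' \<notin> tc.wordsq S1 (Suc q)" for w'
        using that u[of w'] unroll_deg[of w'] vec_out[OF x, of "unroll w'"] by (auto simp: block_r_def level_iff tc.wordsq_def)
      ultimately show ?thesis using vec_in[OF x] by (simp add: free_mod_carrier_fin) (simp add: block_r_def)
    qed
    have "tboundary R V x (unroll w) = tb V x (unroll w)" by (simp add: tboundary_tb[OF finite_V vec_iwords[OF x]])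
    also have "\<dots> = (\<Oplus>k\<in>I. \<Oplus>j\<in>N k. sg (\<Sum>u\<in>{u\<in>V. u < (k, j)}. tdeg (unroll w u)) \<otimes>
        (if unroll w (k, j) = Tn then x ((unroll w)((k, j) := Tnbar)) else \<zero>))"
      unfolding tb_def vertices_def by (rule finsum_Sigma) (use vec_in[OF x] in auto)
    also have "\<dots> = tc.dtot ?y w" unfolding tc.dtot_def
    proof (rule add.finprod_cong')
      fix k assume k: "k \<in> I"
      let ?a = "projl (w k)"
      have sl: "(\<lambda>a. ?y (w(k := a))) \<in> vec {a\<in>S1 k. dk k a = Suc q - tc.rest k w}"
        by (rule tc.slice_deg[OF y k]) (use fin_factors k in \<open>simp add: S1_def\<close>)
      moreover have "{a\<in>S1 k. dk k a = p} = Inl ` level (word_deg (N k)) (S k) p" for p by (auto simp: S1_def dk_def level_iff)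
      ultimately have sl: "(\<lambda>a. ?y (w(k := a))) \<in> vec (Inl ` level (word_deg (N k)) (S k) (Suc q - tc.rest k w))" by simp
      have "lift k (Dk k) ?y w = tboundary R (N k) (\<lambda>a. ?y (w(k := Inl a))) ?a"
        unfolding lift_def pf(3)[OF k k sl] by (subst shapeD(1)[OF w k]) simp
      also have "\<dots> = tb (N k) (\<lambda>a. ?y (w(k := Inl a))) ?a"
        by (rule fun_cong[OF tboundary_tb[OF _ vec_iwords[OF lvec[OF outL_lin sl]]]]) simp
      finally have L: "lift k (Dk k) ?y w = tb (N k) (\<lambda>a. ?y (w(k := Inl a))) ?a" .
      have sh: "w(k := Inl (?a(j := Tnbar))) \<in> shape" if "j \<in> N k" for j
        using w k that shapeD(2)[OF w k] by (auto simp: shape_def PiE_iff extensional_def)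
      have un: "unroll (w(k := Inl (?a(j := Tnbar)))) = (unroll w)((k, j) := Tnbar)" if "j \<in> N k" for j
        using that k by (auto simp: unroll_def fun_eq_iff V_iff)
      have "(\<Oplus>j\<in>N k. sg (\<Sum>u\<in>{u\<in>V. u < (k, j)}. tdeg (unroll w u)) \<otimes> (if unroll w (k, j) = Tn then x ((unroll w)((k, j) := Tnbar)) else \<zero>))
          = (\<Oplus>j\<in>N k. tc.eps k w \<otimes> (sg (\<Sum>u\<in>{u\<in>N k. u < j}. tdeg (?a u)) \<otimes> (if ?a j = Tn then ?y (w(k := Inl (?a(j := Tnbar)))) else \<zero>)))"
        by (rule add.finprod_cong') (use vec_in[OF x] vec_in[OF y] in \<open>auto simp: eps_unroll[OF w k] unroll_at[OF k] yval[OF sh] un m_assoc\<close>)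
      also have "\<dots> = tc.eps k w \<otimes> tb (N k) (\<lambda>a. ?y (w(k := Inl a))) ?a"
        unfolding tb_def by (rule finsum_rdistr[symmetric]) (use vec_in[OF y] in auto)
      finally show "(\<Oplus>j\<in>N k. sg (\<Sum>u\<in>{u\<in>V. u < (k, j)}. tdeg (unroll w u)) \<otimes>
          (if unroll w (k, j) = Tn then x ((unroll w)((k, j) := Tnbar)) else \<zero>)) = tc.dterm k ?y w"
        unfolding tc.dterm_def L .
    qed (use tc.dterm_carrier[OF adm1 _ tc.wordsq_words[OF y]] in auto)
    finally have "tboundary R V x (unroll w) = tc.dtot ?y w" .
    thus "tc.dtot (?r b x) w = \<one> \<otimes> tboundary R V x (unroll w)"
      using vec_in[OF lvec[OF tc.dtot_lin[OF adm1] y]] by simp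
  qed (use u z unroll_deg roll_unroll cpxZ cpx1 in \<open>auto simp: level_words1[abs_def]\<close>)
  thus ?thesis unfolding level_words1[abs_def] by blast
qed

subsection \<open>Blocks of words over the classes of the pairs\<close>

text \<open>A block is a choice of one class for every pair.  In the tensor complex the letters \<open>Tnbar\<close> have to pass the
  classes in front of them, in the complex of \<open>K\<close> they do not; \<open>bsign\<close> makes up for the difference.\<close>

definition pclass :: "nat \<Rightarrow> (xsym \<times> nat \<times> 'y) set" where "pclass k = {(\<kappa>, q, b). b \<in> B k \<kappa> q}"
definition blocks where "blocks = (\<Pi>\<^sub>E k\<in>I. pclass k)"
definition bdeg :: "(nat \<Rightarrow> xsym \<times> nat \<times> 'y) \<Rightarrow> nat" where "bdeg \<beta> = (\<Sum>k\<in>I. fst (snd (\<beta> k)))"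
definition bindex :: "(nat \<Rightarrow> xsym \<times> nat \<times> 'y) \<Rightarrow> nat xindex"
  where "bindex \<beta> = ({k\<in>I. fst (\<beta> k) = Xe}, {k\<in>I. fst (\<beta> k) = Xn})"
definition merge :: "(nat \<Rightarrow> xsym \<times> nat \<times> 'y) \<Rightarrow> (nat \<Rightarrow> tgen) \<Rightarrow> (nat \<Rightarrow> (nat \<Rightarrow> tgen) + 'y label)"
  where "merge \<beta> w = (\<lambda>k\<in>I. Inr (\<beta> k, w k))"
definition bsign :: "(nat \<Rightarrow> xsym \<times> nat \<times> 'y) \<Rightarrow> (nat \<Rightarrow> tgen) \<Rightarrow> 'a"
  where "bsign \<beta> w = sg (\<Sum>l\<in>{l\<in>I. w l = Tnbar}. \<Sum>j\<in>{j\<in>I. j < l}. fst (snd (\<beta> j)))"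

lemma bindex: "bindex \<beta> \<in> xindices I" "k \<in> I \<Longrightarrow> xsym_at (bindex \<beta>) k = fst (\<beta> k)"
  by (auto simp: bindex_def xindices_def xsym_at_def) (metis xsym.exhaust)

lemma finite_pclass: "k \<in> I \<Longrightarrow> finite (pclass k)"
proof -
  assume k: "k \<in> I"
  have "pclass k \<subseteq> fst ` model (B k)"
  proof
    fix c assume "c \<in> pclass k"
    then obtain \<kappa> q b where c: "c = (\<kappa>, q, b)" "b \<in> B k \<kappa> q" by (auto simp: pclass_def)
    obtain l where "l \<in> letters \<kappa>" by (cases \<kappa>) auto
    hence "(c, l) \<in> model (B k)" using c by simp
    thus "c \<in> fst ` model (B k)" by force
  qed
  thus "finite (pclass k)" using fin_factors(2)[OF k] by (auto intro: finite_subset)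
qed

lemma finite_blocks: "finite blocks"
  unfolding blocks_def by (rule finite_PiE) (use finite_pclass in auto)

lemma merge_words:
  assumes \<beta>: "\<beta> \<in> blocks" and w: "w \<in> I \<rightarrow>\<^sub>E UNIV"
  shows "merge \<beta> w \<in> tc.words S2 \<longleftrightarrow> w \<in> iwords I K (bindex \<beta>)"
proof -
  have c: "\<beta> k \<in> pclass k" if "k \<in> I" for k using \<beta> that by (auto simp: blocks_def)
  have s: "Inr (\<beta> k, w k) \<in> S2 k \<longleftrightarrow> w k \<in> letters (xsym_at (bindex \<beta>) k)" if "k \<in> I" for k
    using c[OF that] bindex(2)[OF that, of \<beta>] by (cases "\<beta> k") (auto simp: S2_def pclass_def)
  have "{k\<in>I. merge \<beta> w k \<notin> Ak k} = {k\<in>I. w k \<notin> {Tn, Ti}}" by (auto simp: merge_def Ak_def)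
  moreover have "merge \<beta> w \<in> (\<Pi>\<^sub>E k\<in>I. S2 k) \<longleftrightarrow> word_index I w = bindex \<beta>"
    unfolding letters_index[OF bindex(1), symmetric] using s by (auto simp: merge_def PiE_iff)
  ultimately show ?thesis using w twords_iff[OF sK, of w] by (auto simp: tc.words_def iwords_def)
qed

lemma merge_deg: "tc.wdeg (merge \<beta> w) = word_deg I w + bdeg \<beta>"
proof -
  have "dk k (merge \<beta> w k) = tdeg (w k) + fst (snd (\<beta> k))" if "k \<in> I" for k
    using that by (cases "\<beta> k") (simp add: merge_def dk_def)
  thus ?thesis by (simp add: tc.wdeg_def word_deg_def bdeg_def sum.distrib)
qed

lemma bsign_upd:
  assumes k: "k \<in> I" and wk: "w k = Tn"
  shows "sg (\<Sum>u\<in>{u\<in>I. u < k}. tdeg (w u)) \<otimes> bsign \<beta> (w(k := Tnbar)) = bsign \<beta> w \<otimes> tc.eps k (merge \<beta> w)"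
proof -
  let ?s = "\<lambda>l. \<Sum>j\<in>{j\<in>I. j < l}. fst (snd (\<beta> j))"
  have e: "{l\<in>I. (w(k := Tnbar)) l = Tnbar} = insert k {l\<in>I. w l = Tnbar}" using k by auto
  have "(\<Sum>l\<in>{l\<in>I. (w(k := Tnbar)) l = Tnbar}. ?s l) = ?s k + (\<Sum>l\<in>{l\<in>I. w l = Tnbar}. ?s l)"
    unfolding e by (rule sum.insert) (use wk in auto)
  hence b: "bsign \<beta> (w(k := Tnbar)) = sg (?s k) \<otimes> bsign \<beta> w" by (simp add: bsign_def sg_add)
  have "dk l (merge \<beta> w l) = fst (snd (\<beta> l)) + tdeg (w l)" if "l \<in> I" for l
    using that by (cases "\<beta> l") (simp add: merge_def dk_def)
  hence "(\<Sum>l\<in>{l\<in>I. l < k}. dk l (merge \<beta> w l)) = ?s k + (\<Sum>u\<in>{u\<in>I. u < k}. tdeg (w u))"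
    by (simp add: sum.distrib)
  hence "tc.eps k (merge \<beta> w) = sg (?s k) \<otimes> sg (\<Sum>u\<in>{u\<in>I. u < k}. tdeg (w u))" by (simp add: tc.eps_def sg_add)
  thus ?thesis unfolding b by (simp add: bsign_def m_ac)
qed

lemma cpxK: "is_cpx (wds I K (bindex \<beta>)) (tboundary R I)"
  by (rule word_cpx[OF _ sK bindex(1)]) simp

definition tag where "tag x = (\<lambda>k\<in>I. fst (projr (x k)))" for x :: "nat \<Rightarrow> (nat \<Rightarrow> tgen) + 'y label"
definition rst where "rst x = (\<lambda>k\<in>I. snd (projr (x k)))" for x :: "nat \<Rightarrow> (nat \<Rightarrow> tgen) + 'y label"

lemma tag_merge: "\<beta> \<in> blocks \<Longrightarrow> tag (merge \<beta> w) = \<beta>" "w \<in> I \<rightarrow>\<^sub>E UNIV \<Longrightarrow> rst (merge \<beta> w) = w"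
  by (auto simp: tag_def rst_def merge_def blocks_def fun_eq_iff PiE_iff extensional_def)

lemma words2:
  assumes x: "x \<in> tc.words S2"
  shows "tag x \<in> blocks" "rst x \<in> I \<rightarrow>\<^sub>E UNIV" "merge (tag x) (rst x) = x"
proof -
  have xk: "x k \<in> Inr ` model (B k)" if "k \<in> I" for k using x that by (auto simp: tc.words_def S2_def)
  have xI: "x k = undefined" if "k \<notin> I" for k using x that by (auto simp: tc.words_def PiE_iff extensional_def)
  have "fst (projr (x k)) \<in> pclass k" if "k \<in> I" for k using xk[OF that] by (auto simp: pclass_def model_def)
  thus "tag x \<in> blocks" by (auto simp: tag_def blocks_def)
  show "rst x \<in> I \<rightarrow>\<^sub>E UNIV" by (auto simp: rst_def)
  show "merge (tag x) (rst x) = x"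
  proof
    fix k show "merge (tag x) (rst x) k = x k" using xk[of k] xI[of k] by (auto simp: merge_def tag_def rst_def)
  qed
qed

text \<open>The differential of the model changes the letter of a label and keeps its class, so the words with the classes \<open>\<beta>\<close> span
  a subcomplex, and forgetting the classes identifies it with the complex of \<open>K\<close>.\<close>

lemma blocks_split: "\<exists>r j. splits (tc.wordsq S2) tc.dtot blocks bdeg
    (\<lambda>\<beta>. wds I K (bindex \<beta>)) (tboundary R I) r j"
proof -
  let ?U = "\<lambda>\<beta>. iwords I K (bindex \<beta>)"
  have U: "w \<in> I \<rightarrow>\<^sub>E UNIV" if "w \<in> ?U \<beta>" for w \<beta> using that by (auto simp: iwords_def twords_def)
  have bs: "bsign \<beta> w \<in> carrier R" "bsign \<beta> w \<otimes> bsign \<beta> w = \<one>" for \<beta> w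
    using sg_sq[of \<one>] by (auto simp: bsign_def)
  let ?r = "block_r ?U merge bsign"
  have "splits (level tc.wdeg (tc.words S2)) tc.dtot blocks bdeg (\<lambda>\<beta>. level (word_deg I) (?U \<beta>)) (tboundary R I)
      ?r (block_j (tc.words S2) tag rst bsign)"
  proof (rule block_splits)
    fix \<beta> q x w assume \<beta>: "\<beta> \<in> blocks" and x': "x \<in> vec (level tc.wdeg (tc.words S2) (Suc q + bdeg \<beta>))"
      and w': "w \<in> level (word_deg I) (?U \<beta>) q"
    have x: "x \<in> vec (tc.wordsq S2 (Suc (q + bdeg \<beta>)))" using x' by (simp add: level_words1)
    have w: "w \<in> I \<rightarrow>\<^sub>E UNIV" using w' U[of w \<beta>] by (simp add: level_iff)
    let ?y = "?r \<beta> x" and ?z = "merge \<beta> w"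
    have yval: "?y v = bsign \<beta> v \<otimes> x (merge \<beta> v)" if "v \<in> I \<rightarrow>\<^sub>E UNIV" for v
      using merge_words[OF \<beta> that] vec_out[OF tc.wordsq_words[OF x], of "merge \<beta> v"] bs by (auto simp: block_r_def)
    have yR: "?y v \<in> carrier R" for v using vec_in[OF x] bs by (simp add: block_r_def)
    have y: "?y \<in> vec (I \<rightarrow>\<^sub>E UNIV)"
      using yR U by (auto simp: free_mod_carrier_fin[OF finite_PiE[OF _ finite_tgen]] block_r_def)
    have "tboundary R I ?y w = tb I ?y w" by (simp add: tboundary_tb[OF _ y])
    also have "\<dots> = (\<Oplus>k\<in>I. bsign \<beta> w \<otimes> tc.dterm k x ?z)" unfolding tb_def
    proof (rule add.finprod_cong')
      fix k assume k: "k \<in> I"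
      have sl: "(\<lambda>a. x (?z(k := a))) \<in> vec {a\<in>S2 k. dk k a = Suc (q + bdeg \<beta>) - tc.rest k ?z}"
        by (rule tc.slice_deg[OF x k]) (use fin_factors k in \<open>simp add: S2_def\<close>)
      moreover have "{a\<in>S2 k. dk k a = p} = Inr ` level model_deg (model (B k)) p" for p by (auto simp: S2_def dk_def level_iff)
      ultimately have sl: "(\<lambda>a. x (?z(k := a))) \<in> vec (Inr ` level model_deg (model (B k)) (Suc (q + bdeg \<beta>) - tc.rest k ?z))" by simp
      have "lift k (Dk k) x ?z = (if w k = Tn then x (?z(k := Inr (\<beta> k, Tnbar))) else \<zero>)"
        unfolding lift_def pf(4)[OF k k sl] using k by (simp add: merge_def)
      moreover have "?z(k := Inr (\<beta> k, Tnbar)) = merge \<beta> (w(k := Tnbar))" using k by (auto simp: merge_def fun_eq_iff)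
      ultimately have L: "lift k (Dk k) x ?z = (if w k = Tn then x (merge \<beta> (w(k := Tnbar))) else \<zero>)" by simp
      have wu: "w(k := Tnbar) \<in> I \<rightarrow>\<^sub>E UNIV" using w k by (auto simp: PiE_iff extensional_def)
      show "sg (\<Sum>u\<in>{u\<in>I. u < k}. tdeg (w u)) \<otimes> (if w k = Tn then ?y (w(k := Tnbar)) else \<zero>) = bsign \<beta> w \<otimes> tc.dterm k x ?z"
      proof (cases "w k = Tn")
        case True
        have "sg (\<Sum>u\<in>{u\<in>I. u < k}. tdeg (w u)) \<otimes> ?y (w(k := Tnbar))
            = (sg (\<Sum>u\<in>{u\<in>I. u < k}. tdeg (w u)) \<otimes> bsign \<beta> (w(k := Tnbar))) \<otimes> x (merge \<beta> (w(k := Tnbar)))"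
          using vec_in[OF x] bs by (simp add: yval[OF wu] m_assoc)
        also have "\<dots> = bsign \<beta> w \<otimes> tc.dterm k x ?z"
          by (subst bsign_upd[where w = w, OF k True]) (use vec_in[OF x] bs True in \<open>simp add: tc.dterm_def L m_assoc\<close>)
        finally show ?thesis using True by simp
      qed (use bs in \<open>simp add: tc.dterm_def L\<close>)
    qed (use bs tc.dterm_carrier[OF adm2 _ tc.wordsq_words[OF x]] in auto)
    also have "\<dots> = bsign \<beta> w \<otimes> tc.dtot x ?z" unfolding tc.dtot_def
      by (rule finsum_rdistr[symmetric]) (use bs tc.dterm_carrier[OF adm2 _ tc.wordsq_words[OF x]] in auto)
    finally show "tboundary R I ?y w = bsign \<beta> w \<otimes> tc.dtot x ?z" .
  next
    fix \<beta> w assume b: "\<beta> \<in> blocks" and w: "w \<in> ?U \<beta>"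
    thus "merge \<beta> w \<in> tc.words S2 \<and> tc.wdeg (merge \<beta> w) = word_deg I w + bdeg \<beta> \<and> tag (merge \<beta> w) = \<beta> \<and> rst (merge \<beta> w) = w"
      using merge_words[OF b U[OF w]] merge_deg tag_merge(1)[OF b] tag_merge(2)[OF U[OF w]] by simp
  next
    fix x assume x: "x \<in> tc.words S2"
    thus "tag x \<in> blocks \<and> rst x \<in> ?U (tag x) \<and> merge (tag x) (rst x) = x"
      using words2[OF x] merge_words[OF words2(1,2)[OF x]] by simp
  qed (use finite_blocks bs cpx2 cpxK in \<open>simp_all add: level_words1[abs_def]\<close>)
  thus ?thesis unfolding level_words1[abs_def] by blast
qed

lemma join_hom: "module_iso R (thom R V Z t q) (dsum {\<beta>\<in>blocks. bdeg \<beta> \<le> q} (\<lambda>\<beta>. thom R I K (bindex \<beta>) (q - bdeg \<beta>)))"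
  and join_coh: "module_iso R (tcoh R V Z t q) (dsum {\<beta>\<in>blocks. bdeg \<beta> \<le> q} (\<lambda>\<beta>. tcoh R I K (bindex \<beta>) (q - bdeg \<beta>)))"
proof -
  obtain r j where a: "splits (wds V Z t) (tboundary R V) {()} (\<lambda>_. 0) (\<lambda>_. tc.wordsq S1) tc.dtot r j"
    using joins_roll by blast
  note h = splits_single[OF a refl cpxZ cpx1]
  obtain r' j' where b: "splits (tc.wordsq S2) tc.dtot blocks bdeg
    (\<lambda>\<beta>. wds I K (bindex \<beta>)) (tboundary R I) r' j'" using blocks_split by blast
  show "module_iso R (thom R V Z t q) (dsum {\<beta>\<in>blocks. bdeg \<beta> \<le> q} (\<lambda>\<beta>. thom R I K (bindex \<beta>) (q - bdeg \<beta>)))"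
    unfolding thom_bhom
    by (rule module_iso_trans[OF module_iso_trans[OF hequiv_hom[OF cpxZ cpx1 h] factors(1)] splits_hom[OF cpx2 cpxK b]])
  show "module_iso R (tcoh R V Z t q) (dsum {\<beta>\<in>blocks. bdeg \<beta> \<le> q} (\<lambda>\<beta>. tcoh R I K (bindex \<beta>) (q - bdeg \<beta>)))"
    unfolding tcoh_bcoh
    by (rule module_iso_trans[OF module_iso_trans[OF hequiv_coh[OF cpxZ cpx1 h] factors(2)] splits_coh[OF cpx2 cpxK b]])
qed

end

section \<open>The classes of a densely split pair\<close>

context principal_domain begin

text \<open>The ring has \<open>\<one> \<noteq> \<zero>\<close>, so every basis element gives a nonzero vector.\<close>

lemma iso_free_trivial:
  assumes i: "module_iso R M (Fr S)" and c: "carrier M = {z}"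
  shows "S = {}"
proof (rule ccontr)
  assume "S \<noteq> {}"
  then obtain s where s: "s \<in> S" by blast
  obtain h where "bij_betw h (carrier M) (vec S)" using i by (auto simp: module_iso_def)
  hence "vec S = {h z}" using c by (auto simp: bij_betw_def)
  hence "free_gen R s = (\<lambda>_. \<zero>)" using free_gen_carrier[OF s] vec_zero[of S] by auto
  hence "free_gen R s s = \<zero>" by (rule fun_cong)
  thus False using one_not_zero by (simp add: free_gen_def)
qed

context
  fixes V :: "'v::linorder set" and X A :: "'v set set" and s :: "'v xindex"
  assumes V: "finite V" and sX: "simplicial_complex V X" and sA: "simplicial_complex V A" and AX: "A \<subseteq> X"
    and s: "s \<in> xindices V"
begin

abbreviation WX where "WX \<equiv> wds V X s"
abbreviation WA where "WA \<equiv> wds V A s"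
abbreviation dV where "dV \<equiv> tboundary R V"

lemma iwords_A: "iwords V X s \<inter> twords V A = iwords V A s"
  using AX by (auto simp: iwords_def twords_def)

lemma cX: "is_cpx WX dV" and cA: "is_cpx WA dV"
  by (rule word_cpx[OF V sX s], rule word_cpx[OF V sA s])

lemma vAX: "z \<in> vec (WA q) \<Longrightarrow> z \<in> vec (WX q)"
  by (erule vec_mono) (use iwords_A in \<open>auto simp: level_iff\<close>)

lemma tchain_eq: "tchain R V K s q = Fr (wds V K s q)"
proof -
  have "{w \<in> twords V K. word_index V w = s \<and> word_deg V w = q} = wds V K s q"
    by (auto simp: level_iff iwords_def)
  thus ?thesis by (simp add: tchain_def)
qed

lemma tboundaries_eq: "tboundaries R V K s q = Bc (wds V K s) dV q"
  by (simp add: tboundaries_def Bc_def tchain_eq)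

lemma tcoboundaries_eq: "tcoboundaries R V K s q = Bco (wds V K s) dV q"
proof -
  have "tcoboundary R V K s p = pullback (vec (wds V K s (Suc p))) dV" for p
    by (simp add: fun_eq_iff tcoboundary_def pullback_def tchain_eq)
  thus ?thesis by (cases q) (simp_all add: tcoboundaries_def Bco_def tcochain_def tchain_eq)
qed

lemma homology_map:
  shows "\<exists>p. presents R (Fr (WA q)\<lparr>carrier := {z \<in> Zc WA dV q. z \<in> Bc WX dV q}\<rparr>) p (ker_theta R V X A s q) (Bc WA dV q)"
    and "\<exists>p. presents R (Fr (WX q)\<lparr>carrier := Zc WX dV q\<rparr>) p (coker_theta R V X A s q)
      {z \<in> Zc WX dV q. \<exists>y\<in>Zc WA dV q. vdiff z y \<in> Bc WX dV q}"
    and "\<exists>p. presents R (Fr (WA q)\<lparr>carrier := Zc WA dV q\<rparr>) p (coim_theta R V X A s q) {z \<in> Zc WA dV q. z \<in> Bc WX dV q}"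
proof -
  have ZAX: "z \<in> Zc WX dV q" if "z \<in> Zc WA dV q" for z using that vAX by (auto simp: Zc_def)
  have lin: "lin R (Fr (WA q)\<lparr>carrier := Zc WA dV q\<rparr>) (Fr (WX q)\<lparr>carrier := Zc WX dV q\<rparr>) (\<lambda>z. z)"
    by (rule linI) (use ZAX in auto)
  have BB: "(\<lambda>z. z) ` Bc WA dV q \<subseteq> Bc WX dV q" using vAX by (auto simp: Bc_def)
  note im = induced_map[OF module_free cpx_subm[OF cA] module_free cpx_subm[OF cX] lin BB, of "theta R V X s q"]
  have th: "theta R V X s q C = (\<Union>z\<in>C. Bc WX dV q +>\<^bsub>Fr (WX q)\<^esub> z)" for C
    by (simp add: theta_def tboundaries_eq tchain_eq)
  have HA: "subquot_mod (Fr (WA q)) (Zc WA dV q) (Bc WA dV q) = thom R V A s q"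
    and HX: "subquot_mod (Fr (WX q)) (Zc WX dV q) (Bc WX dV q) = thom R V X s q"
    by (simp_all add: thom_bhom bhom_eq)
  note im = im[OF th, unfolded HA HX]
  have e: "{y \<in> Zc WX dV q. \<exists>x\<in>Zc WA dV q. y \<ominus>\<^bsub>Fr (WX q)\<^esub> x \<in> Bc WX dV q}
      = {z \<in> Zc WX dV q. \<exists>y\<in>Zc WA dV q. vdiff z y \<in> Bc WX dV q}"
  proof -
    have "y \<ominus>\<^bsub>Fr (WX q)\<^esub> x = vdiff y x" if "y \<in> Zc WX dV q" "x \<in> Zc WA dV q" for x y
      using that ZAX[of x] by (simp add: Zc_def free_minus vdiff_def)
    thus ?thesis by auto
  qed
  show "\<exists>p. presents R (Fr (WA q)\<lparr>carrier := {z \<in> Zc WA dV q. z \<in> Bc WX dV q}\<rparr>) p (ker_theta R V X A s q) (Bc WA dV q)"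
    using im(2) unfolding ker_theta_def .
  show "\<exists>p. presents R (Fr (WX q)\<lparr>carrier := Zc WX dV q\<rparr>) p (coker_theta R V X A s q)
      {z \<in> Zc WX dV q. \<exists>y\<in>Zc WA dV q. vdiff z y \<in> Bc WX dV q}"
    using im(3) unfolding coker_theta_def e .
  show "\<exists>p. presents R (Fr (WA q)\<lparr>carrier := Zc WA dV q\<rparr>) p (coim_theta R V X A s q) {z \<in> Zc WA dV q. z \<in> Bc WX dV q}"
    using im(4) unfolding coim_theta_def .
qed

lemma cohomology_map:
  assumes sp: "split_pair R (iwords V X s) (twords V A) (word_deg V) dV B \<phi>"
  shows "\<exists>p. presents R (Du (WX q)\<lparr>carrier := {f \<in> Zco WX dV q. restrict f (vec (WA q)) \<in> Bco WA dV q}\<rparr>) p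
      (ker_theta_co R V X A s q) (Bco WX dV q)"
    and "\<exists>p. presents R (Du (WA q)\<lparr>carrier := Zco WA dV q\<rparr>) p (coker_theta_co R V X A s q)
      {f \<in> Zco WA dV q. \<exists>h\<in>Zco WX dV q. f \<ominus>\<^bsub>Du (WA q)\<^esub> restrict h (vec (WA q)) \<in> Bco WA dV q}"
    and "\<exists>p. presents R (Du (WX q)\<lparr>carrier := Zco WX dV q\<rparr>) p (im_theta_co R V X A s q)
      {f \<in> Zco WX dV q. restrict f (vec (WA q)) \<in> Bco WA dV q}"
proof -
  interpret sp: split_pair R "iwords V X s" "twords V A" "word_deg V" dV B \<phi> by (rule sp)
  obtain F G H where ret: "sp.retraction F G H" using sp.retraction_exists by blast
  note md = module_dual[OF module_free]
  note rl = sp.res_lin[OF ret, unfolded iwords_A] and rZ = sp.res_Zco[OF ret, unfolded iwords_A]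
    and rB = sp.res_Bco[OF ret, unfolded iwords_A]
  have lin: "lin R (Du (WX q)\<lparr>carrier := Zco WX dV q\<rparr>) (Du (WA q)\<lparr>carrier := Zco WA dV q\<rparr>)
      (\<lambda>f. restrict f (vec (WA q)))"
  proof (rule linI)
    fix f g assume "f \<in> carrier (Du (WX q)\<lparr>carrier := Zco WX dV q\<rparr>)" "g \<in> carrier (Du (WX q)\<lparr>carrier := Zco WX dV q\<rparr>)"
    hence "f \<in> covec (WX q)" "g \<in> covec (WX q)" by (simp_all add: Zco_iff)
    from lin_add[OF rl this] show "restrict (f \<oplus>\<^bsub>Du (WX q)\<lparr>carrier := Zco WX dV q\<rparr>\<^esub> g) (vec (WA q))
      = restrict f (vec (WA q)) \<oplus>\<^bsub>Du (WA q)\<lparr>carrier := Zco WA dV q\<rparr>\<^esub> restrict g (vec (WA q))" by simp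
  next
    fix a f assume a: "a \<in> carrier R" and "f \<in> carrier (Du (WX q)\<lparr>carrier := Zco WX dV q\<rparr>)"
    hence "f \<in> covec (WX q)" by (simp add: Zco_iff)
    from lin_smult[OF rl a this] show "restrict (a \<odot>\<^bsub>Du (WX q)\<lparr>carrier := Zco WX dV q\<rparr>\<^esub> f) (vec (WA q))
      = a \<odot>\<^bsub>Du (WA q)\<lparr>carrier := Zco WA dV q\<rparr>\<^esub> restrict f (vec (WA q))" by simp
  qed (use rZ in simp)
  have BB: "(\<lambda>f. restrict f (vec (WA q))) ` Bco WX dV q \<subseteq> Bco WA dV q" using rB by (rule image_subsetI)
  have th: "theta_co R V A s q C = (\<Union>f\<in>C. Bco WA dV q +>\<^bsub>Du (WA q)\<^esub> restrict f (vec (WA q)))" for C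
    by (simp add: theta_co_def tcoboundaries_eq tchain_eq tcochain_def)
  have HX: "subquot_mod (Du (WX q)) (Zco WX dV q) (Bco WX dV q) = tcoh R V X s q"
    and HA: "subquot_mod (Du (WA q)) (Zco WA dV q) (Bco WA dV q) = tcoh R V A s q"
    by (simp_all add: tcoh_bcoh bcoh_eq)
  note im = induced_map[OF md cpx_subm_co[OF cX] md cpx_subm_co[OF cA] lin BB, of "theta_co R V A s q", OF th, unfolded HA HX]
  show "\<exists>p. presents R (Du (WX q)\<lparr>carrier := {f \<in> Zco WX dV q. restrict f (vec (WA q)) \<in> Bco WA dV q}\<rparr>) p
      (ker_theta_co R V X A s q) (Bco WX dV q)" using im(2) unfolding ker_theta_co_def .
  show "\<exists>p. presents R (Du (WA q)\<lparr>carrier := Zco WA dV q\<rparr>) p (coker_theta_co R V X A s q)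
      {f \<in> Zco WA dV q. \<exists>h\<in>Zco WX dV q. f \<ominus>\<^bsub>Du (WA q)\<^esub> restrict h (vec (WA q)) \<in> Bco WA dV q}"
    using im(3) unfolding coker_theta_co_def .
  show "\<exists>p. presents R (Du (WX q)\<lparr>carrier := Zco WX dV q\<rparr>) p (im_theta_co R V X A s q)
      {f \<in> Zco WX dV q. restrict f (vec (WA q)) \<in> Bco WA dV q}" using im(5) unfolding im_theta_co_def .
qed

text \<open>The bases \<open>B\<close> come from freeness in homology; the retraction then shows that they are bases in cohomology as well.\<close>

lemma split_pair_exists:
  assumes d: "\<And>q. free_module R (ker_theta R V X A s q) \<and> free_module R (coker_theta R V X A s q) \<and> free_module R (coim_theta R V X A s q)"
  shows "\<exists>(B :: xsym \<Rightarrow> nat \<Rightarrow> (('v \<Rightarrow> tgen) \<Rightarrow> 'a) set set set) \<phi>. split_pair R (iwords V X s) (twords V A) (word_deg V) dV B \<phi>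
    \<and> (\<forall>\<kappa> q. module_iso R (pair_hom R V X A \<kappa> s q) (Fr (B \<kappa> q)) \<and> Module.module R (pair_hom R V X A \<kappa> s q))
    \<and> (\<forall>\<kappa> q. module_iso R (pair_coh R V X A \<kappa> s q) (Fr (B \<kappa> q)) \<and> Module.module R (pair_coh R V X A \<kappa> s q))"
proof -
  have "free_module R (pair_hom R V X A \<kappa> s q)" for \<kappa> q using d[of q] by (cases \<kappa>) auto
  hence "\<exists>S :: (('v \<Rightarrow> tgen) \<Rightarrow> 'a) set set set. module_iso R (Fr S) (pair_hom R V X A \<kappa> s q)" for \<kappa> q by (simp add: free_module_def)
  hence "\<exists>B :: _ \<Rightarrow> _ \<Rightarrow> (('v \<Rightarrow> tgen) \<Rightarrow> 'a) set set set. \<forall>\<kappa> q. module_iso R (Fr (B \<kappa> q)) (pair_hom R V X A \<kappa> s q)" by metis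
  then obtain B :: "xsym \<Rightarrow> nat \<Rightarrow> (('v \<Rightarrow> tgen) \<Rightarrow> 'a) set set set" where B: "module_iso R (Fr (B \<kappa> q)) (pair_hom R V X A \<kappa> s q)" for \<kappa> q by blast
  have Bi: "module_iso R (pair_hom R V X A \<kappa> s q) (Fr (B \<kappa> q))" for \<kappa> q by (rule module_iso_sym[OF module_free B])
  define M where "M \<kappa> q = (case \<kappa> of Xe \<Rightarrow> Fr (WX q)\<lparr>carrier := Zc WX dV q\<rparr>
    | Xn \<Rightarrow> Fr (WA q)\<lparr>carrier := {z \<in> Zc WA dV q. z \<in> Bc WX dV q}\<rparr> | Xi \<Rightarrow> Fr (WA q)\<lparr>carrier := Zc WA dV q\<rparr>)" for \<kappa> q
  define Q where "Q \<kappa> q = (case \<kappa> of Xe \<Rightarrow> {z \<in> Zc WX dV q. \<exists>y\<in>Zc WA dV q. vdiff z y \<in> Bc WX dV q}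
    | Xn \<Rightarrow> Bc WA dV q | Xi \<Rightarrow> {z \<in> Zc WA dV q. z \<in> Bc WX dV q})" for \<kappa> q
  have "\<exists>p. presents R (M \<kappa> q) p (pair_hom R V X A \<kappa> s q) (Q \<kappa> q)" for \<kappa> q
    using homology_map[of q] by (cases \<kappa>) (auto simp: M_def Q_def)
  then obtain p where p: "presents R (M \<kappa> q) (p \<kappa> q) (pair_hom R V X A \<kappa> s q) (Q \<kappa> q)" for \<kappa> q by metis
  hence m: "Module.module R (pair_hom R V X A \<kappa> s q)" for \<kappa> q by (meson presents_def)
  have "\<exists>f. presents R (M \<kappa> q) f (Fr (B \<kappa> q)) (Q \<kappa> q)" for \<kappa> q by (rule presents_iso_right[OF p Bi module_free])
  then obtain \<phi> where f: "presents R (M \<kappa> q) (\<phi> \<kappa> q) (Fr (B \<kappa> q)) (Q \<kappa> q)" for \<kappa> q by metis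
  have fr: "Fr (WA q)\<lparr>carrier := P\<rparr> = Fr (WX q)\<lparr>carrier := P\<rparr>" for P q by (simp only: free_mod_def partial_object.update_convs)
  have sp: "split_pair R (iwords V X s) (twords V A) (word_deg V) dV B \<phi>"
  proof unfold_locales
    have "iwords V X s \<subseteq> V \<rightarrow>\<^sub>E UNIV" by (auto simp: iwords_def twords_def)
    thus "finite (iwords V X s)" using finite_PiE[OF V finite_tgen] by (rule finite_subset)
  qed (use cX cA f[of Xe] f[of Xn] f[of Xi] in \<open>simp_all add: iwords_A M_def Q_def fr\<close>)
  interpret sp: split_pair R "iwords V X s" "twords V A" "word_deg V" dV B \<phi> by (rule sp)
  obtain F G H where ret: "sp.retraction F G H" using sp.retraction_exists by blast
  have "module_iso R (pair_coh R V X A \<kappa> s q) (Fr (B \<kappa> q)) \<and> Module.module R (pair_coh R V X A \<kappa> s q)" for \<kappa> q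
  proof (cases \<kappa>)
    case Xe
    obtain p where p: "presents R (Du (WX q)\<lparr>carrier := {f \<in> Zco WX dV q. restrict f (vec (WA q)) \<in> Bco WA dV q}\<rparr>) p
      (ker_theta_co R V X A s q) (Bco WX dV q)" using cohomology_map(1)[OF sp] by blast
    show ?thesis using presents_iso[OF p sp.coh_ker[OF ret, unfolded iwords_A]] p Xe by (simp add: presents_def)
  next
    case Xn
    obtain p where p: "presents R (Du (WA q)\<lparr>carrier := Zco WA dV q\<rparr>) p (coker_theta_co R V X A s q)
      {f \<in> Zco WA dV q. \<exists>h\<in>Zco WX dV q. f \<ominus>\<^bsub>Du (WA q)\<^esub> restrict h (vec (WA q)) \<in> Bco WA dV q}"
      using cohomology_map(2)[OF sp] by blast
    show ?thesis using presents_iso[OF p sp.coh_coker[OF ret, unfolded iwords_A]] p Xn by (simp add: presents_def)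
  next
    case Xi
    obtain p where p: "presents R (Du (WX q)\<lparr>carrier := Zco WX dV q\<rparr>) p (im_theta_co R V X A s q)
      {f \<in> Zco WX dV q. restrict f (vec (WA q)) \<in> Bco WA dV q}" using cohomology_map(3)[OF sp] by blast
    show ?thesis using presents_iso[OF p sp.coh_im[OF ret, unfolded iwords_A]] p Xi by (simp add: presents_def)
  qed
  thus ?thesis using sp Bi m by (intro exI[of _ B] exI[of _ \<phi>]) simp
qed

lemma coker_trivial:
  assumes "theta_epi R V X A s"
  shows "\<exists>z. carrier (coker_theta R V X A s q) = {z}"
proof -
  let ?N = "thom R V X s q"
  have m: "Module.module R ?N" unfolding thom_bhom by (rule module_bhom[OF cX])
  note p = presents_quot[OF m subm_carrier[OF m]]
  have e: "theta R V X s q ` carrier (thom R V A s q) = carrier ?N" using assms by (simp add: theta_epi_def)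
  have "carrier (coker_theta R V X A s q) \<subseteq> {\<zero>\<^bsub>quot_mod ?N (carrier ?N)\<^esub>}"
    using p unfolding coker_theta_def mod_coker_def e presents_def by auto
  moreover have "carrier (coker_theta R V X A s q) \<noteq> {}"
  proof -
    obtain p' where "presents R (Fr (WX q)\<lparr>carrier := Zc WX dV q\<rparr>) p' (coker_theta R V X A s q)
      {z \<in> Zc WX dV q. \<exists>y\<in>Zc WA dV q. vdiff z y \<in> Bc WX dV q}" using homology_map(2) by blast
    then interpret Module.module R "coker_theta R V X A s q" by (simp add: presents_def)
    show ?thesis using M.zero_closed by blast
  qed
  ultimately show ?thesis by blast
qed

end

end

section \<open>Tensor products over the blocks\<close>

context join_data begin

text \<open>A block amounts to an index \<open>s\<close>, a degree for every pair, and a basis element of every module of the kind given by \<open>s\<close>.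
  These data also index the basis of the tensor product.\<close>

lemma bij_blocks:
  assumes D: "\<And>\<beta>. \<beta> \<in> blocks \<Longrightarrow> bindex \<beta> \<in> D" "D \<subseteq> xindices I"
  shows "bij_betw (\<lambda>\<beta>. (bindex \<beta>, (q - bdeg \<beta>, bdeg \<beta>), (\<lambda>k\<in>I. fst (snd (\<beta> k))), (\<lambda>k\<in>I. snd (snd (\<beta> k)))))
    {\<beta>\<in>blocks. bdeg \<beta> \<le> q}
    (SIGMA s:D. SIGMA ij:{(i, j). i + j = q}. SIGMA d:{d \<in> I \<rightarrow>\<^sub>E UNIV. (\<Sum>k\<in>I. d k) = snd ij}. \<Pi>\<^sub>E k\<in>I. B k (xsym_at s k) (d k))"
proof (rule bij_betw_byWitness[where f' = "\<lambda>(s, ij, d, b). \<lambda>k\<in>I. (xsym_at s k, d k, b k)"])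
  let ?f = "\<lambda>\<beta>. (bindex \<beta>, (q - bdeg \<beta>, bdeg \<beta>), (\<lambda>k\<in>I. fst (snd (\<beta> k))), (\<lambda>k\<in>I. snd (snd (\<beta> k))))"
  let ?g = "\<lambda>(s, ij :: nat \<times> nat, d, b). \<lambda>k\<in>I. (xsym_at s k, d k, b k)"
  let ?T = "SIGMA s:D. SIGMA ij:{(i, j). i + j = q}. SIGMA d:{d \<in> I \<rightarrow>\<^sub>E UNIV. (\<Sum>k\<in>I. d k) = snd ij}. \<Pi>\<^sub>E k\<in>I. B k (xsym_at s k) (d k)"
  show "\<forall>\<beta>\<in>{\<beta>\<in>blocks. bdeg \<beta> \<le> q}. ?g (?f \<beta>) = \<beta>"
    using bindex(2) by (auto simp: blocks_def fun_eq_iff PiE_iff extensional_def)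
  have idx: "bindex (\<lambda>k\<in>I. (xsym_at s k, d k, b k)) = s" if "s \<in> D" for s and d :: "nat \<Rightarrow> nat" and b :: "nat \<Rightarrow> 'y"
  proof -
    have "fst s \<subseteq> I" "snd s \<subseteq> I" "fst s \<inter> snd s = {}" using subsetD[OF D(2) that] by (auto simp: xindices_def)
    thus ?thesis by (cases s) (auto simp: bindex_def xsym_at_def)
  qed
  have deg: "bdeg (\<lambda>k\<in>I. (xsym_at s k, d k, b k)) = (\<Sum>k\<in>I. d k)" for s and d :: "nat \<Rightarrow> nat" and b :: "nat \<Rightarrow> 'y"
    by (simp add: bdeg_def)
  show "\<forall>x\<in>?T. ?f (?g x) = x"
    using idx deg by (auto simp: PiE_iff extensional_def fun_eq_iff)
  show "?f ` {\<beta>\<in>blocks. bdeg \<beta> \<le> q} \<subseteq> ?T"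
  proof (rule image_subsetI)
    fix \<beta> assume "\<beta> \<in> {\<beta>\<in>blocks. bdeg \<beta> \<le> q}"
    hence b: "\<beta> \<in> blocks" "bdeg \<beta> \<le> q" by auto
    have "snd (snd (\<beta> k)) \<in> B k (xsym_at (bindex \<beta>) k) (fst (snd (\<beta> k)))" if "k \<in> I" for k
      using b(1) that bindex(2)[OF that, of \<beta>] by (auto simp: blocks_def pclass_def PiE_iff dest!: bspec[of _ _ k])
    thus "?f \<beta> \<in> ?T" using b D(1)[OF b(1)] by (auto simp: bdeg_def)
  qed
  show "?g ` ?T \<subseteq> {\<beta>\<in>blocks. bdeg \<beta> \<le> q}"
    using deg by (auto simp: blocks_def pclass_def)
qed

lemma tensor_blocks:
  fixes Hs :: "nat xindex \<Rightarrow> ('a, 'h) gmodule" and Ps :: "nat xindex \<Rightarrow> nat \<Rightarrow> ('a, 'p) gmodule"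
  assumes D: "\<And>\<beta>. \<beta> \<in> blocks \<Longrightarrow> bindex \<beta> \<in> D" "D \<subseteq> xindices I"
    and Hm: "\<And>s i. s \<in> D \<Longrightarrow> Module.module R (Hs s i)"
    and P: "\<And>s k d. s \<in> D \<Longrightarrow> k \<in> I \<Longrightarrow> Module.module R (Ps s k d)"
      "\<And>s k d. s \<in> D \<Longrightarrow> k \<in> I \<Longrightarrow> module_iso R (Ps s k d) (Fr (B k (xsym_at s k) d))"
  shows "module_iso R (dsum {\<beta>\<in>blocks. bdeg \<beta> \<le> q} (\<lambda>\<beta>. Hs (bindex \<beta>) (q - bdeg \<beta>)))
    (gdsum D (\<lambda>s. gtensor R (Hs s) (gtensor_fam R I (Ps s))) q)"
proof -
  define C where "C s j = (SIGMA d:{d \<in> I \<rightarrow>\<^sub>E UNIV. (\<Sum>k\<in>I. d k) = j}. \<Pi>\<^sub>E k\<in>I. B k (xsym_at s k) (d k))" for s j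
  let ?Q = "{(i, j). i + j = q}"
  have fB: "finite (B k \<kappa> d)" if "k \<in> I" for k \<kappa> d by (rule split_pair.finite_B[OF sp[OF that]])
  have fd: "finite {d \<in> I \<rightarrow>\<^sub>E UNIV. (\<Sum>k\<in>I. d k) = j}" for j :: nat
  proof (rule finite_subset[of _ "I \<rightarrow>\<^sub>E {..j}"])
    show "{d \<in> I \<rightarrow>\<^sub>E UNIV. (\<Sum>k\<in>I. d k) = j} \<subseteq> (I \<rightarrow>\<^sub>E {..j})" by (auto intro: member_le_sum)
  qed (simp add: finite_PiE)
  have fC: "finite (C s j)" for s j unfolding C_def by (intro finite_SigmaI fd finite_PiE) (use fB in auto)
  have fQ: "finite ?Q" by (rule finite_subset[of _ "{..q} \<times> {..q}"]) auto
  have fX: "finite (xindices I)" by (rule finite_subset[of _ "Pow I \<times> Pow I"]) (auto simp: xindices_def)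
  have fD: "finite D" using D(2) fX by (rule finite_subset)
  have fam: "module_iso R (gtensor_fam R I (Ps s) j) (Fr (C s j))" if s: "s \<in> D" for s j
    unfolding gtensor_fam_def C_def
    by (rule module_iso_trans[OF dsum_cong[OF fd tensor_fam_free] dsum_free[OF fd]]) (use P s fB in \<open>auto intro: finite_PiE\<close>)
  have mf: "Module.module R (gtensor_fam R I (Ps s) j)" if s: "s \<in> D" for s j
    unfolding gtensor_fam_def by (rule module_dsum[OF fd module_tensor_fam]) (use P s in auto)
  have gt: "module_iso R (gtensor R (Hs s) (gtensor_fam R I (Ps s)) q) (dsum (SIGMA ij:?Q. C s (snd ij)) (\<lambda>(ij, c). Hs s (fst ij)))"
    if s: "s \<in> D" for s
  proof -
    have "module_iso R (dsum ?Q (\<lambda>(i, j). tensor R (Hs s i) (gtensor_fam R I (Ps s) j))) (dsum ?Q (\<lambda>ij. dsum (C s (snd ij)) (\<lambda>c. Hs s (fst ij))))"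
      by (rule dsum_cong[OF fQ]) (clarsimp, rule tensor_free[OF Hm[OF s] mf[OF s] fC fam[OF s]])
    thus ?thesis unfolding gtensor_def by (rule module_iso_trans) (rule dsum_Sigma[OF fQ fC])
  qed
  have mg: "Module.module R (gtensor R (Hs s) (gtensor_fam R I (Ps s)) q)" if s: "s \<in> D" for s
    unfolding gtensor_def by (rule module_dsum[OF fQ]) (use module_tensor[OF Hm[OF s] mf[OF s]] in auto)
  have fS: "finite (SIGMA ij:?Q. C s (snd ij))" for s by (intro finite_SigmaI fQ fC)
  let ?T = "SIGMA s:D. SIGMA ij:?Q. C s (snd ij)"
  have "module_iso R (gdsum D (\<lambda>s. gtensor R (Hs s) (gtensor_fam R I (Ps s))) q) (dsum ?T (\<lambda>(s, ij, c). Hs s (fst ij)))"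
    unfolding gdsum_def by (rule module_iso_trans[OF dsum_cong[OF fD gt] dsum_Sigma[OF fD fS]])
  moreover have "module_iso R (dsum ?T (\<lambda>(s, ij, c). Hs s (fst ij))) (dsum {\<beta>\<in>blocks. bdeg \<beta> \<le> q} (\<lambda>\<beta>. Hs (bindex \<beta>) (q - bdeg \<beta>)))"
    using dsum_reindex[of "{\<beta>\<in>blocks. bdeg \<beta> \<le> q}", OF _ bij_blocks[where q = q, OF D], of "\<lambda>(s, ij, c). Hs s (fst ij)"]
      finite_blocks by (simp add: C_def)
  ultimately have "module_iso R (gdsum D (\<lambda>s. gtensor R (Hs s) (gtensor_fam R I (Ps s))) q)
      (dsum {\<beta>\<in>blocks. bdeg \<beta> \<le> q} (\<lambda>\<beta>. Hs (bindex \<beta>) (q - bdeg \<beta>)))" by (rule module_iso_trans)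
  moreover have "Module.module R (gdsum D (\<lambda>s. gtensor R (Hs s) (gtensor_fam R I (Ps s))) q)"
    unfolding gdsum_def by (rule module_dsum[OF fD mg])
  ultimately show ?thesis using module_iso_sym by blast
qed

end

section \<open>The homology of a polyhedral join\<close>

context principal_domain begin

text \<open>What remains is to see that the indices of all blocks lie in \<open>D\<close>.  A block contains a class of its kind for every pair,
  so the corresponding module is not zero.\<close>

lemma polyhedral_join_iso:
  fixes K :: "nat set set" and X A :: "nat \<Rightarrow> nat set set"
  assumes sK: "simplicial_complex {1..m} K"
    and sX: "\<And>k. k \<in> {1..m} \<Longrightarrow> simplicial_complex {1..n k} (X k)"
    and sA: "\<And>k. k \<in> {1..m} \<Longrightarrow> simplicial_complex {1..n k} (A k)"
    and AX: "\<And>k. k \<in> {1..m} \<Longrightarrow> A k \<subseteq> X k"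
    and Ts: "\<And>k. k \<in> {1..m} \<Longrightarrow> Ts k \<subseteq> xindices {1..n k}"
    and d: "\<And>k. k \<in> {1..m} \<Longrightarrow> densely_split R {1..n k} (X k) (A k) (Ts k)"
    and t: "t \<in> xindex_prod m n Ts" and D: "D \<subseteq> xindices {1..m}"
    and supp: "xsym_prod m (\<lambda>k. dense_support R {1..n k} (X k) (A k) (Ts k)) \<subseteq> D
      \<or> D = rindices {1..m} \<and> (\<forall>k\<in>{1..m}. theta_epi R {1..n k} (X k) (A k) (xindex_part k t))"
  shows "gmodule_iso R (thom R (vertices m n) (polyhedral_join m K X A) t)
      (gdsum D (\<lambda>s. gtensor R (thom R {1..m} K s) (seq_hom R m n X A s t)))" (is ?hom)
    and "gmodule_iso R (tcoh R (vertices m n) (polyhedral_join m K X A) t)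
      (gdsum D (\<lambda>s. gtensor R (tcoh R {1..m} K s) (seq_coh R m n X A s t)))" (is ?coh)
proof -
  have tv: "t \<in> xindices (vertices m n)" and tk: "k \<in> {1..m} \<Longrightarrow> xindex_part k t \<in> Ts k" for k
    using t by (auto simp: xindex_prod_def)
  define good where "good k B \<phi> \<longleftrightarrow> split_pair R (iwords {1..n k} (X k) (xindex_part k t)) (twords {1..n k} (A k))
      (word_deg {1..n k}) (tboundary R {1..n k}) B \<phi>
    \<and> (\<forall>\<kappa> q. module_iso R (pair_hom R {1..n k} (X k) (A k) \<kappa> (xindex_part k t) q) (Fr (B \<kappa> q))
        \<and> Module.module R (pair_hom R {1..n k} (X k) (A k) \<kappa> (xindex_part k t) q))
    \<and> (\<forall>\<kappa> q. module_iso R (pair_coh R {1..n k} (X k) (A k) \<kappa> (xindex_part k t) q) (Fr (B \<kappa> q))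
        \<and> Module.module R (pair_coh R {1..n k} (X k) (A k) \<kappa> (xindex_part k t) q))"
    for k and B :: "xsym \<Rightarrow> nat \<Rightarrow> ((nat \<Rightarrow> tgen) \<Rightarrow> 'a) set set set" and \<phi>
  have "\<exists>B\<phi>. good k (fst B\<phi>) (snd B\<phi>)" if k: "k \<in> {1..m}" for k
    using split_pair_exists[OF _ sX[OF k] sA[OF k] AX[OF k] subsetD[OF Ts[OF k] tk[OF k]]] d[OF k] tk[OF k]
    unfolding good_def densely_split_def by simp
  then obtain B\<phi> where g: "\<And>k. k \<in> {1..m} \<Longrightarrow> good k (fst (B\<phi> k)) (snd (B\<phi> k))" by metis
  define B where "B k = fst (B\<phi> k)" for k
  note g' = g[unfolded good_def, folded B_def]
  have sp: "split_pair R (iwords {1..n k} (X k) (xindex_part k t)) (twords {1..n k} (A k))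
      (word_deg {1..n k}) (tboundary R {1..n k}) (B k) (snd (B\<phi> k))" if "k \<in> {1..m}" for k
    using g'[OF that] by (rule conjunct1)
  interpret join_data R m n K X A t B "\<lambda>k. snd (B\<phi> k)"
    by (intro join_data.intro join_data_axioms.intro principal_domain_axioms sK sX sA AX tv sp)
  have empty: "B k \<kappa> q = {}" if "k \<in> I" "carrier (pair_hom R (N k) (X k) (A k) \<kappa> (xindex_part k t) q) = {z}" for k \<kappa> q z
    by (rule iso_free_trivial[OF _ that(2)]) (use g'[OF that(1)] in blast)
  have kind: "\<exists>q b. b \<in> B k (xsym_at (bindex \<beta>) k) q" if "\<beta> \<in> blocks" "k \<in> I" for \<beta> k
  proof -
    have "\<beta> k \<in> pclass k" using that by (auto simp: blocks_def)
    then obtain \<kappa> q b where "\<beta> k = (\<kappa>, q, b)" "b \<in> B k \<kappa> q" unfolding pclass_def by blast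
    thus ?thesis using bindex(2)[OF that(2), of \<beta>] by auto
  qed
  have idx: "bindex \<beta> \<in> D" if b: "\<beta> \<in> blocks" for \<beta>
    using supp
  proof
    assume S: "xsym_prod m (\<lambda>k. dense_support R {1..n k} (X k) (A k) (Ts k)) \<subseteq> D"
    have "xsym_at (bindex \<beta>) k \<in> dense_support R {1..n k} (X k) (A k) (Ts k)" if k: "k \<in> I" for k
    proof -
      obtain q b where "b \<in> B k (xsym_at (bindex \<beta>) k) q" using kind[OF b k] by blast
      hence "carrier (pair_hom R (N k) (X k) (A k) (xsym_at (bindex \<beta>) k) (xindex_part k t) q)
          \<noteq> {\<zero>\<^bsub>pair_hom R (N k) (X k) (A k) (xsym_at (bindex \<beta>) k) (xindex_part k t) q\<^esub>}" using empty[OF k] by blast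
      thus ?thesis unfolding dense_support_def using tk[OF k] by blast
    qed
    thus ?thesis using S bindex(1) by (auto simp: xsym_prod_def)
  next
    assume r: "D = rindices {1..m} \<and> (\<forall>k\<in>{1..m}. theta_epi R {1..n k} (X k) (A k) (xindex_part k t))"
    have "xsym_at (bindex \<beta>) k \<noteq> Xe" if k: "k \<in> I" for k
    proof
      assume e: "xsym_at (bindex \<beta>) k = Xe"
      obtain q b where "b \<in> B k Xe q" using kind[OF b k] e by auto
      moreover obtain z where "carrier (coker_theta R (N k) (X k) (A k) (xindex_part k t) q) = {z}"
        using coker_trivial[OF _ sX[OF k] sA[OF k] AX[OF k] part_index[OF k]] r k by (metis finite_atLeastAtMost)
      ultimately show False using empty[OF k, of Xe q z] by auto
    qed
    hence "fst (bindex \<beta>) = {}" using bindex(2)[of _ \<beta>] by (auto simp: bindex_def)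
    thus ?thesis using r by (auto simp: rindices_def bindex_def)
  qed
  have mK: "Module.module R (thom R I K s i)" "Module.module R (tcoh R I K s i)" if "s \<in> D" for s i
    unfolding thom_bhom tcoh_bcoh using word_cpx[OF _ sK subsetD[OF D that]] by (auto intro: module_bhom module_bcoh)
  show ?hom unfolding gmodule_iso_def seq_hom_def
  proof
    fix q
    show "module_iso R (thom R V Z t q) (gdsum D (\<lambda>s. gtensor R (thom R I K s)
        (gtensor_fam R I (\<lambda>k. pair_hom R (N k) (X k) (A k) (xsym_at s k) (xindex_part k t)))) q)"
      by (rule module_iso_trans[OF join_hom tensor_blocks[OF idx D]]) (use mK g' in auto)
  qed
  show ?coh unfolding gmodule_iso_def seq_coh_def
  proof
    fix q
    show "module_iso R (tcoh R V Z t q) (gdsum D (\<lambda>s. gtensor R (tcoh R I K s)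
        (gtensor_fam R I (\<lambda>k. pair_coh R (N k) (X k) (A k) (xsym_at s k) (xindex_part k t)))) q)"
      by (rule module_iso_trans[OF join_coh tensor_blocks[OF idx D]]) (use mK g' in auto)
  qed
qed

end

lemma pair_hom_at: "pair_hom R V X A (xsym_at s k) t = (if k \<in> fst s then coker_theta R V X A t
    else if k \<in> snd s then ker_theta R V X A t else coim_theta R V X A t)"
  by (simp add: xsym_at_def)

lemma pair_coh_at: "pair_coh R V X A (xsym_at s k) t = (if k \<in> fst s then ker_theta_co R V X A t
    else if k \<in> snd s then coker_theta_co R V X A t else im_theta_co R V X A t)"
  by (simp add: xsym_at_def)

theorem theorem4p13:
  fixes R :: "'r ring" and m :: nat and n :: "nat \<Rightarrow> nat"
    and K :: "nat set set" and X A :: "nat \<Rightarrow> nat set set"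
    and Ts :: "nat \<Rightarrow> nat xindex set" and T :: "(nat \<times> nat) xindex set"
  assumes "cring R" and "field R \<or> R \<simeq> \<Z>"
    and "simplicial_complex {1..m} K"
    and "\<And>k. k \<in> {1..m} \<Longrightarrow> simplicial_complex {1..n k} (X k)"
    and "\<And>k. k \<in> {1..m} \<Longrightarrow> simplicial_complex {1..n k} (A k)"
    and "\<And>k. k \<in> {1..m} \<Longrightarrow> A k \<subseteq> X k"
    and "\<And>k. k \<in> {1..m} \<Longrightarrow> Ts k \<subseteq> xindices {1..n k}"
    and "\<And>k. k \<in> {1..m} \<Longrightarrow> densely_split R {1..n k} (X k) (A k) (Ts k)"
    and "T \<subseteq> xindex_prod m n Ts"
  shows
    "let Z = polyhedral_join m K X A;
         V = vertices m n;
         S = xsym_prod m (\<lambda>k. dense_support R {1..n k} (X k) (A k) (Ts k));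
         iso_on = (\<lambda>D.
             gmodule_iso R (gdsum T (thom R V Z))
               (gdsum T (diag_tensor R D (thom R {1..m} K) (seq_hom R m n X A)))
           \<and> gmodule_iso R (gdsum T (tcoh R V Z))
               (gdsum T (diag_tensor R D (tcoh R {1..m} K) (seq_coh R m n X A)))
           \<and> (\<forall>t\<in>T.
               gmodule_iso R (thom R V Z t)
                 (gdsum D (\<lambda>(\<sigma>, \<omega>). gtensor R (thom R {1..m} K (\<sigma>, \<omega>))
                   (gtensor_fam R {1..m} (\<lambda>k.
                      let t\<^sub>k = xindex_part k t in
                      if k \<in> \<sigma> then coker_theta R {1..n k} (X k) (A k) t\<^sub>k
                      else if k \<in> \<omega> then ker_theta R {1..n k} (X k) (A k) t\<^sub>k
                      else coim_theta R {1..n k} (X k) (A k) t\<^sub>k))))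
             \<and> gmodule_iso R (tcoh R V Z t)
                 (gdsum D (\<lambda>(\<sigma>, \<omega>). gtensor R (tcoh R {1..m} K (\<sigma>, \<omega>))
                   (gtensor_fam R {1..m} (\<lambda>k.
                      let t\<^sub>k = xindex_part k t in
                      if k \<in> \<sigma> then ker_theta_co R {1..n k} (X k) (A k) t\<^sub>k
                      else if k \<in> \<omega> then coker_theta_co R {1..n k} (X k) (A k) t\<^sub>k
                      else im_theta_co R {1..n k} (X k) (A k) t\<^sub>k))))))
     in (\<forall>D. S \<subseteq> D \<and> D \<subseteq> xindices {1..m} \<longrightarrow> iso_on D)
      \<and> ((\<forall>t\<in>T. \<forall>k\<in>{1..m}. theta_epi R {1..n k} (X k) (A k) (xindex_part k t))
           \<longrightarrow> iso_on (rindices {1..m}))"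
proof -
  interpret principal_domain R by (rule principal_domain_field_or_int[OF assms(1,2)])
  let ?Z = "polyhedral_join m K X A" and ?V = "vertices m n"
  let ?S = "xsym_prod m (\<lambda>k. dense_support R {1..n k} (X k) (A k) (Ts k))"
  have fT: "finite T"
  proof (rule finite_subset)
    show "T \<subseteq> Pow ?V \<times> Pow ?V" using assms(9) by (auto simp: xindex_prod_def xindices_def)
  qed (simp add: vertices_def)
  have total: "gmodule_iso R (gdsum T M) (gdsum T M')" if "\<And>t. t \<in> T \<Longrightarrow> gmodule_iso R (M t) (M' t)"
    for M :: "_ \<Rightarrow> ('r, 'x) gmodule" and M' :: "_ \<Rightarrow> ('r, 'z) gmodule"
    unfolding gmodule_iso_def gdsum_def by (intro allI dsum_cong[OF fT]) (use that in \<open>simp add: gmodule_iso_def\<close>)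
  have main: "gmodule_iso R (thom R ?V ?Z t) (gdsum D (\<lambda>s. gtensor R (thom R {1..m} K s) (seq_hom R m n X A s t)))
      \<and> gmodule_iso R (tcoh R ?V ?Z t) (gdsum D (\<lambda>s. gtensor R (tcoh R {1..m} K s) (seq_coh R m n X A s t)))"
    if "t \<in> T" "D \<subseteq> xindices {1..m}" "?S \<subseteq> D \<or> D = rindices {1..m} \<and> (\<forall>k\<in>{1..m}. theta_epi R {1..n k} (X k) (A k) (xindex_part k t))"
    for t D
    using polyhedral_join_iso[OF assms(3-8) subsetD[OF assms(9) that(1)] that(2,3)] by blast
  have R: "rindices {1..m} \<subseteq> xindices {1..m}" by (auto simp: rindices_def xindices_def)
  show ?thesis
    unfolding Let_def diag_tensor_def[abs_def] case_prod_unfold prod.collapse seq_hom_def[symmetric] seq_coh_def[symmetric]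
      pair_hom_at[symmetric] pair_coh_at[symmetric]
    using main R by (intro conjI allI impI ballI total) blast+
qed

end
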